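(* If $c$ and $n$ are positive integers with $n\ge c+2$, and $D=F_1\times\cdots\times F_n$ is a direct product of free groups of rank $2$, then there exists a finitely presented subgroup $S\subset D$ with $S\cap F_i=\gamma_{c+1}(F_i)$ for $i=1,\dots,n$.
   Context: $\gamma_k(G)$ denotes the $k$-th term of the lower central series of a group $G$, with $\gamma_1(G)=G$ and $\gamma_{k+1}(G)=[\gamma_k(G),G]$. *)

theory Defs
  imports "HOL-Algebra.Generated_Groups" "HOL-Algebra.Product_Groups"
begin

(* A letter is a pair of a generator and an exponent sign, True for x and False for x^-1. *)
type_synonym 'x letter = "'x \<times> bool"

definition inv_letter :: "'x letter \<Rightarrow> 'x letter" where
  "inv_letter l = (fst l, \<not> snd l)"

definition reduced :: "'x letter list \<Rightarrow> bool" where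
  "reduced w \<longleftrightarrow> successively (\<lambda>k l. l \<noteq> inv_letter k) w"

fun cancel_cons :: "'x letter \<Rightarrow> 'x letter list \<Rightarrow> 'x letter list" where
  "cancel_cons k [] = [k]"
| "cancel_cons k (l # w) = (if l = inv_letter k then w else k # l # w)"

(* Reduced words over X; the product of u and v is the reduced form of u @ v. *)
definition free_group :: "'x set \<Rightarrow> 'x letter list monoid" where
  "free_group X = \<lparr>carrier = {w. reduced w \<and> fst ` set w \<subseteq> X},
     monoid.mult = (\<lambda>u v. foldr cancel_cons u v), one = []\<rparr>"

definition is_free_of_rank :: "('a, 'b) monoid_scheme \<Rightarrow> nat \<Rightarrow> bool" where
  "is_free_of_rank G r \<longleftrightarrow> group G \<and> G \<cong> free_group {..<r}"

definition normal_closure :: "('a, 'b) monoid_scheme \<Rightarrow> 'a set \<Rightarrow> 'a set" where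
  "normal_closure G R = \<Inter> {N. N \<lhd> G \<and> R \<subseteq> N}"

definition finitely_presented :: "('a, 'b) monoid_scheme \<Rightarrow> bool" where
  "finitely_presented G \<longleftrightarrow> group G \<and>
     (\<exists>(m::nat) R. finite R \<and> R \<subseteq> carrier (free_group {..<m}) \<and>
        G \<cong> free_group {..<m} Mod normal_closure (free_group {..<m}) R)"

definition commutator_subgroup :: "('a, 'b) monoid_scheme \<Rightarrow> 'a set \<Rightarrow> 'a set \<Rightarrow> 'a set" where
  "commutator_subgroup G H K =
     generate G (\<Union>h\<in>H. \<Union>k\<in>K. {h \<otimes>\<^bsub>G\<^esub> k \<otimes>\<^bsub>G\<^esub> inv\<^bsub>G\<^esub> h \<otimes>\<^bsub>G\<^esub> inv\<^bsub>G\<^esub> k})"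

(* The lower central series is indexed from 1; the value at 0 is junk. *)
fun lower_central :: "('a, 'b) monoid_scheme \<Rightarrow> nat \<Rightarrow> 'a set" where
  "lower_central G 0 = carrier G"
| "lower_central G (Suc 0) = carrier G"
| "lower_central G (Suc (Suc k)) = commutator_subgroup G (lower_central G (Suc k)) (carrier G)"

(* The canonical embedding of the i-th factor into product_group I G. *)
definition factor_embed :: "'i set \<Rightarrow> ('i \<Rightarrow> ('a, 'b) monoid_scheme) \<Rightarrow> 'i \<Rightarrow> 'a \<Rightarrow> 'i \<Rightarrow> 'a" where
  "factor_embed I G i a = (\<lambda>j\<in>I. if j = i then a else \<one>\<^bsub>G j\<^esub>)"

lemma inv_letter_inv_letter [simp]: "inv_letter (inv_letter l) = l"
  by (simp add: inv_letter_def)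

lemma fst_inv_letter [simp]: "fst (inv_letter l) = fst l"
  by (simp add: inv_letter_def)

lemma reduced_Nil [simp]: "reduced []"
  by (simp add: reduced_def)

lemma reduced_Cons: "reduced (k # w) \<longleftrightarrow> reduced w \<and> (w = [] \<or> hd w \<noteq> inv_letter k)"
  by (cases w) (auto simp: reduced_def)

lemma reduced_cancel_cons: "reduced w \<Longrightarrow> reduced (cancel_cons k w)"
  by (cases w) (auto simp: reduced_Cons)

lemma reduced_mult: "reduced v \<Longrightarrow> reduced (foldr cancel_cons u v)"
  by (induction u) (auto simp: reduced_cancel_cons)

lemma set_cancel_cons: "set (cancel_cons k w) \<subseteq> insert k (set w)"
  by (cases w) auto

lemma set_mult_words: "set (foldr cancel_cons u v) \<subseteq> set u \<union> set v"
proof (induction u)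
  case (Cons k u)
  then show ?case using set_cancel_cons[of k "foldr cancel_cons u v"] by auto
qed simp

lemma cancel_cons_inv: "reduced w \<Longrightarrow> cancel_cons k (cancel_cons (inv_letter k) w) = w"
  by (cases w rule: remdups_adj.cases) (auto simp: reduced_Cons)

lemma cancel_cons_reduced: "reduced (k # w) \<Longrightarrow> cancel_cons k w = k # w"
  by (cases w) (auto simp: reduced_Cons)

lemma foldr_cancel_cons:
  assumes "reduced w"
  shows "foldr cancel_cons (cancel_cons k u) w = cancel_cons k (foldr cancel_cons u w)"
proof (cases u)
  case (Cons l u')
  then show ?thesis
    using cancel_cons_inv[of "foldr cancel_cons u' w" k] assms by (auto simp: reduced_mult)
qed simp

lemma foldr_cancel_cons_assoc:
  "reduced w \<Longrightarrow> foldr cancel_cons (foldr cancel_cons u v) w = foldr cancel_cons u (foldr cancel_cons v w)"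
  by (induction u) (auto simp: foldr_cancel_cons)

lemma foldr_cancel_cons_Nil: "reduced u \<Longrightarrow> foldr cancel_cons u [] = u"
proof (induction u)
  case (Cons k u)
  then show ?case using cancel_cons_reduced[of k u] by (simp add: reduced_Cons)
qed simp

lemma foldr_cancel_cons_l_inv:
  "reduced v \<Longrightarrow> foldr cancel_cons (rev (map inv_letter u)) (foldr cancel_cons u v) = v"
proof (induction u arbitrary: v)
  case (Cons k u)
  then show ?case
    using cancel_cons_inv[of "foldr cancel_cons u v" "inv_letter k"] by (simp add: reduced_mult)
qed simp

lemma group_free_group: "group (free_group X)"
proof (rule groupI)
  fix u assume u: "u \<in> carrier (free_group X)"
  let ?v = "foldr cancel_cons (rev (map inv_letter u)) []"
  have "set ?v \<subseteq> inv_letter ` set u"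
    using set_mult_words[of "rev (map inv_letter u)" "[]"] by simp
  then have "?v \<in> carrier (free_group X)"
    using u by (fastforce simp: free_group_def intro: reduced_mult)
  moreover have "foldr cancel_cons ?v u = []"
    using u foldr_cancel_cons_l_inv[of "[]" u]
    by (simp add: free_group_def foldr_cancel_cons_assoc foldr_cancel_cons_Nil)
  ultimately show "\<exists>v\<in>carrier (free_group X). v \<otimes>\<^bsub>free_group X\<^esub> u = \<one>\<^bsub>free_group X\<^esub>"
    by (auto simp: free_group_def)
next
  fix u v assume "u \<in> carrier (free_group X)" "v \<in> carrier (free_group X)"
  then show "u \<otimes>\<^bsub>free_group X\<^esub> v \<in> carrier (free_group X)"
    using set_mult_words[of u v] by (fastforce simp: free_group_def intro: reduced_mult)
qed (auto simp: free_group_def foldr_cancel_cons_assoc)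

definition free_lift :: "('a, 'b) monoid_scheme \<Rightarrow> ('x \<Rightarrow> 'a) \<Rightarrow> 'x letter list \<Rightarrow> 'a" where
  "free_lift G f w = foldr (\<lambda>l a. (if snd l then f (fst l) else inv\<^bsub>G\<^esub> f (fst l)) \<otimes>\<^bsub>G\<^esub> a) w \<one>\<^bsub>G\<^esub>"

context group
begin

lemma free_lift_closed:
  "f ` fst ` set w \<subseteq> carrier G \<Longrightarrow> free_lift G f w \<in> carrier G"
  by (induction w) (auto simp: free_lift_def)

lemma free_lift_cancel_cons:
  assumes "f (fst k) \<in> carrier G" "f ` fst ` set w \<subseteq> carrier G"
  shows "free_lift G f (cancel_cons k w) = free_lift G f [k] \<otimes> free_lift G f w"
proof (cases w)
  case (Cons l w')
  have "free_lift G f w' \<in> carrier G"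
    using assms Cons by (intro free_lift_closed) auto
  then show ?thesis
    using assms Cons by (auto simp: free_lift_def inv_letter_def m_assoc[symmetric])
qed (use assms in \<open>auto simp: free_lift_def\<close>)

lemma free_lift_mult:
  assumes "f ` fst ` set u \<subseteq> carrier G" "f ` fst ` set v \<subseteq> carrier G"
  shows "free_lift G f (foldr cancel_cons u v) = free_lift G f u \<otimes> free_lift G f v"
  using assms(1)
proof (induction u)
  case Nil
  then show ?case using free_lift_closed[OF assms(2)] by (simp add: free_lift_def)
next
  case (Cons k u)
  have *: "f ` fst ` set (foldr cancel_cons u v) \<subseteq> carrier G"
  proof -
    have "f ` fst ` set (foldr cancel_cons u v) \<subseteq> f ` fst ` (set u \<union> set v)"
      by (intro image_mono set_mult_words)
    also have "\<dots> \<subseteq> carrier G"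
      unfolding image_Un using Cons.prems assms(2) by (intro Un_least) simp_all
    finally show ?thesis .
  qed
  have c: "free_lift G f [k] \<in> carrier G" "free_lift G f u \<in> carrier G" "free_lift G f v \<in> carrier G"
    using Cons.prems assms(2) by (intro free_lift_closed; simp)+
  have fk: "f (fst k) \<in> carrier G" using Cons.prems by simp
  have "free_lift G f (k # u) = free_lift G f [k] \<otimes> free_lift G f u"
    using fk c by (simp add: free_lift_def)
  then show ?case
    using Cons free_lift_cancel_cons[OF fk *] c by (simp add: m_assoc)
qed

lemma free_lift_hom:
  "f ` X \<subseteq> carrier G \<Longrightarrow> free_lift G f \<in> hom (free_group X) G"
proof (rule homI)
  fix u assume "f ` X \<subseteq> carrier G" "u \<in> carrier (free_group X)"
  then show "free_lift G f u \<in> carrier G"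
    by (intro free_lift_closed) (auto simp: free_group_def)
next
  fix u v
  assume "f ` X \<subseteq> carrier G" "u \<in> carrier (free_group X)" "v \<in> carrier (free_group X)"
  then show "free_lift G f (u \<otimes>\<^bsub>free_group X\<^esub> v) = free_lift G f u \<otimes> free_lift G f v"
    using free_lift_mult[of f u v] by (fastforce simp: free_group_def)
qed

lemma free_lift_generator: "f x \<in> carrier G \<Longrightarrow> free_lift G f [(x, True)] = f x"
  by (simp add: free_lift_def)

end

lemma inv_free_group_generator:
  assumes "x \<in> X"
  shows "inv\<^bsub>free_group X\<^esub> [(x, True)] = [(x, False)]"
  using assms
  by (intro group.inv_equality[OF group_free_group])
     (auto simp: free_group_def reduced_def inv_letter_def)

lemma generate_free_group:
  "generate (free_group X) ((\<lambda>x. [(x, True)]) ` X) = carrier (free_group X)"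
proof
  interpret F: group "free_group X" by (rule group_free_group)
  have sub: "(\<lambda>x. [(x, True)]) ` X \<subseteq> carrier (free_group X)"
    by (auto simp: free_group_def reduced_def)
  show "generate (free_group X) ((\<lambda>x. [(x, True)]) ` X) \<subseteq> carrier (free_group X)"
    by (rule F.generate_incl[OF sub])
  have "w \<in> generate (free_group X) ((\<lambda>x. [(x, True)]) ` X)"
    if "reduced w" "fst ` set w \<subseteq> X" for w
    using that
  proof (induction w)
    case Nil
    then show ?case using generate.one[of "free_group X"] by (simp add: free_group_def)
  next
    case (Cons k w)
    obtain x b where k: "k = (x, b)" by fastforce
    have "[k] \<in> generate (free_group X) ((\<lambda>x. [(x, True)]) ` X)"
    proof (cases b)
      case True
      then show ?thesis using Cons.prems k by (auto intro: generate.incl)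
    next
      case False
      then show ?thesis
        using Cons.prems k inv_free_group_generator[of x X]
          generate.inv[of "[(x, True)]" "(\<lambda>x. [(x, True)]) ` X" "free_group X"] by auto
    qed
    moreover have "w \<in> generate (free_group X) ((\<lambda>x. [(x, True)]) ` X)"
      using Cons by (auto simp: reduced_Cons)
    ultimately have "[k] \<otimes>\<^bsub>free_group X\<^esub> w \<in> generate (free_group X) ((\<lambda>x. [(x, True)]) ` X)"
      by (rule generate.eng)
    then show ?case
      using Cons.prems by (simp add: free_group_def cancel_cons_reduced)
  qed
  then show "carrier (free_group X) \<subseteq> generate (free_group X) ((\<lambda>x. [(x, True)]) ` X)"
    by (auto simp: free_group_def)
qed

end

theory Submission
  imports Defs
begin

text \<open>Write \<open>L\<close> for \<open>\<gamma>\<^sub>c\<^sub>+\<^sub>1(F)\<close>, \<open>F\<close> free on \<open>x, y\<close>. Let \<open>\<phi>\<^sub>i\<close> map the free group on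
  \<open>x, y, x', y'\<close> to \<open>F\<close> by fixing \<open>x, y\<close> and sending \<open>x', y'\<close> to \<open>x\<^sup>i, y\<^sup>i\<close>. Choose \<open>U \<lhd> F\<close> containing \<open>L\<close> with
  \<open>U / L\<close> torsion-free and \<open>F / U\<close> torsion. Then \<open>S\<close> consists of the tuples that are congruent modulo
  \<open>L\<close> to \<open>(\<phi>\<^sub>1 w, \<dots>, \<phi>\<^sub>n w)\<close> for some word \<open>w\<close> and whose entries are all congruent modulo \<open>U\<close>.

  Modulo \<open>\<gamma>\<^sub>k\<^sub>+\<^sub>1\<close> the leading term of \<open>\<phi>\<^sub>i w\<close> is, up to torsion, a polynomial in \<open>i\<close> of degree at most
  \<open>k \<le> c \<le> n - 2\<close>. If it vanishes for all but one \<open>i\<close>, then an alternating binomial sum shows that it is torsion at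
  the remaining one; hence an element of \<open>S \<inter> F\<^sub>i\<close> is torsion modulo \<open>L\<close>, and as it lies in \<open>U\<close>, it lies in \<open>L\<close>.

  For the finite presentation only three properties of \<open>S\<close> matter: it contains the diagonal, it contains every
  \<open>\<gamma>\<^sub>c\<^sub>+\<^sub>1(F\<^sub>i)\<close>, and its projection to any two factors has finite index. Finitely many relators of \<open>S\<close> define a group \<open>E\<close> with
  maps \<open>q\<^sub>j : E \<rightarrow> F\<close> such that \<open>ker q\<^sub>j\<close> centralizes the normal closure \<open>K\<^sub>j\<close> of the lifts of generators of
  \<open>\<gamma>\<^sub>c\<^sub>+\<^sub>1(F\<^sub>j)\<close>, and the joint kernel of the \<open>q\<^sub>j\<close> is generated by the groups \<open>ker q\<^sub>j \<inter> K\<^sub>j\<close>. So \<open>K\<^sub>j\<close> is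
  a crossed module over \<open>F\<close>. Its image in \<open>F\<close> is projective, so \<open>ker q\<^sub>j \<inter> K\<^sub>j\<close> embeds in
  the abelianization of \<open>K\<^sub>j\<close>, a finitely generated module over the polycyclic group \<open>F / L\<close>. By P. Hall this module is
  Noetherian, so finitely many further relators suffice.\<close>

section \<open>Normal closures and polycyclic extensions\<close>

text \<open>The congruence modulo U has two tasks. Comparing the remaining entry of an element of
  the intersection with a trivial one puts it into U, which disposes of the torsion left by finite
  differences. But S must stay large in every pair of coordinates, and for this F/U has to be
  torsion: the word x'^e x^(-ej) is trivial in coordinate j and a power of x in coordinate i, and
  its entries are congruent modulo U once x^e lies in U.

  The obstacle with words is that one whose values all lie in gamma_k need not lie in gamma_k
  itself, so its values are not visibly polynomial in i. The endomorphism squaring all generators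
  acts on gamma_j/gamma_(j+1) as 2^j; combined with powers it removes the parts of weight j < k at
  the cost of a nonzero factor 2^k - 2^j. With n coordinates the difference has order n-1 and
  annihilates degrees up to n-2, whence n >= c+2.

  Pairwise finite index makes the kernel of each coordinate finitely generated; its generators
  provide the finitely many relators by which ker q_j centralizes K_j.\<close>

definition gcomm :: "('a, 'b) monoid_scheme \<Rightarrow> 'a \<Rightarrow> 'a \<Rightarrow> 'a" where
  "gcomm G x y = x \<otimes>\<^bsub>G\<^esub> y \<otimes>\<^bsub>G\<^esub> inv\<^bsub>G\<^esub> x \<otimes>\<^bsub>G\<^esub> inv\<^bsub>G\<^esub> y"

text \<open>Both inclusions are required because a conjugate of an infinite subgroup may lie
  properly inside it; together they express t H t^-1 = H.\<close>

definition normalizes :: "('a, 'b) monoid_scheme \<Rightarrow> 'a \<Rightarrow> 'a set \<Rightarrow> bool" where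
  "normalizes G t H \<longleftrightarrow> t \<in> carrier G \<and>
     (\<forall>h\<in>H. t \<otimes>\<^bsub>G\<^esub> h \<otimes>\<^bsub>G\<^esub> inv\<^bsub>G\<^esub> t \<in> H \<and> inv\<^bsub>G\<^esub> t \<otimes>\<^bsub>G\<^esub> h \<otimes>\<^bsub>G\<^esub> t \<in> H)"

text \<open>\<open>polycyclic_over G M H\<close> replaces ``\<open>H / M\<close> is polycyclic'': \<open>M\<close> need not be normal in \<open>H\<close>.\<close>

inductive polycyclic_over :: "('a, 'b) monoid_scheme \<Rightarrow> 'a set \<Rightarrow> 'a set \<Rightarrow> bool"
  for G and M where
  refl: "subgroup M G \<Longrightarrow> polycyclic_over G M M"
| step: "\<lbrakk>polycyclic_over G M H; subgroup H' G; H \<subseteq> H'; t \<in> H'; normalizes G t H;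
    \<And>g. g \<in> H' \<Longrightarrow> \<exists>k::int. \<exists>h\<in>H. g = t [^]\<^bsub>G\<^esub> k \<otimes>\<^bsub>G\<^esub> h\<rbrakk> \<Longrightarrow> polycyclic_over G M H'"

text \<open>Division with remainder by the least positive element. The generator 0 is allowed, so
  that a trivial \<open>K\<close> is not a separate case later, when \<open>K\<close> is a set of
  exponents.\<close>

lemma additive_int_set_principal:
  fixes K :: "int set"
  assumes "0 \<in> K" and diff: "\<And>a b. a \<in> K \<Longrightarrow> b \<in> K \<Longrightarrow> a - b \<in> K"
  obtains r where "r \<in> K" "\<And>k. k \<in> K \<Longrightarrow> r dvd k"
proof (cases "K \<subseteq> {0}")
  case True
  then show ?thesis using assms that[of 0] by auto
next
  case False
  then obtain a where a: "a \<in> K" "a \<noteq> 0" by auto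
  have neg: "- k \<in> K" if "k \<in> K" for k using diff[OF assms(1) that] by simp
  have add: "k + l \<in> K" if "k \<in> K" "l \<in> K" for k l using diff[OF that(1) neg[OF that(2)]] by simp
  have "\<exists>n. 0 < n \<and> int n \<in> K"
    using a neg[of a] by (intro exI[of _ "nat \<bar>a\<bar>"]) (auto simp: abs_if)
  then obtain n where n: "0 < n" "int n \<in> K" and least: "\<And>m. m < n \<Longrightarrow> \<not> (0 < m \<and> int m \<in> K)"
    using LeastI_ex[of "\<lambda>n. 0 < n \<and> int n \<in> K"] not_less_Least[of _ "\<lambda>n. 0 < n \<and> int n \<in> K"] by blast
  have mult: "int m * int n \<in> K" for m
    by (induction m) (use assms(1) n add in \<open>auto simp: algebra_simps\<close>)
  have mult': "z * int n \<in> K" for z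
    using mult[of "nat z"] neg[OF mult[of "nat (-z)"]] by (cases "z \<ge> 0") auto
  have "int n dvd k" if "k \<in> K" for k
  proof -
    have "k mod int n \<in> K"
      using diff[OF that mult'[of "k div int n"]] by (simp add: minus_div_mult_eq_mod)
    moreover have "0 \<le> k mod int n" "k mod int n < int n" using n by auto
    ultimately have "k mod int n = 0"
      using least[of "nat (k mod int n)"] by auto
    then show ?thesis by auto
  qed
  with n that show ?thesis by blast
qed

section \<open>Commutators, normal closures and products with normal subgroups\<close>

context group
begin

lemma inv_l_cancel [simp]: "x \<in> carrier G \<Longrightarrow> y \<in> carrier G \<Longrightarrow> inv x \<otimes> (x \<otimes> y) = y"
  by (simp add: m_assoc[symmetric])

lemma inv_r_cancel [simp]: "x \<in> carrier G \<Longrightarrow> y \<in> carrier G \<Longrightarrow> x \<otimes> (inv x \<otimes> y) = y"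
  by (simp add: m_assoc[symmetric])

lemma gcomm_closed [simp]: "x \<in> carrier G \<Longrightarrow> y \<in> carrier G \<Longrightarrow> gcomm G x y \<in> carrier G"
  by (simp add: gcomm_def)

lemma gcomm_eq_one_iff:
  "x \<in> carrier G \<Longrightarrow> y \<in> carrier G \<Longrightarrow> gcomm G x y = \<one> \<longleftrightarrow> x \<otimes> y = y \<otimes> x"
  unfolding gcomm_def
  using inv_solve_right'[of \<one> "x \<otimes> y" "y \<otimes> x"] by (simp add: inv_mult_group m_assoc)

text \<open>The assumption on \<open>R\<close> puts the whole group into the intersected family, so
  the intersection is not taken over the empty family.\<close>

lemma normal_closure_normal:
  assumes "R \<subseteq> carrier G"
  shows "normal_closure G R \<lhd> G"
proof -
  have "carrier G \<in> {N. N \<lhd> G \<and> R \<subseteq> N}"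
    using assms by (auto intro!: normal_invI subgroup_self)
  then show ?thesis
    unfolding normal_closure_def
    by (intro normal_invI subgroups_Inter) (auto dest: normal_imp_subgroup normal.inv_op_closed2)
qed

lemma normal_closure_incl: "R \<subseteq> normal_closure G R"
  unfolding normal_closure_def by auto

lemma normal_closure_least: "N \<lhd> G \<Longrightarrow> R \<subseteq> N \<Longrightarrow> normal_closure G R \<subseteq> N"
  unfolding normal_closure_def by auto

lemma normal_closure_mono:
  "R \<subseteq> R' \<Longrightarrow> normal_closure G R \<subseteq> normal_closure G R'"
  unfolding normal_closure_def by blast

lemma normal_vimage:
  assumes "group A" "p \<in> hom A G" "N \<lhd> G"
  shows "{a \<in> carrier A. p a \<in> N} \<lhd> A"
proof -
  interpret A: group A by fact
  interpret p: group_hom A G p using assms by (simp add: group_hom_def group_hom_axioms_def A.is_group is_group)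
  interpret N: normal N G by fact
  show ?thesis
    by (rule A.normal_invI, rule A.subgroupI) (auto intro: N.inv_op_closed2)
qed

lemma subgroup_vimage:
  assumes "group A" "p \<in> hom A G" "subgroup N G" "subgroup B A"
  shows "subgroup {a \<in> B. p a \<in> N} A"
proof -
  interpret A: group A by fact
  interpret p: group_hom A G p using assms by (simp add: group_hom_def group_hom_axioms_def A.is_group is_group)
  interpret N: subgroup N G by fact
  interpret B: subgroup B A by fact
  show ?thesis
    by (rule A.subgroupI)
      (use B.subset in \<open>auto simp: subset_iff intro!: exI[of _ "\<one>\<^bsub>A\<^esub>"] B.one_closed\<close>)
qed

lemma normal_closure_vimage:
  assumes "group A" "p \<in> hom A G" "R \<subseteq> carrier A" "a \<in> normal_closure A R"
  shows "p a \<in> normal_closure G (p ` R)"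
proof -
  have "p ` R \<subseteq> carrier G" using assms(2,3) by (auto simp: hom_def)
  then have "{a \<in> carrier A. p a \<in> normal_closure G (p ` R)} \<lhd> A"
    by (intro normal_vimage assms normal_closure_normal)
  then have "normal_closure A R \<subseteq> {a \<in> carrier A. p a \<in> normal_closure G (p ` R)}"
    using assms normal_closure_incl[of "p ` R"] by (intro group.normal_closure_least) auto
  with assms(4) show ?thesis by auto
qed

lemma image_normal:
  assumes "group A" "p \<in> hom A G" "p ` carrier A = carrier G" "N \<lhd> A"
  shows "p ` N \<lhd> G"
proof -
  interpret p: group_hom A G p using assms by (simp add: group_hom_def group_hom_axioms_def is_group)
  interpret N: normal N A by fact
  have "subgroup (p ` N) G" by (simp add: p.subgroup_img_is_subgroup N.is_subgroup)
  then show ?thesis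
  proof (rule normal_invI)
    fix x h assume "x \<in> carrier G" "h \<in> p ` N"
    then obtain a n where a: "a \<in> carrier A" "x = p a" "n \<in> N" "h = p n"
      using assms(3) by blast
    then have "x \<otimes> h \<otimes> inv x = p (a \<otimes>\<^bsub>A\<^esub> n \<otimes>\<^bsub>A\<^esub> inv\<^bsub>A\<^esub> a)" by simp
    then show "x \<otimes> h \<otimes> inv x \<in> p ` N" using a N.inv_op_closed2 by blast
  qed
qed

text \<open>Under a surjection the image of a normal subgroup is normal. This is how normal
  generation passes to the quotient by finitely many relators, and back from the quotient by lifting
  generators.\<close>

lemma normal_closure_image:
  assumes "group A" "p \<in> hom A G" "p ` carrier A = carrier G" "R \<subseteq> carrier A"
  shows "normal_closure G (p ` R) = p ` normal_closure A R"
proof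
  interpret A: group A by fact
  show "normal_closure G (p ` R) \<subseteq> p ` normal_closure A R"
    using A.normal_closure_incl[of R] image_normal[OF assms(1,2,3) A.normal_closure_normal[OF assms(4)]]
    by (intro normal_closure_least) auto
  show "p ` normal_closure A R \<subseteq> normal_closure G (p ` R)"
    using normal_closure_vimage[OF assms(1,2,4)] by auto
qed

text \<open>The centralizer of a normal subgroup is itself normal, so it contains the normal closure
  of \<open>V\<close> as soon as it contains \<open>V\<close>.\<close>

lemma commutes_normal_closure:
  assumes "N \<lhd> G" "V \<subseteq> carrier G" "\<And>a v. a \<in> N \<Longrightarrow> v \<in> V \<Longrightarrow> a \<otimes> v = v \<otimes> a"
    and "a \<in> N" "k \<in> normal_closure G V"
  shows "a \<otimes> k = k \<otimes> a"
proof -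
  interpret N: normal N G by fact
  let ?C = "{k \<in> carrier G. \<forall>a\<in>N. a \<otimes> k = k \<otimes> a}"
  have conj: "x \<otimes> h \<otimes> inv x \<in> ?C" if x: "x \<in> carrier G" and h: "h \<in> ?C" for x h
  proof -
    have hc: "h \<in> carrier G" using h by auto
    have "a \<otimes> (x \<otimes> h \<otimes> inv x) = x \<otimes> h \<otimes> inv x \<otimes> a" if "a \<in> N" for a
    proof -
      have ac: "a \<in> carrier G" using that N.subset by auto
      have "inv x \<otimes> a \<otimes> x \<in> N" using N.inv_op_closed1[OF x that] .
      then have "(inv x \<otimes> a \<otimes> x) \<otimes> h = h \<otimes> (inv x \<otimes> a \<otimes> x)" using h by blast
      then have "x \<otimes> ((inv x \<otimes> a \<otimes> x) \<otimes> h) \<otimes> inv x = x \<otimes> (h \<otimes> (inv x \<otimes> a \<otimes> x)) \<otimes> inv x" by simp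
      then show ?thesis using x ac hc by (simp add: m_assoc)
    qed
    then show ?thesis using x h by simp
  qed
  have "subgroup ?C G"
  proof (rule subgroupI)
    show "?C \<noteq> {}" by (auto intro!: exI[of _ \<one>])
    fix h assume h: "h \<in> ?C"
    have "a \<otimes> inv h = inv h \<otimes> a" if "a \<in> N" for a
    proof -
      have "a \<in> carrier G" "h \<in> carrier G" "a \<otimes> h = h \<otimes> a" using that h by auto
      then have "inv h \<otimes> (a \<otimes> h) \<otimes> inv h = inv h \<otimes> (h \<otimes> a) \<otimes> inv h" by simp
      with \<open>a \<in> carrier G\<close> \<open>h \<in> carrier G\<close> show ?thesis by (simp add: m_assoc)
    qed
    with h show "inv h \<in> ?C" by simp
  next
    fix h g assume hg: "h \<in> ?C" "g \<in> ?C"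
    have "a \<otimes> (h \<otimes> g) = h \<otimes> g \<otimes> a" if "a \<in> N" for a
    proof -
      have "a \<in> carrier G" "h \<in> carrier G" "g \<in> carrier G" "a \<otimes> h = h \<otimes> a" "a \<otimes> g = g \<otimes> a"
        using that hg by auto
      then show ?thesis by (metis m_assoc)
    qed
    with hg show "h \<otimes> g \<in> ?C" by simp
  qed auto
  then have "?C \<lhd> G" using conj by (rule normal_invI)
  then have "normal_closure G V \<subseteq> ?C" using assms by (intro normal_closure_least) auto
  then show ?thesis using assms by auto
qed

lemma subgroup_mult_normal:
  assumes "subgroup H G" "N \<lhd> G"
  shows "subgroup {h \<otimes> n | h n. h \<in> H \<and> n \<in> N} G"
proof -
  interpret H: subgroup H G by fact
  interpret N: normal N G by fact
  show ?thesis
  proof (rule subgroupI)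
    show "{h \<otimes> n | h n. h \<in> H \<and> n \<in> N} \<noteq> {}" using H.one_closed N.one_closed by blast
    fix a assume "a \<in> {h \<otimes> n | h n. h \<in> H \<and> n \<in> N}"
    then obtain h n where a: "h \<in> H" "n \<in> N" "a = h \<otimes> n" by auto
    have "inv a = inv h \<otimes> (h \<otimes> inv n \<otimes> inv h)" using a by (simp add: inv_mult_group m_assoc)
    moreover have "h \<otimes> inv n \<otimes> inv h \<in> N" "inv h \<in> H"
      using a N.inv_op_closed2[of h "inv n"] by simp_all
    ultimately show "inv a \<in> {h \<otimes> n | h n. h \<in> H \<and> n \<in> N}" by blast
    fix b assume "b \<in> {h \<otimes> n | h n. h \<in> H \<and> n \<in> N}"
    then obtain h' n' where b: "h' \<in> H" "n' \<in> N" "b = h' \<otimes> n'" by auto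
    have "a \<otimes> b = (h \<otimes> h') \<otimes> ((inv h' \<otimes> n \<otimes> h') \<otimes> n')" using a b by (simp add: m_assoc)
    moreover have "(inv h' \<otimes> n \<otimes> h') \<otimes> n' \<in> N" "h \<otimes> h' \<in> H"
      using a b N.inv_op_closed1[of h' n] by simp_all
    ultimately show "a \<otimes> b \<in> {h \<otimes> n | h n. h \<in> H \<and> n \<in> N}" by blast
  qed auto
qed

lemma generate_un_normal:
  assumes "T \<subseteq> carrier G" "N \<lhd> G"
  shows "generate G (T \<union> N) = {h \<otimes> n | h n. h \<in> generate G T \<and> n \<in> N}"
proof
  interpret N: normal N G by fact
  interpret T: subgroup "generate G T" G using assms generate_is_subgroup by auto
  have "t \<in> {h \<otimes> n | h n. h \<in> generate G T \<and> n \<in> N}" if "t \<in> T" for t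
    using that assms by (intro CollectI exI[of _ t] exI[of _ \<one>]) (auto intro: generate.incl)
  moreover have "t \<in> {h \<otimes> n | h n. h \<in> generate G T \<and> n \<in> N}" if "t \<in> N" for t
    using that by (intro CollectI exI[of _ \<one>] exI[of _ t]) auto
  ultimately show "generate G (T \<union> N) \<subseteq> {h \<otimes> n | h n. h \<in> generate G T \<and> n \<in> N}"
    using subgroup_mult_normal[OF T.is_subgroup assms(2)] by (intro generate_subgroup_incl) auto
  show "{h \<otimes> n | h n. h \<in> generate G T \<and> n \<in> N} \<subseteq> generate G (T \<union> N)"
    using mono_generate[of T "T \<union> N"] by (auto intro!: generate.eng intro: generate.incl)
qed

lemma hom_eq_on_generate:
  assumes "group H" "f \<in> hom G H" "g \<in> hom G H" "X \<subseteq> carrier G" "\<And>x. x \<in> X \<Longrightarrow> f x = g x"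
    and "w \<in> generate G X"
  shows "f w = g w"
  using assms(6)
proof (induction rule: generate.induct)
  case one
  then show ?case using assms(1,2,3) is_group by (metis hom_one)
next
  case (inv h)
  then have "h \<in> carrier G" using assms(4) by auto
  then show ?case using assms inv is_group
    by (metis group_hom.hom_inv group_hom_axioms.intro group_hom_def)
next
  case (eng h1 h2)
  then have "h1 \<in> carrier G" "h2 \<in> carrier G" using generate_in_carrier assms(4) by auto
  then show ?case using assms(2,3) eng by (simp add: hom_mult)
qed (use assms in auto)

section \<open>Calculus of polycyclic series\<close>

lemma polycyclic_over_subgroups:
  "polycyclic_over G M H \<Longrightarrow> subgroup M G \<and> subgroup H G \<and> M \<subseteq> H"
  by (induction rule: polycyclic_over.induct) auto

lemma polycyclic_over_trans:
  assumes "polycyclic_over G H H'" "polycyclic_over G M H"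
  shows "polycyclic_over G M H'"
  using assms by (induction rule: polycyclic_over.induct) (auto intro: polycyclic_over.step)

lemma normalizesD:
  assumes "normalizes G t H"
  shows "t \<in> carrier G" "h \<in> H \<Longrightarrow> t \<otimes> h \<otimes> inv t \<in> H" "h \<in> H \<Longrightarrow> inv t \<otimes> h \<otimes> t \<in> H"
  using assms unfolding normalizes_def by auto

lemma normalizes_int_pow:
  assumes "normalizes G t H" "H \<subseteq> carrier G" "h \<in> H"
  shows "t [^] (k::int) \<otimes> h \<otimes> inv (t [^] k) \<in> H"
proof -
  have t: "t \<in> carrier G" using assms by (simp add: normalizes_def)
  have pos: "t [^] n \<otimes> h \<otimes> inv (t [^] n) \<in> H" if "h \<in> H" for n :: nat and h
    using that
  proof (induction n arbitrary: h)
    case (Suc n)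
    have h: "h \<in> carrier G" using Suc assms by auto
    have "t \<otimes> h \<otimes> inv t \<in> H" by (rule normalizesD(2)[OF assms(1) Suc.prems])
    then have "t [^] n \<otimes> (t \<otimes> h \<otimes> inv t) \<otimes> inv (t [^] n) \<in> H" by (rule Suc.IH)
    then show ?case using t h by (simp add: m_assoc inv_mult_group)
  next
    case 0
    then show ?case using assms(2) by (simp add: subset_iff)
  qed
  have neg: "inv (t [^] n) \<otimes> h \<otimes> (t [^] n) \<in> H" if "h \<in> H" for n :: nat and h
    using that
  proof (induction n arbitrary: h)
    case (Suc n)
    have h: "h \<in> carrier G" using Suc assms by auto
    have "inv (t [^] n) \<otimes> h \<otimes> t [^] n \<in> H" by (rule Suc.IH[OF Suc.prems])
    then have "inv t \<otimes> (inv (t [^] n) \<otimes> h \<otimes> t [^] n) \<otimes> t \<in> H" by (rule normalizesD(3)[OF assms(1)])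
    then show ?case using t h by (simp add: m_assoc inv_mult_group)
  next
    case 0
    then show ?case using assms(2) by (simp add: subset_iff)
  qed
  show ?thesis
    using pos[OF assms(3), of "nat k"] neg[OF assms(3), of "nat (- k)"] t
    by (cases "k \<ge> 0") (auto simp: int_pow_def2 simp del: pow_nat)
qed

lemma normalizes_int_pow':
  assumes "normalizes G t H" "H \<subseteq> carrier G" "h \<in> H"
  shows "inv (t [^] (k::int)) \<otimes> h \<otimes> t [^] k \<in> H"
  using normalizes_int_pow[OF assms, of "- k"] assms by (simp add: int_pow_neg normalizes_def)

text \<open>The coset t^k H. These cosets multiply by adding exponents when t normalizes H, although
  the exponent is not determined by the coset if a nontrivial power of t lies in H.\<close>

definition power_coset :: "'a \<Rightarrow> 'a set \<Rightarrow> int \<Rightarrow> 'a set" where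
  "power_coset t H k = {t [^] k \<otimes> h | h. h \<in> H}"

context
  fixes t H
  assumes nt: "normalizes G t H" and sH: "subgroup H G"
begin

lemma power_coset_carrier: "g \<in> power_coset t H k \<Longrightarrow> g \<in> carrier G"
  using nt subgroup.subset[OF sH] by (auto simp: power_coset_def normalizes_def)

lemma power_coset_mult:
  assumes "a \<in> power_coset t H k" "b \<in> power_coset t H l"
  shows "a \<otimes> b \<in> power_coset t H (k + l)"
proof -
  interpret subgroup H G by (rule sH)
  have t: "t \<in> carrier G" using nt by (simp add: normalizes_def)
  obtain h h' where h: "h \<in> H" "h' \<in> H" "a = t [^] k \<otimes> h" "b = t [^] l \<otimes> h'"
    using assms unfolding power_coset_def by auto
  have "a \<otimes> b = t [^] (k + l) \<otimes> ((inv (t [^] l) \<otimes> h \<otimes> t [^] l) \<otimes> h')"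
    using h t by (simp add: m_assoc int_pow_mult)
  moreover have "(inv (t [^] l) \<otimes> h \<otimes> t [^] l) \<otimes> h' \<in> H"
    using normalizes_int_pow'[OF nt subset h(1)] h by simp
  ultimately show ?thesis unfolding power_coset_def by blast
qed

lemma power_coset_inv:
  assumes "a \<in> power_coset t H k"
  shows "inv a \<in> power_coset t H (- k)"
proof -
  interpret subgroup H G by (rule sH)
  have t: "t \<in> carrier G" using nt by (simp add: normalizes_def)
  obtain h where h: "h \<in> H" "a = t [^] k \<otimes> h"
    using assms unfolding power_coset_def by auto
  have "inv a = t [^] (- k) \<otimes> (t [^] k \<otimes> inv h \<otimes> inv (t [^] k))"
    using h t by (simp add: m_assoc int_pow_neg inv_mult_group)
  moreover have "t [^] k \<otimes> inv h \<otimes> inv (t [^] k) \<in> H"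
    using normalizes_int_pow[OF nt subset] h by simp
  ultimately show ?thesis unfolding power_coset_def by blast
qed

lemma power_coset_0: "power_coset t H 0 = H"
  using subgroup.subset[OF sH] by (force simp: power_coset_def)

lemma power_coset_int_pow:
  assumes "a \<in> power_coset t H k"
  shows "a [^] (q::int) \<in> power_coset t H (k * q)"
proof -
  have a: "a \<in> carrier G" using assms by (rule power_coset_carrier)
  have pos: "a [^] n \<in> power_coset t H (k * int n)" for n :: nat
  proof (induction n)
    case 0
    then show ?case using power_coset_0 subgroup.one_closed[OF sH] by simp
  next
    case (Suc n)
    then show ?case using power_coset_mult[OF Suc assms] by (simp add: algebra_simps)
  qed
  show ?thesis
    using pos[of "nat q"] power_coset_inv[OF pos[of "nat (- q)"]]
    by (cases "q \<ge> 0") (auto simp: int_pow_def2 simp del: pow_nat)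
qed

lemma subgroup_Union_power_coset: "subgroup (\<Union>k. power_coset t H k) G"
  using power_coset_0 subgroup.one_closed[OF sH]
  by (intro subgroupI) (auto dest: power_coset_carrier power_coset_inv intro: power_coset_mult)

end

text \<open>Each cyclic step pulls back to a cyclic step: the exponents k for which t^k H is met by
  the image form a subgroup of the integers, and any element over a generator of it is the new
  cyclic generator. The identity map yields subgroups, a coordinate map yields pulled back
  quotients.\<close>

lemma polycyclic_over_vimage:
  assumes "polycyclic_over G M H" "group A" "p \<in> hom A G" "subgroup B A"
  shows "polycyclic_over A {b \<in> B. p b \<in> M} {b \<in> B. p b \<in> H}"
  using assms(1)
proof (induction rule: polycyclic_over.induct)
  case refl
  then show ?case using assms by (intro polycyclic_over.refl subgroup_vimage)
next
  case (step H H' t)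
  interpret A: group A by fact
  interpret p: group_hom A G p using assms by (simp add: group_hom_def group_hom_axioms_def is_group)
  interpret B: subgroup B A by fact
  have sH: "subgroup H G" using polycyclic_over_subgroups step by blast
  have Hc: "H \<subseteq> carrier G" using subgroup.subset[OF sH] .
  have t: "t \<in> carrier G" using step by (simp add: normalizes_def)
  have pcl: "\<And>a b k l. a \<in> power_coset t H k \<Longrightarrow> b \<in> power_coset t H l \<Longrightarrow> a \<otimes> b \<in> power_coset t H (k + l)"
    "\<And>a k. a \<in> power_coset t H k \<Longrightarrow> inv a \<in> power_coset t H (- k)"
    "\<And>a k q. a \<in> power_coset t H k \<Longrightarrow> a [^] (q::int) \<in> power_coset t H (k * q)"
    using power_coset_mult[OF \<open>normalizes G t H\<close> sH] power_coset_inv[OF \<open>normalizes G t H\<close> sH]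
    power_coset_int_pow[OF \<open>normalizes G t H\<close> sH] by blast+
  have p0: "power_coset t H 0 = H" by (rule power_coset_0[OF \<open>normalizes G t H\<close> sH])
  define K where "K = {k. \<exists>b\<in>B. p b \<in> H' \<and> p b \<in> power_coset t H k}"
  have "0 \<in> K" unfolding K_def using p0 subgroup.one_closed[OF sH] step(3)
    by (auto intro!: bexI[of _ "\<one>\<^bsub>A\<^esub>"])
  moreover have "a - b \<in> K" if ab: "a \<in> K" "b \<in> K" for a b
  proof -
    obtain x y where x: "x \<in> B" "p x \<in> H'" "p x \<in> power_coset t H a"
      and y: "y \<in> B" "p y \<in> H'" "p y \<in> power_coset t H b" using ab unfolding K_def by auto
    have "p (x \<otimes>\<^bsub>A\<^esub> inv\<^bsub>A\<^esub> y) = p x \<otimes> inv (p y)" using x y by simp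
    moreover have "p x \<otimes> inv (p y) \<in> power_coset t H (a + - b)" by (intro pcl(1) pcl(2) x y)
    moreover have "p x \<otimes> inv (p y) \<in> H'"
      using x y step by (simp add: subgroup.m_closed subgroup.m_inv_closed)
    ultimately show ?thesis unfolding K_def using x y by (auto intro!: bexI[of _ "x \<otimes>\<^bsub>A\<^esub> inv\<^bsub>A\<^esub> y"])
  qed
  ultimately obtain r where r: "r \<in> K" "\<And>k. k \<in> K \<Longrightarrow> r dvd k"
    using additive_int_set_principal[of K] by blast
  then obtain b0 where b0: "b0 \<in> B" "p b0 \<in> H'" "p b0 \<in> power_coset t H r" unfolding K_def by auto
  show ?case
  proof (rule polycyclic_over.step[OF step.IH])
    show "subgroup {b \<in> B. p b \<in> H'} A" using assms step(2) by (intro subgroup_vimage)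
    show "{b \<in> B. p b \<in> H} \<subseteq> {b \<in> B. p b \<in> H'}" using step(3) by auto
    show "b0 \<in> {b \<in> B. p b \<in> H'}" using b0 by blast
    have "p b0 \<otimes> h \<otimes> inv (p b0) \<in> H \<and> inv (p b0) \<otimes> h \<otimes> p b0 \<in> H" if "h \<in> H" for h
    proof -
      have "p b0 \<otimes> h \<otimes> inv (p b0) \<in> power_coset t H (r + 0 + - r)"
        "inv (p b0) \<otimes> h \<otimes> p b0 \<in> power_coset t H (- r + 0 + r)"
        by (intro pcl(1) pcl(2) b0(3); use that p0 in simp)+
      then show ?thesis using p0 by simp
    qed
    then show "normalizes A b0 {b \<in> B. p b \<in> H}"
      using b0 by (auto simp: normalizes_def)
  next
    fix g assume g: "g \<in> {b \<in> B. p b \<in> H'}"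
    then obtain k :: int and h where k: "h \<in> H" "p g = t [^] k \<otimes> h" using step(6)[of "p g"] by auto
    then have pg: "p g \<in> power_coset t H k" unfolding power_coset_def by auto
    then have "k \<in> K" using g unfolding K_def by auto
    then obtain q where q: "k = r * q" using r by (auto simp: dvd_def)
    \<comment> \<open>Dividing by a power of \<open>b0\<close> brings the exponent of the image to
      0, that is, the image into \<open>H\<close>.\<close>
    define b where "b = inv\<^bsub>A\<^esub> (b0 [^]\<^bsub>A\<^esub> q) \<otimes>\<^bsub>A\<^esub> g"
    have "p b = inv (p b0 [^] q) \<otimes> p g" using g b0 unfolding b_def by (simp add: p.hom_int_pow)
    moreover have "inv (p b0 [^] q) \<otimes> p g \<in> power_coset t H (- (r * q) + k)"
      by (intro pcl(1) pcl(2) pcl(3) b0(3) pg)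
    ultimately have "p b \<in> H" using q p0 by simp
    moreover have "b \<in> B" using g b0 unfolding b_def
      by (auto intro!: B.m_closed B.m_inv_closed A.subgroup_int_pow_closed assms)
    moreover have "g = b0 [^]\<^bsub>A\<^esub> q \<otimes>\<^bsub>A\<^esub> b" using g b0 unfolding b_def by simp
    ultimately show "\<exists>k::int. \<exists>h\<in>{b \<in> B. p b \<in> H}. g = b0 [^]\<^bsub>A\<^esub> k \<otimes>\<^bsub>A\<^esub> h" by blast
  qed
qed

lemma polycyclic_over_subgroup:
  assumes "polycyclic_over G M H" "subgroup B G" "M \<subseteq> B" "B \<subseteq> H"
  shows "polycyclic_over G M B"
proof -
  have "polycyclic_over G {b \<in> B. b \<in> M} {b \<in> B. b \<in> H}"
    using polycyclic_over_vimage[OF assms(1) is_group _ assms(2), of "\<lambda>x. x"] by (simp add: hom_def)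
  moreover have "{b \<in> B. b \<in> M} = M" "{b \<in> B. b \<in> H} = B" using assms by auto
  ultimately show ?thesis by simp
qed

lemma polycyclic_over_finitely_generated:
  assumes "polycyclic_over G M H"
  shows "\<exists>T. finite T \<and> T \<subseteq> H \<and> H = generate G (T \<union> M)"
  using assms
proof (induction rule: polycyclic_over.induct)
  case refl
  then have "M = generate G M" using generateI subgroup.subset by blast
  then show ?case by (intro exI[of _ "{}"]) auto
next
  case (step H H' t)
  then obtain T where T: "finite T" "T \<subseteq> H" "H = generate G (T \<union> M)" by auto
  have M: "M \<subseteq> H" using step polycyclic_over_subgroups by blast
  have sub: "insert t T \<union> M \<subseteq> carrier G"
    using T M step(2,3,4) subgroup.subset by blast
  have "g \<in> generate G (insert t T \<union> M)" if g: "g \<in> H'" for g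
  proof -
    obtain k h where kh: "h \<in> H" "g = t [^] (k::int) \<otimes> h" using step(6)[OF g] by auto
    have "h \<in> generate G (insert t T \<union> M)"
      using T(3) kh(1) mono_generate[of "T \<union> M" "insert t T \<union> M"] by auto
    moreover have "t [^] k \<in> generate G (insert t T \<union> M)"
      by (intro subgroup_int_pow_closed generate_is_subgroup sub) (auto intro: generate.incl)
    ultimately show ?thesis using kh generate.eng by metis
  qed
  moreover have "generate G (insert t T \<union> M) \<subseteq> H'"
    using step(2,3,4) T M by (intro generate_subgroup_incl) auto
  ultimately show ?case using T step(3,4) by (intro exI[of _ "insert t T"]) auto
qed

text \<open>A polycyclic torsion group is finite: at each step of the chain the exponent of t
  matters only modulo the order of t modulo \<open>P\<close>. The set \<open>T\<close> represents
  the left cosets of \<open>P\<close> that meet \<open>H\<close>.\<close>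

lemma polycyclic_over_torsion_finite:
  assumes "polycyclic_over G M H" "P \<lhd> G" "M \<subseteq> P"
    and tor: "\<And>g. g \<in> carrier G \<Longrightarrow> \<exists>r::nat. 0 < r \<and> g [^] r \<in> P"
  shows "\<exists>T. finite T \<and> T \<subseteq> carrier G \<and> (\<forall>g\<in>H. \<exists>s\<in>T. inv s \<otimes> g \<in> P)"
  using assms(1)
proof (induction rule: polycyclic_over.induct)
  case refl
  then show ?case using assms normal_imp_subgroup[OF assms(2), THEN subgroup.mem_carrier]
    by (intro exI[of _ "{\<one>}"]) auto
next
  case (step H H' t)
  interpret P: normal P G by fact
  obtain T where T: "finite T" "T \<subseteq> carrier G" "\<And>g. g \<in> H \<Longrightarrow> \<exists>s\<in>T. inv s \<otimes> g \<in> P"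
    using step by auto
  have t: "t \<in> carrier G" using step by (simp add: normalizes_def)
  obtain r where r: "0 < r" "t [^] (r::nat) \<in> P" using tor[OF t] by auto
  let ?T = "(\<lambda>(j, s). t [^] j \<otimes> s) ` ({0..<r} \<times> T)"
  have "\<exists>s\<in>?T. inv s \<otimes> g \<in> P" if g: "g \<in> H'" for g
  proof -
    obtain k h where kh: "h \<in> H" "g = t [^] (k::int) \<otimes> h" using step(6)[OF g] by auto
    have hc: "h \<in> carrier G" using kh step(3) subgroup.subset[OF step(2)] by auto
    obtain s where s: "s \<in> T" "inv s \<otimes> h \<in> P" using T kh by auto
    have sc: "s \<in> carrier G" using s T by auto
    define j where "j = nat (k mod int r)"
    define q where "q = k div int r"
    have j: "j < r" "k = int j + int r * q"
      using r unfolding j_def q_def by (auto simp: nat_less_iff)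
    have "t [^] k = t [^] j \<otimes> (t [^] r) [^] q"
      using t by (simp add: j(2) int_pow_mult int_pow_int[symmetric] int_pow_pow)
    moreover have zP: "(t [^] r) [^] q \<in> P" by (intro subgroup_int_pow_closed P.is_subgroup r)
    moreover define z where "z = (t [^] r) [^] q"
    ultimately have tk: "t [^] k = t [^] j \<otimes> z" and z: "z \<in> P" "z \<in> carrier G" using P.subset by auto
    have "inv (t [^] j \<otimes> s) \<otimes> g = (inv s \<otimes> z \<otimes> s) \<otimes> (inv s \<otimes> h)"
      using tk t z hc sc kh by (simp add: m_assoc inv_mult_group)
    moreover have "\<dots> \<in> P" using P.inv_op_closed1[OF sc z(1)] s by simp
    ultimately show ?thesis using j s by (intro bexI[of _ "t [^] j \<otimes> s"]) auto
  qed
  moreover have "finite ?T" "?T \<subseteq> carrier G" using T t by auto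
  ultimately show ?case by blast
qed

text \<open>Schreier's lemma: the set of products of a representative and an element of the subgroup
  generated by \<open>Y\<close> is stable under left multiplication by the generators and their
  inverses, hence by the whole group.\<close>

lemma finite_index_finitely_generated:
  assumes X: "finite X" "X \<subseteq> carrier G" "generate G X = carrier G" and P: "subgroup P G"
    and T: "finite T" "T \<subseteq> carrier G" "\<And>g. g \<in> carrier G \<Longrightarrow> \<exists>s\<in>T. inv s \<otimes> g \<in> P"
  shows "\<exists>Y. finite Y \<and> Y \<subseteq> P \<and> generate G Y = P"
proof -
  interpret P: subgroup P G by fact
  define T' where "T' = insert \<one> T"
  define X' where "X' = X \<union> (\<lambda>x. inv x) ` X"
  define Y where "Y = {inv s \<otimes> x \<otimes> u | s x u. s \<in> T' \<and> x \<in> insert \<one> X' \<and> u \<in> T'} \<inter> P"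
  have T': "T' \<subseteq> carrier G" "X' \<subseteq> carrier G" using T X by (auto simp: T'_def X'_def)
  have "Y \<subseteq> (\<lambda>(s, x, u). inv s \<otimes> x \<otimes> u) ` (T' \<times> insert \<one> X' \<times> T')" unfolding Y_def by force
  then have fin: "finite Y" using T X by (elim finite_subset) (auto simp: T'_def X'_def)
  have Yc: "Y \<subseteq> P" unfolding Y_def by auto
  interpret Y: subgroup "generate G Y" G using Yc P.subset by (intro generate_is_subgroup) auto
  have step: "\<exists>s\<in>T'. \<exists>y\<in>generate G Y. x \<otimes> g = s \<otimes> y"
    if x: "x \<in> insert \<one> X'" and g: "g = u \<otimes> y" "u \<in> T'" "y \<in> generate G Y" for x g u y
  proof -
    have c: "x \<in> carrier G" "u \<in> carrier G" "y \<in> carrier G"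
      using x g T' Y.subset by auto
    obtain s where s: "s \<in> T" "inv s \<otimes> (x \<otimes> u) \<in> P" using T(3)[of "x \<otimes> u"] c by auto
    have sc: "s \<in> carrier G" "s \<in> T'" using s T by (auto simp: T'_def)
    have "inv s \<otimes> x \<otimes> u \<in> Y" using s sc c x g unfolding Y_def
      by (intro IntI CollectI exI[of _ s] exI[of _ x] exI[of _ u] conjI) (auto simp: m_assoc)
    then have "(inv s \<otimes> x \<otimes> u) \<otimes> y \<in> generate G Y" using g by (auto intro: generate.eng generate.incl)
    moreover have "x \<otimes> g = s \<otimes> ((inv s \<otimes> x \<otimes> u) \<otimes> y)" using g c sc by (simp add: m_assoc)
    ultimately show ?thesis using sc by blast
  qed
  have all: "\<forall>u\<in>T'. \<forall>y\<in>generate G Y. \<exists>s\<in>T'. \<exists>z\<in>generate G Y. g \<otimes> (u \<otimes> y) = s \<otimes> z"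
    if "g \<in> generate G X" for g
    using that
  proof (induction rule: generate.induct)
    case one
    then show ?case using step[of \<one>] by blast
  next
    case (incl h)
    then have "h \<in> insert \<one> X'" unfolding X'_def by simp
    then show ?case using step[of h] by blast
  next
    case (inv h)
    then have "inv h \<in> insert \<one> X'" unfolding X'_def by simp
    then show ?case using step[of "inv h"] by blast
  next
    case (eng h1 h2)
    show ?case
    proof (intro ballI)
      fix u y assume uy: "u \<in> T'" "y \<in> generate G Y"
      obtain s z where sz: "s \<in> T'" "z \<in> generate G Y" "h2 \<otimes> (u \<otimes> y) = s \<otimes> z" using eng(4)[rule_format, OF uy] by blast
      obtain s' z' where sz': "s' \<in> T'" "z' \<in> generate G Y" "h1 \<otimes> (s \<otimes> z) = s' \<otimes> z'" using eng(3)[rule_format, OF sz(1,2)] by blast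
      have "h1 \<in> carrier G" "h2 \<in> carrier G" "u \<in> carrier G" "y \<in> carrier G"
        using generate_in_carrier[OF X(2) eng(1)] generate_in_carrier[OF X(2) eng(2)] uy T'(1) Y.subset by blast+
      then have "h1 \<otimes> h2 \<otimes> (u \<otimes> y) = h1 \<otimes> (h2 \<otimes> (u \<otimes> y))" by (simp add: m_assoc)
      then show "\<exists>s\<in>T'. \<exists>z\<in>generate G Y. h1 \<otimes> h2 \<otimes> (u \<otimes> y) = s \<otimes> z" using sz sz' by metis
    qed
  qed
  have "g \<in> generate G Y" if g: "g \<in> P" for g
  proof -
    have gc: "g \<in> generate G X" using g X by auto
    have "\<exists>s\<in>T'. \<exists>z\<in>generate G Y. g \<otimes> (\<one> \<otimes> \<one>) = s \<otimes> z"
      using bspec[OF bspec[OF all[OF gc], of \<one>], of \<one>] by (auto simp: T'_def)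
    then obtain s z where sz: "s \<in> T'" "z \<in> generate G Y" "g = s \<otimes> z" using g by auto
    have zP: "z \<in> P" using sz generate_subgroup_incl[OF Yc P] by auto
    have sc: "s \<in> carrier G" using sz T' by auto
    have "s = g \<otimes> inv z" using sz zP sc by (simp add: m_assoc)
    then have "s \<in> P" using g zP by simp
    then have "inv \<one> \<otimes> \<one> \<otimes> s \<in> Y" using sz sc unfolding Y_def
      by (intro IntI CollectI exI[of _ \<one>] exI[of _ s] conjI) (auto simp: T'_def)
    then have "s \<in> generate G Y" using sc by (auto intro: generate.incl)
    then show ?thesis using sz generate.eng by metis
  qed
  then have "generate G Y = P" using generate_subgroup_incl[OF Yc P] by auto
  then show ?thesis using fin Yc by blast
qed

section \<open>Finite normal generation of kernels onto polycyclic groups\<close>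

lemma conj_hom: "a \<in> carrier G \<Longrightarrow> (\<lambda>x. a \<otimes> x \<otimes> inv a) \<in> hom G G"
  by (rule homI) (auto simp: m_assoc)

lemma subgroup_Collect_conj:
  assumes "subgroup N G" "a \<in> carrier G"
  shows "subgroup {x \<in> carrier G. a \<otimes> x \<otimes> inv a \<in> N} G"
  by (rule subgroup_vimage[OF is_group conj_hom[OF assms(2)] assms(1) subgroup_self])

lemma normalizes_generate:
  assumes Y: "Y \<subseteq> carrier G" and t: "t \<in> carrier G"
    and "\<And>y. y \<in> Y \<Longrightarrow> t \<otimes> y \<otimes> inv t \<in> generate G Y" "\<And>y. y \<in> Y \<Longrightarrow> inv t \<otimes> y \<otimes> t \<in> generate G Y"
  shows "normalizes G t (generate G Y)"
proof -
  have sub: "subgroup (generate G Y) G" using Y by (rule generate_is_subgroup)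
  have "generate G Y \<subseteq> {x \<in> carrier G. t \<otimes> x \<otimes> inv t \<in> generate G Y}"
    using assms by (intro generate_subgroup_incl subgroup_Collect_conj sub) auto
  moreover have "generate G Y \<subseteq> {x \<in> carrier G. inv t \<otimes> x \<otimes> inv (inv t) \<in> generate G Y}"
    using assms by (intro generate_subgroup_incl subgroup_Collect_conj sub) auto
  ultimately show ?thesis using t unfolding normalizes_def by auto
qed

text \<open>Identities that hold up to corrections from an infinite \<open>M\<close> involve only
  finitely many corrections when there are finitely many identities. These corrections become the
  relators throughout.\<close>

lemma finite_absorb:
  assumes "finite B" "\<And>b. b \<in> B \<Longrightarrow> \<exists>x\<in>T. \<exists>m\<in>M. b = x \<otimes> m"
  obtains R where "finite R" "R \<subseteq> M" "\<And>b. b \<in> B \<Longrightarrow> \<exists>x\<in>T. \<exists>m\<in>R. b = x \<otimes> m"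
proof -
  have "\<forall>b\<in>B. \<exists>m. m \<in> M \<and> (\<exists>x\<in>T. b = x \<otimes> m)" using assms(2) by blast
  then obtain f where f: "\<forall>b\<in>B. f b \<in> M \<and> (\<exists>x\<in>T. b = x \<otimes> f b)" by (rule bchoice[THEN exE])
  have "finite (f ` B)" "f ` B \<subseteq> M" using f assms(1) by auto
  moreover have "\<forall>b\<in>B. \<exists>x\<in>T. \<exists>m\<in>f ` B. b = x \<otimes> m"
  proof
    fix b assume b: "b \<in> B"
    then obtain x where "x \<in> T" "b = x \<otimes> f b" using f by auto
    with b show "\<exists>x\<in>T. \<exists>m\<in>f ` B. b = x \<otimes> m" by blast
  qed
  ultimately show ?thesis by (intro that[of "f ` B"]) auto
qed

lemma int_pow_in_subgroup_principal:
  assumes "t \<in> carrier G" "subgroup H G"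
  obtains r :: int where "t [^] r \<in> H" "\<And>k::int. t [^] k \<in> H \<Longrightarrow> r dvd k"
proof -
  interpret H: subgroup H G by fact
  have "t [^] (a - b) \<in> H" if "t [^] a \<in> H" "t [^] b \<in> H" for a b :: int
    using that assms(1) by (simp add: int_pow_diff)
  then show thesis
    using additive_int_set_principal[of "{k. t [^] k \<in> H}"] that by auto
qed

text \<open>Lifts to \<open>H\<close>, by the finite set \<open>T\<close>, of a polycyclic generating sequence of \<open>H / M\<close>; \<open>R\<close> contains the values of the
  polycyclic relators.\<close>

lemma polycyclic_over_relators:
  assumes "polycyclic_over G M H" "M \<lhd> G"
  shows "\<exists>T R. finite T \<and> T \<subseteq> H \<and> finite R \<and> R \<subseteq> M \<and>
    (\<forall>h\<in>H. \<exists>x\<in>generate G T. \<exists>m\<in>M. h = x \<otimes> m) \<and> generate G T \<inter> M \<subseteq> normal_closure G R"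
  using assms(1)
proof (induction rule: polycyclic_over.induct)
  case refl
  interpret M: normal M G by fact
  have "generate G {} \<subseteq> normal_closure G {}"
    by (intro generate_subgroup_incl normal_imp_subgroup normal_closure_normal) auto
  moreover have "\<exists>x\<in>generate G {}. \<exists>m\<in>M. h = x \<otimes> m" if "h \<in> M" for h
    using that generate.one[of G "{}"] by (intro bexI[of _ \<one>] bexI[of _ h]) auto
  ultimately show ?case by (intro exI[of _ "{}"]) auto
next
  case (step H H' t)
  interpret M: normal M G by fact
  obtain T R where T: "finite T" "T \<subseteq> H" and R: "finite R" "R \<subseteq> M"
    and dec: "\<And>h. h \<in> H \<Longrightarrow> \<exists>x\<in>generate G T. \<exists>m\<in>M. h = x \<otimes> m"
    and int: "generate G T \<inter> M \<subseteq> normal_closure G R" using step.IH by auto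
  have H: "subgroup H G" "M \<subseteq> H" using polycyclic_over_subgroups[OF step(1)] by auto
  have Hc: "H \<subseteq> carrier G" using H subgroup.subset by blast
  have t: "t \<in> carrier G" using normalizesD(1)[OF step(5)] .
  have Tc: "T \<subseteq> carrier G" using T Hc by auto
  obtain r where r: "t [^] (r::int) \<in> H" "\<And>k::int. t [^] k \<in> H \<Longrightarrow> r dvd k"
    using int_pow_in_subgroup_principal[OF t H(1)] by blast
  \<comment> \<open>The polycyclic relators that involve t rewrite these elements as words in
    \<open>T\<close>: the two conjugation actions of t on \<open>T\<close>, and the power of t that
    generates all powers lying in \<open>H\<close>.\<close>
  define B where "B = (\<lambda>y. t \<otimes> y \<otimes> inv t) ` T \<union> (\<lambda>y. inv t \<otimes> y \<otimes> t) ` T \<union> {t [^] r}"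
  have "B \<subseteq> H" using T(2) normalizesD[OF step(5)] r unfolding B_def by auto
  then have decB: "\<exists>x\<in>generate G T. \<exists>m\<in>M. b = x \<otimes> m" if "b \<in> B" for b
    by (intro dec) (use that in auto)
  have finB: "finite B" unfolding B_def using T by auto
  obtain R1 where R1: "finite R1" "R1 \<subseteq> M" "\<And>b. b \<in> B \<Longrightarrow> \<exists>x\<in>generate G T. \<exists>m\<in>R1. b = x \<otimes> m"
    using finite_absorb[of B "generate G T" M, OF finB decB] by (metis (no_types, lifting))
  define N where "N = normal_closure G (R \<union> R1)"
  have RM: "R \<union> R1 \<subseteq> M" using R R1 by auto
  have N: "N \<lhd> G" "N \<subseteq> M" "R \<union> R1 \<subseteq> N" unfolding N_def
    using normal_closure_normal[of "R \<union> R1"] normal_closure_incl[of "R \<union> R1"] RM M.subset normal_closure_least[OF assms(2) RM]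
    by blast+
  interpret N: normal N G by fact
  \<comment> \<open>Modulo \<open>N\<close> the new relators hold. So t normalizes \<open>W\<close>,
    and the powers of t in \<open>W\<close> are exactly the powers of t^r.\<close>
  define W where "W = generate G (T \<union> N)"
  have Weq: "W = {h \<otimes> n | h n. h \<in> generate G T \<and> n \<in> N}"
    unfolding W_def by (rule generate_un_normal[OF Tc N(1)])
  have BW: "b \<in> W" if "b \<in> B" for b using R1(3)[OF that] N(3) unfolding Weq by fast
  have TNc: "T \<union> N \<subseteq> carrier G" using Tc N.subset by auto
  have W: "subgroup W G" unfolding W_def by (rule generate_is_subgroup[OF TNc])
  interpret W: subgroup W G by fact
  have NW: "N \<subseteq> W" unfolding W_def by (auto intro: generate.incl)
  have WH: "W \<subseteq> H" unfolding W_def using T N H by (intro generate_subgroup_incl) auto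
  have norm: "normalizes G t W"
    unfolding W_def
  proof (rule normalizes_generate[OF TNc t])
    fix y assume y: "y \<in> T \<union> N"
    show "t \<otimes> y \<otimes> inv t \<in> generate G (T \<union> N)"
      using y BW[of "t \<otimes> y \<otimes> inv t"] N.inv_op_closed2[OF t, of y] NW unfolding W_def[symmetric] B_def by blast
    show "inv t \<otimes> y \<otimes> t \<in> generate G (T \<union> N)"
      using y BW[of "inv t \<otimes> y \<otimes> t"] N.inv_op_closed1[OF t, of y] NW unfolding W_def[symmetric] B_def by blast
  qed
  have "t \<in> power_coset t W 1"
    using t unfolding power_coset_def by (intro CollectI exI[of _ \<one>]) simp
  moreover have "T \<subseteq> W" unfolding W_def by (auto intro: generate.incl)
  then have "T \<subseteq> power_coset t W 0" unfolding power_coset_0[OF norm W] .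
  ultimately have genT': "generate G (insert t T) \<subseteq> (\<Union>k. power_coset t W k)"
    by (intro generate_subgroup_incl subgroup_Union_power_coset norm W) blast
  \<comment> \<open>The t-exponent of such a word is divisible by r because the word lies in
    \<open>H\<close>; hence the word is in \<open>W\<close>, that is, a word in \<open>T\<close>
    modulo \<open>N\<close>, and the induction hypothesis applies to that word.\<close>
  have "w \<in> N" if w: "w \<in> generate G (insert t T)" "w \<in> M" for w
  proof -
    obtain k w0 where k: "w0 \<in> W" "w = t [^] (k::int) \<otimes> w0"
      using subsetD[OF genT' w(1)] unfolding power_coset_def by blast
    have w0: "w0 \<in> H" "w0 \<in> carrier G" "w \<in> H" using k WH w H W.subset by auto
    have "t [^] k = w \<otimes> inv w0" using k(2) w0 t by (simp add: m_assoc)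
    then have "t [^] k \<in> H" using w0 H(1) by (simp add: subgroup.m_closed subgroup.m_inv_closed)
    then obtain q where q: "k = r * q" using r(2) by (auto simp: dvd_def)
    have "(t [^] r) [^] q \<in> W"
      by (rule subgroup_int_pow_closed[OF W BW]) (simp add: B_def)
    then have "t [^] k \<in> W" using q t by (simp add: int_pow_pow)
    then have "w \<in> W" using k by simp
    then obtain x n where xn: "x \<in> generate G T" "n \<in> N" "w = x \<otimes> n" unfolding Weq by blast
    have xc: "x \<in> carrier G" using xn(1) generate_in_carrier[OF Tc] by blast
    have "x = w \<otimes> inv n" using xn xc by (simp add: m_assoc)
    then have "x \<in> M" using w(2) xn(2) N(2) by (simp add: subsetD)
    then have "x \<in> N" using int xn(1) normal_closure_mono[of R "R \<union> R1"] unfolding N_def by blast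
    then show ?thesis using xn by simp
  qed
  then have c1: "generate G (insert t T) \<inter> M \<subseteq> normal_closure G (R \<union> R1)" unfolding N_def by blast
  have c2: "\<exists>x\<in>generate G (insert t T). \<exists>m\<in>M. g = x \<otimes> m" if g: "g \<in> H'" for g
  proof -
    obtain k h where k: "h \<in> H" "g = t [^] (k::int) \<otimes> h" using step(6)[OF g] by blast
    obtain x m where xm: "x \<in> generate G T" "m \<in> M" "h = x \<otimes> m" using dec[OF k(1)] by blast
    have iT: "insert t T \<subseteq> carrier G" using t Tc by auto
    have "x \<in> generate G (insert t T)" using xm(1) mono_generate[of T "insert t T"] by blast
    moreover have "t [^] k \<in> generate G (insert t T)"
      by (intro subgroup_int_pow_closed generate_is_subgroup iT generate.incl) simp
    ultimately have "t [^] k \<otimes> x \<in> generate G (insert t T)" by (intro generate.eng)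
    moreover have "g = t [^] k \<otimes> x \<otimes> m"
      using k xm t generate_in_carrier[OF Tc xm(1)] by (simp add: m_assoc)
    ultimately show ?thesis using xm(2) by blast
  qed
  show ?case
    using T R R1 step(3,4) c1 c2 RM by (intro exI[of _ "insert t T"] exI[of _ "R \<union> R1"]) auto
qed

text \<open>This is finite presentability of polycyclic groups, relative to prescribed generators
  \<open>X\<close>: besides the polycyclic relators, finitely many more express \<open>X\<close>
  through the polycyclic generators and so force G to be generated by these modulo the
  relators.\<close>

proposition polycyclic_quotient_normally_finitely_generated:
  assumes X: "finite X" "X \<subseteq> carrier G" "generate G X = carrier G"
    and M: "M \<lhd> G" "polycyclic_over G M (carrier G)"
  obtains R where "finite R" "R \<subseteq> M" "normal_closure G R = M"
proof -
  interpret M: normal M G by fact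
  obtain T R where T: "finite T" "T \<subseteq> carrier G" and R: "finite R" "R \<subseteq> M"
    and dec: "\<And>h. h \<in> carrier G \<Longrightarrow> \<exists>x\<in>generate G T. \<exists>m\<in>M. h = x \<otimes> m"
    and int: "generate G T \<inter> M \<subseteq> normal_closure G R"
    using polycyclic_over_relators[OF M(2,1)] by auto
  have decX: "\<exists>x\<in>generate G T. \<exists>m\<in>M. b = x \<otimes> m" if "b \<in> X" for b
    by (intro dec) (use that X in auto)
  obtain R1 where R1: "finite R1" "R1 \<subseteq> M" "\<And>b. b \<in> X \<Longrightarrow> \<exists>x\<in>generate G T. \<exists>m\<in>R1. b = x \<otimes> m"
    using finite_absorb[of X "generate G T" M, OF X(1) decX] by (metis (no_types, lifting))
  define N where "N = normal_closure G (R \<union> R1)"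
  have RM: "R \<union> R1 \<subseteq> M" using R R1 by auto
  have N: "N \<lhd> G" "N \<subseteq> M" "R \<union> R1 \<subseteq> N" unfolding N_def
    using normal_closure_normal[of "R \<union> R1"] normal_closure_incl[of "R \<union> R1"] RM M.subset normal_closure_least[OF M(1) RM]
    by blast+
  interpret N: normal N G by fact
  let ?W = "{h \<otimes> n | h n. h \<in> generate G T \<and> n \<in> N}"
  have "X \<subseteq> ?W" using R1(3) N(3) by blast
  then have "generate G X \<subseteq> ?W"
    by (intro generate_subgroup_incl subgroup_mult_normal generate_is_subgroup T N(1))
  have "m \<in> N" if m: "m \<in> M" for m
  proof -
    have "m \<in> ?W" using \<open>generate G X \<subseteq> ?W\<close> m X(3) M.subset by blast
    then obtain x n where xn: "x \<in> generate G T" "n \<in> N" "m = x \<otimes> n" by blast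
    have xc: "x \<in> carrier G" using xn(1) generate_in_carrier[OF T(2)] by blast
    have "x = m \<otimes> inv n" using xn xc by (simp add: m_assoc)
    then have "x \<in> M" using m xn(2) N(2) by (simp add: subsetD)
    then have "x \<in> N" using int xn(1) normal_closure_mono[of R "R \<union> R1"] unfolding N_def by blast
    then show ?thesis using xn by simp
  qed
  then have "normal_closure G (R \<union> R1) = M" using N unfolding N_def by blast
  then show ?thesis using that R R1 RM by blast
qed

end

section \<open>Noetherian modules over polycyclic groups\<close>

definition invariant_between :: "('a, 'b) monoid_scheme \<Rightarrow> 'a set \<Rightarrow> 'a set \<Rightarrow> 'a set \<Rightarrow> 'a set \<Rightarrow> bool" where
  "invariant_between G D K H U \<longleftrightarrow> subgroup U G \<and> D \<subseteq> U \<and> U \<subseteq> K \<and>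
     (\<forall>h\<in>H. \<forall>u\<in>U. h \<otimes>\<^bsub>G\<^esub> u \<otimes>\<^bsub>G\<^esub> inv\<^bsub>G\<^esub> h \<in> U)"

definition invariant_span :: "('a, 'b) monoid_scheme \<Rightarrow> 'a set \<Rightarrow> 'a set \<Rightarrow> 'a set \<Rightarrow> 'a set" where
  "invariant_span G D H V = generate G (D \<union> (\<Union>h\<in>H. \<Union>v\<in>V. {h \<otimes>\<^bsub>G\<^esub> v \<otimes>\<^bsub>G\<^esub> inv\<^bsub>G\<^esub> h}))"

text \<open>\<open>K / D\<close> is an abelian normal section, that is, a module over \<open>G\<close> acting by conjugation. Submodules are represented by
  their preimages in \<open>K\<close>.\<close>

locale abelian_section = group +
  fixes D K
  assumes D_normal: "D \<lhd> G" and K_normal: "K \<lhd> G" and D_K: "D \<subseteq> K"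
    and abelian: "\<And>a b. a \<in> K \<Longrightarrow> b \<in> K \<Longrightarrow> gcomm G a b \<in> D"
begin

sublocale D: normal D G by (rule D_normal)
sublocale K: normal K G by (rule K_normal)

definition "invariant H U \<longleftrightarrow> invariant_between G D K H U"
definition "span H V = invariant_span G D H V"

lemma invariantD:
  assumes "invariant H U"
  shows "subgroup U G" "D \<subseteq> U" "U \<subseteq> K" "\<And>h u. h \<in> H \<Longrightarrow> u \<in> U \<Longrightarrow> h \<otimes> u \<otimes> inv h \<in> U"
  using assms unfolding invariant_def invariant_between_def by blast+

lemma invariantI:
  assumes "subgroup U G" "D \<subseteq> U" "U \<subseteq> K" "\<And>h u. h \<in> H \<Longrightarrow> u \<in> U \<Longrightarrow> h \<otimes> u \<otimes> inv h \<in> U"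
  shows "invariant H U"
  using assms unfolding invariant_def invariant_between_def by blast

text \<open>k u k^-1 = [k,u] u, and [k,u] lies in D, hence in U: the group K acts trivially on K/D.
  Therefore submodules normalize each other and their products are subgroups.\<close>

lemma invariant_K_conj:
  assumes "invariant H U" "k \<in> K" "u \<in> U"
  shows "k \<otimes> u \<otimes> inv k \<in> U"
proof -
  interpret U: subgroup U G by (rule invariantD[OF assms(1)])
  have uK: "u \<in> K" using assms invariantD(3) by blast
  have "gcomm G k u \<in> U" using abelian[OF assms(2) uK] invariantD(2)[OF assms(1)] by blast
  then have "gcomm G k u \<otimes> u \<in> U" using assms(3) by simp
  moreover have "gcomm G k u \<otimes> u = k \<otimes> u \<otimes> inv k"
    using assms(2) uK by (simp add: gcomm_def m_assoc)
  ultimately show ?thesis by simp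
qed

lemma invariant_Int: "invariant H U \<Longrightarrow> invariant H W \<Longrightarrow> invariant H (U \<inter> W)"
  by (rule invariantI) (use subgroups_Inter_pair invariantD in blast)+

lemma invariant_mult:
  assumes "invariant H U" "invariant H W" "H \<subseteq> carrier G"
  shows "invariant H {u \<otimes> w | u w. u \<in> U \<and> w \<in> W}"
proof (rule invariantI)
  interpret U: subgroup U G by (rule invariantD[OF assms(1)])
  interpret W: subgroup W G by (rule invariantD[OF assms(2)])
  let ?P = "{u \<otimes> w | u w. u \<in> U \<and> w \<in> W}"
  have UK: "u \<in> K" if "u \<in> U" for u using that invariantD(3)[OF assms(1)] by blast
  have WK: "u \<in> K" if "u \<in> W" for u using that invariantD(3)[OF assms(2)] by blast
  show "subgroup ?P G"
  proof (rule subgroupI)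
    show "?P \<subseteq> carrier G" by auto
    show "?P \<noteq> {}" using U.one_closed W.one_closed by blast
    fix a assume "a \<in> ?P"
    then obtain u w where a: "u \<in> U" "w \<in> W" "a = u \<otimes> w" by blast
    have "inv a = inv u \<otimes> (u \<otimes> inv w \<otimes> inv u)" using a by (simp add: inv_mult_group m_assoc)
    moreover have "u \<otimes> inv w \<otimes> inv u \<in> W" using invariant_K_conj[OF assms(2) UK[OF a(1)]] a by simp
    moreover have "inv u \<in> U" using a by simp
    ultimately show "inv a \<in> ?P" by blast
    fix b assume "b \<in> ?P"
    then obtain u' w' where b: "u' \<in> U" "w' \<in> W" "b = u' \<otimes> w'" by blast
    have "a \<otimes> b = (u \<otimes> u') \<otimes> ((inv u' \<otimes> w \<otimes> inv (inv u')) \<otimes> w')" using a b by (simp add: m_assoc)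
    moreover have "inv u' \<otimes> w \<otimes> inv (inv u') \<in> W"
      using invariant_K_conj[OF assms(2) UK[of "inv u'"] a(2)] b by simp
    then have "(inv u' \<otimes> w \<otimes> inv (inv u')) \<otimes> w' \<in> W" using b by simp
    moreover have "u \<otimes> u' \<in> U" using a b by simp
    ultimately show "a \<otimes> b \<in> ?P" by blast
  qed
  show "D \<subseteq> ?P"
  proof
    fix d assume d: "d \<in> D"
    then have "d \<in> U" "d = d \<otimes> \<one>" using invariantD(2)[OF assms(1)] by auto
    then show "d \<in> ?P" using W.one_closed by blast
  qed
  show "?P \<subseteq> K" using UK WK by auto
  fix h x assume h: "h \<in> H" and "x \<in> ?P"
  then obtain u w where x: "u \<in> U" "w \<in> W" "x = u \<otimes> w" by blast
  have hc: "h \<in> carrier G" using h assms by auto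
  have "h \<otimes> x \<otimes> inv h = (h \<otimes> u \<otimes> inv h) \<otimes> (h \<otimes> w \<otimes> inv h)" using x hc by (simp add: m_assoc)
  then show "h \<otimes> x \<otimes> inv h \<in> ?P" using invariantD(4)[OF assms(1) h x(1)] invariantD(4)[OF assms(2) h x(2)] by blast
qed

text \<open>Conjugation by \<open>a\<close> is not H-linear but twisted by the automorphism that
  \<open>a\<close> induces on \<open>H\<close>; this is enough for it to carry H-submodules to
  H-submodules.\<close>

lemma invariant_vimage_conj:
  assumes "invariant H U" "H \<subseteq> carrier G" "normalizes G a H"
  shows "invariant H {x \<in> K. a \<otimes> x \<otimes> inv a \<in> U}"
proof (rule invariantI)
  have a: "a \<in> carrier G" using normalizesD(1)[OF assms(3)] .
  show "subgroup {x \<in> K. a \<otimes> x \<otimes> inv a \<in> U} G"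
    by (rule subgroup_vimage[OF is_group conj_hom[OF a] invariantD(1)[OF assms(1)] K.is_subgroup])
  show "D \<subseteq> {x \<in> K. a \<otimes> x \<otimes> inv a \<in> U}"
    using D_K D.inv_op_closed2[OF a] invariantD(2)[OF assms(1)] by blast
  show "{x \<in> K. a \<otimes> x \<otimes> inv a \<in> U} \<subseteq> K" by blast
  fix h u assume h: "h \<in> H" and u: "u \<in> {x \<in> K. a \<otimes> x \<otimes> inv a \<in> U}"
  have hc: "h \<in> carrier G" using h assms by auto
  have "a \<otimes> h \<otimes> inv a \<in> H" using normalizesD(2)[OF assms(3) h] .
  then have "(a \<otimes> h \<otimes> inv a) \<otimes> (a \<otimes> u \<otimes> inv a) \<otimes> inv (a \<otimes> h \<otimes> inv a) \<in> U"
    using invariantD(4)[OF assms(1)] u by blast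
  moreover have "(a \<otimes> h \<otimes> inv a) \<otimes> (a \<otimes> u \<otimes> inv a) \<otimes> inv (a \<otimes> h \<otimes> inv a) = a \<otimes> (h \<otimes> u \<otimes> inv h) \<otimes> inv a"
    using a hc u by (simp add: m_assoc inv_mult_group)
  ultimately show "h \<otimes> u \<otimes> inv h \<in> {x \<in> K. a \<otimes> x \<otimes> inv a \<in> U}"
    using u K.inv_op_closed2[OF hc] by simp
qed

lemma invariant_image_conj:
  assumes "invariant H U" "H \<subseteq> carrier G" "normalizes G a H"
  shows "invariant H ((\<lambda>x. a \<otimes> x \<otimes> inv a) ` U)"
proof -
  have a: "a \<in> carrier G" using normalizesD(1)[OF assms(3)] .
  have UK: "U \<subseteq> K" using invariantD(3)[OF assms(1)] .
  have na: "normalizes G (inv a) H" using assms(3) a unfolding normalizes_def by simp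
  have "(\<lambda>x. a \<otimes> x \<otimes> inv a) ` U = {x \<in> K. inv a \<otimes> x \<otimes> inv (inv a) \<in> U}"
  proof (intro equalityI subsetI)
    fix y assume "y \<in> (\<lambda>x. a \<otimes> x \<otimes> inv a) ` U"
    then obtain x where x: "x \<in> U" "y = a \<otimes> x \<otimes> inv a" by blast
    have xK: "x \<in> K" using x UK by blast
    then have "x \<in> carrier G" by simp
    then have "inv a \<otimes> y \<otimes> inv (inv a) = x" using x a by (simp add: m_assoc)
    then show "y \<in> {x \<in> K. inv a \<otimes> x \<otimes> inv (inv a) \<in> U}" using x K.inv_op_closed2[OF a xK] by simp
  next
    fix y assume y: "y \<in> {x \<in> K. inv a \<otimes> x \<otimes> inv (inv a) \<in> U}"
    then have "y \<in> carrier G" by simp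
    then have "y = a \<otimes> (inv a \<otimes> y \<otimes> inv (inv a)) \<otimes> inv a" using a by (simp add: m_assoc)
    then show "y \<in> (\<lambda>x. a \<otimes> x \<otimes> inv a) ` U" using y by blast
  qed
  then show ?thesis using invariant_vimage_conj[OF assms(1,2) na] by simp
qed

lemma invariant_span:
  assumes V: "V \<subseteq> K" and H: "subgroup H G"
  shows "invariant H (span H V)" "V \<subseteq> span H V"
proof -
  interpret H: subgroup H G by fact
  let ?Y = "D \<union> (\<Union>h\<in>H. \<Union>v\<in>V. {h \<otimes> v \<otimes> inv h})"
  have YK: "?Y \<subseteq> K" using D_K V K.inv_op_closed2 H.subset by blast
  then have Yc: "?Y \<subseteq> carrier G" using K.subset by blast
  have sub: "subgroup (span H V) G" unfolding span_def invariant_span_def by (rule generate_is_subgroup[OF Yc])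
  have inc: "?Y \<subseteq> span H V" unfolding span_def invariant_span_def by (auto intro: generate.incl)
  show "V \<subseteq> span H V"
  proof
    fix v assume v: "v \<in> V"
    then have "\<one> \<otimes> v \<otimes> inv \<one> \<in> ?Y" using H.one_closed by blast
    moreover have "\<one> \<otimes> v \<otimes> inv \<one> = v" using v V K.subset by auto
    ultimately show "v \<in> span H V" using inc by auto
  qed
  show "invariant H (span H V)"
  proof (rule invariantI[OF sub])
    show "D \<subseteq> span H V" using inc by blast
    show "span H V \<subseteq> K" unfolding span_def invariant_span_def by (rule generate_subgroup_incl[OF YK K.is_subgroup])
    fix h u assume h: "h \<in> H" and u: "u \<in> span H V"
    have hc: "h \<in> carrier G" using h by simp
    have "h \<otimes> y \<otimes> inv h \<in> span H V" if y: "y \<in> ?Y" for y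
    proof (cases "y \<in> D")
      case True
      then show ?thesis using D.inv_op_closed2[OF hc] inc by blast
    next
      case False
      then obtain h' v where hv: "h' \<in> H" "v \<in> V" "y = h' \<otimes> v \<otimes> inv h'" using y by blast
      have "h \<otimes> h' \<in> H" using h hv by simp
      then have "(h \<otimes> h') \<otimes> v \<otimes> inv (h \<otimes> h') \<in> span H V" using inc hv(2) by blast
      moreover have "v \<in> carrier G" "h' \<in> carrier G" using hv V K.subset by auto
      ultimately show ?thesis using hc hv by (simp add: m_assoc inv_mult_group)
    qed
    then have "?Y \<subseteq> {x \<in> carrier G. h \<otimes> x \<otimes> inv h \<in> span H V}" using Yc by blast
    then have "span H V \<subseteq> {x \<in> carrier G. h \<otimes> x \<otimes> inv h \<in> span H V}"
      unfolding span_def[of H V] invariant_span_def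
      by (rule generate_subgroup_incl) (use subgroup_Collect_conj[OF sub hc] in \<open>simp add: span_def invariant_span_def\<close>)
    then show "h \<otimes> u \<otimes> inv h \<in> span H V" using u by blast
  qed
qed

lemma span_least:
  assumes "invariant H U" "V \<subseteq> U"
  shows "span H V \<subseteq> U"
proof -
  have "D \<union> (\<Union>h\<in>H. \<Union>v\<in>V. {h \<otimes> v \<otimes> inv h}) \<subseteq> U"
    using invariantD(2)[OF assms(1)] invariantD(4)[OF assms(1)] assms(2) by blast
  then show ?thesis
    unfolding span_def invariant_span_def by (rule generate_subgroup_incl[OF _ invariantD(1)[OF assms(1)]])
qed

lemma invariant_mono: "invariant H U \<Longrightarrow> H' \<subseteq> H \<Longrightarrow> invariant H' U"
  by (rule invariantI) (use invariantD in blast)+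

text \<open>The condition concerns submodules of finitely generated modules, and not of K/D itself,
  since K/D need not be finitely generated over the smaller groups of a polycyclic chain. In this
  form it can be proved by induction along the chain.\<close>

definition noetherian_under :: "'a set \<Rightarrow> bool" where
  "noetherian_under H \<longleftrightarrow> (\<forall>V U. finite V \<and> V \<subseteq> K \<and> invariant H U \<and> U \<subseteq> span H V \<longrightarrow>
     (\<exists>B. finite B \<and> B \<subseteq> U \<and> U \<subseteq> span H B))"

text \<open>Elements of \<open>V\<close> are adjoined one at a time; each normalizes what has been
  generated so far, because K acts trivially on K/D. Invariance under the trivial group is a way to
  carry the inclusions D \<subseteq> U \<subseteq> K through the induction.\<close>

lemma polycyclic_over_generate:
  assumes "finite V" "V \<subseteq> K"
  shows "polycyclic_over G D (generate G (D \<union> V)) \<and> invariant {\<one>} (generate G (D \<union> V))"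
  using assms
proof (induction V rule: finite_induct)
  case empty
  have "generate G D = D" using generateI[OF D.is_subgroup, of D] by auto
  moreover have "invariant {\<one>} D" using D_K by (intro invariantI) (auto simp: D.is_subgroup)
  ultimately show ?case using polycyclic_over.refl[OF D.is_subgroup] by simp
next
  case (insert v V)
  let ?H = "generate G (D \<union> V)" and ?H' = "generate G (D \<union> insert v V)"
  have IH: "polycyclic_over G D ?H" "invariant {\<one>} ?H" using insert by auto
  have DVK: "D \<union> insert v V \<subseteq> K" using insert D_K by auto
  then have DVc: "D \<union> insert v V \<subseteq> carrier G" using K.subset by blast
  have sub': "subgroup ?H' G" by (rule generate_is_subgroup[OF DVc])
  have H'K: "?H' \<subseteq> K" by (rule generate_subgroup_incl[OF DVK K.is_subgroup])
  have vK: "v \<in> K" "inv v \<in> K" "v \<in> carrier G" using DVK by auto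
  have norm: "normalizes G v ?H"
    unfolding normalizes_def
    using invariant_K_conj[OF IH(2) vK(1)] invariant_K_conj[OF IH(2) vK(2)] vK(3) by simp
  have HH': "?H \<subseteq> ?H'" by (rule mono_generate) auto
  have vH': "v \<in> ?H'" by (auto intro: generate.incl)
  have "v \<in> power_coset v ?H 1"
    using vK(3) generate.one[of G "D \<union> V"] unfolding power_coset_def by (intro CollectI exI[of _ \<one>]) simp
  moreover have "D \<union> V \<subseteq> power_coset v ?H 0"
    unfolding power_coset_0[OF norm invariantD(1)[OF IH(2)]] by (auto intro: generate.incl)
  ultimately have H'sub: "?H' \<subseteq> (\<Union>k. power_coset v ?H k)"
    by (intro generate_subgroup_incl subgroup_Union_power_coset[OF norm invariantD(1)[OF IH(2)]]) blast
  have "polycyclic_over G D ?H'"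
  proof (rule polycyclic_over.step[OF IH(1) sub' HH' vH' norm])
    fix g assume "g \<in> ?H'"
    then show "\<exists>k::int. \<exists>h\<in>?H. g = v [^] k \<otimes> h"
      using subsetD[OF H'sub] unfolding power_coset_def by blast
  qed
  moreover have "invariant {\<one>} ?H'"
  proof (rule invariantI[OF sub' _ H'K])
    show "D \<subseteq> ?H'" by (auto intro: generate.incl)
    show "h \<otimes> u \<otimes> inv h \<in> ?H'" if "h \<in> {\<one>}" "u \<in> ?H'" for h u
      using that subgroup.mem_carrier[OF sub'] by simp
  qed
  ultimately show ?case by blast
qed

text \<open>Under a trivial action the span of \<open>V\<close> is generated by \<open>V\<close> as
  a group over D, so it is polycyclic over D, and so are its subgroups.\<close>

lemma noetherian_under_trivial_action:
  assumes C: "subgroup C G" and triv: "\<And>c k. c \<in> C \<Longrightarrow> k \<in> K \<Longrightarrow> gcomm G c k \<in> D"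
  shows "noetherian_under C"
  unfolding noetherian_under_def
proof (intro allI impI, elim conjE)
  fix V U assume V: "finite V" "V \<subseteq> K" and U: "invariant C U" "U \<subseteq> span C V"
  interpret C: subgroup C G by fact
  note pc = polycyclic_over_generate[OF V]
  let ?A = "generate G (D \<union> V)"
  have "invariant C ?A"
  proof (rule invariantI)
    show "subgroup ?A G" "D \<subseteq> ?A" "?A \<subseteq> K" using invariantD(1-3)[of "{\<one>}" ?A] pc by blast+
    fix h u assume h: "h \<in> C" and u: "u \<in> ?A"
    have uK: "u \<in> K" using u \<open>?A \<subseteq> K\<close> by blast
    have "gcomm G h u \<otimes> u \<in> ?A" using triv[OF h uK] \<open>D \<subseteq> ?A\<close> u by (intro generate.eng) auto
    moreover have "gcomm G h u \<otimes> u = h \<otimes> u \<otimes> inv h" using h uK by (simp add: gcomm_def m_assoc)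
    ultimately show "h \<otimes> u \<otimes> inv h \<in> ?A" by simp
  qed
  then have "span C V \<subseteq> ?A" by (rule span_least) (auto intro: generate.incl)
  then have "U \<subseteq> ?A" using U by blast
  then have "polycyclic_over G D U"
    using polycyclic_over_subgroup[OF conjunct1[OF pc] invariantD(1)[OF U(1)] invariantD(2)[OF U(1)]] by simp
  then obtain T where T: "finite T" "T \<subseteq> U" "U = generate G (T \<union> D)"
    using polycyclic_over_finitely_generated by blast
  have TK: "T \<subseteq> K" using T(2) invariantD(3)[OF U(1)] by blast
  have "T \<union> D \<subseteq> span C T" using invariant_span[OF TK C] invariantD(2) by blast
  then have "generate G (T \<union> D) \<subseteq> span C T"
    by (rule generate_subgroup_incl) (rule invariantD(1)[OF invariant_span(1)[OF TK C]])
  then show "\<exists>B. finite B \<and> B \<subseteq> U \<and> U \<subseteq> span C B" using T by blast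
qed

text \<open>Hilbert's basis theorem in the form of P. Hall: the role of the leading coefficients of polynomials is played by
  the submodules \<open>{b. t\<^sup>n b t\<^sup>-\<^sup>n \<in> U A\<^sub>n}\<close> for the subgroups \<open>A\<^sub>n\<close> spanned by the \<open>t\<^sup>i v t\<^sup>-\<^sup>i\<close> with
  \<open>i < n\<close>.\<close>

lemma noetherian_under_cyclic_extension:
  assumes H: "subgroup H G" and H': "subgroup H' G" and HH': "H \<subseteq> H'" and tH': "t \<in> H'"
    and norm: "normalizes G t H"
    and cyc: "\<And>g. g \<in> H' \<Longrightarrow> \<exists>k::int. \<exists>h\<in>H. g = t [^] k \<otimes> h"
    and noeth: "noetherian_under H"
  shows "noetherian_under H'"
  unfolding noetherian_under_def
proof (intro allI impI, elim conjE)
  fix V U assume V: "finite V" "V \<subseteq> K" and U: "invariant H' U" "U \<subseteq> span H' V"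
  interpret H: subgroup H G by fact
  interpret H': subgroup H' G by fact
  interpret U: subgroup U G by (rule invariantD(1)[OF U(1)])
  have t: "t \<in> carrier G" using normalizesD(1)[OF norm] .
  have Hc: "H \<subseteq> carrier G" and H'c: "H' \<subseteq> carrier G" by (rule H.subset, rule H'.subset)
  have UH: "invariant H U" by (rule invariant_mono[OF U(1) HH'])
  have UK: "U \<subseteq> K" by (rule invariantD(3)[OF U(1)])
  define cj where "cj n x = t [^] n \<otimes> x \<otimes> inv (t [^] n)" for n :: nat and x
  have normn: "normalizes G (t [^] n) H" for n :: nat
    unfolding normalizes_def
    using normalizes_int_pow[OF norm Hc, of _ "int n"] normalizes_int_pow'[OF norm Hc, of _ "int n"] t
    by (simp add: int_pow_int)
  have tnH': "t [^] n \<in> H'" for n :: nat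
    by (induction n) (use tH' in auto)
  have cjK: "cj n x \<in> K" if "x \<in> K" for n x
    unfolding cj_def by (rule K.inv_op_closed2) (use t that in auto)
  have cj_hom: "cj n \<in> hom G G" for n
    using conj_hom[of "t [^] n"] t unfolding cj_def by simp
  have cj_mult: "cj n (x \<otimes> y) = cj n x \<otimes> cj n y" if "x \<in> carrier G" "y \<in> carrier G" for n x y
    using hom_mult[OF cj_hom that] .
  have cj_add: "cj m (cj n x) = cj (m + n) x" if "x \<in> carrier G" for m n x
    using that t unfolding cj_def by (simp add: nat_pow_mult[symmetric] inv_mult_group m_assoc)
  have cjU: "cj n u \<in> W" if "invariant H' W" "u \<in> W" for n u W
    unfolding cj_def by (rule invariantD(4)[OF that(1) tnH' that(2)])
  \<comment> \<open>These are the polynomials of degree less than n in the variable t, where t acts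
    by conjugation and the coefficients come from \<open>A 1\<close>. In particular
    \<open>A 0\<close> is the zero module D.\<close>
  define A where "A n = span H (\<Union>i\<in>{..<n}. cj i ` V)" for n
  have VnK: "(\<Union>i\<in>{..<n}. cj i ` V) \<subseteq> K" for n using cjK V(2) by blast
  have Vnfin: "finite (\<Union>i\<in>{..<n}. cj i ` V)" for n using V(1) by simp
  have invA: "invariant H (A n)" for n unfolding A_def by (rule invariant_span(1)[OF VnK H])
  have VnA: "(\<Union>i\<in>{..<n}. cj i ` V) \<subseteq> A n" for n unfolding A_def by (rule invariant_span(2)[OF VnK H])
  have AK: "A n \<subseteq> K" for n by (rule invariantD(3)[OF invA])
  have Ac: "x \<in> carrier G" if "x \<in> A n" for x n using that AK by (blast intro: K.mem_carrier)
  have Amono: "A m \<subseteq> A n" if "m \<le> n" for m n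
    unfolding A_def[of m]
  proof (rule span_least[OF invA])
    have "(\<Union>i\<in>{..<m}. cj i ` V) \<subseteq> (\<Union>i\<in>{..<n}. cj i ` V)" using that by force
    then show "(\<Union>i\<in>{..<m}. cj i ` V) \<subseteq> A n" using VnA[of n] by (rule order_trans)
  qed
  \<comment> \<open>Multiplication by t^r raises the degree bound by r; it respects the spans over
    \<open>H\<close> because t^r normalizes \<open>H\<close>.\<close>
  have shift: "cj r x \<in> A (n + r)" if "x \<in> A n" for r n x
  proof -
    let ?S = "{x \<in> K. t [^] r \<otimes> x \<otimes> inv (t [^] r) \<in> A (n + r)}"
    have "A n \<subseteq> ?S"
      unfolding A_def[of n]
    proof (rule span_least[OF invariant_vimage_conj[OF invA Hc normn]], rule subsetI)
      fix y assume "y \<in> (\<Union>i\<in>{..<n}. cj i ` V)"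
      then obtain i v where iv: "i < n" "v \<in> V" "y = cj i v" by blast
      have vc: "v \<in> carrier G" using iv V by auto
      have "cj r y = cj (r + i) v" using iv cj_add[OF vc] by simp
      moreover have "cj (r + i) v \<in> A (n + r)" using VnA[of "n + r"] iv by force
      moreover have "y \<in> K" using iv cjK V by auto
      ultimately show "y \<in> ?S" unfolding cj_def[symmetric] by simp
    qed
    then show ?thesis using that unfolding cj_def by blast
  qed
  \<comment> \<open>The top term of a polynomial is split off, with its coefficient b in
    \<open>A 1\<close>.\<close>
  have split: "\<exists>b\<in>A 1. \<exists>a\<in>A n. x = cj n b \<otimes> a" if "x \<in> A (Suc n)" for n x
  proof -
    let ?P = "{u \<otimes> w | u w. u \<in> (\<lambda>x. t [^] n \<otimes> x \<otimes> inv (t [^] n)) ` A 1 \<and> w \<in> A n}"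
    have P: "invariant H ?P" by (rule invariant_mult[OF invariant_image_conj[OF invA Hc normn] invA Hc])
    have 1: "\<one> \<in> A m" for m using invariantD(1)[OF invA] by (rule subgroup.one_closed)
    have "A (Suc n) \<subseteq> ?P"
      unfolding A_def[of "Suc n"]
    proof (rule span_least[OF P], rule subsetI)
      fix y assume "y \<in> (\<Union>i\<in>{..<Suc n}. cj i ` V)"
      then obtain i v where iv: "i < Suc n" "v \<in> V" "y = cj i v" by blast
      have vc: "v \<in> carrier G" using iv V by auto
      show "y \<in> ?P"
      proof (cases "i = n")
        case True
        have "cj 0 v \<in> A 1" using VnA[of 1] iv by force
        then have "v \<in> A 1" using vc unfolding cj_def by simp
        then have "cj n v \<in> (\<lambda>x. t [^] n \<otimes> x \<otimes> inv (t [^] n)) ` A 1" unfolding cj_def by blast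
        moreover have "y = cj n v \<otimes> \<one>" using iv True vc t unfolding cj_def by simp
        ultimately show ?thesis using 1 by blast
      next
        case False
        then have "y \<in> A n" using VnA[of n] iv by force
        moreover have "cj n \<one> \<in> (\<lambda>x. t [^] n \<otimes> x \<otimes> inv (t [^] n)) ` A 1" using 1 unfolding cj_def by blast
        moreover have "y = cj n \<one> \<otimes> y" using Ac[OF \<open>y \<in> A n\<close>] t unfolding cj_def by simp
        ultimately show ?thesis by blast
      qed
    qed
    then show ?thesis using that unfolding cj_def by blast
  qed
  define I where "I n = {b \<in> A 1. \<exists>u\<in>U. \<exists>a\<in>A n. cj n b = u \<otimes> a}" for n
  have invI: "invariant H (I n)" for n
  proof -
    have "I n = A 1 \<inter> {x \<in> K. t [^] n \<otimes> x \<otimes> inv (t [^] n) \<in> {u \<otimes> w | u w. u \<in> U \<and> w \<in> A n}}"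
      unfolding I_def cj_def using AK[of 1] by blast
    then show ?thesis
      using invariant_Int[OF invA invariant_vimage_conj[OF invariant_mult[OF UH invA Hc] Hc normn]] by simp
  qed
  have IA: "I n \<subseteq> A 1" for n unfolding I_def by blast
  have IK: "I n \<subseteq> K" for n by (rule invariantD(3)[OF invI])
  \<comment> \<open>Multiplying an element of U by t keeps its leading coefficient and raises the
    degree by one.\<close>
  have Isuc: "I n \<subseteq> I (Suc n)" for n
  proof
    fix b assume "b \<in> I n"
    then obtain u a where b: "b \<in> A 1" "u \<in> U" "a \<in> A n" "cj n b = u \<otimes> a" unfolding I_def by blast
    have "cj (Suc n) b = cj 1 (cj n b)" using cj_add[OF Ac[OF b(1)]] by simp
    also have "\<dots> = cj 1 u \<otimes> cj 1 a" using b Ac[OF b(3)] cj_mult[of u a 1] U.mem_carrier by simp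
    finally have "cj (Suc n) b = cj 1 u \<otimes> cj 1 a" .
    moreover have "cj 1 u \<in> U" by (rule cjU[OF U(1) b(2)])
    moreover have "cj 1 a \<in> A (Suc n)" using shift[OF b(3), of 1] by simp
    ultimately show "b \<in> I (Suc n)" using b(1) unfolding I_def by blast
  qed
  have Imono: "I m \<subseteq> I n" if "m \<le> n" for m n
    by (rule lift_Suc_mono_le[of I, OF Isuc that])
  define J where "J = (\<Union>n. I n)"
  have invJ: "invariant H J"
  proof (rule invariantI)
    show "subgroup J G"
    proof (rule subgroupI)
      show "J \<subseteq> carrier G" unfolding J_def using IK K.subset by blast
      show "J \<noteq> {}" unfolding J_def using subgroup.one_closed[OF invariantD(1)[OF invI]] by blast
      fix a assume "a \<in> J"
      then obtain m where m: "a \<in> I m" unfolding J_def by blast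
      show "inv a \<in> J" unfolding J_def using subgroup.m_inv_closed[OF invariantD(1)[OF invI] m] by blast
      fix b assume "b \<in> J"
      then obtain n where n: "b \<in> I n" unfolding J_def by blast
      have "a \<in> I (max m n)" "b \<in> I (max m n)" using m n Imono[of m "max m n"] Imono[of n "max m n"] by auto
      then show "a \<otimes> b \<in> J" unfolding J_def using subgroup.m_closed[OF invariantD(1)[OF invI]] by blast
    qed
    show "D \<subseteq> J" unfolding J_def using invariantD(2)[OF invI] by blast
    show "J \<subseteq> K" unfolding J_def using IK by blast
    show "h \<otimes> u \<otimes> inv h \<in> J" if "h \<in> H" "u \<in> J" for h u
      using that(2) invariantD(4)[OF invI that(1)] unfolding J_def by blast
  qed
  \<comment> \<open>All leading coefficients together form a submodule of a finitely generated
    H-module. It is finitely generated by the assumption on \<open>H\<close>, so the ascending union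
    is reached at some \<open>n0\<close>.\<close>
  have "J \<subseteq> span H (\<Union>i\<in>{..<1}. cj i ` V)" using IA unfolding J_def A_def by blast
  then obtain B where B: "finite B" "B \<subseteq> J" "J \<subseteq> span H B"
    using noeth Vnfin[of 1] VnK[of 1] invJ unfolding noetherian_under_def by meson
  have "\<exists>n0. B \<subseteq> I n0"
    using B(1,2)
  proof (induction B rule: finite_induct)
    case (insert b B)
    then obtain n0 where n0: "B \<subseteq> I n0" by auto
    obtain m where m: "b \<in> I m" using insert(4) unfolding J_def by blast
    have "insert b B \<subseteq> I (max m n0)" using m n0 Imono[of m "max m n0"] Imono[of n0 "max m n0"] by auto
    then show ?case by blast
  qed simp
  then obtain n0 where n0: "B \<subseteq> I n0" by blast
  have J: "J \<subseteq> I n0" using B(3) span_least[OF invI n0] by (rule order_trans)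
  \<comment> \<open>The elements of U of degree at most \<open>n0\<close> also form a submodule of a
    finitely generated H-module; generators of it will generate all of U over
    \<open>H'\<close>.\<close>
  have invUA: "invariant H (U \<inter> A (Suc n0))" by (rule invariant_Int[OF UH invA])
  have "U \<inter> A (Suc n0) \<subseteq> span H (\<Union>i\<in>{..<Suc n0}. cj i ` V)" unfolding A_def by blast
  then obtain B1 where B1: "finite B1" "B1 \<subseteq> U \<inter> A (Suc n0)" "U \<inter> A (Suc n0) \<subseteq> span H B1"
    using noeth Vnfin[of "Suc n0"] VnK[of "Suc n0"] invUA unfolding noetherian_under_def by meson
  define Z where "Z = span H' B1"
  have B1K: "B1 \<subseteq> K" using B1(2) UK by blast
  have invZ: "invariant H' Z" unfolding Z_def by (rule invariant_span(1)[OF B1K H'])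
  interpret Z: subgroup Z G by (rule invariantD(1)[OF invZ])
  have "span H B1 \<subseteq> Z"
    by (rule span_least[OF invariant_mono[OF invZ HH']]) (simp add: Z_def invariant_span(2)[OF B1K H'])
  then have base: "U \<inter> A (Suc n0) \<subseteq> Z" using B1(3) by (rule order_trans[rotated])
  \<comment> \<open>The degree is lowered: above \<open>n0\<close>, the leading coefficient b of u
    is already the leading coefficient of some u' in U of degree \<open>n0\<close>, and u' shifted
    by t^(n - n0) cancels the top term of u.\<close>
  have UA: "U \<inter> A n \<subseteq> Z" for n
  proof (induction n)
    case 0
    then show ?case using base Amono[of 0 "Suc n0"] by blast
  next
    case (Suc n)
    show ?case
    proof (cases "n \<le> n0")
      case True
      then show ?thesis using base Amono[of "Suc n" "Suc n0"] by auto
    next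
      case False
      show ?thesis
      proof
        fix u assume u: "u \<in> U \<inter> A (Suc n)"
        then obtain b a where ba: "b \<in> A 1" "a \<in> A n" "u = cj n b \<otimes> a" using split[of u n] by blast
        interpret An: subgroup "A n" G by (rule invariantD(1)[OF invA])
        interpret An0: subgroup "A (Suc n0)" G by (rule invariantD(1)[OF invA])
        have uc: "u \<in> carrier G" using u by simp
        have bK: "b \<in> K" using ba(1) AK by blast
        have bc: "b \<in> carrier G" using bK by simp
        have cjc: "cj m b \<in> carrier G" for m using cjK[OF bK] by simp
        have "cj n b = u \<otimes> inv a" using ba uc cjc by (simp add: m_assoc)
        moreover have "inv a \<in> A n" using ba by simp
        ultimately have "b \<in> I n" using ba u unfolding I_def by blast
        then have "b \<in> I n0" using J unfolding J_def by blast
        then obtain u' a' where ua: "u' \<in> U" "a' \<in> A n0" "cj n0 b = u' \<otimes> a'" unfolding I_def by blast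
        have u'c: "u' \<in> carrier G" and a'c: "a' \<in> carrier G" using ua Ac by auto
        have "u' = cj n0 b \<otimes> inv a'" using ua u'c a'c by (simp add: m_assoc)
        moreover have "cj n0 b \<in> A (Suc n0)" using shift[OF ba(1), of n0] by simp
        moreover have "a' \<in> A (Suc n0)" using ua(2) Amono[of n0 "Suc n0"] by auto
        ultimately have u'A: "u' \<in> A (Suc n0)" by simp
        then have u'Z: "u' \<in> Z" using ua(1) base by blast
        define r where "r = n - n0"
        have rn: "n = r + n0" using False unfolding r_def by simp
        have "cj n b = cj r (cj n0 b)" using cj_add[OF bc, of r n0] rn by simp
        also have "\<dots> = cj r u' \<otimes> cj r a'" using ua(3) cj_mult[OF u'c a'c] by simp
        finally have cjn: "cj n b = cj r u' \<otimes> cj r a'" .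
        have z1: "cj r u' \<in> Z" "cj r u' \<in> U" using cjU[OF invZ u'Z] cjU[OF U(1) ua(1)] by auto
        have z2: "cj r a' \<in> A n" using shift[OF ua(2), of r] rn by (simp add: add.commute)
        have cs: "cj r u' \<in> carrier G" "cj r a' \<in> carrier G" "a \<in> carrier G"
          using z1 z2 ba(2) by auto
        have ueq: "u = cj r u' \<otimes> (cj r a' \<otimes> a)" using ba(3) cjn cs by (simp add: m_assoc)
        then have "cj r a' \<otimes> a = inv (cj r u') \<otimes> u" using cs by simp
        moreover have "inv (cj r u') \<otimes> u \<in> U" using z1 u by simp
        ultimately have "cj r a' \<otimes> a \<in> U" by simp
        moreover have "cj r a' \<otimes> a \<in> A n" using z2 ba(2) by simp
        ultimately have "cj r a' \<otimes> a \<in> U \<inter> A n" by simp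
        then have "cj r a' \<otimes> a \<in> Z" using Suc by blast
        then show "u \<in> Z" using ueq z1(1) by simp
      qed
    qed
  qed
  \<comment> \<open>Negative exponents are cleared: elements of the span over \<open>H'\<close> are
    Laurent polynomials in t, and a sufficiently high power of t turns them into
    polynomials.\<close>
  have reach: "\<exists>m n. cj m x \<in> A n" if "x \<in> span H' V" for x
  proof -
    let ?S = "{x \<in> K. \<exists>m n. cj m x \<in> A n}"
    have S: "subgroup ?S G"
    proof (rule subgroupI)
      show "?S \<subseteq> carrier G" using K.subset by blast
      have "cj 0 \<one> \<in> A 0" using subgroup.one_closed[OF invariantD(1)[OF invA]] unfolding cj_def by simp
      then show "?S \<noteq> {}" using K.one_closed by blast
      fix a assume "a \<in> ?S"
      then obtain m n where a: "a \<in> K" "cj m a \<in> A n" by blast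
      have ac: "a \<in> carrier G" using a by simp
      have "cj m (inv a) = inv (cj m a)" using ac t unfolding cj_def by (simp add: inv_mult_group m_assoc)
      then have "cj m (inv a) \<in> A n" using subgroup.m_inv_closed[OF invariantD(1)[OF invA] a(2)] by simp
      then show "inv a \<in> ?S" using a(1) by blast
      fix b assume "b \<in> ?S"
      then obtain m' n' where b: "b \<in> K" "cj m' b \<in> A n'" by blast
      have bc: "b \<in> carrier G" using b by simp
      let ?N = "max (n + m') (n' + m)"
      have "cj (m' + m) a \<in> A ?N"
        using shift[OF a(2), of m'] cj_add[OF ac, of m' m] Amono[of "n + m'" ?N] by auto
      moreover have "cj (m' + m) b \<in> A ?N"
        using shift[OF b(2), of m] cj_add[OF bc, of m m'] Amono[of "n' + m" ?N] by (auto simp: add.commute)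
      ultimately have "cj (m' + m) (a \<otimes> b) \<in> A ?N"
        using cj_mult[OF ac bc] subgroup.m_closed[OF invariantD(1)[OF invA]] by simp
      moreover have "a \<otimes> b \<in> K" using a(1) b(1) by simp
      ultimately show "a \<otimes> b \<in> ?S" by blast
    qed
    have gens: "D \<union> (\<Union>h\<in>H'. \<Union>v\<in>V. {h \<otimes> v \<otimes> inv h}) \<subseteq> ?S"
    proof (intro Un_least subsetI)
      fix d assume d: "d \<in> D"
      then have "cj 0 d \<in> A 0" using invariantD(2)[OF invA] unfolding cj_def by auto
      then show "d \<in> ?S" using d D_K by blast
    next
      fix y assume "y \<in> (\<Union>h\<in>H'. \<Union>v\<in>V. {h \<otimes> v \<otimes> inv h})"
      then obtain h v where hv: "h \<in> H'" "v \<in> V" "y = h \<otimes> v \<otimes> inv h" by blast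
      obtain k h1 where kh: "h1 \<in> H" "h = t [^] (k::int) \<otimes> h1" using cyc[OF hv(1)] by blast
      have vK: "v \<in> K" using hv V by blast
      have vc: "v \<in> carrier G" and h1c: "h1 \<in> carrier G" using vK kh by auto
      have yK: "y \<in> K" using hv vK K.inv_op_closed2[of h v] by auto
      \<comment> \<open>Large enough to make the exponent m + k nonnegative, whatever the sign of
        k.\<close>
      define m where "m = nat \<bar>k\<bar>"
      define l where "l = nat (int m + k)"
      have ml: "int m + k = int l" unfolding l_def m_def by (auto simp: abs_if)
      have "cj 0 v \<in> A 1" using VnA[of 1] hv by force
      then have "v \<in> A 1" using vc unfolding cj_def by simp
      then have w: "h1 \<otimes> v \<otimes> inv h1 \<in> A 1" using invariantD(4)[OF invA kh(1)] by blast
      have pw: "t [^] m \<otimes> t [^] k = t [^] l"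
      proof -
        have "t [^] m \<otimes> t [^] k = t [^] (int m + k)" using t by (simp add: int_pow_mult int_pow_int)
        then show ?thesis unfolding ml by (simp add: int_pow_int)
      qed
      have tk: "t [^] k \<in> carrier G" "t [^] m \<in> carrier G" using t by auto
      have "cj m y = (t [^] m \<otimes> t [^] k) \<otimes> (h1 \<otimes> v \<otimes> inv h1) \<otimes> inv (t [^] m \<otimes> t [^] k)"
        using hv(3) kh(2) tk vc h1c unfolding cj_def by (simp add: m_assoc inv_mult_group)
      also have "\<dots> = cj l (h1 \<otimes> v \<otimes> inv h1)" unfolding pw cj_def ..
      finally have "cj m y \<in> A (1 + l)" using shift[OF w, of l] by simp
      then show "y \<in> ?S" using yK by blast
    qed
    have "span H' V \<subseteq> ?S" unfolding span_def invariant_span_def by (rule generate_subgroup_incl[OF gens S])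
    then show ?thesis using that by blast
  qed
  have "U \<subseteq> Z"
  proof
    fix u assume u: "u \<in> U"
    then obtain m n where "cj m u \<in> A n" using reach U(2) by blast
    moreover have "cj m u \<in> U" by (rule cjU[OF U(1) u])
    ultimately have z: "cj m u \<in> Z" using UA by blast
    have "inv (t [^] m) \<in> H'" using tnH' by simp
    then have "inv (t [^] m) \<otimes> cj m u \<otimes> inv (inv (t [^] m)) \<in> Z" using invariantD(4)[OF invZ _ z] by blast
    moreover have "inv (t [^] m) \<otimes> cj m u \<otimes> inv (inv (t [^] m)) = u"
      using t U.mem_carrier[OF u] unfolding cj_def by (simp add: m_assoc)
    ultimately show "u \<in> Z" by simp
  qed
  then show "\<exists>B. finite B \<and> B \<subseteq> U \<and> U \<subseteq> span H' B" using B1 unfolding Z_def by blast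
qed

text \<open>P. Hall's theorem by induction along the chain. It starts from a group \<open>C\<close>
  that acts trivially on K/D, so only the quotient acting on the module has to be
  polycyclic.\<close>

proposition noetherian_under_polycyclic:
  assumes "polycyclic_over G C H" and "\<And>c k. c \<in> C \<Longrightarrow> k \<in> K \<Longrightarrow> gcomm G c k \<in> D"
  shows "noetherian_under H"
  using assms(1)
proof (induction rule: polycyclic_over.induct)
  case refl
  then show ?case using assms(2) by (rule noetherian_under_trivial_action)
next
  case (step H H' t)
  then show ?case
    using noetherian_under_cyclic_extension[of H H' t] polycyclic_over_subgroups by blast
qed

end

section \<open>Subgroups of free groups are projective\<close>

text \<open>The extension of letter values \<open>\<kappa>\<close> to words by the cocycle rule;
  \<open>\<rho> w\<close> is the coset reached after the suffix w has acted, which is where the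
  letter in front of it is evaluated.\<close>

primrec transversal_cocycle ::
    "('a, 'b) monoid_scheme \<Rightarrow> ('x letter \<Rightarrow> 'c \<Rightarrow> 'a) \<Rightarrow> ('x letter list \<Rightarrow> 'c) \<Rightarrow> 'x letter list \<Rightarrow> 'a" where
  "transversal_cocycle K \<kappa> \<rho> [] = \<one>\<^bsub>K\<^esub>"
| "transversal_cocycle K \<kappa> \<rho> (l # w) = \<kappa> l (\<rho> w) \<otimes>\<^bsub>K\<^esub> transversal_cocycle K \<kappa> \<rho> w"

lemma free_group_letter_mult:
  "w \<in> carrier (free_group X) \<Longrightarrow> [l] \<otimes>\<^bsub>free_group X\<^esub> w = cancel_cons l w"
  by (simp add: free_group_def)

lemma free_group_letter: "fst l \<in> X \<Longrightarrow> [l] \<in> carrier (free_group X)"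
  by (simp add: free_group_def reduced_def)

lemma free_group_one: "\<one>\<^bsub>free_group X\<^esub> = []"
  by (simp add: free_group_def)

lemma free_group_Nil_mult: "[] \<otimes>\<^bsub>free_group X\<^esub> w = w"
  by (simp add: free_group_def)

lemma free_group_inv_letter:
  assumes "fst l \<in> X"
  shows "inv\<^bsub>free_group X\<^esub> [l] = [inv_letter l]"
  using assms
  by (intro group.inv_equality[OF group_free_group])
     (auto simp: free_group_def reduced_def)

lemma free_group_Cons:
  assumes "l # w \<in> carrier (free_group X)"
  shows "fst l \<in> X" "w \<in> carrier (free_group X)" "l # w = [l] \<otimes>\<^bsub>free_group X\<^esub> w"
proof -
  show "fst l \<in> X" "w \<in> carrier (free_group X)"
    using assms by (auto simp: free_group_def reduced_Cons)
  then show "l # w = [l] \<otimes>\<^bsub>free_group X\<^esub> w"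
    using assms by (simp add: free_group_def cancel_cons_reduced)
qed

text \<open>A subgroup \<open>M\<close> of a free group is projective, although we do not show that it is free: the
  Kaloujnine-Krasner embedding turns lifts of the generators into a cocycle on the cosets of \<open>M\<close>,
  whose value at the trivial coset is the required splitting.\<close>

proposition free_group_subgroup_projective:
  assumes E: "group E" and K: "subgroup K E" and q: "q \<in> hom E (free_group X)"
    and M: "subgroup M (free_group X)" and qK: "q ` K = M"
  obtains \<tau> where "\<And>m. m \<in> M \<Longrightarrow> \<tau> m \<in> K" "\<And>m. m \<in> M \<Longrightarrow> q (\<tau> m) = m"
    "\<And>m m'. m \<in> M \<Longrightarrow> m' \<in> M \<Longrightarrow> \<tau> (m \<otimes>\<^bsub>free_group X\<^esub> m') = \<tau> m \<otimes>\<^bsub>E\<^esub> \<tau> m'"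
proof -
  let ?F = "free_group X"
  interpret F: group ?F by (rule group_free_group)
  interpret E: group E by fact
  interpret K: subgroup K E by fact
  interpret M: subgroup M ?F by fact
  interpret q: group_hom E ?F q using q by (simp add: group_hom_def group_hom_axioms_def E.is_group F.is_group)
  have "\<forall>m\<in>M. \<exists>k. k \<in> K \<and> q k = m" using qK by blast
  then obtain s where "\<forall>m\<in>M. s m \<in> K \<and> q (s m) = m" by (rule bchoice[THEN exE])
  then have sK: "s m \<in> K" and qs: "q (s m) = m" if "m \<in> M" for m using that by auto
  \<comment> \<open>Representatives of the left cosets of \<open>M\<close> that depend on the coset
    alone. The coset \<open>M\<close> receives the identity, so that the cocycle at the trivial
    coset maps under q exactly to the given element of \<open>M\<close>.\<close>
  define rep where "rep f = (if f \<in> M then \<one>\<^bsub>?F\<^esub> else (SOME y. y \<in> carrier ?F \<and> inv\<^bsub>?F\<^esub> f \<otimes>\<^bsub>?F\<^esub> y \<in> M))" for f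
  have rep_ex: "rep f \<in> carrier ?F \<and> inv\<^bsub>?F\<^esub> f \<otimes>\<^bsub>?F\<^esub> rep f \<in> M" if f: "f \<in> carrier ?F" for f
  proof (cases "f \<in> M")
    case True
    then show ?thesis unfolding rep_def by simp
  next
    case False
    have "f \<in> carrier ?F \<and> inv\<^bsub>?F\<^esub> f \<otimes>\<^bsub>?F\<^esub> f \<in> M" using f by simp
    then have "\<exists>y. y \<in> carrier ?F \<and> inv\<^bsub>?F\<^esub> f \<otimes>\<^bsub>?F\<^esub> y \<in> M" by blast
    from someI_ex[OF this] show ?thesis using False unfolding rep_def by simp
  qed
  then have repc: "rep f \<in> carrier ?F" and repM: "inv\<^bsub>?F\<^esub> f \<otimes>\<^bsub>?F\<^esub> rep f \<in> M"
    if "f \<in> carrier ?F" for f using that by blast+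
  have rep_eq: "rep f = rep g"
    if f: "f \<in> carrier ?F" and g: "g \<in> carrier ?F" and fg: "inv\<^bsub>?F\<^esub> f \<otimes>\<^bsub>?F\<^esub> g \<in> M" for f g
  proof -
    have gf: "inv\<^bsub>?F\<^esub> g \<otimes>\<^bsub>?F\<^esub> f \<in> M"
      using M.m_inv_closed[OF fg] f g by (simp add: F.inv_mult_group)
    have iff: "inv\<^bsub>?F\<^esub> f \<otimes>\<^bsub>?F\<^esub> y \<in> M \<longleftrightarrow> inv\<^bsub>?F\<^esub> g \<otimes>\<^bsub>?F\<^esub> y \<in> M" if y: "y \<in> carrier ?F" for y
    proof
      assume "inv\<^bsub>?F\<^esub> f \<otimes>\<^bsub>?F\<^esub> y \<in> M"
      from M.m_closed[OF gf this] show "inv\<^bsub>?F\<^esub> g \<otimes>\<^bsub>?F\<^esub> y \<in> M" using f g y by (simp add: F.m_assoc)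
    next
      assume "inv\<^bsub>?F\<^esub> g \<otimes>\<^bsub>?F\<^esub> y \<in> M"
      from M.m_closed[OF fg this] show "inv\<^bsub>?F\<^esub> f \<otimes>\<^bsub>?F\<^esub> y \<in> M" using f g y by (simp add: F.m_assoc)
    qed
    have "f \<in> M \<longleftrightarrow> g \<in> M"
    proof
      assume "f \<in> M"
      from M.m_closed[OF this fg] show "g \<in> M" using f g by simp
    next
      assume "g \<in> M"
      from M.m_closed[OF this gf] show "f \<in> M" using f g by simp
    qed
    moreover have "(\<lambda>y. y \<in> carrier ?F \<and> inv\<^bsub>?F\<^esub> f \<otimes>\<^bsub>?F\<^esub> y \<in> M) = (\<lambda>y. y \<in> carrier ?F \<and> inv\<^bsub>?F\<^esub> g \<otimes>\<^bsub>?F\<^esub> y \<in> M)"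
      using iff by blast
    ultimately show ?thesis unfolding rep_def by simp
  qed
  have rep_rep: "rep (f \<otimes>\<^bsub>?F\<^esub> rep g) = rep (f \<otimes>\<^bsub>?F\<^esub> g)" if "f \<in> carrier ?F" "g \<in> carrier ?F" for f g
  proof -
    have "inv\<^bsub>?F\<^esub> (f \<otimes>\<^bsub>?F\<^esub> g) \<otimes>\<^bsub>?F\<^esub> (f \<otimes>\<^bsub>?F\<^esub> rep g) = inv\<^bsub>?F\<^esub> g \<otimes>\<^bsub>?F\<^esub> rep g"
      using that repc by (simp add: F.inv_mult_group F.m_assoc)
    then have "rep (f \<otimes>\<^bsub>?F\<^esub> g) = rep (f \<otimes>\<^bsub>?F\<^esub> rep g)"
      using that repc repM by (intro rep_eq) auto
    then show ?thesis by simp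
  qed
  have rep_one: "rep m = \<one>\<^bsub>?F\<^esub>" if "m \<in> M" for m using that unfolding rep_def by simp
  \<comment> \<open>The coordinate of f at the coset of c in the Kaloujnine-Krasner embedding: the
    deviation of f c from its representative, an element of \<open>M\<close>.\<close>
  define h where "h f c = inv\<^bsub>?F\<^esub> (rep (f \<otimes>\<^bsub>?F\<^esub> c)) \<otimes>\<^bsub>?F\<^esub> f \<otimes>\<^bsub>?F\<^esub> c" for f c
  have hM: "h f c \<in> M" if "f \<in> carrier ?F" "c \<in> carrier ?F" for f c
  proof -
    have "inv\<^bsub>?F\<^esub> (inv\<^bsub>?F\<^esub> (f \<otimes>\<^bsub>?F\<^esub> c) \<otimes>\<^bsub>?F\<^esub> rep (f \<otimes>\<^bsub>?F\<^esub> c)) \<in> M"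
      using that by (intro M.m_inv_closed repM) simp
    then show ?thesis using that repc unfolding h_def by (simp add: F.inv_mult_group F.m_assoc)
  qed
  \<comment> \<open>Lifts are chosen for positive letters. The value at an inverse letter is then
    forced: it undoes the value of the positive letter that leads back from the coset
    reached.\<close>
  define \<kappa> where "\<kappa> l c = (if snd l then s (h [l] c)
     else inv\<^bsub>E\<^esub> (s (h [inv_letter l] (rep ([l] \<otimes>\<^bsub>?F\<^esub> c)))))" for l c
  define C where "C w c = transversal_cocycle E \<kappa> (\<lambda>w. rep (w \<otimes>\<^bsub>?F\<^esub> c)) w" for w c
  have il: "fst (inv_letter l) \<in> X" if "fst l \<in> X" for l using that by simp
  have \<kappa>K: "\<kappa> l c \<in> K" if "fst l \<in> X" "c \<in> carrier ?F" for l c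
    using that hM sK free_group_letter[of l X] free_group_letter[OF il[OF that(1)]] repc
    unfolding \<kappa>_def by simp
  have CK: "C w c \<in> K" if "w \<in> carrier ?F" "c \<in> carrier ?F" for w c
    using that(1)
  proof (induction w)
    case Nil
    then show ?case unfolding C_def by simp
  next
    case (Cons l w)
    have "\<kappa> l (rep (w \<otimes>\<^bsub>?F\<^esub> c)) \<in> K"
      using \<kappa>K free_group_Cons(1,2)[OF Cons.prems] repc that(2) by simp
    moreover have "C w c \<in> K" by (rule Cons.IH[OF free_group_Cons(2)[OF Cons.prems]])
    ultimately show ?case unfolding C_def by simp
  qed
  \<comment> \<open>A letter followed by its inverse contributes nothing, so the cocycle is
    insensitive to the cancellation in products of reduced words.\<close>
  have \<kappa>_cancel: "\<kappa> l (rep ([inv_letter l] \<otimes>\<^bsub>?F\<^esub> rep g)) \<otimes>\<^bsub>E\<^esub> \<kappa> (inv_letter l) (rep g) = \<one>\<^bsub>E\<^esub>"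
    if l: "fst l \<in> X" and g: "g \<in> carrier ?F" for l g
  proof -
    have lc: "[l] \<in> carrier ?F" "[inv_letter l] \<in> carrier ?F"
      using free_group_letter[OF l] free_group_letter[OF il[OF l]] by auto
    have 1: "[l] \<otimes>\<^bsub>?F\<^esub> [inv_letter l] = \<one>\<^bsub>?F\<^esub>"
      using free_group_inv_letter[OF l] F.r_inv[OF lc(1)] by simp
    have "rep ([l] \<otimes>\<^bsub>?F\<^esub> rep ([inv_letter l] \<otimes>\<^bsub>?F\<^esub> rep g)) = rep ([l] \<otimes>\<^bsub>?F\<^esub> ([inv_letter l] \<otimes>\<^bsub>?F\<^esub> rep g))"
      using lc g repc by (intro rep_rep) auto
    also have "\<dots> = rep (rep g)" using lc g repc 1 by (simp add: F.m_assoc[symmetric])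
    also have "\<dots> = rep g" using rep_rep[of "\<one>\<^bsub>?F\<^esub>" g] g repc by simp
    finally have r: "rep ([l] \<otimes>\<^bsub>?F\<^esub> rep ([inv_letter l] \<otimes>\<^bsub>?F\<^esub> rep g)) = rep g" .
    have k1: "s (h [l'] c) \<in> carrier E" if "[l'] \<in> carrier ?F" "c \<in> carrier ?F" for l' c
      using sK[OF hM[OF that]] by simp
    have sn: "snd (inv_letter l) = (\<not> snd l)" by (simp add: inv_letter_def)
    show ?thesis
      using lc g repc r k1[OF lc(1), of "rep ([inv_letter l] \<otimes>\<^bsub>?F\<^esub> rep g)"] k1[OF lc(2), of "rep g"]
      unfolding \<kappa>_def by (cases "snd l") (simp_all add: sn)
  qed
  have C_cancel: "C (cancel_cons l w) c = \<kappa> l (rep (w \<otimes>\<^bsub>?F\<^esub> c)) \<otimes>\<^bsub>E\<^esub> C w c"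
    if l: "fst l \<in> X" and w: "w \<in> carrier ?F" and c: "c \<in> carrier ?F" for l w c
  proof (cases "\<exists>w'. w = inv_letter l # w'")
    case True
    then obtain w' where w': "w = inv_letter l # w'" by blast
    note wc = free_group_Cons[OF w[unfolded w']]
    have lc: "[inv_letter l] \<in> carrier ?F" using free_group_letter[OF wc(1)] .
    have "rep (w \<otimes>\<^bsub>?F\<^esub> c) = rep ([inv_letter l] \<otimes>\<^bsub>?F\<^esub> rep (w' \<otimes>\<^bsub>?F\<^esub> c))"
      using rep_rep[OF lc, of "w' \<otimes>\<^bsub>?F\<^esub> c"] wc c lc unfolding w' wc(3) by (simp add: F.m_assoc)
    then have "\<kappa> l (rep (w \<otimes>\<^bsub>?F\<^esub> c)) \<otimes>\<^bsub>E\<^esub> \<kappa> (inv_letter l) (rep (w' \<otimes>\<^bsub>?F\<^esub> c)) = \<one>\<^bsub>E\<^esub>"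
      using \<kappa>_cancel[OF l, of "w' \<otimes>\<^bsub>?F\<^esub> c"] wc c by simp
    moreover have "C w c = \<kappa> (inv_letter l) (rep (w' \<otimes>\<^bsub>?F\<^esub> c)) \<otimes>\<^bsub>E\<^esub> C w' c" unfolding w' C_def by simp
    moreover have "\<kappa> l (rep (w \<otimes>\<^bsub>?F\<^esub> c)) \<in> carrier E" "\<kappa> (inv_letter l) (rep (w' \<otimes>\<^bsub>?F\<^esub> c)) \<in> carrier E" "C w' c \<in> carrier E"
      using \<kappa>K[OF l repc] \<kappa>K[OF wc(1) repc] CK[OF wc(2) c] w wc c by auto
    ultimately show ?thesis using w' by (simp add: E.m_assoc[symmetric])
  next
    case False
    then have "cancel_cons l w = l # w" by (cases w) auto
    then show ?thesis unfolding C_def by simp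
  qed
  \<comment> \<open>For v in \<open>M\<close> and trivial c the shifted argument
    \<open>rep (v \<otimes> c)\<close> is trivial again, and the cocycle rule becomes
    multiplicativity on \<open>M\<close>.\<close>
  have C_mult: "C (u \<otimes>\<^bsub>?F\<^esub> v) c = C u (rep (v \<otimes>\<^bsub>?F\<^esub> c)) \<otimes>\<^bsub>E\<^esub> C v c"
    if u: "u \<in> carrier ?F" and v: "v \<in> carrier ?F" and c: "c \<in> carrier ?F" for u v c
    using u
  proof (induction u)
    case Nil
    then show ?case using CK[OF v c] unfolding free_group_Nil_mult unfolding C_def by simp
  next
    case (Cons l u)
    note lu = free_group_Cons[OF Cons.prems]
    have lc: "[l] \<in> carrier ?F" using free_group_letter[OF lu(1)] .
    have "(l # u) \<otimes>\<^bsub>?F\<^esub> v = [l] \<otimes>\<^bsub>?F\<^esub> (u \<otimes>\<^bsub>?F\<^esub> v)" using lu lc v by (simp add: F.m_assoc)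
    also have "\<dots> = cancel_cons l (u \<otimes>\<^bsub>?F\<^esub> v)" using lu v by (intro free_group_letter_mult) simp
    finally have "C ((l # u) \<otimes>\<^bsub>?F\<^esub> v) c = \<kappa> l (rep (u \<otimes>\<^bsub>?F\<^esub> v \<otimes>\<^bsub>?F\<^esub> c)) \<otimes>\<^bsub>E\<^esub> C (u \<otimes>\<^bsub>?F\<^esub> v) c"
      using C_cancel[OF lu(1) _ c, of "u \<otimes>\<^bsub>?F\<^esub> v"] lu v by simp
    moreover have "rep (u \<otimes>\<^bsub>?F\<^esub> v \<otimes>\<^bsub>?F\<^esub> c) = rep (u \<otimes>\<^bsub>?F\<^esub> rep (v \<otimes>\<^bsub>?F\<^esub> c))"
      using rep_rep[of u "v \<otimes>\<^bsub>?F\<^esub> c"] lu v c by (simp add: F.m_assoc)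
    moreover have "C (l # u) (rep (v \<otimes>\<^bsub>?F\<^esub> c)) = \<kappa> l (rep (u \<otimes>\<^bsub>?F\<^esub> rep (v \<otimes>\<^bsub>?F\<^esub> c))) \<otimes>\<^bsub>E\<^esub> C u (rep (v \<otimes>\<^bsub>?F\<^esub> c))"
      unfolding C_def by simp
    moreover have "\<kappa> l (rep (u \<otimes>\<^bsub>?F\<^esub> rep (v \<otimes>\<^bsub>?F\<^esub> c))) \<in> carrier E" "C u (rep (v \<otimes>\<^bsub>?F\<^esub> c)) \<in> carrier E" "C v c \<in> carrier E"
      using \<kappa>K[OF lu(1) repc] CK[OF lu(2) repc] CK[OF v c] lu v c repc by auto
    ultimately show ?case using Cons.IH[OF lu(2)] by (simp add: E.m_assoc)
  qed
  \<comment> \<open>Applied to the cocycle, q gives the telescoping product of the values of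
    \<open>h\<close>. At the trivial coset and for w in \<open>M\<close>, \<open>h w c\<close> is
    w.\<close>
  have qC: "q (C w c) = h w c" if w: "w \<in> carrier ?F" and c: "c \<in> carrier ?F" "rep c = c" for w c
    using w
  proof (induction w)
    case Nil
    have "q (C [] c) = \<one>\<^bsub>?F\<^esub>" unfolding C_def by simp
    also have "\<dots> = h \<one>\<^bsub>?F\<^esub> c" using c unfolding h_def by simp
    finally show ?case unfolding free_group_one .
  next
    case (Cons l w)
    note lw = free_group_Cons[OF Cons.prems]
    have lc: "[l] \<in> carrier ?F" "[inv_letter l] \<in> carrier ?F"
      using free_group_letter[OF lw(1)] free_group_letter[OF il[OF lw(1)]] by auto
    let ?g = "rep (w \<otimes>\<^bsub>?F\<^esub> c)"
    have g: "?g \<in> carrier ?F" using repc lw c by simp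
    have qk: "q (\<kappa> l ?g) = h [l] ?g"
    proof (cases "snd l")
      case True
      then show ?thesis using qs hM lc g unfolding \<kappa>_def by simp
    next
      case False
      have 1: "[inv_letter l] \<otimes>\<^bsub>?F\<^esub> [l] = \<one>\<^bsub>?F\<^esub>"
        using free_group_inv_letter[OF lw(1)] F.l_inv[OF lc(1)] by simp
      have "rep ([inv_letter l] \<otimes>\<^bsub>?F\<^esub> rep ([l] \<otimes>\<^bsub>?F\<^esub> ?g)) = rep ([inv_letter l] \<otimes>\<^bsub>?F\<^esub> ([l] \<otimes>\<^bsub>?F\<^esub> ?g))"
        using lc g by (intro rep_rep) auto
      also have "\<dots> = rep ?g" using lc g 1 by (simp add: F.m_assoc[symmetric])
      also have "\<dots> = ?g" using rep_rep[of "\<one>\<^bsub>?F\<^esub>" "w \<otimes>\<^bsub>?F\<^esub> c"] lw c repc by simp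
      finally have r: "rep ([inv_letter l] \<otimes>\<^bsub>?F\<^esub> rep ([l] \<otimes>\<^bsub>?F\<^esub> ?g)) = ?g" .
      have rl: "rep ([l] \<otimes>\<^bsub>?F\<^esub> ?g) \<in> carrier ?F" using repc lc g by simp
      have hm: "h [inv_letter l] (rep ([l] \<otimes>\<^bsub>?F\<^esub> ?g)) \<in> M" using hM lc rl by simp
      have "q (\<kappa> l ?g) = inv\<^bsub>?F\<^esub> (h [inv_letter l] (rep ([l] \<otimes>\<^bsub>?F\<^esub> ?g)))"
        using False sK[OF hm] qs[OF hm] unfolding \<kappa>_def by simp
      also have "\<dots> = h [l] ?g"
        using r lc g rl free_group_inv_letter[OF il[OF lw(1)]] unfolding h_def
        by (simp add: F.inv_mult_group F.m_assoc)
      finally show ?thesis .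
    qed
    have "q (C (l # w) c) = q (\<kappa> l ?g) \<otimes>\<^bsub>?F\<^esub> q (C w c)"
      using \<kappa>K[OF lw(1) g] CK[OF lw(2) c(1)] unfolding C_def by simp
    also have "\<dots> = h [l] ?g \<otimes>\<^bsub>?F\<^esub> h w c" using qk Cons.IH[OF lw(2)] by simp
    also have "\<dots> = h (l # w) c"
    proof -
      have "rep ([l] \<otimes>\<^bsub>?F\<^esub> ?g) = rep ((l # w) \<otimes>\<^bsub>?F\<^esub> c)"
        using rep_rep[OF lc(1), of "w \<otimes>\<^bsub>?F\<^esub> c"] lw c lc by (simp add: F.m_assoc)
      then show ?thesis
        using lc lw c g repc[of "(l # w) \<otimes>\<^bsub>?F\<^esub> c"] Cons.prems unfolding h_def by (simp add: F.m_assoc)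
    qed
    finally show ?case .
  qed
  show thesis
  proof
    fix m assume m: "m \<in> M"
    have mc: "m \<in> carrier ?F" using m by simp
    show "C m \<one>\<^bsub>?F\<^esub> \<in> K" using CK[OF mc] by simp
    show "q (C m \<one>\<^bsub>?F\<^esub>) = m" using qC[OF mc, of "\<one>\<^bsub>?F\<^esub>"] rep_one[of "\<one>\<^bsub>?F\<^esub>"] rep_one[OF m] mc
      unfolding h_def by simp
    fix m' assume m': "m' \<in> M"
    have "rep (m' \<otimes>\<^bsub>?F\<^esub> \<one>\<^bsub>?F\<^esub>) = \<one>\<^bsub>?F\<^esub>" using rep_one[OF m'] m' by simp
    then show "C (m \<otimes>\<^bsub>?F\<^esub> m') \<one>\<^bsub>?F\<^esub> = C m \<one>\<^bsub>?F\<^esub> \<otimes>\<^bsub>E\<^esub> C m' \<one>\<^bsub>?F\<^esub>"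
      using C_mult[OF mc, of m' "\<one>\<^bsub>?F\<^esub>"] m' by simp
  qed
qed

context group
begin

section \<open>Finite generation of joint kernels\<close>

lemma normal_mult:
  assumes "N \<lhd> G" "P \<lhd> G"
  shows "{n \<otimes> p | n p. n \<in> N \<and> p \<in> P} \<lhd> G"
proof (rule normal_invI)
  interpret N: normal N G by fact
  interpret P: normal P G by fact
  show "subgroup {n \<otimes> p | n p. n \<in> N \<and> p \<in> P} G" by (rule subgroup_mult_normal[OF N.is_subgroup assms(2)])
  fix x h assume x: "x \<in> carrier G" and "h \<in> {n \<otimes> p | n p. n \<in> N \<and> p \<in> P}"
  then obtain n p where np: "n \<in> N" "p \<in> P" "h = n \<otimes> p" by blast
  have "x \<otimes> h \<otimes> inv x = (x \<otimes> n \<otimes> inv x) \<otimes> (x \<otimes> p \<otimes> inv x)" using np x by (simp add: m_assoc)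
  then show "x \<otimes> h \<otimes> inv x \<in> {n \<otimes> p | n p. n \<in> N \<and> p \<in> P}"
    using N.inv_op_closed2[OF x np(1)] P.inv_op_closed2[OF x np(2)] by blast
qed

lemma normal_closure_Un:
  assumes "U \<subseteq> carrier G" "V \<subseteq> carrier G" "z \<in> normal_closure G (U \<union> V)"
  obtains u v where "u \<in> normal_closure G U" "v \<in> normal_closure G V" "z = u \<otimes> v"
proof -
  let ?U = "normal_closure G U" and ?V = "normal_closure G V"
  interpret U: normal ?U G by (rule normal_closure_normal[OF assms(1)])
  interpret V: normal ?V G by (rule normal_closure_normal[OF assms(2)])
  have "u \<in> {u \<otimes> v | u v. u \<in> ?U \<and> v \<in> ?V}" if "u \<in> U" for u
  proof -
    have "u \<in> ?U" "u = u \<otimes> \<one>" using that normal_closure_incl[of U] assms(1) by auto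
    then show ?thesis using V.one_closed by blast
  qed
  moreover have "v \<in> {u \<otimes> v | u v. u \<in> ?U \<and> v \<in> ?V}" if "v \<in> V" for v
  proof -
    have "v \<in> ?V" "v = \<one> \<otimes> v" using that normal_closure_incl[of V] assms(2) by auto
    then show ?thesis using U.one_closed by blast
  qed
  ultimately have "U \<union> V \<subseteq> {u \<otimes> v | u v. u \<in> ?U \<and> v \<in> ?V}" by blast
  then have "normal_closure G (U \<union> V) \<subseteq> {u \<otimes> v | u v. u \<in> ?U \<and> v \<in> ?V}"
    by (rule normal_closure_least[OF normal_mult[OF U.normal_axioms V.normal_axioms]])
  then show thesis using assms(3) that by blast
qed

text \<open>Conjugation makes the normal closure \<open>K\<close> of \<open>V\<close> a crossed module over \<open>F\<close>, and the lemma says that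
  its kernel (the identities among the relators \<open>q ` V\<close>) is finitely generated. Since \<open>q ` K\<close> is
  projective, this kernel embeds in the abelianization of \<open>K\<close>, a Noetherian module.\<close>

proposition kernel_in_normal_closure_finitely_generated:
  fixes F and X :: "'x set"
  defines "F \<equiv> free_group X"
  assumes q: "q \<in> hom G F" and surj: "q ` carrier G = carrier F"
    and V: "finite V" "V \<subseteq> carrier G"
    and comm: "\<And>a v. a \<in> carrier G \<Longrightarrow> q a = \<one>\<^bsub>F\<^esub> \<Longrightarrow> v \<in> V \<Longrightarrow> a \<otimes> v = v \<otimes> a"
    and pc: "polycyclic_over F (q ` normal_closure G V) (carrier F)"
  obtains B where "finite B" "\<And>b. b \<in> B \<Longrightarrow> b \<in> normal_closure G V \<and> q b = \<one>\<^bsub>F\<^esub>"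
    "\<And>k. k \<in> normal_closure G V \<Longrightarrow> q k = \<one>\<^bsub>F\<^esub> \<Longrightarrow> k \<in> normal_closure G B"
proof -
  interpret F: group F unfolding F_def by (rule group_free_group)
  interpret q: group_hom G F q using q by (simp add: group_hom_def group_hom_axioms_def is_group F.is_group)
  define K where "K = normal_closure G V"
  define M where "M = q ` K"
  define Z where "Z = {k \<in> K. q k = \<one>\<^bsub>F\<^esub>}"
  define D where "D = generate G (\<Union>a\<in>K. \<Union>b\<in>K. {gcomm G a b})"
  interpret K: normal K G unfolding K_def by (rule normal_closure_normal[OF V(2)])
  have VK: "V \<subseteq> K" unfolding K_def by (rule normal_closure_incl)
  \<comment> \<open>The kernel of q is normal and centralizes \<open>V\<close>, hence it centralizes
    \<open>K\<close>. In particular \<open>Z\<close> is central in \<open>K\<close>.\<close>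
  have kercomm: "a \<otimes> k = k \<otimes> a" if "a \<in> carrier G" "q a = \<one>\<^bsub>F\<^esub>" "k \<in> K" for a k
  proof (rule commutes_normal_closure[OF q.normal_kernel V(2) _ _ that(3)[unfolded K_def]])
    show "x \<otimes> v = v \<otimes> x" if "x \<in> kernel G F q" "v \<in> V" for x v
      using comm that by (simp add: kernel_def)
    show "a \<in> kernel G F q" using that by (simp add: kernel_def)
  qed
  have Kc: "K \<subseteq> carrier G" by (rule K.subset)
  have gK: "gcomm G a b \<in> K" if "a \<in> K" "b \<in> K" for a b using that unfolding gcomm_def by simp
  have Dg: "(\<Union>a\<in>K. \<Union>b\<in>K. {gcomm G a b}) \<subseteq> K" using gK by blast
  have DK: "D \<subseteq> K" unfolding D_def by (rule generate_subgroup_incl[OF Dg K.is_subgroup])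
  have D: "D \<lhd> G" unfolding D_def
  proof (rule normal_generateI)
    show "(\<Union>a\<in>K. \<Union>b\<in>K. {gcomm G a b}) \<subseteq> carrier G" using Dg Kc by blast
    fix h g assume "h \<in> (\<Union>a\<in>K. \<Union>b\<in>K. {gcomm G a b})" and g: "g \<in> carrier G"
    then obtain a b where ab: "a \<in> K" "b \<in> K" "h = gcomm G a b" by blast
    have "g \<otimes> h \<otimes> inv g = gcomm G (g \<otimes> a \<otimes> inv g) (g \<otimes> b \<otimes> inv g)"
      using ab g unfolding gcomm_def by (simp add: m_assoc inv_mult_group)
    then show "g \<otimes> h \<otimes> inv g \<in> (\<Union>a\<in>K. \<Union>b\<in>K. {gcomm G a b})"
      using K.inv_op_closed2[OF g ab(1)] K.inv_op_closed2[OF g ab(2)] by blast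
  qed
  interpret D: normal D G by (rule D)
  have gD: "gcomm G a b \<in> D" if "a \<in> K" "b \<in> K" for a b
    using that unfolding D_def by (intro generate.incl) blast
  interpret AS: abelian_section G D K
    by (intro abelian_section.intro abelian_section_axioms.intro is_group D K.normal_axioms DK gD)
  have M: "subgroup M F" unfolding M_def by (rule q.subgroup_img_is_subgroup[OF K.is_subgroup])
  have "q ` K = M" by (simp add: M_def)
  then obtain \<tau> where \<tau>: "\<And>m. m \<in> M \<Longrightarrow> \<tau> m \<in> K" "\<And>m. m \<in> M \<Longrightarrow> q (\<tau> m) = m"
    and \<tau>m: "\<And>m m'. m \<in> M \<Longrightarrow> m' \<in> M \<Longrightarrow> \<tau> (m \<otimes>\<^bsub>F\<^esub> m') = \<tau> m \<otimes> \<tau> m'"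
    using free_group_subgroup_projective[OF is_group K.is_subgroup q[unfolded F_def] M[unfolded F_def]]
    unfolding F_def by metis
  interpret M: subgroup M F by (rule M)
  have \<tau>c: "\<tau> m \<in> carrier G" if "m \<in> M" for m using \<tau>(1)[OF that] by simp
  have \<tau>1: "\<tau> \<one>\<^bsub>F\<^esub> = \<one>"
  proof -
    have "\<tau> \<one>\<^bsub>F\<^esub> = \<tau> \<one>\<^bsub>F\<^esub> \<otimes> \<tau> \<one>\<^bsub>F\<^esub>" using \<tau>m[OF M.one_closed M.one_closed] by simp
    then show ?thesis using \<tau>c[OF M.one_closed] by (simp add: l_cancel_one')
  qed
  have \<tau>inv: "\<tau> (inv\<^bsub>F\<^esub> m) = inv (\<tau> m)" if m: "m \<in> M" for m
  proof -
    have "\<tau> (inv\<^bsub>F\<^esub> m) \<otimes> \<tau> m = \<one>" using \<tau>m[of "inv\<^bsub>F\<^esub> m" m] m \<tau>1 by simp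
    then show ?thesis using \<tau>c m by (intro inv_equality[symmetric]) auto
  qed
  have \<tau>sub: "subgroup (\<tau> ` M) G"
  proof (rule subgroupI)
    show "\<tau> ` M \<subseteq> carrier G" using \<tau>c by blast
    show "\<tau> ` M \<noteq> {}" using M.one_closed by blast
    fix a assume "a \<in> \<tau> ` M"
    then obtain m where m: "m \<in> M" "a = \<tau> m" by blast
    show "inv a \<in> \<tau> ` M" using \<tau>inv[OF m(1)] m M.m_inv_closed by (metis imageI)
    fix b assume "b \<in> \<tau> ` M"
    then obtain m' where m': "m' \<in> M" "b = \<tau> m'" by blast
    show "a \<otimes> b \<in> \<tau> ` M" using \<tau>m[OF m(1) m'(1)] m m' M.m_closed by (metis imageI)
  qed
  \<comment> \<open>Up to elements of the kernel of q, which centralize \<open>K\<close>, a and b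
    are the lifts of their images under \<open>\<tau>\<close>; commutators do not see central
    factors.\<close>
  have comm\<tau>: "gcomm G a b = gcomm G (\<tau> (q a)) (\<tau> (q b))" if a: "a \<in> K" and b: "b \<in> K" for a b
  proof -
    have ac: "a \<in> carrier G" and bc: "b \<in> carrier G" using a b by auto
    have qM: "q a \<in> M" "q b \<in> M" using a b unfolding M_def by auto
    define x y where "x = \<tau> (q a)" and "y = \<tau> (q b)"
    have xy: "x \<in> K" "y \<in> K" "x \<in> carrier G" "y \<in> carrier G" "q x = q a" "q y = q b"
      using \<tau>[OF qM(1)] \<tau>[OF qM(2)] \<tau>c[OF qM(1)] \<tau>c[OF qM(2)] unfolding x_def y_def by auto
    define z w where "z = a \<otimes> inv x" and "w = b \<otimes> inv y"
    have zw: "z \<in> carrier G" "w \<in> carrier G" "q z = \<one>\<^bsub>F\<^esub>" "q w = \<one>\<^bsub>F\<^esub>"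
      using ac bc xy unfolding z_def w_def by auto
    have eq: "a = z \<otimes> x" "b = w \<otimes> y" using ac bc xy unfolding z_def w_def by (auto simp: m_assoc)
    have zb: "z \<otimes> (x \<otimes> b \<otimes> inv x) = (x \<otimes> b \<otimes> inv x) \<otimes> z"
      by (rule kercomm[OF zw(1,3)]) (use K.inv_op_closed2[OF xy(3) b] in simp)
    have "gcomm G a b = z \<otimes> (x \<otimes> b \<otimes> inv x) \<otimes> inv z \<otimes> inv b"
      using eq(1) zw xy bc unfolding gcomm_def by (simp add: m_assoc inv_mult_group)
    also have "\<dots> = x \<otimes> b \<otimes> inv x \<otimes> inv b"
      unfolding zb using zw xy bc by (simp add: m_assoc)
    also have "\<dots> = x \<otimes> (w \<otimes> y) \<otimes> inv x \<otimes> inv (w \<otimes> y)" using eq(2) by simp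
    also have "\<dots> = (x \<otimes> w) \<otimes> y \<otimes> inv x \<otimes> inv y \<otimes> inv w" using zw xy by (simp add: m_assoc inv_mult_group)
    also have "\<dots> = w \<otimes> (x \<otimes> y \<otimes> inv x \<otimes> inv y) \<otimes> inv w"
      unfolding kercomm[OF zw(2,4) xy(1), symmetric] using zw xy by (simp add: m_assoc)
    also have "w \<otimes> (x \<otimes> y \<otimes> inv x \<otimes> inv y) = (x \<otimes> y \<otimes> inv x \<otimes> inv y) \<otimes> w"
      by (rule kercomm[OF zw(2,4)]) (use xy in simp)
    also have "(x \<otimes> y \<otimes> inv x \<otimes> inv y) \<otimes> w \<otimes> inv w = gcomm G x y"
      using zw xy unfolding gcomm_def by (simp add: m_assoc)
    finally show ?thesis unfolding x_def y_def .
  qed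
  have D\<tau>: "D \<subseteq> \<tau> ` M"
    unfolding D_def
  proof (rule generate_subgroup_incl[OF _ \<tau>sub], rule subsetI)
    fix x assume "x \<in> (\<Union>a\<in>K. \<Union>b\<in>K. {gcomm G a b})"
    then obtain a b where ab: "a \<in> K" "b \<in> K" "x = gcomm G a b" by blast
    have "q a \<in> M" "q b \<in> M" using ab unfolding M_def by auto
    then have "\<tau> (q a) \<in> \<tau> ` M" "\<tau> (q b) \<in> \<tau> ` M" by auto
    then show "x \<in> \<tau> ` M" unfolding ab(3) comm\<tau>[OF ab(1,2)]
      by (simp add: gcomm_def subgroup.m_closed[OF \<tau>sub] subgroup.m_inv_closed[OF \<tau>sub])
  qed
  \<comment> \<open>The commutator subgroup \<open>D\<close> lies in the image of
    \<open>\<tau>\<close>, on which q is injective. So \<open>D\<close> meets \<open>Z\<close>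
    trivially, and \<open>Z\<close> embeds in the abelianization of \<open>K\<close>.\<close>
  have DZ: "d = \<one>" if d: "d \<in> D" "q d = \<one>\<^bsub>F\<^esub>" for d
  proof -
    obtain m where m: "m \<in> M" "d = \<tau> m" using D\<tau> d(1) by blast
    have "m = \<one>\<^bsub>F\<^esub>" using \<tau>(2)[OF m(1)] d(2) unfolding m(2) by metis
    then show ?thesis using m(2) \<tau>1 by metis
  qed
  let ?C = "{g \<in> carrier G. q g \<in> M}"
  have "polycyclic_over G ?C {b \<in> carrier G. q b \<in> carrier F}"
    using F.polycyclic_over_vimage[OF pc is_group q subgroup_self] unfolding M_def K_def .
  moreover have "{b \<in> carrier G. q b \<in> carrier F} = carrier G" by auto
  ultimately have pcG: "polycyclic_over G ?C (carrier G)" by simp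
  \<comment> \<open>An element over \<open>M\<close> differs from an element of \<open>K\<close> by
    an element of the kernel of q, which centralizes \<open>K\<close>. Hence it acts on
    \<open>K\<close> modulo \<open>D\<close> as an inner, and so trivial, automorphism.\<close>
  have "gcomm G c k \<in> D" if c: "c \<in> ?C" and k: "k \<in> K" for c k
  proof -
    obtain k0 where k0: "k0 \<in> K" "q c = q k0" using c unfolding M_def by blast
    have cc: "c \<in> carrier G" "k0 \<in> carrier G" "k \<in> carrier G" using c k0 k by auto
    define a where "a = c \<otimes> inv k0"
    have a: "a \<in> carrier G" "q a = \<one>\<^bsub>F\<^esub>" "c = a \<otimes> k0" using cc k0 unfolding a_def by (auto simp: m_assoc)
    have "a \<otimes> (k0 \<otimes> k \<otimes> inv k0) = (k0 \<otimes> k \<otimes> inv k0) \<otimes> a"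
      by (rule kercomm[OF a(1,2)]) (use k0 k in simp)
    moreover have "gcomm G c k = a \<otimes> (k0 \<otimes> k \<otimes> inv k0) \<otimes> inv a \<otimes> inv k"
      using a cc unfolding gcomm_def by (simp add: m_assoc inv_mult_group)
    ultimately have "gcomm G c k = gcomm G k0 k"
      using a cc unfolding gcomm_def by (simp add: m_assoc)
    then show ?thesis using AS.abelian[OF k0(1) k] by simp
  qed
  then have noeth: "AS.noetherian_under (carrier G)"
    using AS.noetherian_under_polycyclic[OF pcG] by blast
  have Z: "Z \<lhd> G"
  proof -
    have "Z = K \<inter> kernel G F q" unfolding Z_def kernel_def by auto
    then show ?thesis using normal_subgroup_intersect[OF K.normal_axioms q.normal_kernel] by simp
  qed
  interpret Z: normal Z G by (rule Z)
  let ?U = "{d \<otimes> z | d z. d \<in> D \<and> z \<in> Z}"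
  have normal_invb: "AS.invariant (carrier G) {d \<otimes> n | d n. d \<in> D \<and> n \<in> N}" if N: "N \<lhd> G" "N \<subseteq> K" for N
  proof (rule AS.invariantI)
    interpret N: normal N G by (rule N(1))
    note U = normal_mult[OF D N(1)]
    show "subgroup {d \<otimes> n | d n. d \<in> D \<and> n \<in> N} G" by (rule normal_imp_subgroup[OF U])
    show "D \<subseteq> {d \<otimes> n | d n. d \<in> D \<and> n \<in> N}"
    proof
      fix d assume "d \<in> D"
      moreover from this have "d = d \<otimes> \<one>" by simp
      ultimately show "d \<in> {d \<otimes> n | d n. d \<in> D \<and> n \<in> N}" using N.one_closed by blast
    qed
    show "{d \<otimes> n | d n. d \<in> D \<and> n \<in> N} \<subseteq> K"
    proof
      fix x assume "x \<in> {d \<otimes> n | d n. d \<in> D \<and> n \<in> N}"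
      then obtain d n where "x = d \<otimes> n" "d \<in> D" "n \<in> N" by blast
      then show "x \<in> K" using DK N(2) K.m_closed by blast
    qed
    show "h \<otimes> u \<otimes> inv h \<in> {d \<otimes> n | d n. d \<in> D \<and> n \<in> N}"
      if "h \<in> carrier G" "u \<in> {d \<otimes> n | d n. d \<in> D \<and> n \<in> N}" for h u
      using normal.inv_op_closed2[OF U that] .
  qed
  have ZK: "Z \<subseteq> K" unfolding Z_def by blast
  have invU: "AS.invariant (carrier G) ?U" by (rule normal_invb[OF Z ZK])
  have "normal_closure G V \<subseteq> AS.span (carrier G) V"
  proof (rule normal_closure_least)
    show "AS.span (carrier G) V \<lhd> G"
      using AS.invariantD(1,4)[OF AS.invariant_span(1)[OF VK subgroup_self]] by (rule normal_invI)
    show "V \<subseteq> AS.span (carrier G) V" by (rule AS.invariant_span(2)[OF VK subgroup_self])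
  qed
  then have "?U \<subseteq> AS.span (carrier G) V" using AS.invariantD(3)[OF invU] unfolding K_def by (rule order_trans[rotated])
  then obtain B where B: "finite B" "B \<subseteq> ?U" "?U \<subseteq> AS.span (carrier G) B"
    using noeth V(1) VK invU unfolding AS.noetherian_under_def by meson
  have decB: "\<exists>d\<in>D. \<exists>z\<in>Z. b = d \<otimes> z" if "b \<in> B" for b using that B(2) by blast
  \<comment> \<open>The generators of D Z may be taken from \<open>Z\<close>, since the span
    contains \<open>D\<close> in any case.\<close>
  obtain R where R: "finite R" "R \<subseteq> Z" "\<And>b. b \<in> B \<Longrightarrow> \<exists>d\<in>D. \<exists>z\<in>R. b = d \<otimes> z"
    using finite_absorb[of B D Z, OF B(1) decB] by (metis (no_types, lifting))
  have Rc: "R \<subseteq> carrier G" using R(2) Z.subset by blast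
  define N where "N = normal_closure G R"
  have N: "N \<lhd> G" unfolding N_def by (rule normal_closure_normal[OF Rc])
  have NZ: "N \<subseteq> Z" unfolding N_def by (rule normal_closure_least[OF Z R(2)])
  have RN: "R \<subseteq> N" unfolding N_def by (rule normal_closure_incl)
  have NK: "N \<subseteq> K" using NZ ZK by blast
  have BN: "B \<subseteq> {d \<otimes> n | d n. d \<in> D \<and> n \<in> N}"
  proof
    fix b assume "b \<in> B"
    then obtain d z where "d \<in> D" "z \<in> R" "b = d \<otimes> z" using R(3) by blast
    then show "b \<in> {d \<otimes> n | d n. d \<in> D \<and> n \<in> N}" using RN by blast
  qed
  have span: "AS.span (carrier G) B \<subseteq> {d \<otimes> n | d n. d \<in> D \<and> n \<in> N}"
    by (rule AS.span_least[OF normal_invb[OF N NK] BN])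
  show thesis
  proof (rule that[OF R(1)])
    show "b \<in> normal_closure G V \<and> q b = \<one>\<^bsub>F\<^esub>" if "b \<in> R" for b
      using that R(2) unfolding Z_def K_def by blast
    fix k assume k: "k \<in> normal_closure G V" "q k = \<one>\<^bsub>F\<^esub>"
    then have kZ: "k \<in> Z" unfolding Z_def K_def by simp
    then have "k = \<one> \<otimes> k" by simp
    then have "k \<in> ?U" using kZ D.one_closed by blast
    then obtain d n where dn: "d \<in> D" "n \<in> N" "k = d \<otimes> n" using B(3) span by blast
    have "q n = \<one>\<^bsub>F\<^esub>" using dn(2) NZ unfolding Z_def by blast
    moreover have "d \<in> carrier G" "n \<in> carrier G" using dn NZ Z.subset by auto
    ultimately have "q d = \<one>\<^bsub>F\<^esub>" using k(2) dn(3) by simp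
    then have "d = \<one>" using DZ dn(1) by blast
    then show "k \<in> normal_closure G R" using dn(2,3) \<open>n \<in> carrier G\<close> unfolding N_def by simp
  qed
qed

text \<open>An element of \<open>R\<close> is a product of elements k_i from the normal closures of
  the \<open>V i\<close>. As q_j kills every k_i with i different from j, it also kills k_j. So each
  factor lies in one of the kernels that were shown to be finitely generated as normal
  subgroups.\<close>

proposition joint_kernel_normally_finitely_generated:
  fixes F and X :: "'x set"
  defines "F \<equiv> free_group X"
  assumes I: "finite I"
    and q: "\<And>i. i \<in> I \<Longrightarrow> q i \<in> hom G F" "\<And>i. i \<in> I \<Longrightarrow> q i ` carrier G = carrier F"
    and V: "\<And>i. i \<in> I \<Longrightarrow> finite (V i)" "\<And>i. i \<in> I \<Longrightarrow> V i \<subseteq> carrier G"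
    and Vker: "\<And>i j v. \<lbrakk>i \<in> I; j \<in> I; i \<noteq> j; v \<in> V i\<rbrakk> \<Longrightarrow> q j v = \<one>\<^bsub>F\<^esub>"
    and comm: "\<And>i a v. \<lbrakk>i \<in> I; a \<in> carrier G; q i a = \<one>\<^bsub>F\<^esub>; v \<in> V i\<rbrakk> \<Longrightarrow> a \<otimes> v = v \<otimes> a"
    and pc: "\<And>i. i \<in> I \<Longrightarrow> polycyclic_over F (q i ` normal_closure G (V i)) (carrier F)"
    and R: "R = {g \<in> carrier G. \<forall>i\<in>I. q i g = \<one>\<^bsub>F\<^esub>}" "R \<subseteq> normal_closure G (\<Union>i\<in>I. V i)"
  obtains B where "finite B" "B \<subseteq> R" "normal_closure G B = R"
proof -
  interpret F: group F unfolding F_def by (rule group_free_group)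
  have qhom: "group_hom G F (q i)" if "i \<in> I" for i
    using q that by (simp add: group_hom_def group_hom_axioms_def is_group F.is_group)
  have "\<exists>B. finite B \<and> (\<forall>b\<in>B. b \<in> normal_closure G (V i) \<and> q i b = \<one>\<^bsub>F\<^esub>) \<and>
      (\<forall>k\<in>normal_closure G (V i). q i k = \<one>\<^bsub>F\<^esub> \<longrightarrow> k \<in> normal_closure G B)" if i: "i \<in> I" for i
  proof (rule kernel_in_normal_closure_finitely_generated[OF q(1)[OF i, unfolded F_def] q(2)[OF i, unfolded F_def]
        V(1)[OF i] V(2)[OF i] _ pc[OF i, unfolded F_def]])
    show "a \<otimes> v = v \<otimes> a" if "a \<in> carrier G" "q i a = \<one>\<^bsub>free_group X\<^esub>" "v \<in> V i" for a v
      using comm[OF i] that unfolding F_def by blast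
  next
    fix B assume "finite B" "\<And>b. b \<in> B \<Longrightarrow> b \<in> normal_closure G (V i) \<and> q i b = \<one>\<^bsub>free_group X\<^esub>"
      "\<And>k. \<lbrakk>k \<in> normal_closure G (V i); q i k = \<one>\<^bsub>free_group X\<^esub>\<rbrakk> \<Longrightarrow> k \<in> normal_closure G B"
    then show ?thesis unfolding F_def by (intro exI[of _ B]) blast
  qed
  then have "\<forall>i\<in>I. \<exists>B. finite B \<and> (\<forall>b\<in>B. b \<in> normal_closure G (V i) \<and> q i b = \<one>\<^bsub>F\<^esub>) \<and>
      (\<forall>k\<in>normal_closure G (V i). q i k = \<one>\<^bsub>F\<^esub> \<longrightarrow> k \<in> normal_closure G B)" by blast
  then obtain B where B': "\<forall>i\<in>I. finite (B i) \<and> (\<forall>b\<in>B i. b \<in> normal_closure G (V i) \<and> q i b = \<one>\<^bsub>F\<^esub>) \<and>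
      (\<forall>k\<in>normal_closure G (V i). q i k = \<one>\<^bsub>F\<^esub> \<longrightarrow> k \<in> normal_closure G (B i))"
    by (rule bchoice[THEN exE])
  have Bfin: "finite (B i)" and BV: "b \<in> B i \<Longrightarrow> b \<in> normal_closure G (V i) \<and> q i b = \<one>\<^bsub>F\<^esub>"
    and Bk: "\<lbrakk>k \<in> normal_closure G (V i); q i k = \<one>\<^bsub>F\<^esub>\<rbrakk> \<Longrightarrow> k \<in> normal_closure G (B i)" if "i \<in> I" for i b k
    using B' that by blast+
  have Vnc: "normal_closure G (V i) \<subseteq> carrier G" if "i \<in> I" for i
    using normal_imp_subgroup[OF normal_closure_normal[OF V(2)[OF that]]] by (rule subgroup.subset)
  have Vj: "q j k = \<one>\<^bsub>F\<^esub>" if ij: "i \<in> I" "j \<in> I" "i \<noteq> j" and k: "k \<in> normal_closure G (V i)" for i j k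
  proof -
    have "V i \<subseteq> kernel G F (q j)" using Vker[OF ij] V(2)[OF ij(1)] unfolding kernel_def by blast
    then have "normal_closure G (V i) \<subseteq> kernel G F (q j)"
      by (rule normal_closure_least[OF group_hom.normal_kernel[OF qhom[OF ij(2)]]])
    then show ?thesis using k unfolding kernel_def by blast
  qed
  have Bc: "B i \<subseteq> carrier G" if "i \<in> I" for i using BV[OF that] Vnc[OF that] by blast
  have claim: "z \<in> normal_closure G (\<Union>i\<in>J. B i)"
    if "finite J" "J \<subseteq> I" "z \<in> normal_closure G (\<Union>i\<in>J. V i)" "\<And>i. i \<in> I \<Longrightarrow> q i z = \<one>\<^bsub>F\<^esub>" for J z
    using that
  proof (induction J arbitrary: z rule: finite_induct)
    case empty
    then show ?case by simp
  next
    case (insert j J)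
    have j: "j \<in> I" and J: "J \<subseteq> I" using insert.prems(1) by auto
    have Jc: "(\<Union>i\<in>J. V i) \<subseteq> carrier G" using V(2) J by blast
    have un: "(\<Union>i\<in>insert j J. V i) = (\<Union>i\<in>J. V i) \<union> V j" by auto
    obtain a b where ab: "a \<in> normal_closure G (\<Union>i\<in>J. V i)" "b \<in> normal_closure G (V j)" "z = a \<otimes> b"
      using normal_closure_Un[OF Jc V(2)[OF j]] insert.prems(2) unfolding un by blast
    have ac: "a \<in> carrier G"
      using ab(1) subgroup.subset[OF normal_imp_subgroup[OF normal_closure_normal[OF Jc]]] by blast
    have bc: "b \<in> carrier G" using ab(2) Vnc[OF j] by blast
    have "(\<Union>i\<in>J. V i) \<subseteq> kernel G F (q j)"
      using Vker[of _ j] J j insert.hyps Jc unfolding kernel_def by blast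
    then have "normal_closure G (\<Union>i\<in>J. V i) \<subseteq> kernel G F (q j)"
      by (rule normal_closure_least[OF group_hom.normal_kernel[OF qhom[OF j]]])
    then have qja: "q j a = \<one>\<^bsub>F\<^esub>" using ab(1) unfolding kernel_def by blast
    have qz: "q i z = q i a \<otimes>\<^bsub>F\<^esub> q i b" "q i a \<in> carrier F" "q i b \<in> carrier F" if "i \<in> I" for i
      using q(1)[OF that] ac bc ab(3) by (auto simp: hom_def)
    have qjb: "q j b = \<one>\<^bsub>F\<^esub>" using qz[OF j] qja insert.prems(3)[OF j] by simp
    have qb: "q i b = \<one>\<^bsub>F\<^esub>" if "i \<in> I" for i using qjb Vj[OF j that _ ab(2)] by (cases "i = j") auto
    have "q i a = \<one>\<^bsub>F\<^esub>" if "i \<in> I" for i using qz[OF that] qb[OF that] insert.prems(3)[OF that] by simp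
    then have "a \<in> normal_closure G (\<Union>i\<in>J. B i)" using insert.IH[OF J ab(1)] by blast
    then have "a \<in> normal_closure G (\<Union>i\<in>insert j J. B i)"
      using normal_closure_mono[of "\<Union>i\<in>J. B i" "\<Union>i\<in>insert j J. B i"] by blast
    moreover have "b \<in> normal_closure G (\<Union>i\<in>insert j J. B i)"
      using Bk[OF j ab(2) qjb] normal_closure_mono[of "B j" "\<Union>i\<in>insert j J. B i"] by blast
    moreover have "(\<Union>i\<in>insert j J. B i) \<subseteq> carrier G" using Bc insert.prems(1) by blast
    ultimately show ?case
      using subgroup.m_closed[OF normal_imp_subgroup[OF normal_closure_normal]] ab(3) by blast
  qed
  have BR: "(\<Union>i\<in>I. B i) \<subseteq> R"
  proof
    fix b assume "b \<in> (\<Union>i\<in>I. B i)"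
    then obtain i where i: "i \<in> I" "b \<in> B i" by blast
    have "q j b = \<one>\<^bsub>F\<^esub>" if "j \<in> I" for j
      using BV[OF i] Vj[OF i(1) that] by (cases "i = j") auto
    then show "b \<in> R" using Bc i unfolding R(1) by blast
  qed
  have "R \<lhd> G"
  proof (rule normal_invI)
    show "subgroup R G"
      unfolding R(1) by (rule subgroupI) (auto simp: group_hom.hom_inv[OF qhom] hom_mult[OF q(1)] group_hom.hom_one[OF qhom] intro!: exI[of _ \<one>])
    fix x h assume x: "x \<in> carrier G" and "h \<in> R"
    then have h: "h \<in> carrier G" "\<And>i. i \<in> I \<Longrightarrow> q i h = \<one>\<^bsub>F\<^esub>" unfolding R(1) by auto
    have "q i (x \<otimes> h \<otimes> inv x) = \<one>\<^bsub>F\<^esub>" if "i \<in> I" for i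
    proof -
      interpret qi: group_hom G F "q i" by (rule qhom[OF that])
      show ?thesis using x h(1) h(2)[OF that] by simp
    qed
    then show "x \<otimes> h \<otimes> inv x \<in> R" using x h(1) unfolding R(1) by simp
  qed
  then have "normal_closure G (\<Union>i\<in>I. B i) \<subseteq> R" by (rule normal_closure_least[OF _ BR])
  moreover have "R \<subseteq> normal_closure G (\<Union>i\<in>I. B i)"
    using claim[OF I order_refl] R by blast
  moreover have "finite (\<Union>i\<in>I. B i)" using I Bfin by blast
  ultimately show thesis using BR by (intro that[of "\<Union>i\<in>I. B i"]) auto
qed

section \<open>Joint kernels of coordinate maps\<close>

lemma normal_if_generators_normalize:
  assumes W: "subgroup W G" and Y: "Y \<subseteq> carrier G" "generate G Y = carrier G"
    and norm: "\<And>y. y \<in> Y \<Longrightarrow> normalizes G y W"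
  shows "W \<lhd> G"
proof (rule normal_invI[OF W])
  interpret W: subgroup W G by (rule W)
  fix x h assume "x \<in> carrier G" and "h \<in> W"
  then have "x \<in> generate G Y" using Y by simp
  then have "\<forall>h\<in>W. x \<otimes> h \<otimes> inv x \<in> W"
  proof (induction rule: generate.induct)
    case one
    show ?case by simp
  next
    case (incl y)
    then show ?case using normalizesD(2)[OF norm] by blast
  next
    case (inv y)
    then have "y \<in> carrier G" using Y by blast
    then show ?case using normalizesD(3)[OF norm[OF inv]] by simp
  next
    case (eng a b)
    have ab: "a \<in> carrier G" "b \<in> carrier G" using eng(1,2) Y by auto
    show ?case
    proof
      fix h assume h: "h \<in> W"
      then have "a \<otimes> (b \<otimes> h \<otimes> inv b) \<otimes> inv a \<in> W" using eng(3,4) by blast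
      then show "a \<otimes> b \<otimes> h \<otimes> inv (a \<otimes> b) \<in> W" using ab h by (simp add: m_assoc inv_mult_group)
    qed
  qed
  then show "x \<otimes> h \<otimes> inv x \<in> W" using \<open>h \<in> W\<close> by blast
qed

lemma subgroup_centralizer:
  assumes "v \<in> carrier G"
  shows "subgroup {g \<in> carrier G. g \<otimes> v = v \<otimes> g} G"
proof (rule subgroupI)
  show "{g \<in> carrier G. g \<otimes> v = v \<otimes> g} \<noteq> {}" using assms by (auto intro!: exI[of _ \<one>])
  fix a assume a: "a \<in> {g \<in> carrier G. g \<otimes> v = v \<otimes> g}"
  then have ac: "a \<in> carrier G" "a \<otimes> v = v \<otimes> a" by auto
  have "inv a \<otimes> (a \<otimes> v) \<otimes> inv a = inv a \<otimes> (v \<otimes> a) \<otimes> inv a" using ac(2) by simp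
  then show "inv a \<in> {g \<in> carrier G. g \<otimes> v = v \<otimes> g}" using ac(1) assms by (simp add: m_assoc)
  fix b assume b: "b \<in> {g \<in> carrier G. g \<otimes> v = v \<otimes> g}"
  then have bc: "b \<in> carrier G" "b \<otimes> v = v \<otimes> b" by auto
  have "a \<otimes> b \<otimes> v = a \<otimes> v \<otimes> b" using ac(1) bc assms by (simp add: m_assoc)
  also have "\<dots> = v \<otimes> (a \<otimes> b)" unfolding ac(2) using ac(1) bc(1) assms by (simp add: m_assoc)
  finally show "a \<otimes> b \<in> {g \<in> carrier G. g \<otimes> v = v \<otimes> g}" using ac bc by simp
qed auto

text \<open>The quotient embeds in a finite power of F/M. The induction cuts down by one coordinate
  at a time and concatenates the pulled back series.\<close>

lemma polycyclic_over_joint_vimage: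
  assumes J: "finite J" and F: "group F"
    and q: "\<And>i. i \<in> J \<Longrightarrow> q i \<in> hom G F" and M: "M \<lhd> F" "polycyclic_over F M (carrier F)"
  shows "{g \<in> carrier G. \<forall>i\<in>J. q i g \<in> M} \<lhd> G \<and> polycyclic_over G {g \<in> carrier G. \<forall>i\<in>J. q i g \<in> M} (carrier G)"
  using J q
proof (induction J rule: finite_induct)
  case empty
  then show ?case by (auto intro: polycyclic_over.refl subgroup_self normal_invI)
next
  case (insert j J)
  let ?S = "{g \<in> carrier G. \<forall>i\<in>J. q i g \<in> M}"
  interpret F: group F by (rule F)
  have IH: "?S \<lhd> G" "polycyclic_over G ?S (carrier G)" using insert by auto
  have qj: "q j \<in> hom G F" using insert by simp
  have eq: "{g \<in> carrier G. \<forall>i\<in>insert j J. q i g \<in> M} = ?S \<inter> {g \<in> carrier G. q j g \<in> M}"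
    "{g \<in> carrier G. \<forall>i\<in>insert j J. q i g \<in> M} = {g \<in> ?S. q j g \<in> M}" by auto
  have "{g \<in> ?S. q j g \<in> carrier F} = ?S" using qj by (auto simp: hom_def)
  then have "polycyclic_over G {g \<in> ?S. q j g \<in> M} ?S"
    using F.polycyclic_over_vimage[OF M(2) is_group qj normal_imp_subgroup[OF IH(1)]] by simp
  then have "polycyclic_over G {g \<in> carrier G. \<forall>i\<in>insert j J. q i g \<in> M} (carrier G)"
    unfolding eq(2) by (rule polycyclic_over_trans[OF IH(2)])
  moreover have "{g \<in> carrier G. \<forall>i\<in>insert j J. q i g \<in> M} \<lhd> G"
    unfolding eq(1) by (rule normal_subgroup_intersect[OF IH(1) F.normal_vimage[OF is_group qj M(1)]])
  ultimately show ?case by blast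
qed

text \<open>The relators collected in the first approximation \<open>P\<close> force the subgroups generated by the \<open>A i\<close> to be normal with
  free quotient, to centralize \<open>V i\<close>, and force the quotient by the \<open>V i\<close> to be the polycyclic one.\<close>

theorem joint_kernel_of_coordinates_normally_finitely_generated:
  fixes F and X :: "'x set"
  defines "F \<equiv> free_group X"
  assumes I: "finite I" and Y: "finite Y" "Y \<subseteq> carrier G" "generate G Y = carrier G"
    and q: "\<And>i. i \<in> I \<Longrightarrow> q i \<in> hom G F"
    and \<delta>: "\<delta> \<in> hom F G" "\<And>i f. i \<in> I \<Longrightarrow> f \<in> carrier F \<Longrightarrow> q i (\<delta> f) = f"
    and R: "R = {g \<in> carrier G. \<forall>i\<in>I. q i g = \<one>\<^bsub>F\<^esub>}"
    and A: "\<And>i. i \<in> I \<Longrightarrow> finite (A i)" "\<And>i. i \<in> I \<Longrightarrow> A i \<subseteq> carrier G" "\<And>i a. i \<in> I \<Longrightarrow> a \<in> A i \<Longrightarrow> q i a = \<one>\<^bsub>F\<^esub>"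
    and kerA: "\<And>i g. \<lbrakk>i \<in> I; g \<in> carrier G; q i g = \<one>\<^bsub>F\<^esub>\<rbrakk> \<Longrightarrow> \<exists>a\<in>generate G (A i). \<exists>r\<in>R. g = a \<otimes> r"
    and V: "\<And>i. i \<in> I \<Longrightarrow> finite (V i)" "\<And>i. i \<in> I \<Longrightarrow> V i \<subseteq> carrier G"
    and Vker: "\<And>i j v. \<lbrakk>i \<in> I; j \<in> I; i \<noteq> j; v \<in> V i\<rbrakk> \<Longrightarrow> q j v = \<one>\<^bsub>F\<^esub>"
    and M: "M \<lhd> F" "polycyclic_over F M (carrier F)" "\<And>i. i \<in> I \<Longrightarrow> normal_closure F (q i ` V i) = M"
    and MV: "\<And>g. \<lbrakk>g \<in> carrier G; \<And>i. i \<in> I \<Longrightarrow> q i g \<in> M\<rbrakk> \<Longrightarrow>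
      \<exists>v\<in>normal_closure G (\<Union>i\<in>I. V i). \<exists>r\<in>R. g = v \<otimes> r"
  obtains B where "finite B" "B \<subseteq> R" "normal_closure G B = R"
proof -
  interpret F: group F unfolding F_def by (rule group_free_group)
  have qhom: "group_hom G F (q i)" if "i \<in> I" for i
    using q that by (simp add: group_hom_def group_hom_axioms_def is_group F.is_group)
  interpret \<delta>: group_hom F G \<delta> using \<delta> by (simp add: group_hom_def group_hom_axioms_def is_group F.is_group)
  \<comment> \<open>The joint preimage of \<open>M\<close> has a polycyclic quotient, hence finitely
    many normal generators \<open>B0\<close>.\<close>
  define \<Gamma> where "\<Gamma> = {g \<in> carrier G. \<forall>i\<in>I. q i g \<in> M}"
  have \<Gamma>: "\<Gamma> \<lhd> G" "polycyclic_over G \<Gamma> (carrier G)"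
    using polycyclic_over_joint_vimage[OF I F.is_group q M(1,2)] unfolding \<Gamma>_def by auto
  have R_normal: "R \<lhd> G"
  proof -
    have "{g \<in> carrier G. \<forall>i\<in>J. q i g \<in> {\<one>\<^bsub>F\<^esub>}} \<lhd> G" if "finite J" "J \<subseteq> I" for J
      using that
    proof (induction J rule: finite_induct)
      case empty
      then show ?case by (auto intro: subgroup_self normal_invI)
    next
      case (insert j J)
      have eq: "{g \<in> carrier G. \<forall>i\<in>insert j J. q i g \<in> {\<one>\<^bsub>F\<^esub>}}
        = {g \<in> carrier G. \<forall>i\<in>J. q i g \<in> {\<one>\<^bsub>F\<^esub>}} \<inter> {g \<in> carrier G. q j g \<in> {\<one>\<^bsub>F\<^esub>}}" by auto
      have J: "{g \<in> carrier G. \<forall>i\<in>J. q i g \<in> {\<one>\<^bsub>F\<^esub>}} \<lhd> G" using insert by blast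
      have "{g \<in> carrier G. q j g \<in> {\<one>\<^bsub>F\<^esub>}} \<lhd> G"
        using insert.prems by (intro F.normal_vimage[OF is_group q F.one_is_normal]) simp
      from normal_subgroup_intersect[OF J this] show ?case unfolding eq .
    qed
    from this[OF I order_refl] show ?thesis unfolding R by simp
  qed
  interpret R: normal R G by (rule R_normal)
  have Rq: "q i r = \<one>\<^bsub>F\<^esub>" if "r \<in> R" "i \<in> I" for i r using that unfolding R by blast
  have UV: "(\<Union>i\<in>I. V i) \<subseteq> carrier G" using V(2) by blast
  obtain B0 where B0: "finite B0" "B0 \<subseteq> \<Gamma>" "normal_closure G B0 = \<Gamma>"
    by (rule polycyclic_quotient_normally_finitely_generated[OF Y \<Gamma>])
  \<comment> \<open>After the corrections r are imposed as relators, the image of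
    \<open>\<Gamma>\<close> lies in the normal closure of the images of the \<open>V i\<close>. The
    joint kernel lies in \<open>\<Gamma>\<close>, so this gives the last hypothesis of the criterion
    applied to the quotient.\<close>
  have "\<exists>v\<in>normal_closure G (\<Union>i\<in>I. V i). \<exists>r\<in>R. b = v \<otimes> r" if "b \<in> B0" for b
    using MV[of b] that B0(2) unfolding \<Gamma>_def by blast
  from finite_absorb[of B0 _ R, OF B0(1) this]
  obtain R0 where R0: "finite R0" "R0 \<subseteq> R"
    "\<And>b. b \<in> B0 \<Longrightarrow> \<exists>v\<in>normal_closure G (\<Union>i\<in>I. V i). \<exists>r\<in>R0. b = v \<otimes> r" by (metis (no_types, lifting))
  \<comment> \<open>Elements of the kernel of q_i that are to be expressed through
    \<open>A i\<close>: the conjugates by generators make the subgroup spanned by \<open>A i\<close>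
    normal, and the differences between a generator and its image under \<open>\<delta>\<close> make
    the quotient by this subgroup a copy of F.\<close>
  define C where "C i = (\<Union>g\<in>Y. \<Union>a\<in>A i. {g \<otimes> a \<otimes> inv g, inv g \<otimes> a \<otimes> g}) \<union> (\<lambda>g. g \<otimes> inv (\<delta> (q i g))) ` Y
      \<union> (\<Union>j\<in>I - {i}. V j)" for i
  have Cfin: "finite (C i)" if "i \<in> I" for i unfolding C_def using that Y(1) A(1) I V(1) by simp
  have Cker: "c \<in> carrier G \<and> q i c = \<one>\<^bsub>F\<^esub>" if i: "i \<in> I" and c: "c \<in> C i" for i c
  proof -
    interpret qi: group_hom G F "q i" by (rule qhom[OF i])
    consider (1) g a where "g \<in> Y" "a \<in> A i" "c = g \<otimes> a \<otimes> inv g" | (2) g a where "g \<in> Y" "a \<in> A i" "c = inv g \<otimes> a \<otimes> g"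
      | (3) g where "g \<in> Y" "c = g \<otimes> inv (\<delta> (q i g))" | (4) j where "j \<in> I" "j \<noteq> i" "c \<in> V j"
      using c unfolding C_def by blast
    then show ?thesis
    proof cases
      case 1
      then have "g \<in> carrier G" "a \<in> carrier G" using Y(2) A(2)[OF i] by auto
      then show ?thesis using 1 A(3)[OF i 1(2)] by simp
    next
      case 2
      then have "g \<in> carrier G" "a \<in> carrier G" using Y(2) A(2)[OF i] by auto
      then show ?thesis using 2 A(3)[OF i 2(2)] by simp
    next
      case 3
      then have "g \<in> carrier G" using Y(2) by auto
      then show ?thesis using 3 \<delta>(2)[OF i, of "q i g"] by simp
    next
      case 4
      then show ?thesis using V(2) Vker[OF 4(1) i 4(2,3)] by blast
    qed
  qed
  have "\<exists>R1. finite R1 \<and> R1 \<subseteq> R \<and> (\<forall>c\<in>C i. \<exists>a\<in>generate G (A i). \<exists>r\<in>R1. c = a \<otimes> r)" if i: "i \<in> I" for i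
  proof -
    have "\<exists>a\<in>generate G (A i). \<exists>r\<in>R. c = a \<otimes> r" if "c \<in> C i" for c
      using kerA[OF i] Cker[OF i that] by blast
    from finite_absorb[of "C i" _ R, OF Cfin[OF i] this] show ?thesis by (metis (no_types, lifting))
  qed
  then have "\<forall>i\<in>I. \<exists>R1. finite R1 \<and> R1 \<subseteq> R \<and> (\<forall>c\<in>C i. \<exists>a\<in>generate G (A i). \<exists>r\<in>R1. c = a \<otimes> r)" by blast
  then obtain R1 where R1': "\<forall>i\<in>I. finite (R1 i) \<and> R1 i \<subseteq> R \<and> (\<forall>c\<in>C i. \<exists>a\<in>generate G (A i). \<exists>r\<in>R1 i. c = a \<otimes> r)"
    by (rule bchoice[THEN exE])
  \<comment> \<open>These commutators die in every coordinate: a is trivial in coordinate i, and v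
    is trivial in all the others.\<close>
  define R2 where "R2 = (\<Union>i\<in>I. \<Union>a\<in>A i. \<Union>v\<in>V i. {gcomm G a v})"
  have R2: "finite R2" unfolding R2_def using I A(1) V(1) by simp
  have R2R: "R2 \<subseteq> R"
  proof
    fix x assume "x \<in> R2"
    then obtain i a v where x: "i \<in> I" "a \<in> A i" "v \<in> V i" "x = gcomm G a v" unfolding R2_def by blast
    have c: "a \<in> carrier G" "v \<in> carrier G" using x A(2) V(2) by blast+
    have "q j x = \<one>\<^bsub>F\<^esub>" if j: "j \<in> I" for j
    proof -
      interpret qj: group_hom G F "q j" by (rule qhom[OF j])
      show ?thesis
      proof (cases "i = j")
        case True
        then show ?thesis using A(3)[OF x(1,2)] c x(4) by (simp add: gcomm_def)
      next
        case False
        then show ?thesis using Vker[OF x(1) j False x(3)] c x(4) by (simp add: gcomm_def)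
      qed
    qed
    then show "x \<in> R" unfolding R using c x(4) by simp
  qed
  define P where "P = R0 \<union> (\<Union>i\<in>I. R1 i) \<union> R2"
  have Pfin: "finite P" unfolding P_def using R0(1) R1' I R2 by blast
  have PR: "P \<subseteq> R" unfolding P_def using R0(2) R1' R2R by blast
  have Pc: "P \<subseteq> carrier G" using PR R.subset by blast
  define N where "N = normal_closure G P"
  have PN: "P \<subseteq> N" unfolding N_def by (rule normal_closure_incl)
  have NR: "N \<subseteq> R" unfolding N_def by (rule normal_closure_least[OF R_normal PR])
  interpret N: normal N G unfolding N_def by (rule normal_closure_normal[OF Pc])
  \<comment> \<open>The quotient by the finitely many relators found so far. The coordinate maps
    factor through it because \<open>N\<close> lies in \<open>R\<close>, and it remains to generate
    their joint kernel in the quotient.\<close>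
  define E where "E = G Mod N"
  define \<pi> where "\<pi> g = N #> g" for g
  interpret E: group E unfolding E_def by (rule N.factorgroup_is_group)
  have \<pi>: "\<pi> \<in> hom G E" unfolding \<pi>_def[abs_def] E_def by (rule N.r_coset_hom_Mod)
  interpret \<pi>: group_hom G E \<pi> using \<pi> by (simp add: group_hom_def group_hom_axioms_def is_group E.is_group)
  have \<pi>surj: "\<pi> ` carrier G = carrier E" unfolding \<pi>_def E_def by (simp add: carrier_FactGroup)
  have \<pi>N: "\<pi> n = \<one>\<^bsub>E\<^esub>" if "n \<in> N" for n
    using that unfolding \<pi>_def E_def by (simp add: N.rcos_const[OF is_group])
  have \<pi>eq: "g \<otimes> inv h \<in> N" if "g \<in> carrier G" "h \<in> carrier G" "\<pi> g = \<pi> h" for g h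
    using that N.rcos_module[OF is_group that(2,1)] rcos_self[OF that(1) N.is_subgroup] unfolding \<pi>_def by simp
  have "\<exists>p. p \<in> hom E F \<and> (\<forall>g\<in>carrier G. p (\<pi> g) = q i g)" if i: "i \<in> I" for i
  proof -
    interpret qi: group_hom G F "q i" by (rule qhom[OF i])
    have "q i x = q i y" if "x \<in> carrier G" "y \<in> carrier G" "N #> x = N #> y" for x y
    proof -
      have "x \<otimes> inv y \<in> R" using \<pi>eq[OF that(1,2)] that(3) NR unfolding \<pi>_def by blast
      then have "q i (x \<otimes> inv y) = \<one>\<^bsub>F\<^esub>" using Rq i by blast
      then show ?thesis using that(1,2) by (simp add: F.inv_solve_right')
    qed
    then show ?thesis
      using FactGroup_universal[OF q[OF i] N.normal_axioms] unfolding E_def \<pi>_def by metis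
  qed
  then have "\<forall>i\<in>I. \<exists>p. p \<in> hom E F \<and> (\<forall>g\<in>carrier G. p (\<pi> g) = q i g)" by blast
  then obtain p where p': "\<forall>i\<in>I. p i \<in> hom E F \<and> (\<forall>g\<in>carrier G. p i (\<pi> g) = q i g)"
    by (rule bchoice[THEN exE])
  then have p: "p i \<in> hom E F" and pq: "g \<in> carrier G \<Longrightarrow> p i (\<pi> g) = q i g" if "i \<in> I" for i g
    using that by auto
  define W where "W i = generate G (A i \<union> N)" for i
  have ANc: "A i \<union> N \<subseteq> carrier G" if "i \<in> I" for i using A(2)[OF that] N.subset by blast
  have W: "subgroup (W i) G" if "i \<in> I" for i unfolding W_def by (rule generate_is_subgroup[OF ANc[OF that]])
  have CW: "c \<in> W i" if i: "i \<in> I" and c: "c \<in> C i" for i c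
  proof -
    obtain a r where ar: "a \<in> generate G (A i)" "r \<in> R1 i" "c = a \<otimes> r" using R1' i c by blast
    have "r \<in> N" using ar(2) i PN unfolding P_def by blast
    then have "r \<in> W i" unfolding W_def by (auto intro: generate.incl)
    moreover have "a \<in> W i" using ar(1) mono_generate[of "A i" "A i \<union> N"] unfolding W_def by blast
    ultimately show ?thesis unfolding ar(3) by (intro subgroup.m_closed[OF W[OF i]])
  qed
  have NW: "N \<subseteq> W i" for i unfolding W_def by (auto intro: generate.incl)
  have Wn: "W i \<lhd> G" if i: "i \<in> I" for i
  proof (rule normal_if_generators_normalize[OF W[OF i] Y(2,3)])
    fix g assume g: "g \<in> Y"
    have gc: "g \<in> carrier G" using g Y(2) by blast
    show "normalizes G g (W i)"
      unfolding W_def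
    proof (rule normalizes_generate[OF ANc[OF i] gc])
      fix y assume y: "y \<in> A i \<union> N"
      have "g \<otimes> y \<otimes> inv g \<in> W i \<and> inv g \<otimes> y \<otimes> g \<in> W i"
      proof (cases "y \<in> N")
        case True
        then show ?thesis using N.inv_op_closed1[OF gc True] N.inv_op_closed2[OF gc True] NW by blast
      next
        case False
        then have "g \<otimes> y \<otimes> inv g \<in> C i" "inv g \<otimes> y \<otimes> g \<in> C i" using y g unfolding C_def by blast+
        then show ?thesis using CW[OF i] by blast
      qed
      then show "g \<otimes> y \<otimes> inv g \<in> generate G (A i \<union> N)" "inv g \<otimes> y \<otimes> g \<in> generate G (A i \<union> N)"
        unfolding W_def by auto
    qed
  qed
  \<comment> \<open>Modulo \<open>W i\<close>, every generator agrees with the image under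
    \<open>\<delta>\<close> of its i-th coordinate; by normality of \<open>W i\<close> so does every
    element, and for an element of the kernel this image is trivial.\<close>
  have kerW: "g \<in> W i" if i: "i \<in> I" and g: "g \<in> carrier G" "q i g = \<one>\<^bsub>F\<^esub>" for i g
  proof -
    interpret qi: group_hom G F "q i" by (rule qhom[OF i])
    interpret Wi: normal "W i" G by (rule Wn[OF i])
    let ?S = "{g \<in> carrier G. g \<otimes> inv (\<delta> (q i g)) \<in> W i}"
    have "subgroup ?S G"
    proof (rule subgroupI)
      have "\<one> \<otimes> inv (\<delta> (q i \<one>)) \<in> W i" by simp
      then show "?S \<noteq> {}" by blast
      fix a assume "a \<in> ?S"
      then have a: "a \<in> carrier G" "a \<otimes> inv (\<delta> (q i a)) \<in> W i" by auto
      have "inv a \<otimes> inv (a \<otimes> inv (\<delta> (q i a))) \<otimes> a \<in> W i"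
        by (rule Wi.inv_op_closed1[OF a(1) Wi.m_inv_closed[OF a(2)]])
      then show "inv a \<in> ?S" using a(1) by (simp add: m_assoc inv_mult_group)
      fix b assume "b \<in> ?S"
      then have b: "b \<in> carrier G" "b \<otimes> inv (\<delta> (q i b)) \<in> W i" by auto
      have "(a \<otimes> (b \<otimes> inv (\<delta> (q i b))) \<otimes> inv a) \<otimes> (a \<otimes> inv (\<delta> (q i a))) \<in> W i"
        by (rule Wi.m_closed[OF Wi.inv_op_closed2[OF a(1) b(2)] a(2)])
      then show "a \<otimes> b \<in> ?S" using a(1) b(1) by (simp add: m_assoc inv_mult_group)
    qed auto
    moreover have "Y \<subseteq> ?S"
    proof
      fix y assume y: "y \<in> Y"
      then have "y \<otimes> inv (\<delta> (q i y)) \<in> C i" unfolding C_def by blast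
      then show "y \<in> ?S" using CW[OF i] y Y(2) by blast
    qed
    ultimately have "generate G Y \<subseteq> ?S" by (intro generate_subgroup_incl)
    then show ?thesis using g Y(3) by auto
  qed
  define V' where "V' i = \<pi> ` V i" for i
  define R' where "R' = {e \<in> carrier E. \<forall>i\<in>I. p i e = \<one>\<^bsub>F\<^esub>}"
  have UV': "(\<Union>i\<in>I. V' i) = \<pi> ` (\<Union>i\<in>I. V i)" unfolding V'_def by blast
  have ncV: "normal_closure E (\<Union>i\<in>I. V' i) = \<pi> ` normal_closure G (\<Union>i\<in>I. V i)"
    unfolding UV' by (rule E.normal_closure_image[OF is_group \<pi> \<pi>surj UV])
  have R'nc: "R' \<subseteq> normal_closure E (\<Union>i\<in>I. V' i)"
  proof
    fix e assume e: "e \<in> R'"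
    then obtain g where g: "g \<in> carrier G" "e = \<pi> g" using \<pi>surj unfolding R'_def by blast
    have "q i g = \<one>\<^bsub>F\<^esub>" if "i \<in> I" for i using e pq[OF that g(1)] that unfolding R'_def g(2) by simp
    then have "g \<in> \<Gamma>" using g(1) subgroup.one_closed[OF normal_imp_subgroup[OF M(1)]] unfolding \<Gamma>_def by simp
    then have "g \<in> normal_closure G B0" using B0(3) by simp
    moreover have "normal_closure G B0 \<subseteq> {v \<otimes> n | v n. v \<in> normal_closure G (\<Union>i\<in>I. V i) \<and> n \<in> N}"
    proof (rule normal_closure_least[OF normal_mult[OF normal_closure_normal[OF UV] N.normal_axioms]], rule subsetI)
      fix b assume "b \<in> B0"
      then obtain v r where "v \<in> normal_closure G (\<Union>i\<in>I. V i)" "r \<in> R0" "b = v \<otimes> r" using R0(3) by blast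
      moreover then have "r \<in> N" using PN unfolding P_def by blast
      ultimately show "b \<in> {v \<otimes> n | v n. v \<in> normal_closure G (\<Union>i\<in>I. V i) \<and> n \<in> N}" by blast
    qed
    ultimately obtain v n where vn: "v \<in> normal_closure G (\<Union>i\<in>I. V i)" "n \<in> N" "g = v \<otimes> n" by blast
    have "v \<in> carrier G" using vn(1) subgroup.subset[OF normal_imp_subgroup[OF normal_closure_normal[OF UV]]] by blast
    then have "\<pi> g = \<pi> v" using vn \<pi>N[OF vn(2)] by simp
    then show "e \<in> normal_closure E (\<Union>i\<in>I. V' i)" unfolding g(2) ncV using vn(1) by blast
  qed
  obtain B' where B': "finite B'" "B' \<subseteq> R'" "normal_closure E B' = R'"
  proof (rule E.joint_kernel_normally_finitely_generated[where I = I and q = p and V = V' and X = X, OF I _ _ _ _ _ _ _ _ R'nc])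
    fix i assume i: "i \<in> I"
    show "p i \<in> hom E (free_group X)" using p[OF i] unfolding F_def .
    show "p i ` carrier E = carrier (free_group X)"
    proof
      show "p i ` carrier E \<subseteq> carrier (free_group X)" using p[OF i] unfolding F_def hom_def by blast
      show "carrier (free_group X) \<subseteq> p i ` carrier E"
      proof
        fix f assume "f \<in> carrier (free_group X)"
        then have f: "f \<in> carrier F" unfolding F_def .
        then have "f = p i (\<pi> (\<delta> f))" using pq[OF i] \<delta>(2)[OF i f] by simp
        then show "f \<in> p i ` carrier E" using f by (metis \<delta>.hom_closed \<pi>.hom_closed imageI)
      qed
    qed
    show "finite (V' i)" unfolding V'_def using V(1)[OF i] by simp
    show "V' i \<subseteq> carrier E" unfolding V'_def using V(2)[OF i] by auto
    show "p j v = \<one>\<^bsub>free_group X\<^esub>" if "j \<in> I" "i \<noteq> j" "v \<in> V' i" for j v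
      using that Vker[OF i that(1,2)] pq[OF that(1)] V(2)[OF i] unfolding V'_def F_def by auto
    show "a \<otimes>\<^bsub>E\<^esub> v = v \<otimes>\<^bsub>E\<^esub> a" if a: "a \<in> carrier E" "p i a = \<one>\<^bsub>free_group X\<^esub>" "v \<in> V' i" for a v
    proof -
      obtain g where g: "g \<in> carrier G" "a = \<pi> g" using \<pi>surj a(1) by blast
      obtain v0 where v0: "v0 \<in> V i" "v = \<pi> v0" using a(3) unfolding V'_def by blast
      have v0c: "v0 \<in> carrier G" using v0 V(2)[OF i] by blast
      \<comment> \<open>The preimage of the centralizer of v contains \<open>A i\<close> by the
        relators \<open>R2\<close>, hence the whole of \<open>W i\<close>, which contains the kernel
        of q_i.\<close>
      let ?Z = "{g \<in> carrier G. \<pi> g \<in> {x \<in> carrier E. x \<otimes>\<^bsub>E\<^esub> v = v \<otimes>\<^bsub>E\<^esub> x}}"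
      have Z: "subgroup ?Z G"
        by (rule E.subgroup_vimage[OF is_group \<pi> E.subgroup_centralizer subgroup_self]) (simp add: v0 v0c)
      have "g \<in> W i" using kerW[OF i g(1)] a(2) pq[OF i g(1)] g(2) unfolding F_def by simp
      moreover have "A i \<union> N \<subseteq> ?Z"
      proof
        fix y assume y: "y \<in> A i \<union> N"
        then have yc: "y \<in> carrier G" using ANc[OF i] by blast
        show "y \<in> ?Z"
        proof (cases "y \<in> N")
          case True
          then show ?thesis using yc \<pi>N v0 v0c by simp
        next
          case False
          then have "gcomm G y v0 \<in> P" using y v0(1) i unfolding P_def R2_def by blast
          then have "\<pi> (gcomm G y v0) = \<one>\<^bsub>E\<^esub>" using PN \<pi>N by blast
          then have "gcomm E (\<pi> y) (\<pi> v0) = \<one>\<^bsub>E\<^esub>" using yc v0c by (simp add: gcomm_def)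
          then show ?thesis using yc v0c v0(2) E.gcomm_eq_one_iff[of "\<pi> y" "\<pi> v0"] by simp
        qed
      qed
      then have "W i \<subseteq> ?Z" unfolding W_def by (rule generate_subgroup_incl[OF _ Z])
      ultimately show ?thesis using g(2) by blast
    qed
    have "normal_closure E (V' i) = \<pi> ` normal_closure G (V i)"
      unfolding V'_def by (rule E.normal_closure_image[OF is_group \<pi> \<pi>surj V(2)[OF i]])
    moreover have "p i ` \<pi> ` normal_closure G (V i) = q i ` normal_closure G (V i)"
    proof -
      have "normal_closure G (V i) \<subseteq> carrier G"
        using subgroup.subset[OF normal_imp_subgroup[OF normal_closure_normal[OF V(2)[OF i]]]] .
      then show ?thesis unfolding image_image using pq[OF i] by (intro image_cong) auto
    qed
    moreover have "q i ` carrier G = carrier F"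
    proof
      show "q i ` carrier G \<subseteq> carrier F" using q[OF i] unfolding hom_def by blast
      show "carrier F \<subseteq> q i ` carrier G" using \<delta>(2)[OF i] by (metis \<delta>.hom_closed imageI subsetI)
    qed
    then have "q i ` normal_closure G (V i) = M"
      using F.normal_closure_image[OF is_group q[OF i] _ V(2)[OF i]] M(3)[OF i] by simp
    ultimately show "polycyclic_over (free_group X) (p i ` normal_closure E (V' i)) (carrier (free_group X))"
      using M(2) unfolding F_def by simp
  next
    show "R' = {g \<in> carrier E. \<forall>i\<in>I. p i g = \<one>\<^bsub>free_group X\<^esub>}" unfolding R'_def F_def ..
  next
    fix B assume "finite B" "B \<subseteq> R'" "normal_closure E B = R'"
    then show thesis by (rule that)
  qed
  have "\<exists>b. b \<in> R \<and> \<pi> b = e" if "e \<in> B'" for e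
  proof -
    have "e \<in> R'" using that B'(2) by blast
    then obtain g where g: "g \<in> carrier G" "e = \<pi> g" using \<pi>surj unfolding R'_def by blast
    have "q i g = \<one>\<^bsub>F\<^esub>" if "i \<in> I" for i using \<open>e \<in> R'\<close> pq[OF that g(1)] that unfolding R'_def g(2) by simp
    then show ?thesis using g unfolding R by blast
  qed
  then have "\<forall>e\<in>B'. \<exists>b. b \<in> R \<and> \<pi> b = e" by blast
  then obtain f where f: "\<forall>e\<in>B'. f e \<in> R \<and> \<pi> (f e) = e" by (rule bchoice[THEN exE])
  have "f ` B' \<subseteq> R" using f by blast
  moreover have "\<pi> ` f ` B' = (\<lambda>e. e) ` B'" unfolding image_image using f by (intro image_cong) simp_all
  ultimately have fB: "f ` B' \<subseteq> R" "\<pi> ` f ` B' = B'" by simp_all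
  have fBc: "f ` B' \<subseteq> carrier G" using fB(1) R.subset by blast
  have ncB: "R' = \<pi> ` normal_closure G (f ` B')"
    using E.normal_closure_image[OF is_group \<pi> \<pi>surj fBc] unfolding fB(2) B'(3) .
  let ?B = "P \<union> f ` B'"
  have BR: "?B \<subseteq> R" using PR fB by blast
  interpret nB: normal "normal_closure G ?B" G by (rule normal_closure_normal) (use BR R.subset in blast)
  have "R \<subseteq> normal_closure G ?B"
  proof
    fix g assume g: "g \<in> R"
    then have gc: "g \<in> carrier G" by simp
    have "\<pi> g \<in> R'" unfolding R'_def using gc pq Rq[OF g] by simp
    then obtain h where h: "h \<in> normal_closure G (f ` B')" "\<pi> g = \<pi> h" unfolding ncB by blast
    have hB: "h \<in> normal_closure G ?B" using h(1) normal_closure_mono[of "f ` B'" ?B] by blast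
    then have hc: "h \<in> carrier G" by simp
    have "g \<otimes> inv h \<in> N" by (rule \<pi>eq[OF gc hc h(2)])
    then have "g \<otimes> inv h \<in> normal_closure G ?B" using normal_closure_mono[of P ?B] unfolding N_def by blast
    then have "g \<otimes> inv h \<otimes> h \<in> normal_closure G ?B" using hB by (rule nB.m_closed)
    then show "g \<in> normal_closure G ?B" using gc hc by (simp add: m_assoc)
  qed
  moreover have "normal_closure G ?B \<subseteq> R" by (rule normal_closure_least[OF R_normal BR])
  moreover have "finite ?B" using Pfin B'(1) by simp
  ultimately show thesis using BR by (intro that[of ?B]) auto
qed

section \<open>Lower central series\<close>

lemma gcomm_mult_right:
  "\<lbrakk>u \<in> carrier G; g \<in> carrier G; h \<in> carrier G\<rbrakk> \<Longrightarrow>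
    gcomm G u (g \<otimes> h) = gcomm G u g \<otimes> (g \<otimes> gcomm G u h \<otimes> inv g)"
  by (simp add: gcomm_def m_assoc inv_mult_group)

lemma gcomm_mult_left:
  "\<lbrakk>u \<in> carrier G; v \<in> carrier G; g \<in> carrier G\<rbrakk> \<Longrightarrow>
    gcomm G (u \<otimes> v) g = (u \<otimes> gcomm G v g \<otimes> inv u) \<otimes> gcomm G u g"
  by (simp add: gcomm_def m_assoc inv_mult_group)

lemma gcomm_inv_right:
  "\<lbrakk>u \<in> carrier G; g \<in> carrier G\<rbrakk> \<Longrightarrow> gcomm G u (inv g) = inv g \<otimes> inv (gcomm G u g) \<otimes> inv (inv g)"
  by (simp add: gcomm_def m_assoc inv_mult_group)

lemma gcomm_inv_left:
  "\<lbrakk>u \<in> carrier G; g \<in> carrier G\<rbrakk> \<Longrightarrow> gcomm G (inv u) g = inv u \<otimes> inv (gcomm G u g) \<otimes> inv (inv u)"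
  by (simp add: gcomm_def m_assoc inv_mult_group)

lemma conj_commuting: "\<lbrakk>g \<in> carrier G; w \<in> carrier G; g \<otimes> w = w \<otimes> g\<rbrakk> \<Longrightarrow> g \<otimes> w \<otimes> inv g = w"
  by (simp add: m_assoc)

text \<open>When x commutes with [u,x], the conjugation in the product formula for commutators
  disappears. In the applications [u,x] is central in a quotient.\<close>

lemma gcomm_pow_right:
  assumes "u \<in> carrier G" "x \<in> carrier G" "x \<otimes> gcomm G u x = gcomm G u x \<otimes> x"
  shows "gcomm G u (x [^] (n::nat)) = gcomm G u x [^] n"
proof (induction n)
  case 0
  then show ?case using assms by (simp add: gcomm_def)
next
  case (Suc n)
  have "x [^] n \<otimes> gcomm G u x = gcomm G u x \<otimes> x [^] n"
    by (rule group_commutes_pow) (use assms in auto)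
  then have "x [^] n \<otimes> gcomm G u x \<otimes> inv (x [^] n) = gcomm G u x" using assms by (intro conj_commuting) auto
  then show ?case using Suc assms(1,2) by (simp add: gcomm_mult_right)
qed

lemma gcomm_pow_left:
  assumes "u \<in> carrier G" "x \<in> carrier G" "u \<otimes> gcomm G u x = gcomm G u x \<otimes> u"
  shows "gcomm G (u [^] (n::nat)) x = gcomm G u x [^] n"
proof (induction n)
  case 0
  then show ?case using assms by (simp add: gcomm_def)
next
  case (Suc n)
  have "u [^] n \<otimes> gcomm G u x = gcomm G u x \<otimes> u [^] n"
    by (rule group_commutes_pow) (use assms in auto)
  then have "u [^] n \<otimes> gcomm G u x \<otimes> inv (u [^] n) = gcomm G u x" using assms by (intro conj_commuting) auto
  then have "gcomm G (u [^] Suc n) x = gcomm G u x \<otimes> gcomm G u x [^] n"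
    using Suc assms(1,2) by (simp add: gcomm_mult_left)
  also have "\<dots> = gcomm G u x [^] Suc n" using nat_pow_Suc2[of "gcomm G u x" n] assms(1,2) by simp
  finally show ?case .
qed

section \<open>Generation of the terms of the lower central series\<close>

lemma commutator_subgroup_eq:
  "commutator_subgroup G H K = generate G (\<Union>h\<in>H. \<Union>k\<in>K. {gcomm G h k})"
  by (simp add: commutator_subgroup_def gcomm_def)

lemma lower_central_Suc:
  "1 \<le> k \<Longrightarrow> lower_central G (Suc k) = generate G (\<Union>h\<in>lower_central G k. \<Union>g\<in>carrier G. {gcomm G h g})"
  by (cases k) (simp_all add: commutator_subgroup_eq)

lemma lower_central_normal: "lower_central G k \<lhd> G"
proof (induction k)
  case 0
  show ?case by (auto intro: subgroup_self normal_invI)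
next
  case (Suc k)
  show ?case
  proof (cases "k = 0")
    case True
    then show ?thesis by (auto intro: subgroup_self normal_invI)
  next
    case False
    interpret L: normal "lower_central G k" G by (rule Suc)
    have eq: "lower_central G (Suc k) = generate G (\<Union>h\<in>lower_central G k. \<Union>g\<in>carrier G. {gcomm G h g})"
      using False by (intro lower_central_Suc) simp
    show ?thesis unfolding eq
    proof (rule normal_generateI)
      show "(\<Union>h\<in>lower_central G k. \<Union>g\<in>carrier G. {gcomm G h g}) \<subseteq> carrier G" by auto
      fix y g assume "y \<in> (\<Union>h\<in>lower_central G k. \<Union>g\<in>carrier G. {gcomm G h g})" and g: "g \<in> carrier G"
      then obtain h x where hx: "h \<in> lower_central G k" "x \<in> carrier G" "y = gcomm G h x" by blast
      have "g \<otimes> y \<otimes> inv g = gcomm G (g \<otimes> h \<otimes> inv g) (g \<otimes> x \<otimes> inv g)"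
        using hx g unfolding gcomm_def by (simp add: m_assoc inv_mult_group)
      moreover have "g \<otimes> x \<otimes> inv g \<in> carrier G" using g hx by simp
      ultimately show "g \<otimes> y \<otimes> inv g \<in> (\<Union>h\<in>lower_central G k. \<Union>g\<in>carrier G. {gcomm G h g})"
        using L.inv_op_closed2[OF g hx(1)] by blast
    qed
  qed
qed

lemma lower_central_subgroup: "subgroup (lower_central G k) G"
  by (rule normal_imp_subgroup[OF lower_central_normal])

lemma lower_central_carrier: "u \<in> lower_central G k \<Longrightarrow> u \<in> carrier G"
  by (rule subgroup.mem_carrier[OF lower_central_subgroup])

lemma lower_central_1: "lower_central G 1 = carrier G"
  by simp

lemma gcomm_lower_central:
  "\<lbrakk>1 \<le> k; u \<in> lower_central G k; g \<in> carrier G\<rbrakk> \<Longrightarrow> gcomm G u g \<in> lower_central G (Suc k)"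
  unfolding lower_central_Suc by (rule generate.incl) blast

lemma lower_central_Suc_subset: "lower_central G (Suc k) \<subseteq> lower_central G k"
proof (cases "k = 0")
  case True
  then show ?thesis by simp
next
  case False
  then have k: "1 \<le> k" by simp
  interpret L: normal "lower_central G k" G by (rule lower_central_normal)
  show ?thesis unfolding lower_central_Suc[OF k]
  proof (rule generate_subgroup_incl[OF _ L.is_subgroup], rule subsetI)
    fix y assume "y \<in> (\<Union>h\<in>lower_central G k. \<Union>g\<in>carrier G. {gcomm G h g})"
    then obtain h x where hx: "h \<in> lower_central G k" "x \<in> carrier G" "y = gcomm G h x" by blast
    have "h \<otimes> (x \<otimes> inv h \<otimes> inv x) \<in> lower_central G k"
      using L.inv_op_closed2[OF hx(2) L.m_inv_closed[OF hx(1)]] hx(1) by simp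
    then show "y \<in> lower_central G k" using hx unfolding gcomm_def by (simp add: m_assoc)
  qed
qed

lemma lower_central_antimono: "j \<le> k \<Longrightarrow> lower_central G k \<subseteq> lower_central G j"
  by (rule lift_Suc_antimono_le[of "lower_central G", OF lower_central_Suc_subset])

text \<open>Modulo gamma_(k+2) the commutator of gamma_k with G is bilinear, so it suffices to know
  it on generators in both entries. With an arbitrary subgroup \<open>H\<close> this becomes the
  induction rule by which properties are carried from gamma_k to gamma_(k+1).\<close>

lemma lower_central_Suc_least:
  assumes X: "X \<subseteq> carrier G" "generate G X = carrier G" and k: "1 \<le> k"
    and Y: "Y \<subseteq> lower_central G k" "lower_central G k \<subseteq> generate G (Y \<union> lower_central G (Suc k))"
    and H: "subgroup H G" "lower_central G (Suc (Suc k)) \<subseteq> H" "\<And>y x. y \<in> Y \<Longrightarrow> x \<in> X \<Longrightarrow> gcomm G y x \<in> H"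
  shows "lower_central G (Suc k) \<subseteq> H"
proof -
  interpret H: subgroup H G by (rule H(1))
  interpret L: normal "lower_central G k" G by (rule lower_central_normal)
  interpret L1: normal "lower_central G (Suc k)" G by (rule lower_central_normal)
  have k1: "1 \<le> Suc k" by simp
  \<comment> \<open>Conjugation changes elements of gamma_(k+1) by elements of gamma_(k+2), which
    lie in \<open>H\<close>. This makes up for normality of \<open>H\<close> in the commutator
    identities.\<close>
  have conj: "g \<otimes> w \<otimes> inv g \<in> H" if "w \<in> H" "w \<in> lower_central G (Suc k)" "g \<in> carrier G" for w g
  proof -
    have "inv (gcomm G w g) \<in> H" using gcomm_lower_central[OF k1 that(2,3)] H(2) by blast
    then have "inv (gcomm G w g) \<otimes> w \<in> H" using that(1) by simp
    then show ?thesis using that(1,3) by (simp add: gcomm_def m_assoc inv_mult_group)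
  qed
  have right: "gcomm G u g \<in> H" if u: "u \<in> lower_central G k" and X': "\<And>x. x \<in> X \<Longrightarrow> gcomm G u x \<in> H" and g: "g \<in> carrier G" for u g
  proof -
    have uc: "u \<in> carrier G" using u by simp
    have "subgroup {g \<in> carrier G. gcomm G u g \<in> H} G"
    proof (rule subgroupI)
      have "gcomm G u \<one> \<in> H" using uc by (simp add: gcomm_def)
      then show "{g \<in> carrier G. gcomm G u g \<in> H} \<noteq> {}" by blast
      fix a assume "a \<in> {g \<in> carrier G. gcomm G u g \<in> H}"
      then have a: "a \<in> carrier G" "gcomm G u a \<in> H" by auto
      have "inv a \<otimes> inv (gcomm G u a) \<otimes> inv (inv a) \<in> H"
        using gcomm_lower_central[OF k u a(1)] a by (intro conj) auto
      then show "inv a \<in> {g \<in> carrier G. gcomm G u g \<in> H}" using a(1) gcomm_inv_right[OF uc a(1)] by simp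
      fix b assume "b \<in> {g \<in> carrier G. gcomm G u g \<in> H}"
      then have b: "b \<in> carrier G" "gcomm G u b \<in> H" by auto
      have "a \<otimes> gcomm G u b \<otimes> inv a \<in> H"
        using gcomm_lower_central[OF k u b(1)] a b by (intro conj) auto
      then show "a \<otimes> b \<in> {g \<in> carrier G. gcomm G u g \<in> H}" using a b gcomm_mult_right[OF uc a(1) b(1)] by simp
    qed auto
    then have "generate G X \<subseteq> {g \<in> carrier G. gcomm G u g \<in> H}"
      using X(1) X' by (intro generate_subgroup_incl) auto
    then show ?thesis using g X(2) by auto
  qed
  have left: "gcomm G u x \<in> H" if u: "u \<in> lower_central G k" and x: "x \<in> X" for u x
  proof -
    have xc: "x \<in> carrier G" using x X(1) by blast
    let ?S = "{u \<in> lower_central G k. gcomm G u x \<in> H}"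
    have S: "subgroup ?S G"
    proof (rule subgroupI)
      show "?S \<subseteq> carrier G" by auto
      have "gcomm G \<one> x \<in> H" using xc by (simp add: gcomm_def)
      then show "?S \<noteq> {}" using L.one_closed by blast
      fix a assume "a \<in> ?S"
      then have a: "a \<in> lower_central G k" "gcomm G a x \<in> H" by auto
      have ac: "a \<in> carrier G" using a by simp
      have "inv a \<otimes> inv (gcomm G a x) \<otimes> inv (inv a) \<in> H"
        using gcomm_lower_central[OF k a(1) xc] a ac by (intro conj) auto
      then show "inv a \<in> ?S" using a gcomm_inv_left[OF ac xc] by simp
      fix b assume "b \<in> ?S"
      then have b: "b \<in> lower_central G k" "gcomm G b x \<in> H" by auto
      have bc: "b \<in> carrier G" using b by simp
      have "a \<otimes> gcomm G b x \<otimes> inv a \<in> H"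
        using gcomm_lower_central[OF k b(1) xc] ac b by (intro conj) auto
      then show "a \<otimes> b \<in> ?S" using a b gcomm_mult_left[OF ac bc xc] by simp
    qed
    have "Y \<union> lower_central G (Suc k) \<subseteq> ?S"
    proof (intro Un_least subsetI)
      show "y \<in> ?S" if "y \<in> Y" for y using that Y(1) H(3) x by blast
      show "y \<in> ?S" if "y \<in> lower_central G (Suc k)" for y
        using that gcomm_lower_central[OF k1 that xc] H(2) lower_central_Suc_subset by blast
    qed
    then have "generate G (Y \<union> lower_central G (Suc k)) \<subseteq> ?S" by (rule generate_subgroup_incl[OF _ S])
    then show ?thesis using u Y(2) by blast
  qed
  show ?thesis unfolding lower_central_Suc[OF k]
  proof (rule generate_subgroup_incl[OF _ H(1)], rule subsetI)
    fix y assume "y \<in> (\<Union>h\<in>lower_central G k. \<Union>g\<in>carrier G. {gcomm G h g})"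
    then obtain h x where hx: "h \<in> lower_central G k" "x \<in> carrier G" "y = gcomm G h x" by blast
    show "y \<in> H" unfolding hx(3) using hx(1) left[OF hx(1)] hx(2) by (rule right)
  qed
qed

lemma lower_central_Suc_least':
  assumes "X \<subseteq> carrier G" "generate G X = carrier G" "1 \<le> k"
    and "subgroup H G" "lower_central G (Suc (Suc k)) \<subseteq> H"
    and "\<And>u x. u \<in> lower_central G k \<Longrightarrow> x \<in> X \<Longrightarrow> gcomm G u x \<in> H"
  shows "lower_central G (Suc k) \<subseteq> H"
  by (rule lower_central_Suc_least[OF assms(1-3) order_refl _ assms(4-6)]) (auto intro: generate.incl)

text \<open>By bilinearity, the brackets of generators of one layer with the generators of G
  generate the next layer.\<close>

lemma lower_central_finitely_generated_mod:
  assumes X: "finite X" "X \<subseteq> carrier G" "generate G X = carrier G"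
  shows "1 \<le> k \<Longrightarrow> \<exists>T. finite T \<and> T \<subseteq> lower_central G k \<and>
    lower_central G k = generate G (lower_central G (Suc k) \<union> T)"
proof (induction k rule: dec_induct)
  case base
  have "carrier G \<subseteq> generate G (lower_central G (Suc 1) \<union> X)"
    using X(3) mono_generate[of X "lower_central G (Suc 1) \<union> X"] by blast
  moreover have "generate G (lower_central G (Suc 1) \<union> X) \<subseteq> carrier G"
    using X(2) lower_central_carrier by (intro generate_incl) blast
  ultimately show ?case using X unfolding lower_central_1 by (intro exI[of _ X]) blast
next
  case (step k)
  then obtain T where T: "finite T" "T \<subseteq> lower_central G k" "lower_central G k = generate G (lower_central G (Suc k) \<union> T)"
    by blast
  define T' where "T' = (\<Union>y\<in>T. \<Union>x\<in>X. {gcomm G y x})"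
  have T'L: "T' \<subseteq> lower_central G (Suc k)"
    unfolding T'_def using gcomm_lower_central[OF step(1)] T(2) X(2) by blast
  have sub: "lower_central G (Suc (Suc k)) \<union> T' \<subseteq> lower_central G (Suc k)"
    using T'L lower_central_Suc_subset by blast
  then have sub': "lower_central G (Suc (Suc k)) \<union> T' \<subseteq> carrier G" using lower_central_carrier by blast
  have "lower_central G (Suc k) \<subseteq> generate G (lower_central G (Suc (Suc k)) \<union> T')"
  proof (rule lower_central_Suc_least[OF X(2,3) step(1) T(2) _ generate_is_subgroup[OF sub']])
    show "lower_central G k \<subseteq> generate G (T \<union> lower_central G (Suc k))" using T(3) by (simp add: Un_commute)
    show "lower_central G (Suc (Suc k)) \<subseteq> generate G (lower_central G (Suc (Suc k)) \<union> T')" by (auto intro: generate.incl)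
    show "gcomm G y x \<in> generate G (lower_central G (Suc (Suc k)) \<union> T')" if "y \<in> T" "x \<in> X" for y x
      using that unfolding T'_def by (intro generate.incl) blast
  qed
  moreover have "generate G (lower_central G (Suc (Suc k)) \<union> T') \<subseteq> lower_central G (Suc k)"
    by (rule generate_subgroup_incl[OF sub lower_central_subgroup])
  moreover have "finite T'" unfolding T'_def using T(1) X(1) by simp
  ultimately show ?case using T'L by (intro exI[of _ T']) blast
qed

text \<open>Every layer of the lower central series is a finitely generated abelian section, hence
  polycyclic, and the series of the layers concatenate.\<close>

lemma lower_central_polycyclic:
  assumes X: "finite X" "X \<subseteq> carrier G" "generate G X = carrier G"
  shows "1 \<le> k \<Longrightarrow> polycyclic_over G (lower_central G k) (carrier G)"
proof (induction k rule: dec_induct)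
  case base
  show ?case unfolding lower_central_1 by (rule polycyclic_over.refl[OF subgroup_self])
next
  case (step k)
  obtain T where T: "finite T" "T \<subseteq> lower_central G k" "lower_central G k = generate G (lower_central G (Suc k) \<union> T)"
    using lower_central_finitely_generated_mod[OF X step(1)] by blast
  interpret abelian_section G "lower_central G (Suc k)" "lower_central G k"
    by (intro abelian_section.intro abelian_section_axioms.intro is_group lower_central_normal
        lower_central_Suc_subset gcomm_lower_central step(1)) (auto dest: lower_central_carrier)
  have "polycyclic_over G (lower_central G (Suc k)) (lower_central G k)"
    using polycyclic_over_generate[OF T(1,2)] T(3) by simp
  then show ?case by (rule polycyclic_over_trans[OF step(3)])
qed

lemma lower_central_hom:
  assumes "group H" "f \<in> hom G H"
  shows "f ` lower_central G k \<subseteq> lower_central H k"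
proof (induction k)
  case 0
  show ?case using assms by (auto simp: hom_def)
next
  case (Suc k)
  interpret H: group H by fact
  interpret f: group_hom G H f using assms by (simp add: group_hom_def group_hom_axioms_def is_group)
  show ?case
  proof (cases "k = 0")
    case True
    then show ?thesis using assms by (auto simp: hom_def)
  next
    case False
    then have k: "1 \<le> k" by simp
    have "lower_central G (Suc k) \<subseteq> {x \<in> carrier G. f x \<in> lower_central H (Suc k)}"
      unfolding lower_central_Suc[OF k]
    proof (rule generate_subgroup_incl)
      show "subgroup {x \<in> carrier G. f x \<in> lower_central H (Suc k)} G"
        by (rule H.subgroup_vimage[OF is_group assms(2) H.lower_central_subgroup subgroup_self])
      show "(\<Union>h\<in>lower_central G k. \<Union>g\<in>carrier G. {gcomm G h g}) \<subseteq> {x \<in> carrier G. f x \<in> lower_central H (Suc k)}"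
      proof
        fix y assume "y \<in> (\<Union>h\<in>lower_central G k. \<Union>g\<in>carrier G. {gcomm G h g})"
        then obtain h x where hx: "h \<in> lower_central G k" "x \<in> carrier G" "y = gcomm G h x" by blast
        have hc: "h \<in> carrier G" using hx(1) by (rule lower_central_carrier)
        have "f y = gcomm H (f h) (f x)" using hx hc unfolding gcomm_def by simp
        moreover have "f h \<in> lower_central H k" using Suc hx(1) by blast
        ultimately have "f y \<in> lower_central H (Suc k)" using H.gcomm_lower_central[OF k] hx(2) by simp
        then show "y \<in> {x \<in> carrier G. f x \<in> lower_central H (Suc k)}" using hx hc by simp
      qed
    qed
    then show ?thesis by blast
  qed
qed

lemma lower_central_hom_onto:
  assumes "group H" "f \<in> hom G H" "f ` carrier G = carrier H"
  shows "lower_central H k = f ` lower_central G k"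
proof (induction k)
  case 0
  show ?case using assms(3) by simp
next
  case (Suc k)
  interpret H: group H by fact
  interpret f: group_hom G H f using assms by (simp add: group_hom_def group_hom_axioms_def is_group)
  show ?case
  proof (cases "k = 0")
    case True
    then show ?thesis using assms(3) by simp
  next
    case False
    then have k: "1 \<le> k" by simp
    have "lower_central H (Suc k) \<subseteq> f ` lower_central G (Suc k)"
      unfolding H.lower_central_Suc[OF k]
    proof (rule H.generate_subgroup_incl[OF _ f.subgroup_img_is_subgroup[OF lower_central_subgroup]], rule subsetI)
      fix y assume "y \<in> (\<Union>h\<in>lower_central H k. \<Union>g\<in>carrier H. {gcomm H h g})"
      then obtain h x where hx: "h \<in> lower_central H k" "x \<in> carrier H" "y = gcomm H h x" by blast
      then obtain h' x' where h': "h' \<in> lower_central G k" "h = f h'" "x' \<in> carrier G" "x = f x'"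
        using Suc assms(3) by blast
      have hc: "h' \<in> carrier G" using h'(1) by (rule lower_central_carrier)
      have "y = f (gcomm G h' x')" using hx h' hc unfolding gcomm_def by simp
      then show "y \<in> f ` lower_central G (Suc k)" using gcomm_lower_central[OF k h'(1,3)] by blast
    qed
    then show ?thesis using lower_central_hom[OF assms(1,2), of "Suc k"] by blast
  qed
qed

end

section \<open>Finite differences and torsion in nilpotent groups\<close>

text \<open>An ordered product, because the factors need not commute; it behaves like a sum after
  passing to a quotient in which the factors are central.\<close>

primrec indexed_prod :: "('a, 'b) monoid_scheme \<Rightarrow> (nat \<Rightarrow> 'a) \<Rightarrow> nat \<Rightarrow> 'a" where
  "indexed_prod G f 0 = \<one>\<^bsub>G\<^esub>"
| "indexed_prod G f (Suc n) = indexed_prod G f n \<otimes>\<^bsub>G\<^esub> f n"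

text \<open>Pascal's rule followed by a shift of the index: one difference step lowers the row of
  the binomial coefficients by one.\<close>

lemma alternating_binomial_recursion:
  fixes f :: "nat \<Rightarrow> int"
  shows "(\<Sum>i\<le>Suc m. (-1) ^ i * int (Suc m choose i) * f i) =
    (\<Sum>i\<le>m. (-1) ^ i * int (m choose i) * (f i - f (Suc i)))"
proof -
  have "(\<Sum>i\<le>Suc m. (-1) ^ i * int (Suc m choose i) * f i)
      = f 0 + (\<Sum>i\<le>m. (-1) ^ Suc i * int (Suc m choose Suc i) * f (Suc i))"
    by (subst sum.atMost_Suc_shift) simp
  also have "(\<Sum>i\<le>m. (-1) ^ Suc i * int (Suc m choose Suc i) * f (Suc i))
      = (\<Sum>i\<le>m. (-1) ^ Suc i * int (m choose Suc i) * f (Suc i)) - (\<Sum>i\<le>m. (-1) ^ i * int (m choose i) * f (Suc i))"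
    unfolding sum_subtractf[symmetric] by (rule sum.cong) (simp_all add: algebra_simps)
  also have "f 0 + ((\<Sum>i\<le>m. (-1) ^ Suc i * int (m choose Suc i) * f (Suc i)) - (\<Sum>i\<le>m. (-1) ^ i * int (m choose i) * f (Suc i)))
      = (\<Sum>i\<le>Suc m. (-1) ^ i * int (m choose i) * f i) - (\<Sum>i\<le>m. (-1) ^ i * int (m choose i) * f (Suc i))"
    by (subst sum.atMost_Suc_shift[of _ m]) simp
  also have "\<dots> = (\<Sum>i\<le>m. (-1) ^ i * int (m choose i) * (f i - f (Suc i)))"
    by (simp add: sum_subtractf right_diff_distrib)
  finally show ?thesis .
qed

text \<open>One difference step turns (i + a)^d into a combination of lower powers of i + a, so m
  steps annihilate every degree below m. The shift \<open>a\<close> allows for coordinates counted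
  from 1.\<close>

lemma alternating_binomial_powers_zero:
  "d < m \<Longrightarrow> (\<Sum>i\<le>m. (-1) ^ i * int (m choose i) * (int i + a) ^ d) = 0"
proof (induction m arbitrary: d)
  case (Suc m)
  have diff: "(int i + a) ^ d - (int (Suc i) + a) ^ d = - (\<Sum>e<d. int (d choose e) * (int i + a) ^ e)" for i
  proof -
    have "(int (Suc i) + a) ^ d = ((int i + a) + 1) ^ d" by (simp add: algebra_simps)
    also have "\<dots> = (\<Sum>e\<le>d. int (d choose e) * (int i + a) ^ e)" by (simp add: binomial_ring)
    also have "\<dots> = (\<Sum>e<d. int (d choose e) * (int i + a) ^ e) + (int i + a) ^ d"
      by (simp add: lessThan_Suc_atMost[symmetric])
    finally show ?thesis by simp
  qed
  have "(\<Sum>i\<le>Suc m. (-1) ^ i * int (Suc m choose i) * (int i + a) ^ d)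
      = (\<Sum>i\<le>m. (-1) ^ i * int (m choose i) * - (\<Sum>e<d. int (d choose e) * (int i + a) ^ e))"
    unfolding alternating_binomial_recursion diff ..
  also have "\<dots> = - (\<Sum>i\<le>m. \<Sum>e<d. int (d choose e) * ((-1) ^ i * int (m choose i) * (int i + a) ^ e))"
    by (simp add: sum_distrib_left sum_negf mult_ac)
  also have "(\<Sum>i\<le>m. \<Sum>e<d. int (d choose e) * ((-1) ^ i * int (m choose i) * (int i + a) ^ e))
      = (\<Sum>e<d. int (d choose e) * (\<Sum>i\<le>m. (-1) ^ i * int (m choose i) * (int i + a) ^ e))"
    by (subst sum.swap) (simp add: sum_distrib_left)
  also have "\<dots> = 0" using Suc by (intro sum.neutral) auto
  finally show ?case by simp
qed simp

section \<open>Central quotients and torsion in nilpotent groups\<close>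

context group
begin

lemma quotient_map:
  assumes "N \<lhd> G"
  shows "group (G Mod N)" "(\<lambda>g. N #> g) \<in> hom G (G Mod N)" "(\<lambda>g. N #> g) ` carrier G = carrier (G Mod N)"
    "\<And>g. g \<in> carrier G \<Longrightarrow> N #> g = \<one>\<^bsub>G Mod N\<^esub> \<longleftrightarrow> g \<in> N"
proof -
  interpret N: normal N G by fact
  show "group (G Mod N)" by (rule N.factorgroup_is_group)
  show "(\<lambda>g. N #> g) \<in> hom G (G Mod N)" by (rule N.r_coset_hom_Mod)
  show "(\<lambda>g. N #> g) ` carrier G = carrier (G Mod N)" by (simp add: carrier_FactGroup)
  show "N #> g = \<one>\<^bsub>G Mod N\<^esub> \<longleftrightarrow> g \<in> N" if "g \<in> carrier G" for g
    using that coset_join1[OF _ that N.is_subgroup] coset_join2[OF that N.is_subgroup] by auto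
qed

definition center :: "'a set" where
  "center = {z \<in> carrier G. \<forall>g\<in>carrier G. g \<otimes> z = z \<otimes> g}"

lemma centerD: "z \<in> center \<Longrightarrow> z \<in> carrier G" "z \<in> center \<Longrightarrow> g \<in> carrier G \<Longrightarrow> g \<otimes> z = z \<otimes> g"
  unfolding center_def by auto

lemma subgroup_center: "subgroup center G"
proof (rule subgroupI)
  show "center \<subseteq> carrier G" unfolding center_def by blast
  have "\<one> \<in> center" unfolding center_def by simp
  then show "center \<noteq> {}" by blast
  fix a assume a: "a \<in> center"
  have "g \<otimes> inv a = inv a \<otimes> g" if g: "g \<in> carrier G" for g
  proof -
    have "inv a \<otimes> (g \<otimes> a) \<otimes> inv a = inv a \<otimes> (a \<otimes> g) \<otimes> inv a" using centerD(2)[OF a g] by simp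
    then show ?thesis using g centerD(1)[OF a] by (simp add: m_assoc)
  qed
  then show "inv a \<in> center" using centerD(1)[OF a] unfolding center_def by blast
  fix b assume b: "b \<in> center"
  have "g \<otimes> (a \<otimes> b) = a \<otimes> b \<otimes> g" if g: "g \<in> carrier G" for g
  proof -
    have ac: "a \<in> carrier G" and bc: "b \<in> carrier G" using a b unfolding center_def by blast+
    have "g \<otimes> (a \<otimes> b) = (g \<otimes> a) \<otimes> b" by (rule m_assoc[symmetric, OF g ac bc])
    also have "\<dots> = (a \<otimes> g) \<otimes> b" by (simp only: centerD(2)[OF a g])
    also have "\<dots> = a \<otimes> (g \<otimes> b)" by (rule m_assoc[OF ac g bc])
    also have "\<dots> = a \<otimes> (b \<otimes> g)" by (simp only: centerD(2)[OF b g])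
    also have "\<dots> = a \<otimes> b \<otimes> g" by (rule m_assoc[symmetric, OF ac bc g])
    finally show ?thesis .
  qed
  then show "a \<otimes> b \<in> center" using centerD(1)[OF a] centerD(1)[OF b] unfolding center_def by blast
qed

lemma center_int_pow: "z \<in> center \<Longrightarrow> z [^] (n::int) \<in> center"
  by (rule subgroup_int_pow_closed[OF subgroup_center])

lemma gcomm_center: "z \<in> center \<Longrightarrow> g \<in> carrier G \<Longrightarrow> gcomm G z g = \<one>"
  using gcomm_eq_one_iff[of z g] centerD[of z] by simp

lemma lower_central_quotient_center:
  assumes "1 \<le> k" "N \<lhd> G" "lower_central G (Suc k) \<subseteq> N" "u \<in> lower_central G k"
  shows "N #> u \<in> group.center (G Mod N)"
proof -
  note Q = quotient_map[OF assms(2)]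
  interpret Q: group "G Mod N" by (rule Q(1))
  interpret \<pi>: group_hom G "G Mod N" "\<lambda>g. N #> g"
    using Q by (simp add: group_hom_def group_hom_axioms_def is_group Q.is_group)
  have uc: "u \<in> carrier G" using assms(4) by (rule lower_central_carrier)
  have "e \<otimes>\<^bsub>G Mod N\<^esub> (N #> u) = (N #> u) \<otimes>\<^bsub>G Mod N\<^esub> e" if e: "e \<in> carrier (G Mod N)" for e
  proof -
    obtain g where g: "g \<in> carrier G" "e = N #> g" using e Q(3) by blast
    have "gcomm G u g \<in> N" using gcomm_lower_central[OF assms(1,4) g(1)] assms(3) by blast
    then have "N #> gcomm G u g = \<one>\<^bsub>G Mod N\<^esub>" using Q(4) uc g by simp
    moreover have "N #> gcomm G u g = gcomm (G Mod N) (N #> u) (N #> g)"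
      using \<pi>.hom_mult \<pi>.hom_inv uc g(1) unfolding gcomm_def by (metis inv_closed m_closed)
    ultimately show ?thesis
      using Q.gcomm_eq_one_iff[of "N #> u" "N #> g"] \<pi>.hom_closed uc g by metis
  qed
  then show ?thesis unfolding Q.center_def using \<pi>.hom_closed[OF uc] by simp
qed

lemma subgroup_torsion_center: "subgroup {z \<in> center. \<exists>r::nat. 0 < r \<and> z [^] r = \<one>} G"
proof (rule subgroupI)
  let ?T = "{z \<in> center. \<exists>r::nat. 0 < r \<and> z [^] r = \<one>}"
  interpret C: subgroup center G by (rule subgroup_center)
  show "?T \<subseteq> carrier G" by auto
  have "\<one> [^] (1::nat) = \<one>" by simp
  then show "?T \<noteq> {}" using C.one_closed by (metis (mono_tags, lifting) empty_iff mem_Collect_eq zero_less_one)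
  fix a assume "a \<in> ?T"
  then obtain r :: nat where a: "a \<in> center" "0 < r" "a [^] r = \<one>" by blast
  have "inv a [^] r = \<one>" using a nat_pow_inv[of a r] by simp
  then show "inv a \<in> ?T" using a C.m_inv_closed by blast
  fix b assume "b \<in> ?T"
  then obtain s :: nat where b: "b \<in> center" "0 < s" "b [^] s = \<one>" by blast
  have ac: "a \<in> carrier G" "b \<in> carrier G" using a b by auto
  have "(a \<otimes> b) [^] (r * s) = a [^] (r * s) \<otimes> b [^] (r * s)"
    by (rule pow_mult_distrib) (use ac centerD(2)[OF b(1) ac(1)] in auto)
  also have "a [^] (r * s) = \<one>" using a(3) ac nat_pow_pow[of a r s] by simp
  also have "b [^] (r * s) = \<one>" using b(3) ac nat_pow_pow[of b s r] by (simp add: mult.commute)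
  finally have "(a \<otimes> b) [^] (r * s) = \<one>" by simp
  moreover have "0 < r * s" using a b by simp
  ultimately show "a \<otimes> b \<in> ?T" using C.m_closed[OF a(1) b(1)] by blast
qed

text \<open>A nilpotent group generated by elements of finite order is torsion: once [u,x] is
  central, [u,x]^r = [u,x^r], so torsion of the generators passes down the lower central series of
  G/P. An arbitrary element is then raised to powers layer by layer.\<close>

proposition torsion_mod_of_torsion_generators:
  assumes X: "X \<subseteq> carrier G" "generate G X = carrier G" and P: "P \<lhd> G" "lower_central G (Suc c) \<subseteq> P"
    and tor: "\<And>x. x \<in> X \<Longrightarrow> \<exists>r::nat. 0 < r \<and> x [^] r \<in> P"
    and g: "g \<in> carrier G"
  shows "\<exists>r::nat. 0 < r \<and> g [^] r \<in> P"
proof -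
  interpret P: normal P G by (rule P(1))
  \<comment> \<open>Dividing by P gamma_(k+1) makes the image of gamma_k central, so the torsion
    elements of the image form a subgroup.\<close>
  define N where "N k = {p \<otimes> v | p v. p \<in> P \<and> v \<in> lower_central G (Suc k)}" for k
  have N: "N k \<lhd> G" for k unfolding N_def by (rule normal_mult[OF P(1) lower_central_normal])
  have LN: "lower_central G (Suc k) \<subseteq> N k" for k
  proof
    fix v assume v: "v \<in> lower_central G (Suc k)"
    then have "v = \<one> \<otimes> v" using lower_central_carrier by simp
    then show "v \<in> N k" using v P.one_closed unfolding N_def by blast
  qed
  have PN: "P \<subseteq> N k" for k
  proof
    fix p assume p: "p \<in> P"
    then have "p = p \<otimes> \<one>" by simp
    then show "p \<in> N k" using p subgroup.one_closed[OF lower_central_subgroup] unfolding N_def by blast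
  qed
  let ?T = "\<lambda>k. {z \<in> group.center (G Mod N k). \<exists>r::nat. 0 < r \<and> z [^]\<^bsub>G Mod N k\<^esub> r = \<one>\<^bsub>G Mod N k\<^esub>}"
  define H where "H k = {u \<in> carrier G. N k #> u \<in> ?T k}" for k
  have H: "subgroup (H k) G" for k
    unfolding H_def
    by (rule group.subgroup_vimage[OF quotient_map(1)[OF N] is_group quotient_map(2)[OF N]
          group.subgroup_torsion_center[OF quotient_map(1)[OF N]] subgroup_self])
  have HI: "u \<in> H k" if "1 \<le> k" "u \<in> lower_central G k" "0 < (r::nat)" "u [^] r \<in> N k" for u k r
  proof -
    have uc: "u \<in> carrier G" using that(2) by (rule lower_central_carrier)
    interpret Nk: normal "N k" G by (rule N)
    have "(N k #> u) [^]\<^bsub>G Mod N k\<^esub> r = N k #> (u [^] r)" by (rule Nk.FactGroup_pow[OF uc])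
    also have "\<dots> = \<one>\<^bsub>G Mod N k\<^esub>" using quotient_map(4)[OF N, of "u [^] r"] uc that(4) by simp
    finally show ?thesis
      using lower_central_quotient_center[OF that(1) N LN that(2)] that(3) uc unfolding H_def by blast
  qed
  have LH: "lower_central G k \<subseteq> H k" if k: "1 \<le> k" for k
  proof (cases "k = 1")
    case True
    have "x \<in> H 1" if x: "x \<in> X" for x
    proof -
      obtain r :: nat where "0 < r" "x [^] r \<in> P" using tor[OF x] by blast
      then show ?thesis using HI[of 1 x r] PN[of 1] x X(1) by auto
    qed
    then have "generate G X \<subseteq> H 1" by (intro generate_subgroup_incl H) blast
    then show ?thesis using X(2) True by simp
  next
    case False
    then obtain j where j: "k = Suc j" "1 \<le> j" using k by (cases k) auto
    have "lower_central G (Suc j) \<subseteq> H (Suc j)"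
    proof (rule lower_central_Suc_least'[OF X j(2) H])
      show "lower_central G (Suc (Suc j)) \<subseteq> H (Suc j)"
      proof
        fix v assume v: "v \<in> lower_central G (Suc (Suc j))"
        then show "v \<in> H (Suc j)"
          using HI[of "Suc j" v 1] LN[of "Suc j"] lower_central_Suc_subset[of "Suc j"] lower_central_carrier[OF v] by auto
      qed
      fix u x assume u: "u \<in> lower_central G j" and x: "x \<in> X"
      obtain r :: nat where r: "0 < r" "x [^] r \<in> P" using tor[OF x] by blast
      have c: "u \<in> carrier G" "x \<in> carrier G" using u x X(1) lower_central_carrier by auto
      let ?w = "gcomm G u x" and ?Q = "G Mod N (Suc j)" and ?\<pi> = "\<lambda>g. N (Suc j) #> g"
      have w: "?w \<in> lower_central G (Suc j)" by (rule gcomm_lower_central[OF j(2) u c(2)])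
      interpret Q: group ?Q by (rule quotient_map(1)[OF N])
      interpret \<pi>: group_hom G ?Q ?\<pi>
        using quotient_map(2)[OF N] by (simp add: group_hom_def group_hom_axioms_def is_group Q.is_group)
      have hc: "?\<pi> (gcomm G a b) = gcomm ?Q (?\<pi> a) (?\<pi> b)" if "a \<in> carrier G" "b \<in> carrier G" for a b
        using \<pi>.hom_mult \<pi>.hom_inv that unfolding gcomm_def by (metis inv_closed m_closed)
      have cen: "?\<pi> ?w \<in> Q.center" using lower_central_quotient_center[OF _ N LN w] by simp
      have "?\<pi> (gcomm G u (x [^] r)) = gcomm ?Q (?\<pi> u) (?\<pi> x [^]\<^bsub>?Q\<^esub> r)"
        using hc[of u "x [^] r"] c \<pi>.hom_nat_pow[of x r] by simp
      also have "\<dots> = gcomm ?Q (?\<pi> u) (?\<pi> x) [^]\<^bsub>?Q\<^esub> r"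
        by (rule Q.gcomm_pow_right[OF \<pi>.hom_closed[OF c(1)] \<pi>.hom_closed[OF c(2)]])
          (use cen Q.centerD(2) hc[OF c] \<pi>.hom_closed[OF c(2)] in metis)
      also have "\<dots> = ?\<pi> (?w [^] r)" using hc[OF c] \<pi>.hom_nat_pow[of ?w r] c by simp
      finally have eq: "?\<pi> (?w [^] r) = ?\<pi> (gcomm G u (x [^] r))" by simp
      have "u \<otimes> (x [^] r) \<otimes> inv u \<in> P" using P.inv_op_closed2[OF c(1) r(2)] .
      then have "gcomm G u (x [^] r) \<in> P" unfolding gcomm_def using r(2) by simp
      then have "?\<pi> (gcomm G u (x [^] r)) = \<one>\<^bsub>?Q\<^esub>"
        using quotient_map(4)[OF N, of "gcomm G u (x [^] r)"] PN c by auto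
      then have "?w [^] r \<in> N (Suc j)" using eq quotient_map(4)[OF N, of "?w [^] r"] c by simp
      then show "?w \<in> H (Suc j)" using HI[of "Suc j" ?w r] w r(1) by simp
    qed
    then show ?thesis unfolding j(1) .
  qed
  let ?Q = "G Mod P" and ?\<pi> = "\<lambda>g. P #> g"
  interpret Q: group ?Q by (rule quotient_map(1)[OF P(1)])
  interpret \<pi>: group_hom G ?Q ?\<pi>
    using quotient_map(2)[OF P(1)] by (simp add: group_hom_def group_hom_axioms_def is_group Q.is_group)
  \<comment> \<open>A suitable power pushes an element of gamma_k one layer down, up to a factor
    from \<open>P\<close>.\<close>
  have step: "\<exists>s::nat. 0 < s \<and> (\<exists>v'\<in>lower_central G (Suc k). ?\<pi> (v [^] s) = ?\<pi> v')"
    if k: "1 \<le> k" and v: "v \<in> lower_central G k" for k v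
  proof -
    interpret Nk: normal "N k" G by (rule N)
    have vc: "v \<in> carrier G" using v by (rule lower_central_carrier)
    obtain s :: nat where s: "0 < s" "(N k #> v) [^]\<^bsub>G Mod N k\<^esub> s = \<one>\<^bsub>G Mod N k\<^esub>"
      using subsetD[OF LH[OF k] v] unfolding H_def by blast
    have "N k #> (v [^] s) = \<one>\<^bsub>G Mod N k\<^esub>" using s(2) Nk.FactGroup_pow[OF vc] by simp
    then have "v [^] s \<in> N k" using quotient_map(4)[OF N] vc by simp
    then obtain p v' where pv: "p \<in> P" "v' \<in> lower_central G (Suc k)" "v [^] s = p \<otimes> v'" unfolding N_def by blast
    have v'c: "v' \<in> carrier G" using pv(2) by (rule lower_central_carrier)
    have "?\<pi> p = \<one>\<^bsub>?Q\<^esub>" using quotient_map(4)[OF P(1), of p] pv(1) by simp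
    moreover have "?\<pi> (v [^] s) = ?\<pi> p \<otimes>\<^bsub>?Q\<^esub> ?\<pi> v'"
      unfolding pv(3) by (rule \<pi>.hom_mult[OF P.mem_carrier[OF pv(1)] v'c])
    ultimately have "?\<pi> (v [^] s) = ?\<pi> v'" using Q.l_one[OF \<pi>.hom_closed[OF v'c]] by metis
    then show ?thesis using s(1) pv(2) by blast
  qed
  have "1 \<le> k \<Longrightarrow> \<exists>r::nat. 0 < r \<and> (\<exists>v\<in>lower_central G k. ?\<pi> (g [^] r) = ?\<pi> v)" for k
  proof (induction k rule: dec_induct)
    case base
    show ?case using g by (intro exI[of _ 1]) auto
  next
    case (step k)
    then obtain r :: nat and v where r: "0 < r" "v \<in> lower_central G k" "?\<pi> (g [^] r) = ?\<pi> v" by blast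
    have vc: "v \<in> carrier G" using r(2) by (rule lower_central_carrier)
    obtain s :: nat and v' where s: "0 < s" "v' \<in> lower_central G (Suc k)" "?\<pi> (v [^] s) = ?\<pi> v'"
      using \<open>\<And>v k. \<lbrakk>1 \<le> k; v \<in> lower_central G k\<rbrakk> \<Longrightarrow> \<exists>s::nat. 0 < s \<and> (\<exists>v'\<in>lower_central G (Suc k). ?\<pi> (v [^] s) = ?\<pi> v')\<close>[OF step(1) r(2)] by blast
    have "?\<pi> (g [^] (r * s)) = ?\<pi> (g [^] r) [^]\<^bsub>?Q\<^esub> s"
      using g \<pi>.hom_nat_pow[of "g [^] r" s] nat_pow_pow[of g r s] by simp
    also have "\<dots> = ?\<pi> v'" using r(3) s(3) \<pi>.hom_nat_pow[OF vc, of s] by simp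
    finally have "?\<pi> (g [^] (r * s)) = ?\<pi> v'" .
    moreover have "0 < r * s" using r(1) s(1) by simp
    ultimately show ?case using s(2) by blast
  qed
  from this[of "Suc c"] obtain r :: nat and v where r: "0 < r" "v \<in> lower_central G (Suc c)" "?\<pi> (g [^] r) = ?\<pi> v" by auto
  have "v \<in> P" using r(2) P(2) by blast
  then have "?\<pi> (g [^] r) = \<one>\<^bsub>?Q\<^esub>" using r(3) quotient_map(4)[OF P(1), of v] by simp
  then show ?thesis using quotient_map(4)[OF P(1), of "g [^] r"] g r(1) by auto
qed

end

section \<open>Upper central series and torsion-free complements\<close>

primrec upper_central :: "('a, 'b) monoid_scheme \<Rightarrow> nat \<Rightarrow> 'a set" where
  "upper_central G 0 = {\<one>\<^bsub>G\<^esub>}"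
| "upper_central G (Suc i) = {g \<in> carrier G. \<forall>h\<in>carrier G. gcomm G g h \<in> upper_central G i}"

lemma (in group_hom) hom_gcomm:
  "x \<in> carrier G \<Longrightarrow> y \<in> carrier G \<Longrightarrow> h (gcomm G x y) = gcomm H (h x) (h y)"
  by (simp add: gcomm_def)

context group
begin

text \<open>The quotient is accessed through a surjection with kernel \<open>N\<close>, without
  reference to cosets.\<close>

lemma quotientE:
  assumes "N \<lhd> G"
  obtains Q :: "'a set monoid" and \<pi> where "group_hom G Q \<pi>" "\<pi> ` carrier G = carrier Q"
    "\<And>g. g \<in> carrier G \<Longrightarrow> \<pi> g = \<one>\<^bsub>Q\<^esub> \<longleftrightarrow> g \<in> N"
  using that[of "G Mod N" "\<lambda>g. N #> g"] quotient_map[OF assms]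
  by (auto simp: group_hom_def group_hom_axioms_def is_group)

lemma center_normal: "center \<lhd> G"
proof (rule normal_invI[OF subgroup_center])
  fix x z assume x: "x \<in> carrier G" and z: "z \<in> center"
  have "x \<otimes> z \<otimes> inv x = z" by (rule conj_commuting[OF x centerD(1)[OF z] centerD(2)[OF z x]])
  then show "x \<otimes> z \<otimes> inv x \<in> center" using z by simp
qed

lemma image_lower_central_center:
  assumes "group_hom G Q \<pi>" "\<pi> ` carrier G = carrier Q" "\<And>g. g \<in> carrier G \<Longrightarrow> \<pi> g = \<one>\<^bsub>Q\<^esub> \<longleftrightarrow> g \<in> N"
    and "1 \<le> k" "lower_central G (Suc k) \<subseteq> N" "u \<in> lower_central G k"
  shows "\<pi> u \<in> group.center Q"
proof -
  interpret \<pi>: group_hom G Q \<pi> by (rule assms(1))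
  have uc: "u \<in> carrier G" using assms(6) by (rule lower_central_carrier)
  have "e \<otimes>\<^bsub>Q\<^esub> \<pi> u = \<pi> u \<otimes>\<^bsub>Q\<^esub> e" if e: "e \<in> carrier Q" for e
  proof -
    obtain g where g: "g \<in> carrier G" "e = \<pi> g" using e assms(2) by blast
    have "gcomm G u g \<in> N" using gcomm_lower_central[OF assms(4,6) g(1)] assms(5) by blast
    then have "gcomm Q (\<pi> u) (\<pi> g) = \<one>\<^bsub>Q\<^esub>" using assms(3)[of "gcomm G u g"] \<pi>.hom_gcomm[OF uc g(1)] uc g(1) by simp
    then show ?thesis using \<pi>.H.gcomm_eq_one_iff[of "\<pi> u" "\<pi> g"] uc g by simp
  qed
  then show ?thesis unfolding \<pi>.H.center_def using uc by simp
qed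

text \<open>The term Z_(i+1) is the preimage of the centre of G/Z_i, and the centre is
  normal.\<close>

lemma upper_central_normal: "upper_central G i \<lhd> G"
proof (induction i)
  case 0
  show ?case by (simp add: one_is_normal)
next
  case (Suc i)
  obtain Q :: "'a set monoid" and \<pi> where Q: "group_hom G Q \<pi>" "\<pi> ` carrier G = carrier Q"
    "\<And>g. g \<in> carrier G \<Longrightarrow> \<pi> g = \<one>\<^bsub>Q\<^esub> \<longleftrightarrow> g \<in> upper_central G i"
    using quotientE[OF Suc] by metis
  interpret \<pi>: group_hom G Q \<pi> by (rule Q(1))
  have "upper_central G (Suc i) = {g \<in> carrier G. \<pi> g \<in> \<pi>.H.center}"
  proof -
    have "(\<forall>h\<in>carrier G. gcomm G g h \<in> upper_central G i) \<longleftrightarrow> \<pi> g \<in> \<pi>.H.center" if g: "g \<in> carrier G" for g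
    proof -
      have "gcomm G g h \<in> upper_central G i \<longleftrightarrow> \<pi> h \<otimes>\<^bsub>Q\<^esub> \<pi> g = \<pi> g \<otimes>\<^bsub>Q\<^esub> \<pi> h" if h: "h \<in> carrier G" for h
      proof -
        have "gcomm G g h \<in> upper_central G i \<longleftrightarrow> gcomm Q (\<pi> g) (\<pi> h) = \<one>\<^bsub>Q\<^esub>"
          using Q(3)[of "gcomm G g h"] \<pi>.hom_gcomm[OF g h] g h by simp
        also have "\<dots> \<longleftrightarrow> \<pi> g \<otimes>\<^bsub>Q\<^esub> \<pi> h = \<pi> h \<otimes>\<^bsub>Q\<^esub> \<pi> g" using \<pi>.H.gcomm_eq_one_iff g h by simp
        finally show ?thesis by auto
      qed
      then have "(\<forall>h\<in>carrier G. gcomm G g h \<in> upper_central G i) \<longleftrightarrow> (\<forall>h\<in>carrier G. \<pi> h \<otimes>\<^bsub>Q\<^esub> \<pi> g = \<pi> g \<otimes>\<^bsub>Q\<^esub> \<pi> h)"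
        by blast
      also have "\<dots> \<longleftrightarrow> (\<forall>e\<in>\<pi> ` carrier G. e \<otimes>\<^bsub>Q\<^esub> \<pi> g = \<pi> g \<otimes>\<^bsub>Q\<^esub> e)" by blast
      also have "\<dots> \<longleftrightarrow> \<pi> g \<in> \<pi>.H.center" unfolding Q(2) \<pi>.H.center_def using g by simp
      finally show ?thesis .
    qed
    then show ?thesis by auto
  qed
  then show ?case using \<pi>.H.normal_vimage[OF is_group \<pi>.homh \<pi>.H.center_normal] by simp
qed

text \<open>Torsion climbs the upper central series. If g lies in Z_(i+2), then [g,x] is torsion
  modulo Z_i, and modulo Z_i its powers are [g^a,x]. The generators being finite in number, one
  power of g commutes with all of them modulo Z_i and so lies in Z_(i+1).\<close>

proposition torsion_of_torsion_center:
  assumes X: "finite X" "X \<subseteq> carrier G" "generate G X = carrier G"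
    and nil: "lower_central G (Suc c) = {\<one>}"
    and tor: "\<And>z. z \<in> center \<Longrightarrow> \<exists>r::nat. 0 < r \<and> z [^] r = \<one>"
    and g: "g \<in> carrier G"
  shows "\<exists>r::nat. 0 < r \<and> g [^] r = \<one>"
proof -
  have sec: "\<exists>r::nat. 0 < r \<and> g [^] r \<in> upper_central G i" if "g \<in> upper_central G (Suc i)" for g i
    using that
  proof (induction i arbitrary: g)
    case 0
    then have g: "g \<in> carrier G" "\<And>h. h \<in> carrier G \<Longrightarrow> gcomm G g h = \<one>" by auto
    have "h \<otimes> g = g \<otimes> h" if "h \<in> carrier G" for h using gcomm_eq_one_iff[OF g(1) that] g(2)[OF that] by simp
    then have "g \<in> center" unfolding center_def using g(1) by blast
    then show ?case using tor by simp
  next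
    case (Suc i)
    have gc: "g \<in> carrier G" using Suc.prems by simp
    obtain Q :: "'a set monoid" and \<pi> where Q: "group_hom G Q \<pi>" "\<pi> ` carrier G = carrier Q"
      "\<And>g. g \<in> carrier G \<Longrightarrow> \<pi> g = \<one>\<^bsub>Q\<^esub> \<longleftrightarrow> g \<in> upper_central G i"
      using quotientE[OF upper_central_normal] by metis
    interpret \<pi>: group_hom G Q \<pi> by (rule Q(1))
    have comm_iff: "gcomm G a b \<in> upper_central G i \<longleftrightarrow> \<pi> a \<otimes>\<^bsub>Q\<^esub> \<pi> b = \<pi> b \<otimes>\<^bsub>Q\<^esub> \<pi> a"
      if "a \<in> carrier G" "b \<in> carrier G" for a b
      using Q(3)[of "gcomm G a b"] \<pi>.hom_gcomm[OF that] \<pi>.H.gcomm_eq_one_iff[of "\<pi> a" "\<pi> b"] that by simp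
    have "\<exists>r::nat. 0 < r \<and> (\<forall>x\<in>X'. \<pi> (g [^] r) \<otimes>\<^bsub>Q\<^esub> \<pi> x = \<pi> x \<otimes>\<^bsub>Q\<^esub> \<pi> (g [^] r))" if "finite X'" "X' \<subseteq> X" for X'
      using that
    proof (induction X' rule: finite_induct)
      case empty
      show ?case by (intro exI[of _ 1]) simp
    next
      case (insert x X')
      then obtain r :: nat where r: "0 < r" "\<And>y. y \<in> X' \<Longrightarrow> \<pi> (g [^] r) \<otimes>\<^bsub>Q\<^esub> \<pi> y = \<pi> y \<otimes>\<^bsub>Q\<^esub> \<pi> (g [^] r)" by auto
      have xc: "x \<in> carrier G" using insert.prems X(2) by blast
      have w: "gcomm G g x \<in> upper_central G (Suc i)" using Suc.prems xc by simp
      obtain a :: nat where a: "0 < a" "gcomm G g x [^] a \<in> upper_central G i" using Suc.IH[OF w] by blast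
      have "gcomm G (gcomm G g x) g \<in> upper_central G i" using w gc by simp
      then have cw: "\<pi> (gcomm G g x) \<otimes>\<^bsub>Q\<^esub> \<pi> g = \<pi> g \<otimes>\<^bsub>Q\<^esub> \<pi> (gcomm G g x)" using comm_iff gc xc by simp
      have "gcomm Q (\<pi> g [^]\<^bsub>Q\<^esub> a) (\<pi> x) = gcomm Q (\<pi> g) (\<pi> x) [^]\<^bsub>Q\<^esub> a"
        by (rule \<pi>.H.gcomm_pow_left) (use gc xc cw \<pi>.hom_gcomm[OF gc xc] in auto)
      also have "\<dots> = \<pi> (gcomm G g x [^] a)" using \<pi>.hom_gcomm[OF gc xc] \<pi>.hom_nat_pow[of "gcomm G g x" a] gc xc by simp
      also have "\<dots> = \<one>\<^bsub>Q\<^esub>" using Q(3)[of "gcomm G g x [^] a"] a(2) gc xc by simp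
      finally have ax: "(\<pi> g [^]\<^bsub>Q\<^esub> a) \<otimes>\<^bsub>Q\<^esub> \<pi> x = \<pi> x \<otimes>\<^bsub>Q\<^esub> (\<pi> g [^]\<^bsub>Q\<^esub> a)"
        using \<pi>.H.gcomm_eq_one_iff[of "\<pi> g [^]\<^bsub>Q\<^esub> a" "\<pi> x"] gc xc by simp
      have e: "\<pi> (g [^] (r * a)) = (\<pi> (g [^] r)) [^]\<^bsub>Q\<^esub> a" "\<pi> (g [^] (r * a)) = (\<pi> g [^]\<^bsub>Q\<^esub> a) [^]\<^bsub>Q\<^esub> r"
        using gc \<pi>.H.nat_pow_pow[of "\<pi> g"] by (simp_all add: \<pi>.hom_nat_pow mult.commute)
      have "\<pi> (g [^] (r * a)) \<otimes>\<^bsub>Q\<^esub> \<pi> y = \<pi> y \<otimes>\<^bsub>Q\<^esub> \<pi> (g [^] (r * a))" if y: "y \<in> insert x X'" for y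
      proof (cases "y = x")
        case True
        show ?thesis unfolding True e(2) by (rule \<pi>.H.group_commutes_pow[OF ax]) (use gc xc in auto)
      next
        case False
        then have "y \<in> X'" "y \<in> carrier G" using y insert.prems X(2) by auto
        then show ?thesis unfolding e(1) using r(2) gc by (intro \<pi>.H.group_commutes_pow) auto
      qed
      then show ?case using r(1) a(1) by (intro exI[of _ "r * a"]) simp
    qed
    from this[OF X(1) order_refl] obtain r :: nat where r: "0 < r"
      "\<And>x. x \<in> X \<Longrightarrow> \<pi> (g [^] r) \<otimes>\<^bsub>Q\<^esub> \<pi> x = \<pi> x \<otimes>\<^bsub>Q\<^esub> \<pi> (g [^] r)" by blast
    have grc: "g [^] r \<in> carrier G" using gc by simp
    let ?S = "{h \<in> carrier G. \<pi> h \<in> {y \<in> carrier Q. y \<otimes>\<^bsub>Q\<^esub> \<pi> (g [^] r) = \<pi> (g [^] r) \<otimes>\<^bsub>Q\<^esub> y}}"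
    have "subgroup ?S G"
      by (rule \<pi>.H.subgroup_vimage[OF is_group \<pi>.homh \<pi>.H.subgroup_centralizer[OF \<pi>.hom_closed[OF grc]] subgroup_self])
    moreover have "X \<subseteq> ?S"
    proof
      fix x assume x: "x \<in> X"
      then show "x \<in> ?S" using r(2)[OF x] X(2) by auto
    qed
    ultimately have "generate G X \<subseteq> ?S" by (intro generate_subgroup_incl)
    then have "\<pi> (g [^] r) \<otimes>\<^bsub>Q\<^esub> \<pi> h = \<pi> h \<otimes>\<^bsub>Q\<^esub> \<pi> (g [^] r)" if "h \<in> carrier G" for h
      using that X(3) by auto
    then have "\<And>h. h \<in> carrier G \<Longrightarrow> gcomm G (g [^] r) h \<in> upper_central G i" using comm_iff[OF grc] by blast
    then have "g [^] r \<in> upper_central G (Suc i)" using grc by simp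
    then show ?case using r(1) by blast
  qed
  \<comment> \<open>In a group of class at most c the lower central series, read from its trivial
    end, lies inside the upper one. For i = c this says that G is Z_c.\<close>
  have "i \<le> c \<Longrightarrow> lower_central G (Suc c - i) \<subseteq> upper_central G i" for i
  proof (induction i)
    case 0
    then show ?case using nil by simp
  next
    case (Suc i)
    have k: "1 \<le> c - i" "Suc c - i = Suc (c - i)" "Suc c - Suc i = c - i" using Suc.prems by auto
    show ?case
    proof
      fix u assume "u \<in> lower_central G (Suc c - Suc i)"
      then have u: "u \<in> lower_central G (c - i)" using k by simp
      have "gcomm G u h \<in> upper_central G i" if "h \<in> carrier G" for h
        using gcomm_lower_central[OF k(1) u that] Suc k(2) by auto
      then show "u \<in> upper_central G (Suc i)" using lower_central_carrier[OF u] by simp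
    qed
  qed
  from this[of c] have top: "g \<in> upper_central G c" using g by auto
  have "j \<le> c \<Longrightarrow> \<exists>r::nat. 0 < r \<and> g [^] r \<in> upper_central G (c - j)" for j
  proof (induction j)
    case 0
    show ?case using top g by (intro exI[of _ 1]) simp
  next
    case (Suc j)
    then obtain r :: nat where r: "0 < r" "g [^] r \<in> upper_central G (c - j)" by auto
    have "c - j = Suc (c - Suc j)" using Suc.prems by simp
    then obtain s :: nat where s: "0 < s" "(g [^] r) [^] s \<in> upper_central G (c - Suc j)"
      using sec[of "g [^] r" "c - Suc j"] r(2) by auto
    then show ?case using r(1) g by (intro exI[of _ "r * s"]) (simp add: nat_pow_pow)
  qed
  from this[of c] show ?thesis by simp
qed

text \<open>A maximal \<open>U\<close> works: the centre of \<open>G / U\<close> is torsion by maximality, so the whole nilpotent group is.\<close>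

proposition torsion_free_complement:
  assumes X: "finite X" "X \<subseteq> carrier G" "generate G X = carrier G"
  obtains U where "U \<lhd> G" "lower_central G (Suc c) \<subseteq> U"
    "\<And>u r. \<lbrakk>u \<in> U; 0 < (r::nat); u [^] r \<in> lower_central G (Suc c)\<rbrakk> \<Longrightarrow> u \<in> lower_central G (Suc c)"
    "\<And>g. g \<in> carrier G \<Longrightarrow> \<exists>r::nat. 0 < r \<and> g [^] r \<in> U"
proof -
  define L where "L = lower_central G (Suc c)"
  define TF where "TF U \<longleftrightarrow> U \<lhd> G \<and> L \<subseteq> U \<and> (\<forall>u\<in>U. \<forall>r::nat. 0 < r \<longrightarrow> u [^] r \<in> L \<longrightarrow> u \<in> L)" for U
  have L: "L \<lhd> G" unfolding L_def by (rule lower_central_normal)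
  have "\<exists>U\<in>{U. TF U}. \<forall>W\<in>{U. TF U}. U \<subseteq> W \<longrightarrow> W = U"
  proof (rule subset_Zorn_nonempty)
    have "TF L" unfolding TF_def using L by blast
    then show "{U. TF U} \<noteq> {}" by blast
    fix \<C> assume ne: "\<C> \<noteq> {}" and ch: "subset.chain {U. TF U} \<C>"
    have TF: "TF U" if "U \<in> \<C>" for U using ch that unfolding subset_chain_def by blast
    have lin: "U \<subseteq> W \<or> W \<subseteq> U" if "U \<in> \<C>" "W \<in> \<C>" for U W using ch that unfolding subset_chain_def by blast
    have norm: "U \<lhd> G" if "U \<in> \<C>" for U using TF[OF that] unfolding TF_def by blast
    note sub = normal_imp_subgroup[OF norm]
    have "\<Union>\<C> \<lhd> G"
    proof (rule normal_invI)
      show "subgroup (\<Union>\<C>) G"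
      proof (rule subgroupI)
        show "\<Union>\<C> \<subseteq> carrier G" using subgroup.subset[OF sub] by blast
        show "\<Union>\<C> \<noteq> {}" using ne subgroup.one_closed[OF sub] by blast
        fix a assume "a \<in> \<Union>\<C>"
        then obtain U where U: "U \<in> \<C>" "a \<in> U" by blast
        show "inv a \<in> \<Union>\<C>" using subgroup.m_inv_closed[OF sub[OF U(1)] U(2)] U(1) by blast
        fix b assume "b \<in> \<Union>\<C>"
        then obtain W where W: "W \<in> \<C>" "b \<in> W" by blast
        show "a \<otimes> b \<in> \<Union>\<C>"
          using lin[OF U(1) W(1)] subgroup.m_closed[OF sub[OF U(1)] U(2)] subgroup.m_closed[OF sub[OF W(1)] _ W(2)] U W by blast
      qed
      show "x \<otimes> h \<otimes> inv x \<in> \<Union>\<C>" if "x \<in> carrier G" "h \<in> \<Union>\<C>" for x h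
        using that(2) normal.inv_op_closed2[OF norm that(1)] by blast
    qed
    moreover have "L \<subseteq> \<Union>\<C>" using ne TF unfolding TF_def by blast
    \<comment> \<open>Torsion-freeness over \<open>L\<close> is a condition on single elements, so
      it passes to unions of chains.\<close>
    moreover have "u \<in> L" if "u \<in> \<Union>\<C>" "0 < r" "u [^] r \<in> L" for u and r :: nat
      using that TF unfolding TF_def by blast
    ultimately show "\<Union>\<C> \<in> {U. TF U}" unfolding TF_def by blast
  qed
  then obtain U where U: "TF U" and max: "\<And>W. TF W \<Longrightarrow> U \<subseteq> W \<Longrightarrow> W = U" by blast
  have Un: "U \<lhd> G" and LU: "L \<subseteq> U" and Ut: "\<And>u r. \<lbrakk>u \<in> U; 0 < (r::nat); u [^] r \<in> L\<rbrakk> \<Longrightarrow> u \<in> L"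
    using U unfolding TF_def by blast+
  obtain Q :: "'a set monoid" and \<pi> where Q: "group_hom G Q \<pi>" "\<pi> ` carrier G = carrier Q"
    "\<And>g. g \<in> carrier G \<Longrightarrow> \<pi> g = \<one>\<^bsub>Q\<^esub> \<longleftrightarrow> g \<in> U"
    using quotientE[OF Un] by metis
  interpret \<pi>: group_hom G Q \<pi> by (rule Q(1))
  have cen: "\<exists>r::nat. 0 < r \<and> z [^]\<^bsub>Q\<^esub> r = \<one>\<^bsub>Q\<^esub>" if z: "z \<in> \<pi>.H.center" for z
  proof (rule ccontr)
    assume no: "\<nexists>r::nat. 0 < r \<and> z [^]\<^bsub>Q\<^esub> r = \<one>\<^bsub>Q\<^esub>"
    have zc: "z \<in> carrier Q" using \<pi>.H.centerD(1)[OF z] .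
    obtain g where g: "g \<in> carrier G" "z = \<pi> g" using zc Q(2) by blast
    define C where "C = generate Q {z}"
    have C: "C \<lhd> Q" unfolding C_def
    proof (rule \<pi>.H.normal_generateI)
      show "{z} \<subseteq> carrier Q" using zc by blast
      fix y x assume y: "y \<in> {z}" and x: "x \<in> carrier Q"
      show "x \<otimes>\<^bsub>Q\<^esub> y \<otimes>\<^bsub>Q\<^esub> inv\<^bsub>Q\<^esub> x \<in> {z}"
        using y \<pi>.H.conj_commuting[OF x zc \<pi>.H.centerD(2)[OF z x]] by blast
    qed
    \<comment> \<open>The preimage of an infinite cyclic central subgroup of G/U. If u^r lies in
      \<open>L\<close> for u in \<open>W\<close>, the exponent of u along z must vanish, so u is in
      \<open>U\<close>; thus \<open>W\<close> contradicts the maximality of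
      \<open>U\<close>.\<close>
    define W where "W = {y \<in> carrier G. \<pi> y \<in> C}"
    have "W \<lhd> G" unfolding W_def by (rule \<pi>.H.normal_vimage[OF is_group \<pi>.homh C])
    moreover have UW: "U \<subseteq> W"
    proof
      fix u assume u: "u \<in> U"
      then have uc: "u \<in> carrier G" by (rule subgroup.mem_carrier[OF normal_imp_subgroup[OF Un]])
      have "\<pi> u = \<one>\<^bsub>Q\<^esub>" using Q(3)[OF uc] u by blast
      then have "\<pi> u \<in> C" unfolding C_def using generate.one[of Q "{z}"] by metis
      then show "u \<in> W" using uc unfolding W_def by blast
    qed
    moreover have "u \<in> L" if u: "u \<in> W" "0 < r" "u [^] r \<in> L" for u and r :: nat
    proof -
      obtain k :: int where k: "u \<in> carrier G" "\<pi> u = z [^]\<^bsub>Q\<^esub> k"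
        using u(1) \<pi>.H.generate_pow[OF zc] unfolding W_def C_def by blast
      have "\<pi> (u [^] r) = \<one>\<^bsub>Q\<^esub>" using Q(3)[of "u [^] r"] u(3) LU k(1) by auto
      then have "(z [^]\<^bsub>Q\<^esub> k) [^]\<^bsub>Q\<^esub> int r = \<one>\<^bsub>Q\<^esub>"
        unfolding int_pow_int k(2)[symmetric] using \<pi>.hom_nat_pow[OF k(1), of r] by metis
      then have zkr: "z [^]\<^bsub>Q\<^esub> (k * int r) = \<one>\<^bsub>Q\<^esub>" unfolding \<pi>.H.int_pow_pow[OF zc] .
      have "z [^]\<^bsub>Q\<^esub> (nat \<bar>k * int r\<bar>) = z [^]\<^bsub>Q\<^esub> \<bar>k * int r\<bar>"
        using int_pow_int[of Q z "nat \<bar>k * int r\<bar>"] by (metis abs_ge_zero int_nat_eq)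
      also have "\<dots> = \<one>\<^bsub>Q\<^esub>"
      proof (cases "k * int r \<ge> 0")
        case True
        then have "\<bar>k * int r\<bar> = k * int r" by (rule abs_of_nonneg)
        then show ?thesis using zkr by metis
      next
        case False
        then have "\<bar>k * int r\<bar> = - (k * int r)" by linarith
        then show ?thesis using \<pi>.H.int_pow_neg[OF zc, of "k * int r"] zkr \<pi>.H.inv_one by metis
      qed
      finally have "z [^]\<^bsub>Q\<^esub> (nat \<bar>k * int r\<bar>) = \<one>\<^bsub>Q\<^esub>" .
      then have "\<not> 0 < nat \<bar>k * int r\<bar>" using no[unfolded not_ex, THEN spec, of "nat \<bar>k * int r\<bar>"] by (simp only: simp_thms)
      then have "k * int r = 0" by linarith
      then have "k = 0" using u(2) by simp
      then have "\<pi> u = \<one>\<^bsub>Q\<^esub>" unfolding k(2) by (simp only: int_pow_0)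
      then have "u \<in> U" using Q(3)[OF k(1)] by blast
      then show ?thesis using Ut u(2,3) by blast
    qed
    ultimately have "TF W" using LU unfolding TF_def by blast
    then have "W = U" using max UW by blast
    moreover have "g \<in> W"
    proof -
      have "\<pi> g \<in> C" unfolding C_def g(2)[symmetric] by (rule generate.incl) simp
      then show ?thesis using g(1) unfolding W_def by blast
    qed
    ultimately have "z = \<one>\<^bsub>Q\<^esub>" using Q(3)[OF g(1)] g(2) by blast
    then have "z [^]\<^bsub>Q\<^esub> (1::nat) = \<one>\<^bsub>Q\<^esub>" by simp
    then show False using no[unfolded not_ex, THEN spec, of 1] by simp
  qed
  have "lower_central Q (Suc c) = {\<one>\<^bsub>Q\<^esub>}"
  proof -
    have "lower_central Q (Suc c) = \<pi> ` L"
      unfolding L_def by (rule lower_central_hom_onto[OF \<pi>.H.is_group \<pi>.homh Q(2)])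
    moreover have "\<pi> y = \<one>\<^bsub>Q\<^esub>" if "y \<in> L" for y
      using Q(3)[of y] that LU subgroup.mem_carrier[OF normal_imp_subgroup[OF L] that] by blast
    moreover have "\<one> \<in> L" by (rule subgroup.one_closed[OF normal_imp_subgroup[OF L]])
    ultimately show ?thesis by auto
  qed
  moreover have "finite (\<pi> ` X)" using X(1) by simp
  moreover have "\<pi> ` X \<subseteq> carrier Q" using X(2) by auto
  moreover have "generate Q (\<pi> ` X) = carrier Q" using \<pi>.generate_img[OF X(2)] X(3) Q(2) by simp
  ultimately have torQ: "\<exists>r::nat. 0 < r \<and> y [^]\<^bsub>Q\<^esub> r = \<one>\<^bsub>Q\<^esub>" if "y \<in> carrier Q" for y
    using \<pi>.H.torsion_of_torsion_center[of "\<pi> ` X" c y] cen that by blast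
  have "\<exists>r::nat. 0 < r \<and> g [^] r \<in> U" if g: "g \<in> carrier G" for g
  proof -
    obtain r :: nat where r: "0 < r" "\<pi> g [^]\<^bsub>Q\<^esub> r = \<one>\<^bsub>Q\<^esub>" using torQ[of "\<pi> g"] g by auto
    then show ?thesis using Q(3)[of "g [^] r"] g \<pi>.hom_nat_pow[OF g] by auto
  qed
  then show thesis using that[OF Un] LU Ut unfolding L_def by blast
qed

section \<open>Products with central factors, and power endomorphisms\<close>

lemma indexed_prod_closed: "(\<And>i. i < n \<Longrightarrow> f i \<in> carrier G) \<Longrightarrow> indexed_prod G f n \<in> carrier G"
  by (induction n) auto

lemma indexed_prod_cong: "(\<And>i. i < n \<Longrightarrow> f i = g i) \<Longrightarrow> indexed_prod G f n = indexed_prod G g n"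
  by (induction n) auto

lemma indexed_prod_center: "(\<And>i. i < n \<Longrightarrow> f i \<in> center) \<Longrightarrow> indexed_prod G f n \<in> center"
proof (induction n)
  case 0
  then show ?case using subgroup.one_closed[OF subgroup_center] by simp
next
  case (Suc n)
  then show ?case using subgroup.m_closed[OF subgroup_center] by simp
qed

lemma indexed_prod_mult:
  assumes "\<And>i. i < n \<Longrightarrow> f i \<in> center" "\<And>i. i < n \<Longrightarrow> g i \<in> center"
  shows "indexed_prod G (\<lambda>i. f i \<otimes> g i) n = indexed_prod G f n \<otimes> indexed_prod G g n"
  using assms
proof (induction n)
  case (Suc n)
  define a b where "a = indexed_prod G f n" and "b = indexed_prod G g n"
  have a: "a \<in> carrier G" and b: "b \<in> carrier G"
    unfolding a_def b_def using Suc.prems by (auto intro!: centerD(1)[OF indexed_prod_center])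
  have fg: "f n \<in> carrier G" "g n \<in> carrier G" using Suc.prems centerD(1) by auto
  have bf: "b \<otimes> f n = f n \<otimes> b" using centerD(2)[OF Suc.prems(1) b, of n] by simp
  have "indexed_prod G (\<lambda>i. f i \<otimes> g i) n = a \<otimes> b" unfolding a_def b_def by (rule Suc.IH) (use Suc.prems in auto)
  then have "indexed_prod G (\<lambda>i. f i \<otimes> g i) (Suc n) = a \<otimes> (b \<otimes> f n) \<otimes> g n" using a b fg by (simp add: m_assoc)
  also have "\<dots> = (a \<otimes> f n) \<otimes> (b \<otimes> g n)" unfolding bf using a b fg by (simp add: m_assoc)
  finally show ?case unfolding a_def b_def by simp
qed simp

lemma indexed_prod_inv:
  assumes "\<And>i. i < n \<Longrightarrow> f i \<in> center"
  shows "indexed_prod G (\<lambda>i. inv (f i)) n = inv (indexed_prod G f n)"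
  using assms
proof (induction n)
  case (Suc n)
  have a: "indexed_prod G f n \<in> carrier G" using Suc.prems by (intro indexed_prod_closed centerD(1)) auto
  have f: "f n \<in> center" using Suc.prems by simp
  have "inv (f n) \<in> center" by (rule subgroup.m_inv_closed[OF subgroup_center f])
  then have "inv (indexed_prod G f n) \<otimes> inv (f n) = inv (f n) \<otimes> inv (indexed_prod G f n)"
    by (rule centerD(2)) (use a in simp)
  then show ?case using Suc a centerD(1)[OF f] by (simp add: inv_mult_group)
qed simp

lemma indexed_prod_pow:
  assumes "b \<in> carrier G"
  shows "indexed_prod G (\<lambda>i. b [^] (e i :: int)) n = b [^] (\<Sum>i<n. e i)"
  using assms by (induction n) (auto simp: int_pow_mult)

lemma indexed_prod_single:
  assumes "i0 < n" "f i0 \<in> carrier G" "\<And>i. i < n \<Longrightarrow> i \<noteq> i0 \<Longrightarrow> f i = \<one>"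
  shows "indexed_prod G f n = f i0"
proof -
  have "indexed_prod G f m = (if i0 < m then f i0 else \<one>)" if "m \<le> n" for m
    using that
  proof (induction m)
    case (Suc m)
    then show ?case using assms by (cases "m = i0") auto
  qed simp
  then show ?thesis using assms by simp
qed

text \<open>In the product formula for commutators the conjugated factor is central, so bracketing
  with b turns the product into the product of the brackets.\<close>

lemma gcomm_indexed_prod:
  assumes "\<And>i. i < n \<Longrightarrow> f i \<in> carrier G" "b \<in> carrier G" "\<And>i. i < n \<Longrightarrow> gcomm G (f i) b \<in> center"
  shows "gcomm G (indexed_prod G f n) b = indexed_prod G (\<lambda>i. gcomm G (f i) b) n"
  using assms
proof (induction n)
  case 0
  then show ?case by (simp add: gcomm_def)
next
  case (Suc n)
  have a: "indexed_prod G f n \<in> carrier G" using Suc.prems by (intro indexed_prod_closed) auto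
  have f: "f n \<in> carrier G" using Suc.prems by simp
  have w: "gcomm G (f n) b \<in> center" using Suc.prems by simp
  have IH: "gcomm G (indexed_prod G f n) b = indexed_prod G (\<lambda>i. gcomm G (f i) b) n" using Suc by simp
  have c: "gcomm G (indexed_prod G f n) b \<in> carrier G" using a Suc.prems(2) by simp
  have "gcomm G (indexed_prod G f n \<otimes> f n) b = (indexed_prod G f n \<otimes> gcomm G (f n) b \<otimes> inv (indexed_prod G f n)) \<otimes> gcomm G (indexed_prod G f n) b"
    by (rule gcomm_mult_left[OF a f Suc.prems(2)])
  also have "\<dots> = gcomm G (f n) b \<otimes> gcomm G (indexed_prod G f n) b"
    using conj_commuting[OF a centerD(1)[OF w] centerD(2)[OF w a]] by simp
  also have "\<dots> = gcomm G (indexed_prod G f n) b \<otimes> gcomm G (f n) b" using centerD(2)[OF w c] by simp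
  finally show ?case using IH by simp
qed

lemma gcomm_int_pow_left:
  assumes "u \<in> carrier G" "x \<in> carrier G" "gcomm G u x \<in> center"
  shows "gcomm G (u [^] (n::int)) x = gcomm G u x [^] n"
proof -
  have nat: "gcomm G (u [^] (m::nat)) x = gcomm G u x [^] m" for m
    using assms centerD(2)[OF assms(3) assms(1)] by (intro gcomm_pow_left) auto
  show ?thesis
  proof (cases "n \<ge> 0")
    case True
    then obtain m where "n = int m" using nonneg_int_cases by blast
    then show ?thesis using nat[of m] by (simp add: int_pow_int)
  next
    case False
    then have "n = - int (nat (- n))" by simp
    then obtain m where m: "n = - int m" by blast
    have um: "u [^] m \<in> carrier G" using assms(1) by simp
    have wc: "gcomm G u x [^] m \<in> center" using center_int_pow[OF assms(3), of "int m"] by (simp add: int_pow_int)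
    have iw: "inv (gcomm G u x [^] m) \<in> center" by (rule subgroup.m_inv_closed[OF subgroup_center wc])
    have ium: "inv (u [^] m) \<in> carrier G" using um by simp
    have "gcomm G (inv (u [^] m)) x = inv (u [^] m) \<otimes> inv (gcomm G u x [^] m) \<otimes> inv (inv (u [^] m))"
      using gcomm_inv_left[OF um assms(2)] nat[of m] by simp
    also have "\<dots> = inv (gcomm G u x [^] m)"
      by (rule conj_commuting[OF ium centerD(1)[OF iw] centerD(2)[OF iw ium]])
    finally show ?thesis using m assms by (simp add: int_pow_neg int_pow_int)
  qed
qed

text \<open>On \<open>\<gamma>\<^sub>k / \<gamma>\<^sub>k\<^sub>+\<^sub>1\<close>, the endomorphism \<open>\<chi>\<close> is multiplication by \<open>m\<^sup>k\<close>. Such endomorphisms separate the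
  components of different weights.\<close>

lemma lower_central_power_endomorphism:
  assumes X: "X \<subseteq> carrier G" "generate G X = carrier G"
    and \<chi>: "\<chi> \<in> hom G G" "\<And>x. x \<in> X \<Longrightarrow> \<chi> x = x [^] (m::nat)"
  shows "1 \<le> k \<Longrightarrow> v \<in> lower_central G k \<Longrightarrow> \<chi> v \<otimes> inv (v [^] (m ^ k)) \<in> lower_central G (Suc k)"
proof (induction k arbitrary: v rule: dec_induct)
  case base
  obtain Q :: "'a set monoid" and \<pi> where Q: "group_hom G Q \<pi>" "\<pi> ` carrier G = carrier Q"
    "\<And>g. g \<in> carrier G \<Longrightarrow> \<pi> g = \<one>\<^bsub>Q\<^esub> \<longleftrightarrow> g \<in> lower_central G (Suc 1)"
    using quotientE[OF lower_central_normal] by metis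
  interpret \<pi>: group_hom G Q \<pi> by (rule Q(1))
  have cen: "\<pi> u \<in> \<pi>.H.center" if "u \<in> carrier G" for u
    by (rule image_lower_central_center[OF Q, of 1]) (use that in auto)
  \<comment> \<open>The quotient is by gamma_2, so it is abelian and the m-th power map is a
    homomorphism; it agrees with \<open>\<chi>\<close> on generators.\<close>
  have pm: "(\<lambda>g. \<pi> g [^]\<^bsub>Q\<^esub> m) \<in> hom G Q"
  proof (rule homI)
    fix a b assume ab: "a \<in> carrier G" "b \<in> carrier G"
    show "\<pi> (a \<otimes> b) [^]\<^bsub>Q\<^esub> m = \<pi> a [^]\<^bsub>Q\<^esub> m \<otimes>\<^bsub>Q\<^esub> \<pi> b [^]\<^bsub>Q\<^esub> m"
      using ab \<pi>.H.pow_mult_distrib[OF \<pi>.H.centerD(2)[OF cen[OF ab(2)] \<pi>.hom_closed[OF ab(1)]], of m] by simp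
  qed simp
  have p\<chi>: "(\<lambda>g. \<pi> (\<chi> g)) \<in> hom G Q" by (rule homI) (use \<chi>(1) in \<open>auto simp: hom_def Pi_iff\<close>)
  have vc: "v \<in> carrier G" using base by simp
  have "\<pi> (\<chi> v) = \<pi> v [^]\<^bsub>Q\<^esub> m"
    by (rule hom_eq_on_generate[OF \<pi>.H.is_group p\<chi> pm X(1)])
      (use \<chi>(2) X vc in \<open>auto simp: \<pi>.hom_nat_pow subset_iff\<close>)
  moreover have "\<chi> v \<in> carrier G" using \<chi>(1) vc by (auto simp: hom_def)
  ultimately have "\<pi> (\<chi> v \<otimes> inv (v [^] m)) = \<one>\<^bsub>Q\<^esub>" using vc by (simp add: \<pi>.hom_nat_pow)
  then show ?case using Q(3)[of "\<chi> v \<otimes> inv (v [^] m)"] vc \<open>\<chi> v \<in> carrier G\<close> by simp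
next
  case (step k)
  interpret \<chi>: group_hom G G \<chi> using \<chi>(1) by (simp add: group_hom_def group_hom_axioms_def is_group)
  obtain Q :: "'a set monoid" and \<pi> where Q: "group_hom G Q \<pi>" "\<pi> ` carrier G = carrier Q"
    "\<And>g. g \<in> carrier G \<Longrightarrow> \<pi> g = \<one>\<^bsub>Q\<^esub> \<longleftrightarrow> g \<in> lower_central G (Suc (Suc k))"
    using quotientE[OF lower_central_normal] by metis
  interpret \<pi>: group_hom G Q \<pi> by (rule Q(1))
  interpret L: normal "lower_central G (Suc k)" G by (rule lower_central_normal)
  have cen: "\<pi> u \<in> \<pi>.H.center" if "u \<in> lower_central G (Suc k)" for u
    by (rule image_lower_central_center[OF Q, of "Suc k"]) (use that in auto)
  let ?e = "m ^ Suc k"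
  let ?S = "{v \<in> lower_central G (Suc k). \<pi> (\<chi> v) = \<pi> v [^]\<^bsub>Q\<^esub> ?e}"
  have S: "subgroup ?S G"
  proof (rule subgroupI)
    show "?S \<subseteq> carrier G" using L.subset by blast
    have "\<pi> (\<chi> \<one>) = \<pi> \<one> [^]\<^bsub>Q\<^esub> ?e" by simp
    then show "?S \<noteq> {}" using L.one_closed by blast
    fix a assume "a \<in> ?S"
    then have a: "a \<in> lower_central G (Suc k)" "\<pi> (\<chi> a) = \<pi> a [^]\<^bsub>Q\<^esub> ?e" by auto
    have ac: "a \<in> carrier G" using a(1) by simp
    have "\<pi> (\<chi> (inv a)) = \<pi> (inv a) [^]\<^bsub>Q\<^esub> ?e" using a(2) ac by (simp add: \<pi>.H.nat_pow_inv del: power_Suc)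
    then show "inv a \<in> ?S" using L.m_inv_closed[OF a(1)] by blast
    fix b assume "b \<in> ?S"
    then have b: "b \<in> lower_central G (Suc k)" "\<pi> (\<chi> b) = \<pi> b [^]\<^bsub>Q\<^esub> ?e" by auto
    have bc: "b \<in> carrier G" using b(1) by simp
    have "\<pi> (\<chi> (a \<otimes> b)) = \<pi> a [^]\<^bsub>Q\<^esub> ?e \<otimes>\<^bsub>Q\<^esub> \<pi> b [^]\<^bsub>Q\<^esub> ?e" using a(2) b(2) ac bc by simp
    also have "\<dots> = (\<pi> a \<otimes>\<^bsub>Q\<^esub> \<pi> b) [^]\<^bsub>Q\<^esub> ?e"
      using \<pi>.H.pow_mult_distrib[OF \<pi>.H.centerD(2)[OF cen[OF b(1)] \<pi>.hom_closed[OF ac]]] ac bc by simp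
    finally have "\<pi> (\<chi> (a \<otimes> b)) = \<pi> (a \<otimes> b) [^]\<^bsub>Q\<^esub> ?e" using ac bc by simp
    then show "a \<otimes> b \<in> ?S" using L.m_closed[OF a(1) b(1)] by blast
  qed
  have "lower_central G (Suc k) \<subseteq> ?S"
  proof (rule lower_central_Suc_least'[OF X step(1) S])
    show "lower_central G (Suc (Suc k)) \<subseteq> ?S"
    proof
      fix y assume y: "y \<in> lower_central G (Suc (Suc k))"
      have yc: "y \<in> carrier G" using y by (rule lower_central_carrier)
      have "\<chi> y \<in> lower_central G (Suc (Suc k))" using lower_central_hom[OF is_group \<chi>(1), of "Suc (Suc k)"] y by blast
      then have "\<pi> (\<chi> y) = \<one>\<^bsub>Q\<^esub>" using Q(3) yc by simp
      moreover have "\<pi> y = \<one>\<^bsub>Q\<^esub>" using Q(3) yc y by simp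
      ultimately have "\<pi> (\<chi> y) = \<pi> y [^]\<^bsub>Q\<^esub> ?e" by simp
      then show "y \<in> ?S" using y lower_central_Suc_subset by blast
    qed
    fix u x assume u: "u \<in> lower_central G k" and x: "x \<in> X"
    have uc: "u \<in> carrier G" using u by (rule lower_central_carrier)
    have xc: "x \<in> carrier G" using x X(1) by blast
    \<comment> \<open>The error of the induction hypothesis at u. It lies in gamma_(k+1), hence is
      central modulo gamma_(k+2) and drops out of the commutator; what is left contributes m^k from
      u and m from x.\<close>
    define z where "z = \<chi> u \<otimes> inv (u [^] (m ^ k))"
    have z: "z \<in> lower_central G (Suc k)" unfolding z_def by (rule step.IH[OF u])
    have zc: "z \<in> carrier G" using z by simp
    have \<chi>u: "\<chi> u = z \<otimes> u [^] (m ^ k)" unfolding z_def using uc by (simp add: m_assoc)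
    have w: "gcomm G u x \<in> lower_central G (Suc k)" by (rule gcomm_lower_central[OF step(1) u xc])
    define U Y where "U = \<pi> u" and "Y = \<pi> x"
    have UY: "U \<in> carrier Q" "Y \<in> carrier Q" unfolding U_def Y_def using uc xc by auto
    have wUY: "gcomm Q U Y = \<pi> (gcomm G u x)" unfolding U_def Y_def using \<pi>.hom_gcomm[OF uc xc] by simp
    have cw: "gcomm Q U Y \<in> \<pi>.H.center" unfolding wUY by (rule cen[OF w])
    have 1: "gcomm Q (U [^]\<^bsub>Q\<^esub> (m ^ k)) Y = gcomm Q U Y [^]\<^bsub>Q\<^esub> (m ^ k)"
      by (rule \<pi>.H.gcomm_pow_left[OF UY \<pi>.H.centerD(2)[OF cw UY(1)]])
    have cw': "gcomm Q U Y [^]\<^bsub>Q\<^esub> (m ^ k) \<in> \<pi>.H.center"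
      using \<pi>.H.center_int_pow[OF cw, of "int (m ^ k)"] unfolding int_pow_int .
    have UK: "U [^]\<^bsub>Q\<^esub> (m ^ k) \<in> carrier Q" using UY(1) by (rule \<pi>.H.nat_pow_closed)
    have 2: "gcomm Q (U [^]\<^bsub>Q\<^esub> (m ^ k)) (Y [^]\<^bsub>Q\<^esub> m) = (gcomm Q U Y [^]\<^bsub>Q\<^esub> (m ^ k)) [^]\<^bsub>Q\<^esub> m"
      using \<pi>.H.gcomm_pow_right[OF UK UY(2), of m] \<pi>.H.centerD(2)[OF cw' UY(2)] unfolding 1 by blast
    have YM: "Y [^]\<^bsub>Q\<^esub> m \<in> carrier Q" using UY(2) by (rule \<pi>.H.nat_pow_closed)
    have zcen: "\<pi> z \<in> \<pi>.H.center" by (rule cen[OF z])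
    have "\<pi> (\<chi> (gcomm G u x)) = gcomm Q (\<pi> (\<chi> u)) (\<pi> (\<chi> x))"
      using \<chi>.hom_gcomm[OF uc xc] \<pi>.hom_gcomm[of "\<chi> u" "\<chi> x"] uc xc by simp
    also have "\<pi> (\<chi> u) = \<pi> z \<otimes>\<^bsub>Q\<^esub> U [^]\<^bsub>Q\<^esub> (m ^ k)" unfolding \<chi>u U_def using zc uc by (simp add: \<pi>.hom_nat_pow)
    also have "\<pi> (\<chi> x) = Y [^]\<^bsub>Q\<^esub> m" unfolding \<chi>(2)[OF x] Y_def using xc by (simp add: \<pi>.hom_nat_pow)
    also have "gcomm Q (\<pi> z \<otimes>\<^bsub>Q\<^esub> U [^]\<^bsub>Q\<^esub> (m ^ k)) (Y [^]\<^bsub>Q\<^esub> m)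
        = (\<pi> z \<otimes>\<^bsub>Q\<^esub> gcomm Q (U [^]\<^bsub>Q\<^esub> (m ^ k)) (Y [^]\<^bsub>Q\<^esub> m) \<otimes>\<^bsub>Q\<^esub> inv\<^bsub>Q\<^esub> \<pi> z) \<otimes>\<^bsub>Q\<^esub> gcomm Q (\<pi> z) (Y [^]\<^bsub>Q\<^esub> m)"
      by (rule \<pi>.H.gcomm_mult_left[OF \<pi>.hom_closed[OF zc] UK YM])
    also have "gcomm Q (\<pi> z) (Y [^]\<^bsub>Q\<^esub> m) = \<one>\<^bsub>Q\<^esub>" by (rule \<pi>.H.gcomm_center[OF zcen YM])
    also have "\<pi> z \<otimes>\<^bsub>Q\<^esub> gcomm Q (U [^]\<^bsub>Q\<^esub> (m ^ k)) (Y [^]\<^bsub>Q\<^esub> m) \<otimes>\<^bsub>Q\<^esub> inv\<^bsub>Q\<^esub> \<pi> z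
        = gcomm Q (U [^]\<^bsub>Q\<^esub> (m ^ k)) (Y [^]\<^bsub>Q\<^esub> m)"
      using \<pi>.H.conj_commuting[OF \<pi>.hom_closed[OF zc] \<pi>.H.gcomm_closed[OF UK YM]]
        \<pi>.H.centerD(2)[OF zcen \<pi>.H.gcomm_closed[OF UK YM]] by metis
    also have "gcomm Q (U [^]\<^bsub>Q\<^esub> (m ^ k)) (Y [^]\<^bsub>Q\<^esub> m) \<otimes>\<^bsub>Q\<^esub> \<one>\<^bsub>Q\<^esub> = gcomm Q (U [^]\<^bsub>Q\<^esub> (m ^ k)) (Y [^]\<^bsub>Q\<^esub> m)"
      by (rule \<pi>.H.r_one[OF \<pi>.H.gcomm_closed[OF UK YM]])
    also have "\<dots> = gcomm Q U Y [^]\<^bsub>Q\<^esub> ?e"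
      unfolding 2 using \<pi>.H.nat_pow_pow[OF \<pi>.H.gcomm_closed[OF UY], of "m ^ k" m] by (simp add: mult.commute)
    finally have "\<pi> (\<chi> (gcomm G u x)) = \<pi> (gcomm G u x) [^]\<^bsub>Q\<^esub> ?e" unfolding wUY .
    then show "gcomm G u x \<in> ?S" using w by blast
  qed
  then have v: "v \<in> lower_central G (Suc k)" "\<pi> (\<chi> v) = \<pi> v [^]\<^bsub>Q\<^esub> ?e" using step.prems by auto
  have vc: "v \<in> carrier G" using v(1) by simp
  have "\<pi> (\<chi> v \<otimes> inv (v [^] ?e)) = \<one>\<^bsub>Q\<^esub>" using v(2) vc by (simp add: \<pi>.hom_nat_pow del: power_Suc)
  then show ?case using Q(3)[of "\<chi> v \<otimes> inv (v [^] ?e)"] vc by (simp del: power_Suc)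
qed

end

section \<open>Words with a single non-trivial coordinate\<close>

text \<open>Coordinates are counted from 0, hence the exponent \<open>Suc i\<close>. The condition
  \<open>generic\<close> says that on generators the value depends on i by an exponent that is
  constant or linear. The squaring endomorphisms \<open>\<alpha>\<close> and \<open>\<beta>\<close>
  are compatible with all coordinates and separate the weights.\<close>

locale coordinate_family = A: group A + B: group B
  for A :: "('a, 'c) monoid_scheme" and B :: "('b, 'd) monoid_scheme" +
  fixes X :: "'a set" and Y :: "'b set" and \<alpha> \<beta> and \<phi> :: "nat \<Rightarrow> 'a \<Rightarrow> 'b" and n :: nat
  assumes X: "X \<subseteq> carrier A" "generate A X = carrier A"
    and Y: "Y \<subseteq> carrier B" "generate B Y = carrier B"
    and \<alpha>: "\<alpha> \<in> hom A A" "\<And>x. x \<in> X \<Longrightarrow> \<alpha> x = x [^]\<^bsub>A\<^esub> (2::nat)"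
    and \<beta>: "\<beta> \<in> hom B B" "\<And>y. y \<in> Y \<Longrightarrow> \<beta> y = y [^]\<^bsub>B\<^esub> (2::nat)"
    and \<phi>: "\<And>i. i < n \<Longrightarrow> \<phi> i \<in> hom A B"
    and \<phi>\<alpha>: "\<And>i w. i < n \<Longrightarrow> w \<in> carrier A \<Longrightarrow> \<phi> i (\<alpha> w) = \<beta> (\<phi> i w)"
    and generic: "\<And>x. x \<in> X \<Longrightarrow> \<exists>b\<in>carrier B. (\<forall>i<n. \<phi> i x = b) \<or> (\<forall>i<n. \<phi> i x = b [^]\<^bsub>B\<^esub> Suc i)"
    and n2: "2 \<le> n"
begin

lemma \<phi>hom: "i < n \<Longrightarrow> group_hom A B (\<phi> i)"
  using \<phi> by (simp add: group_hom_def group_hom_axioms_def A.is_group B.is_group)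

lemma \<phi>_lower_central: "i < n \<Longrightarrow> w \<in> lower_central A k \<Longrightarrow> \<phi> i w \<in> lower_central B k"
  using A.lower_central_hom[OF B.is_group \<phi>] by blast

text \<open>Up to sign, the coefficients of the finite difference of order n - 1 taken over all n
  coordinates.\<close>

definition weight :: "nat \<Rightarrow> int" where
  "weight i = (-1) ^ i * int ((n - 1) choose i)"

lemma weight_nonzero: "i < n \<Longrightarrow> weight i \<noteq> 0"
  using n2 unfolding weight_def by simp

lemma weight_sum: "d \<le> n - 2 \<Longrightarrow> (\<Sum>i<n. weight i * int (Suc i) ^ d) = 0"
proof -
  assume "d \<le> n - 2"
  then have "d < n - 1" using n2 by simp
  from alternating_binomial_powers_zero[OF this, of 1]
  have "(\<Sum>i\<le>n - 1. weight i * int (Suc i) ^ d) = 0" unfolding weight_def by (simp add: add.commute)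
  moreover have "{..n - 1} = {..<n}" using n2 by auto
  ultimately show ?thesis by simp
qed

text \<open>In the quotient by \<open>\<gamma>\<^sub>k\<^sub>+\<^sub>1\<close>, an element of \<open>\<gamma>\<^sub>k\<close> has coordinates that are polynomials of degree at most \<open>k\<close>
  in the index, so a finite difference of higher order kills them.\<close>

lemma weighted_kernel_subgroup:
  assumes Q: "group_hom B Q \<pi>" and k: "1 \<le> k"
    and cen: "\<And>u. u \<in> lower_central B k \<Longrightarrow> \<pi> u \<in> group.center Q"
  shows "subgroup {v \<in> lower_central A k. indexed_prod Q (\<lambda>i. \<pi> (\<phi> i v) [^]\<^bsub>Q\<^esub> (e i :: int)) n = \<one>\<^bsub>Q\<^esub>} A"
    (is "subgroup ?S A")
proof -
  interpret \<pi>: group_hom B Q \<pi> by (rule Q)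
  interpret L: normal "lower_central A k" A by (rule A.lower_central_normal)
  have c: "\<pi> (\<phi> i v) \<in> \<pi>.H.center" if "i < n" "v \<in> lower_central A k" for i v
    by (rule cen[OF \<phi>_lower_central[OF that]])
  have ce: "\<pi> (\<phi> i v) [^]\<^bsub>Q\<^esub> e i \<in> \<pi>.H.center" if "i < n" "v \<in> lower_central A k" for i v
    by (rule \<pi>.H.center_int_pow[OF c[OF that]])
  show ?thesis
  proof (rule A.subgroupI)
    show "?S \<subseteq> carrier A" using L.subset by blast
    have "indexed_prod Q (\<lambda>i. \<pi> (\<phi> i \<one>\<^bsub>A\<^esub>) [^]\<^bsub>Q\<^esub> e i) n = indexed_prod Q (\<lambda>i. \<one>\<^bsub>Q\<^esub> [^]\<^bsub>Q\<^esub> (0::int)) n"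
      by (rule \<pi>.H.indexed_prod_cong) (simp add: group_hom.hom_one[OF \<phi>hom])
    also have "\<dots> = \<one>\<^bsub>Q\<^esub>" using \<pi>.H.indexed_prod_pow[OF \<pi>.H.one_closed, of "\<lambda>i. 0" n] by simp
    finally show "?S \<noteq> {}" using L.one_closed by blast
    fix a assume "a \<in> ?S"
    then have a: "a \<in> lower_central A k" "indexed_prod Q (\<lambda>i. \<pi> (\<phi> i a) [^]\<^bsub>Q\<^esub> e i) n = \<one>\<^bsub>Q\<^esub>" by auto
    have ac: "a \<in> carrier A" using a(1) by simp
    have "indexed_prod Q (\<lambda>i. \<pi> (\<phi> i (inv\<^bsub>A\<^esub> a)) [^]\<^bsub>Q\<^esub> e i) n = indexed_prod Q (\<lambda>i. inv\<^bsub>Q\<^esub> (\<pi> (\<phi> i a) [^]\<^bsub>Q\<^esub> e i)) n"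
    proof (rule \<pi>.H.indexed_prod_cong)
      fix i assume i: "i < n"
      have "\<pi> (\<phi> i (inv\<^bsub>A\<^esub> a)) = inv\<^bsub>Q\<^esub> \<pi> (\<phi> i a)"
        using group_hom.hom_inv[OF \<phi>hom[OF i] ac] group_hom.hom_closed[OF \<phi>hom[OF i] ac] by simp
      then show "\<pi> (\<phi> i (inv\<^bsub>A\<^esub> a)) [^]\<^bsub>Q\<^esub> e i = inv\<^bsub>Q\<^esub> (\<pi> (\<phi> i a) [^]\<^bsub>Q\<^esub> e i)"
        using \<pi>.H.int_pow_inv[OF \<pi>.H.centerD(1)[OF c[OF i a(1)]]] by simp
    qed
    also have "\<dots> = inv\<^bsub>Q\<^esub> (indexed_prod Q (\<lambda>i. \<pi> (\<phi> i a) [^]\<^bsub>Q\<^esub> e i) n)"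
      by (rule \<pi>.H.indexed_prod_inv) (rule ce[OF _ a(1)])
    finally show "inv\<^bsub>A\<^esub> a \<in> ?S" using a L.m_inv_closed by simp
    fix b assume "b \<in> ?S"
    then have b: "b \<in> lower_central A k" "indexed_prod Q (\<lambda>i. \<pi> (\<phi> i b) [^]\<^bsub>Q\<^esub> e i) n = \<one>\<^bsub>Q\<^esub>" by auto
    have bc: "b \<in> carrier A" using b(1) by simp
    have "indexed_prod Q (\<lambda>i. \<pi> (\<phi> i (a \<otimes>\<^bsub>A\<^esub> b)) [^]\<^bsub>Q\<^esub> e i) n
        = indexed_prod Q (\<lambda>i. \<pi> (\<phi> i a) [^]\<^bsub>Q\<^esub> e i \<otimes>\<^bsub>Q\<^esub> \<pi> (\<phi> i b) [^]\<^bsub>Q\<^esub> e i) n"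
    proof (rule \<pi>.H.indexed_prod_cong)
      fix i assume i: "i < n"
      have "\<pi> (\<phi> i (a \<otimes>\<^bsub>A\<^esub> b)) = \<pi> (\<phi> i a) \<otimes>\<^bsub>Q\<^esub> \<pi> (\<phi> i b)"
        using group_hom.hom_mult[OF \<phi>hom[OF i] ac bc] group_hom.hom_closed[OF \<phi>hom[OF i]] ac bc by simp
      then show "\<pi> (\<phi> i (a \<otimes>\<^bsub>A\<^esub> b)) [^]\<^bsub>Q\<^esub> e i = \<pi> (\<phi> i a) [^]\<^bsub>Q\<^esub> e i \<otimes>\<^bsub>Q\<^esub> \<pi> (\<phi> i b) [^]\<^bsub>Q\<^esub> e i"
        using \<pi>.H.int_pow_mult_distrib[OF \<pi>.H.centerD(2)[OF c[OF i b(1)] \<pi>.H.centerD(1)[OF c[OF i a(1)]]]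
            \<pi>.H.centerD(1)[OF c[OF i a(1)]] \<pi>.H.centerD(1)[OF c[OF i b(1)]]] by simp
    qed
    also have "\<dots> = \<one>\<^bsub>Q\<^esub> \<otimes>\<^bsub>Q\<^esub> \<one>\<^bsub>Q\<^esub>"
      using \<pi>.H.indexed_prod_mult[OF ce[OF _ a(1)] ce[OF _ b(1)], of n] a(2) b(2) by simp
    finally show "a \<otimes>\<^bsub>A\<^esub> b \<in> ?S" using a(1) b(1) L.m_closed by simp
  qed
qed

lemma hom_weighted_product:
  assumes Q: "group_hom B Q \<pi>" and v: "v \<in> carrier A"
  shows "\<pi> (indexed_prod B (\<lambda>i. \<phi> i v [^]\<^bsub>B\<^esub> (e i :: int)) n) = indexed_prod Q (\<lambda>i. \<pi> (\<phi> i v) [^]\<^bsub>Q\<^esub> e i) n"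
    "indexed_prod B (\<lambda>i. \<phi> i v [^]\<^bsub>B\<^esub> e i) n \<in> carrier B"
proof -
  interpret \<pi>: group_hom B Q \<pi> by (rule Q)
  have f: "\<phi> i v \<in> carrier B" if "i < n" for i using group_hom.hom_closed[OF \<phi>hom[OF that] v] .
  show "indexed_prod B (\<lambda>i. \<phi> i v [^]\<^bsub>B\<^esub> e i) n \<in> carrier B" by (rule B.indexed_prod_closed) (use f in simp)
  have "\<pi> (indexed_prod B (\<lambda>i. \<phi> i v [^]\<^bsub>B\<^esub> e i) m) = indexed_prod Q (\<lambda>i. \<pi> (\<phi> i v) [^]\<^bsub>Q\<^esub> e i) m" if "m \<le> n" for m
    using that
  proof (induction m)
    case (Suc m)
    have "indexed_prod B (\<lambda>i. \<phi> i v [^]\<^bsub>B\<^esub> e i) m \<in> carrier B" by (rule B.indexed_prod_closed) (use f Suc.prems in auto)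
    then show ?case using Suc f[of m] by (simp add: \<pi>.hom_int_pow)
  qed simp
  then show "\<pi> (indexed_prod B (\<lambda>i. \<phi> i v [^]\<^bsub>B\<^esub> e i) n) = indexed_prod Q (\<lambda>i. \<pi> (\<phi> i v) [^]\<^bsub>Q\<^esub> e i) n" by simp
qed

text \<open>The extra power \<open>d\<close> carries the induction: a bracket with a generator of
  values b^(i+1) multiplies the exponent at i by i + 1. So the statement for (k + 1, d) is reduced
  to (k, d) or (k, d + 1), and the total degree stays at most n - 2.\<close>

lemma weighted_product_lower_central:
  "1 \<le> k \<Longrightarrow> k + d \<le> n - 2 \<Longrightarrow> v \<in> lower_central A k \<Longrightarrow>
    indexed_prod B (\<lambda>i. \<phi> i v [^]\<^bsub>B\<^esub> (weight i * int (Suc i) ^ d)) n \<in> lower_central B (Suc k)"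
proof (induction k arbitrary: d v rule: dec_induct)
  case base
  obtain Q :: "'b set monoid" and \<pi> where Q: "group_hom B Q \<pi>" "\<pi> ` carrier B = carrier Q"
    "\<And>g. g \<in> carrier B \<Longrightarrow> \<pi> g = \<one>\<^bsub>Q\<^esub> \<longleftrightarrow> g \<in> lower_central B (Suc 1)"
    using B.quotientE[OF B.lower_central_normal] by metis
  interpret \<pi>: group_hom B Q \<pi> by (rule Q(1))
  let ?e = "\<lambda>i. weight i * int (Suc i) ^ d"
  let ?S = "{v \<in> lower_central A 1. indexed_prod Q (\<lambda>i. \<pi> (\<phi> i v) [^]\<^bsub>Q\<^esub> ?e i) n = \<one>\<^bsub>Q\<^esub>}"
  have cen: "\<pi> u \<in> \<pi>.H.center" if "u \<in> lower_central B 1" for u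
    by (rule B.image_lower_central_center[OF Q order_refl order_refl that])
  have S: "subgroup ?S A" by (rule weighted_kernel_subgroup[OF Q(1) order_refl cen])
  have "X \<subseteq> ?S"
  proof
    fix x assume x: "x \<in> X"
    obtain b where b: "b \<in> carrier B" "(\<forall>i<n. \<phi> i x = b) \<or> (\<forall>i<n. \<phi> i x = b [^]\<^bsub>B\<^esub> Suc i)" using generic[OF x] by blast
    have \<pi>b: "\<pi> b \<in> carrier Q" using b(1) by simp
    from b(2) have "indexed_prod Q (\<lambda>i. \<pi> (\<phi> i x) [^]\<^bsub>Q\<^esub> ?e i) n = \<one>\<^bsub>Q\<^esub>"
    proof
      assume h: "\<forall>i<n. \<phi> i x = b"
      have "indexed_prod Q (\<lambda>i. \<pi> (\<phi> i x) [^]\<^bsub>Q\<^esub> ?e i) n = indexed_prod Q (\<lambda>i. \<pi> b [^]\<^bsub>Q\<^esub> ?e i) n"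
        by (rule \<pi>.H.indexed_prod_cong) (use h in simp)
      also have "\<dots> = \<pi> b [^]\<^bsub>Q\<^esub> (0::int)" unfolding \<pi>.H.indexed_prod_pow[OF \<pi>b] using weight_sum[of d] base by simp
      finally show ?thesis by simp
    next
      assume h: "\<forall>i<n. \<phi> i x = b [^]\<^bsub>B\<^esub> Suc i"
      have "indexed_prod Q (\<lambda>i. \<pi> (\<phi> i x) [^]\<^bsub>Q\<^esub> ?e i) n = indexed_prod Q (\<lambda>i. \<pi> b [^]\<^bsub>Q\<^esub> (weight i * int (Suc i) ^ Suc d)) n"
      proof (rule \<pi>.H.indexed_prod_cong)
        fix i assume i: "i < n"
        have "\<pi> (\<phi> i x) = \<pi> b [^]\<^bsub>Q\<^esub> int (Suc i)" unfolding h[rule_format, OF i] int_pow_int by (rule \<pi>.hom_nat_pow[OF b(1)])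
        then have "\<pi> (\<phi> i x) [^]\<^bsub>Q\<^esub> ?e i = \<pi> b [^]\<^bsub>Q\<^esub> (int (Suc i) * ?e i)" by (simp only: \<pi>.H.int_pow_pow[OF \<pi>b])
        moreover have "int (Suc i) * ?e i = weight i * int (Suc i) ^ Suc d" by (simp only: power_Suc mult_ac)
        ultimately show "\<pi> (\<phi> i x) [^]\<^bsub>Q\<^esub> ?e i = \<pi> b [^]\<^bsub>Q\<^esub> (weight i * int (Suc i) ^ Suc d)" by (simp only:)
      qed
      also have "\<dots> = \<pi> b [^]\<^bsub>Q\<^esub> (0::int)" unfolding \<pi>.H.indexed_prod_pow[OF \<pi>b] using weight_sum[of "Suc d"] base by (simp del: power_Suc)
      finally show ?thesis by simp
    qed
    then show "x \<in> ?S" using x X(1) by auto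
  qed
  then have "generate A X \<subseteq> ?S" by (rule A.generate_subgroup_incl[OF _ S])
  then have v: "v \<in> ?S" using X(2) base by auto
  have vc: "v \<in> carrier A" using base by simp
  have "\<pi> (indexed_prod B (\<lambda>i. \<phi> i v [^]\<^bsub>B\<^esub> ?e i) n) = \<one>\<^bsub>Q\<^esub>" unfolding hom_weighted_product(1)[OF Q(1) vc] using v by blast
  then show ?case using Q(3)[OF hom_weighted_product(2)[OF Q(1) vc, of ?e]] by blast
next
  case (step k)
  obtain Q :: "'b set monoid" and \<pi> where Q: "group_hom B Q \<pi>" "\<pi> ` carrier B = carrier Q"
    "\<And>g. g \<in> carrier B \<Longrightarrow> \<pi> g = \<one>\<^bsub>Q\<^esub> \<longleftrightarrow> g \<in> lower_central B (Suc (Suc k))"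
    using B.quotientE[OF B.lower_central_normal] by metis
  interpret \<pi>: group_hom B Q \<pi> by (rule Q(1))
  let ?e = "\<lambda>i. weight i * int (Suc i) ^ d"
  let ?S = "{v \<in> lower_central A (Suc k). indexed_prod Q (\<lambda>i. \<pi> (\<phi> i v) [^]\<^bsub>Q\<^esub> ?e i) n = \<one>\<^bsub>Q\<^esub>}"
  have k1: "1 \<le> Suc k" by simp
  have cen: "\<pi> u \<in> \<pi>.H.center" if "u \<in> lower_central B (Suc k)" for u
    by (rule B.image_lower_central_center[OF Q k1 order_refl that])
  have S: "subgroup ?S A" by (rule weighted_kernel_subgroup[OF Q(1) k1 cen])
  have "lower_central A (Suc k) \<subseteq> ?S"
  proof (rule A.lower_central_Suc_least'[OF X step(1) S])
    show "lower_central A (Suc (Suc k)) \<subseteq> ?S"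
    proof
      fix y assume y: "y \<in> lower_central A (Suc (Suc k))"
      have yc: "y \<in> carrier A" using y by (rule A.lower_central_carrier)
      have "indexed_prod Q (\<lambda>i. \<pi> (\<phi> i y) [^]\<^bsub>Q\<^esub> ?e i) n = indexed_prod Q (\<lambda>i. \<one>\<^bsub>Q\<^esub> [^]\<^bsub>Q\<^esub> (0::int)) n"
      proof (rule \<pi>.H.indexed_prod_cong)
        fix i assume i: "i < n"
        have "\<pi> (\<phi> i y) = \<one>\<^bsub>Q\<^esub>"
          using Q(3)[OF group_hom.hom_closed[OF \<phi>hom[OF i] yc]] \<phi>_lower_central[OF i y] by blast
        then show "\<pi> (\<phi> i y) [^]\<^bsub>Q\<^esub> ?e i = \<one>\<^bsub>Q\<^esub> [^]\<^bsub>Q\<^esub> (0::int)" by simp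
      qed
      also have "\<dots> = \<one>\<^bsub>Q\<^esub>" using \<pi>.H.indexed_prod_pow[OF \<pi>.H.one_closed, of "\<lambda>i. 0" n] by simp
      finally show "y \<in> ?S" using y A.lower_central_Suc_subset by blast
    qed
    fix u x assume u: "u \<in> lower_central A k" and x: "x \<in> X"
    have uc: "u \<in> carrier A" using u by (rule A.lower_central_carrier)
    have xc: "x \<in> carrier A" using x X(1) by blast
    have \<phi>c: "\<phi> i u \<in> carrier B" if "i < n" for i by (rule group_hom.hom_closed[OF \<phi>hom[OF that] uc])
    obtain b where b: "b \<in> carrier B" "(\<forall>i<n. \<phi> i x = b) \<or> (\<forall>i<n. \<phi> i x = b [^]\<^bsub>B\<^esub> Suc i)" using generic[OF x] by blast
    have \<pi>b: "\<pi> b \<in> carrier Q" using b(1) by simp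
    define w where "w i = gcomm Q (\<pi> (\<phi> i u)) (\<pi> b)" for i
    have wc: "w i \<in> \<pi>.H.center" if i: "i < n" for i
    proof -
      have "gcomm B (\<phi> i u) b \<in> lower_central B (Suc k)"
        by (rule B.gcomm_lower_central[OF step(1) \<phi>_lower_central[OF i u] b(1)])
      from cen[OF this] show ?thesis unfolding w_def \<pi>.hom_gcomm[OF \<phi>c[OF i] b(1)] .
    qed
    \<comment> \<open>The weighted product for u lies in gamma_(k+1) by induction, so it is central
      in \<open>Q\<close> and its bracket with b is trivial; this bracket is the weighted product of
      the single brackets.\<close>
    have key: "indexed_prod Q (\<lambda>i. w i [^]\<^bsub>Q\<^esub> (weight i * int (Suc i) ^ d')) n = \<one>\<^bsub>Q\<^esub>" if d': "k + d' \<le> n - 2" for d'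
    proof -
      let ?f = "\<lambda>i. \<phi> i u [^]\<^bsub>B\<^esub> (weight i * int (Suc i) ^ d')"
      define p where "p = indexed_prod B ?f n"
      have p: "p \<in> lower_central B (Suc k)" unfolding p_def by (rule step.IH[OF d' u])
      have pc: "p \<in> carrier B" using p by (rule B.lower_central_carrier)
      have \<pi>p: "\<pi> p = indexed_prod Q (\<lambda>i. \<pi> (\<phi> i u) [^]\<^bsub>Q\<^esub> (weight i * int (Suc i) ^ d')) n"
        unfolding p_def by (rule hom_weighted_product(1)[OF Q(1) uc])
      have gw: "gcomm Q (\<pi> (\<phi> i u) [^]\<^bsub>Q\<^esub> (weight i * int (Suc i) ^ d')) (\<pi> b) = w i [^]\<^bsub>Q\<^esub> (weight i * int (Suc i) ^ d')"
        if i: "i < n" for i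
        unfolding w_def
        by (rule \<pi>.H.gcomm_int_pow_left[OF \<pi>.hom_closed[OF \<phi>c[OF i]] \<pi>b wc[OF i, unfolded w_def]])
      have "\<one>\<^bsub>Q\<^esub> = gcomm Q (\<pi> p) (\<pi> b)" by (rule \<pi>.H.gcomm_center[OF cen[OF p] \<pi>b, symmetric])
      also have "\<dots> = indexed_prod Q (\<lambda>i. gcomm Q (\<pi> (\<phi> i u) [^]\<^bsub>Q\<^esub> (weight i * int (Suc i) ^ d')) (\<pi> b)) n"
        unfolding \<pi>p
      proof (rule \<pi>.H.gcomm_indexed_prod[OF _ \<pi>b])
        fix i assume i: "i < n"
        show "\<pi> (\<phi> i u) [^]\<^bsub>Q\<^esub> (weight i * int (Suc i) ^ d') \<in> carrier Q"
          by (rule \<pi>.H.int_pow_closed[OF \<pi>.hom_closed[OF \<phi>c[OF i]]])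
        show "gcomm Q (\<pi> (\<phi> i u) [^]\<^bsub>Q\<^esub> (weight i * int (Suc i) ^ d')) (\<pi> b) \<in> \<pi>.H.center"
          unfolding gw[OF i] by (rule \<pi>.H.center_int_pow[OF wc[OF i]])
      qed
      also have "\<dots> = indexed_prod Q (\<lambda>i. w i [^]\<^bsub>Q\<^esub> (weight i * int (Suc i) ^ d')) n"
        by (rule \<pi>.H.indexed_prod_cong) (rule gw)
      finally show ?thesis by (rule sym)
    qed
    have \<pi>g: "\<pi> (\<phi> i (gcomm A u x)) = gcomm Q (\<pi> (\<phi> i u)) (\<pi> (\<phi> i x))" if i: "i < n" for i
    proof -
      interpret \<phi>i: group_hom A B "\<phi> i" by (rule \<phi>hom[OF i])
      show ?thesis unfolding \<phi>i.hom_gcomm[OF uc xc] by (rule \<pi>.hom_gcomm[OF \<phi>i.hom_closed[OF uc] \<phi>i.hom_closed[OF xc]])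
    qed
    from b(2) have "indexed_prod Q (\<lambda>i. \<pi> (\<phi> i (gcomm A u x)) [^]\<^bsub>Q\<^esub> ?e i) n = \<one>\<^bsub>Q\<^esub>"
    proof
      assume h: "\<forall>i<n. \<phi> i x = b"
      have "indexed_prod Q (\<lambda>i. \<pi> (\<phi> i (gcomm A u x)) [^]\<^bsub>Q\<^esub> ?e i) n = indexed_prod Q (\<lambda>i. w i [^]\<^bsub>Q\<^esub> ?e i) n"
      proof (rule \<pi>.H.indexed_prod_cong)
        fix i assume i: "i < n"
        show "\<pi> (\<phi> i (gcomm A u x)) [^]\<^bsub>Q\<^esub> ?e i = w i [^]\<^bsub>Q\<^esub> ?e i" unfolding \<pi>g[OF i] w_def h[rule_format, OF i] ..
      qed
      also have "\<dots> = \<one>\<^bsub>Q\<^esub>" by (rule key) (use step.prems in simp)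
      finally show ?thesis .
    next
      assume h: "\<forall>i<n. \<phi> i x = b [^]\<^bsub>B\<^esub> Suc i"
      have "indexed_prod Q (\<lambda>i. \<pi> (\<phi> i (gcomm A u x)) [^]\<^bsub>Q\<^esub> ?e i) n = indexed_prod Q (\<lambda>i. w i [^]\<^bsub>Q\<^esub> (weight i * int (Suc i) ^ Suc d)) n"
      proof (rule \<pi>.H.indexed_prod_cong)
        fix i assume i: "i < n"
        have ui: "\<pi> (\<phi> i u) \<in> carrier Q" by (rule \<pi>.hom_closed[OF \<phi>c[OF i]])
        have "\<pi> (\<phi> i (gcomm A u x)) = gcomm Q (\<pi> (\<phi> i u)) (\<pi> b [^]\<^bsub>Q\<^esub> Suc i)"
          unfolding \<pi>g[OF i] h[rule_format, OF i] \<pi>.hom_nat_pow[OF b(1)] ..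
        also have "\<dots> = w i [^]\<^bsub>Q\<^esub> int (Suc i)"
          unfolding w_def int_pow_int
          by (rule \<pi>.H.gcomm_pow_right[OF ui \<pi>b \<pi>.H.centerD(2)[OF wc[OF i, unfolded w_def] \<pi>b]])
        finally have "\<pi> (\<phi> i (gcomm A u x)) [^]\<^bsub>Q\<^esub> ?e i = w i [^]\<^bsub>Q\<^esub> (int (Suc i) * ?e i)"
          by (simp only: \<pi>.H.int_pow_pow[OF \<pi>.H.centerD(1)[OF wc[OF i]]])
        moreover have "int (Suc i) * ?e i = weight i * int (Suc i) ^ Suc d" by (simp only: power_Suc mult_ac)
        ultimately show "\<pi> (\<phi> i (gcomm A u x)) [^]\<^bsub>Q\<^esub> ?e i = w i [^]\<^bsub>Q\<^esub> (weight i * int (Suc i) ^ Suc d)" by (simp only:)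
      qed
      also have "\<dots> = \<one>\<^bsub>Q\<^esub>" by (rule key) (use step.prems in simp)
      finally show ?thesis .
    qed
    then show "gcomm A u x \<in> ?S" using A.gcomm_lower_central[OF step(1) u xc] by blast
  qed
  then have v: "v \<in> ?S" using step.prems by blast
  have vc: "v \<in> carrier A" using step.prems(2) by (rule A.lower_central_carrier)
  have "\<pi> (indexed_prod B (\<lambda>i. \<phi> i v [^]\<^bsub>B\<^esub> ?e i) n) = \<one>\<^bsub>Q\<^esub>" unfolding hom_weighted_product(1)[OF Q(1) vc] using v by blast
  then show ?case using Q(3)[OF hom_weighted_product(2)[OF Q(1) vc, of ?e]] by blast
qed

text \<open>A word with all values in gamma_k need not lie in gamma_k itself. If it lies in gamma_j,
  then \<open>\<alpha>\<close> divided by the 2^j-th power moves it into gamma_(j+1), while the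
  values, modulo gamma_(k+1), are raised to the power 2^k - 2^j because \<open>\<beta>\<close> acts
  on them as 2^k. These factors are nonzero for j < k and accumulate in \<open>C\<close>.\<close>

lemma leading_term:
  assumes k: "1 \<le> k" and w: "w \<in> carrier A" "\<And>i. i < n \<Longrightarrow> \<phi> i w \<in> lower_central B k"
  obtains w' C where "w' \<in> lower_central A k" "0 < (C::nat)"
    "\<And>i. i < n \<Longrightarrow> \<phi> i w' \<otimes>\<^bsub>B\<^esub> inv\<^bsub>B\<^esub> (\<phi> i w [^]\<^bsub>B\<^esub> C) \<in> lower_central B (Suc k)"
proof -
  obtain Q :: "'b set monoid" and \<pi> where Q: "group_hom B Q \<pi>" "\<pi> ` carrier B = carrier Q"
    "\<And>g. g \<in> carrier B \<Longrightarrow> \<pi> g = \<one>\<^bsub>Q\<^esub> \<longleftrightarrow> g \<in> lower_central B (Suc k)"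
    using B.quotientE[OF B.lower_central_normal] by metis
  interpret \<pi>: group_hom B Q \<pi> by (rule Q(1))
  interpret \<alpha>: group_hom A A \<alpha> using \<alpha>(1) by (simp add: group_hom_def group_hom_axioms_def A.is_group)
  interpret \<beta>: group_hom B B \<beta> using \<beta>(1) by (simp add: group_hom_def group_hom_axioms_def B.is_group)
  interpret L: normal "lower_central B k" B by (rule B.lower_central_normal)
  have \<phi>c: "\<phi> i x \<in> carrier B" if "i < n" "x \<in> carrier A" for i x using \<phi>[OF that(1)] that(2) by (auto simp: hom_def)
  have "j \<le> k \<Longrightarrow> \<exists>w' C. w' \<in> lower_central A j \<and> 0 < (C::nat) \<and>
      (\<forall>i<n. \<phi> i w' \<in> lower_central B k \<and> \<pi> (\<phi> i w') = \<pi> (\<phi> i w) [^]\<^bsub>Q\<^esub> C)" if "1 \<le> j" for j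
    using that
  proof (induction j rule: dec_induct)
    case base
    have "\<pi> (\<phi> i w) = \<pi> (\<phi> i w) [^]\<^bsub>Q\<^esub> (1::nat)" if "i < n" for i using \<phi>c[OF that w(1)] by simp
    then show ?case using w by (intro exI[of _ w] exI[of _ 1]) auto
  next
    case (step j)
    have jk: "j < k" "j \<le> k" using step.prems by auto
    obtain w' C where w': "w' \<in> lower_central A j" "0 < (C::nat)"
      "\<And>i. i < n \<Longrightarrow> \<phi> i w' \<in> lower_central B k" "\<And>i. i < n \<Longrightarrow> \<pi> (\<phi> i w') = \<pi> (\<phi> i w) [^]\<^bsub>Q\<^esub> C"
      using step.IH[OF jk(2)] by blast
    have w'c: "w' \<in> carrier A" using w'(1) by (rule A.lower_central_carrier)
    define e where "e = (2::nat) ^ j"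
    define w'' where "w'' = \<alpha> w' \<otimes>\<^bsub>A\<^esub> inv\<^bsub>A\<^esub> (w' [^]\<^bsub>A\<^esub> e)"
    have w''L: "w'' \<in> lower_central A (Suc j)"
      unfolding w''_def e_def by (rule A.lower_central_power_endomorphism[OF X \<alpha> step(1) w'(1)])
    have lt: "(2::nat) ^ j < 2 ^ k" using jk(1) by simp
    have "\<phi> i w'' \<in> lower_central B k \<and> \<pi> (\<phi> i w'') = \<pi> (\<phi> i w) [^]\<^bsub>Q\<^esub> (C * (2 ^ k - e))" if i: "i < n" for i
    proof -
      interpret \<phi>i: group_hom A B "\<phi> i" by (rule \<phi>hom[OF i])
      define u where "u = \<phi> i w'"
      have u: "u \<in> lower_central B k" unfolding u_def by (rule w'(3)[OF i])
      have uc: "u \<in> carrier B" using u by simp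
      have \<phi>w: "\<phi> i w'' = \<beta> u \<otimes>\<^bsub>B\<^esub> inv\<^bsub>B\<^esub> (u [^]\<^bsub>B\<^esub> e)"
        unfolding w''_def u_def using w'c \<phi>\<alpha>[OF i w'c] by (simp add: \<phi>i.hom_nat_pow)
      have \<beta>u: "\<beta> u \<in> lower_central B k" using B.lower_central_hom[OF B.is_group \<beta>(1), of k] u by blast
      have ue: "u [^]\<^bsub>B\<^esub> e \<in> lower_central B k"
        using B.subgroup_int_pow_closed[OF L.is_subgroup u, of "int e"] unfolding int_pow_int .
      have 1: "\<phi> i w'' \<in> lower_central B k" unfolding \<phi>w using \<beta>u ue by simp
      have "\<beta> u \<otimes>\<^bsub>B\<^esub> inv\<^bsub>B\<^esub> (u [^]\<^bsub>B\<^esub> ((2::nat) ^ k)) \<in> lower_central B (Suc k)"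
        by (rule B.lower_central_power_endomorphism[OF Y \<beta> k u])
      moreover have "\<beta> u \<otimes>\<^bsub>B\<^esub> inv\<^bsub>B\<^esub> (u [^]\<^bsub>B\<^esub> ((2::nat) ^ k)) \<in> carrier B" using uc by simp
      ultimately have "\<pi> (\<beta> u \<otimes>\<^bsub>B\<^esub> inv\<^bsub>B\<^esub> (u [^]\<^bsub>B\<^esub> ((2::nat) ^ k))) = \<one>\<^bsub>Q\<^esub>" using Q(3) by blast
      then have \<pi>\<beta>: "\<pi> (\<beta> u) = \<pi> u [^]\<^bsub>Q\<^esub> ((2::nat) ^ k)" using uc by (simp add: \<pi>.hom_nat_pow \<pi>.H.inv_solve_right')
      have "\<pi> (\<phi> i w'') = \<pi> u [^]\<^bsub>Q\<^esub> ((2::nat) ^ k) \<otimes>\<^bsub>Q\<^esub> inv\<^bsub>Q\<^esub> (\<pi> u [^]\<^bsub>Q\<^esub> e)"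
        unfolding \<phi>w using uc \<pi>\<beta> by (simp add: \<pi>.hom_nat_pow)
      also have "(2::nat) ^ k = (2 ^ k - e) + e" using lt unfolding e_def by simp
      also have "\<pi> u [^]\<^bsub>Q\<^esub> ((2 ^ k - e) + e) \<otimes>\<^bsub>Q\<^esub> inv\<^bsub>Q\<^esub> (\<pi> u [^]\<^bsub>Q\<^esub> e) = \<pi> u [^]\<^bsub>Q\<^esub> (2 ^ k - e)"
        using uc by (simp only: \<pi>.H.nat_pow_mult[symmetric] \<pi>.hom_closed) (simp add: \<pi>.H.m_assoc)
      also have "\<dots> = \<pi> (\<phi> i w) [^]\<^bsub>Q\<^esub> (C * (2 ^ k - e))"
        unfolding u_def w'(4)[OF i] using \<phi>c[OF i w(1)] by (simp add: \<pi>.H.nat_pow_pow)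
      finally show ?thesis using 1 by blast
    qed
    moreover have "0 < C * (2 ^ k - e)" using w'(2) lt unfolding e_def by simp
    ultimately show ?case using w''L by blast
  qed
  from this[OF k order_refl] obtain w' C where w': "w' \<in> lower_central A k" "0 < (C::nat)"
    "\<And>i. i < n \<Longrightarrow> \<pi> (\<phi> i w') = \<pi> (\<phi> i w) [^]\<^bsub>Q\<^esub> C" by blast
  have w'c: "w' \<in> carrier A" using w'(1) by (rule A.lower_central_carrier)
  have "\<phi> i w' \<otimes>\<^bsub>B\<^esub> inv\<^bsub>B\<^esub> (\<phi> i w [^]\<^bsub>B\<^esub> C) \<in> lower_central B (Suc k)" if i: "i < n" for i
  proof -
    have c: "\<phi> i w' \<in> carrier B" "\<phi> i w \<in> carrier B" using \<phi>c[OF i] w'c w(1) by auto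
    have "\<pi> (\<phi> i w' \<otimes>\<^bsub>B\<^esub> inv\<^bsub>B\<^esub> (\<phi> i w [^]\<^bsub>B\<^esub> C)) = \<one>\<^bsub>Q\<^esub>" using c w'(3)[OF i] by (simp add: \<pi>.hom_nat_pow)
    then show ?thesis using Q(3)[of "\<phi> i w' \<otimes>\<^bsub>B\<^esub> inv\<^bsub>B\<^esub> (\<phi> i w [^]\<^bsub>B\<^esub> C)"] c by simp
  qed
  then show thesis using that w'(1,2) by blast
qed

text \<open>One layer at a time: once a power of the value at \<open>i0\<close> lies in gamma_k, the
  word may be replaced by one from gamma_k of the free group. Its weighted product vanishes modulo
  gamma_(k+1), and so do all factors except the one at \<open>i0\<close>. The weight there is a
  nonzero integer, so a further power lies in gamma_(k+1).\<close>

proposition isolated_coordinate_torsion: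
  assumes c: "c \<le> n - 2" and i0: "i0 < n" and w: "w \<in> carrier A"
    and others: "\<And>i. i < n \<Longrightarrow> i \<noteq> i0 \<Longrightarrow> \<phi> i w \<in> lower_central B (Suc c)"
  shows "\<exists>M::nat. 0 < M \<and> \<phi> i0 w [^]\<^bsub>B\<^esub> M \<in> lower_central B (Suc c)"
proof -
  have \<phi>c: "\<phi> i x \<in> carrier B" if "i < n" "x \<in> carrier A" for i x using \<phi>[OF that(1)] that(2) by (auto simp: hom_def)
  have "k \<le> Suc c \<Longrightarrow> \<exists>M::nat. 0 < M \<and> \<phi> i0 w [^]\<^bsub>B\<^esub> M \<in> lower_central B k" if "1 \<le> k" for k
    using that
  proof (induction k rule: dec_induct)
    case base
    show ?case using \<phi>c[OF i0 w] by (intro exI[of _ 1]) simp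
  next
    case (step k)
    have kc: "k \<le> c" "k \<le> Suc c" using step.prems by auto
    obtain M :: nat where M: "0 < M" "\<phi> i0 w [^]\<^bsub>B\<^esub> M \<in> lower_central B k" using step.IH[OF kc(2)] by blast
    define w1 where "w1 = w [^]\<^bsub>A\<^esub> M"
    have w1c: "w1 \<in> carrier A" unfolding w1_def using w by simp
    have \<phi>w1: "\<phi> i w1 = \<phi> i w [^]\<^bsub>B\<^esub> M" if "i < n" for i
      unfolding w1_def by (rule group_hom.hom_nat_pow[OF \<phi>hom[OF that] w])
    have oth1: "\<phi> i w1 \<in> lower_central B (Suc k)" if "i < n" "i \<noteq> i0" for i
    proof -
      have "\<phi> i w \<in> lower_central B (Suc k)" using others[OF that] B.lower_central_antimono[of "Suc k" "Suc c"] kc by auto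
      then show ?thesis
        using B.subgroup_int_pow_closed[OF B.lower_central_subgroup, of _ "Suc k" "int M"] unfolding \<phi>w1[OF that(1)] int_pow_int by blast
    qed
    have all1: "\<phi> i w1 \<in> lower_central B k" if "i < n" for i
    proof (cases "i = i0")
      case True
      then show ?thesis using M(2) \<phi>w1[OF i0] by simp
    next
      case False
      then show ?thesis using oth1[OF that] B.lower_central_Suc_subset by blast
    qed
    obtain w' C where w': "w' \<in> lower_central A k" "0 < (C::nat)"
      "\<And>i. i < n \<Longrightarrow> \<phi> i w' \<otimes>\<^bsub>B\<^esub> inv\<^bsub>B\<^esub> (\<phi> i w1 [^]\<^bsub>B\<^esub> C) \<in> lower_central B (Suc k)"
      using leading_term[OF step(1) w1c all1] by blast
    have w'c: "w' \<in> carrier A" using w'(1) by (rule A.lower_central_carrier)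
    obtain Q :: "'b set monoid" and \<pi> where Q: "group_hom B Q \<pi>" "\<pi> ` carrier B = carrier Q"
      "\<And>g. g \<in> carrier B \<Longrightarrow> \<pi> g = \<one>\<^bsub>Q\<^esub> \<longleftrightarrow> g \<in> lower_central B (Suc k)"
      using B.quotientE[OF B.lower_central_normal] by metis
    interpret \<pi>: group_hom B Q \<pi> by (rule Q(1))
    have eq: "\<pi> (\<phi> i w') = \<pi> (\<phi> i w1) [^]\<^bsub>Q\<^esub> C" if i: "i < n" for i
    proof -
      have cc: "\<phi> i w' \<in> carrier B" "\<phi> i w1 \<in> carrier B" using \<phi>c[OF i] w'c w1c by auto
      have "\<phi> i w' \<otimes>\<^bsub>B\<^esub> inv\<^bsub>B\<^esub> (\<phi> i w1 [^]\<^bsub>B\<^esub> C) \<in> carrier B" using cc by simp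
      then have "\<pi> (\<phi> i w' \<otimes>\<^bsub>B\<^esub> inv\<^bsub>B\<^esub> (\<phi> i w1 [^]\<^bsub>B\<^esub> C)) = \<one>\<^bsub>Q\<^esub>" using Q(3) w'(3)[OF i] by blast
      then show ?thesis using cc by (simp add: \<pi>.hom_nat_pow \<pi>.H.inv_solve_right')
    qed
    \<comment> \<open>The bound on the number of coordinates enters here: the values have degree at
      most k, and k \<le> c \<le> n - 2.\<close>
    have kd: "k + 0 \<le> n - 2" using kc c by simp
    have "indexed_prod B (\<lambda>i. \<phi> i w' [^]\<^bsub>B\<^esub> (weight i * int (Suc i) ^ 0)) n \<in> lower_central B (Suc k)"
      by (rule weighted_product_lower_central[OF step(1) kd w'(1)])
    then have wp: "indexed_prod B (\<lambda>i. \<phi> i w' [^]\<^bsub>B\<^esub> weight i) n \<in> lower_central B (Suc k)"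
      by (simp only: power_0 mult_1_right)
    have \<pi>c: "\<pi> (\<phi> i w') \<in> carrier Q" if "i < n" for i by (rule \<pi>.hom_closed[OF \<phi>c[OF that w'c]])
    have "\<pi> (\<phi> i0 w') [^]\<^bsub>Q\<^esub> weight i0 = indexed_prod Q (\<lambda>i. \<pi> (\<phi> i w') [^]\<^bsub>Q\<^esub> weight i) n"
    proof (rule \<pi>.H.indexed_prod_single[OF i0, symmetric])
      show "\<pi> (\<phi> i0 w') [^]\<^bsub>Q\<^esub> weight i0 \<in> carrier Q" by (rule \<pi>.H.int_pow_closed[OF \<pi>c[OF i0]])
      fix i assume i: "i < n" "i \<noteq> i0"
      have "\<pi> (\<phi> i w1) = \<one>\<^bsub>Q\<^esub>" using Q(3)[OF \<phi>c[OF i(1) w1c]] oth1[OF i] by blast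
      then have "\<pi> (\<phi> i w') = \<one>\<^bsub>Q\<^esub>" unfolding eq[OF i(1)] by simp
      then show "\<pi> (\<phi> i w') [^]\<^bsub>Q\<^esub> weight i = \<one>\<^bsub>Q\<^esub>" by simp
    qed
    also have "\<dots> = \<one>\<^bsub>Q\<^esub>"
      unfolding hom_weighted_product(1)[OF Q(1) w'c, of weight, symmetric]
      using Q(3)[OF hom_weighted_product(2)[OF Q(1) w'c, of weight]] wp by blast
    finally have "\<pi> (\<phi> i0 w' [^]\<^bsub>B\<^esub> weight i0) = \<one>\<^bsub>Q\<^esub>" unfolding \<pi>.hom_int_pow[OF \<phi>c[OF i0 w'c]] .
    then have z: "\<phi> i0 w' [^]\<^bsub>B\<^esub> weight i0 \<in> lower_central B (Suc k)"
      using Q(3)[OF B.int_pow_closed[OF \<phi>c[OF i0 w'c]]] by blast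
    have c0: "\<phi> i0 w' \<in> carrier B" "\<phi> i0 w1 \<in> carrier B" "\<phi> i0 w \<in> carrier B" using \<phi>c[OF i0] w'c w1c w by auto
    define s where "s = nat \<bar>weight i0\<bar>"
    have s0: "0 < s" using weight_nonzero[OF i0] unfolding s_def by simp
    have "weight i0 = int s \<or> weight i0 = - int s" unfolding s_def by auto
    then have "\<phi> i0 w' [^]\<^bsub>B\<^esub> s \<in> lower_central B (Suc k)"
    proof
      assume "weight i0 = int s"
      then show ?thesis using z by (simp add: int_pow_int)
    next
      assume "weight i0 = - int s"
      then have "inv\<^bsub>B\<^esub> (\<phi> i0 w' [^]\<^bsub>B\<^esub> s) \<in> lower_central B (Suc k)" using z c0(1) by (simp add: B.int_pow_neg_int)
      from subgroup.m_inv_closed[OF B.lower_central_subgroup this] show ?thesis using c0(1) by simp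
    qed
    then have "\<pi> (\<phi> i0 w') [^]\<^bsub>Q\<^esub> s = \<one>\<^bsub>Q\<^esub>" using Q(3)[of "\<phi> i0 w' [^]\<^bsub>B\<^esub> s"] c0(1) \<pi>.hom_nat_pow[OF c0(1), of s] by simp
    then have "(\<pi> (\<phi> i0 w1) [^]\<^bsub>Q\<^esub> C) [^]\<^bsub>Q\<^esub> s = \<one>\<^bsub>Q\<^esub>" unfolding eq[OF i0] .
    then have "\<pi> (\<phi> i0 w1 [^]\<^bsub>B\<^esub> (C * s)) = \<one>\<^bsub>Q\<^esub>" using c0(2) by (simp add: \<pi>.hom_nat_pow \<pi>.H.nat_pow_pow)
    then have "\<phi> i0 w1 [^]\<^bsub>B\<^esub> (C * s) \<in> lower_central B (Suc k)" using Q(3) c0(2) by simp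
    then have "\<phi> i0 w [^]\<^bsub>B\<^esub> (M * (C * s)) \<in> lower_central B (Suc k)" unfolding \<phi>w1[OF i0] using c0(3) by (simp add: B.nat_pow_pow)
    moreover have "0 < M * (C * s)" using M(1) w'(2) s0 by simp
    ultimately show ?case by blast
  qed
  from this[of "Suc c"] show ?thesis by simp
qed

end

section \<open>Finite presentability\<close>

lemma (in group) restrict_hom_subgroup:
  "group H \<Longrightarrow> subgroup P G \<Longrightarrow> f \<in> hom G H \<Longrightarrow> f \<in> hom (G\<lparr>carrier := P\<rparr>) H"
  by (auto simp: hom_def subgroup.mem_carrier)

text \<open>The condition \<open>torsion_S\<close> expresses that projections to pairs of
  coordinates have finite index in a form that can be checked on generators: the elements trivial in
  coordinate j reach a positive power of every generator in coordinate i.\<close>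

locale subdirect_power =
  fixes X :: "'x set" and I :: "'i set" and S :: "('i \<Rightarrow> 'x letter list) set" and L :: "'x letter list set"
    and F and D and gen and embed and diag and c :: nat
  defines "F \<equiv> free_group X" and "D \<equiv> product_group I (\<lambda>_. F)"
    and "gen \<equiv> (\<lambda>x. [(x, True)]) ` X" and "embed \<equiv> factor_embed I (\<lambda>_. F)"
    and "diag \<equiv> (\<lambda>f. \<lambda>j\<in>I. f)"
  assumes X: "finite X" and I: "finite I" "I \<noteq> {}"
    and L_def: "L = lower_central F (Suc c)"
    and S: "subgroup S D"
    and diag_S: "\<And>f. f \<in> carrier F \<Longrightarrow> diag f \<in> S"
    and embed_S: "\<And>i m. i \<in> I \<Longrightarrow> m \<in> L \<Longrightarrow> embed i m \<in> S"
    and torsion_S: "\<And>i j x. \<lbrakk>i \<in> I; j \<in> I; i \<noteq> j; x \<in> gen\<rbrakk> \<Longrightarrow>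
      \<exists>s\<in>S. s j = \<one>\<^bsub>F\<^esub> \<and> (\<exists>r::nat. 0 < r \<and> s i = x [^]\<^bsub>F\<^esub> r)"
begin

sublocale F: group F unfolding F_def by (rule group_free_group)
sublocale D: group D unfolding D_def by (rule product_group) (rule F.is_group)
sublocale L: normal L F unfolding L_def by (rule F.lower_central_normal)

lemma carrier_D: "carrier D = (\<Pi>\<^sub>E i\<in>I. carrier F)"
  unfolding D_def by simp

lemma coord_closed: "s \<in> carrier D \<Longrightarrow> i \<in> I \<Longrightarrow> s i \<in> carrier F"
  unfolding carrier_D by auto

lemma D_mult: "i \<in> I \<Longrightarrow> (s \<otimes>\<^bsub>D\<^esub> t) i = s i \<otimes>\<^bsub>F\<^esub> t i"
  unfolding D_def by simp

lemma D_one: "i \<in> I \<Longrightarrow> \<one>\<^bsub>D\<^esub> i = \<one>\<^bsub>F\<^esub>"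
  unfolding D_def by simp

lemma D_ext: "s \<in> carrier D \<Longrightarrow> t \<in> carrier D \<Longrightarrow> (\<And>i. i \<in> I \<Longrightarrow> s i = t i) \<Longrightarrow> s = t"
  unfolding carrier_D by (rule PiE_ext)

lemma coord_hom: "i \<in> I \<Longrightarrow> (\<lambda>s. s i) \<in> hom D F"
  by (rule homI) (auto simp: coord_closed D_mult)

lemma D_inv: "s \<in> carrier D \<Longrightarrow> i \<in> I \<Longrightarrow> (inv\<^bsub>D\<^esub> s) i = inv\<^bsub>F\<^esub> (s i)"
  using group_hom.hom_inv[of D F "\<lambda>s. s i" s] coord_hom
  by (simp add: group_hom_def group_hom_axioms_def D.is_group F.is_group)

lemma diag_carrier: "f \<in> carrier F \<Longrightarrow> diag f \<in> carrier D"
  unfolding carrier_D diag_def by auto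

lemma diag_coord: "i \<in> I \<Longrightarrow> diag f i = f"
  unfolding diag_def by simp

lemma diag_hom: "diag \<in> hom F D"
  by (rule homI, simp add: diag_carrier, rule D_ext) (simp_all add: diag_carrier D_mult diag_coord)

lemma embed_coord: "j \<in> I \<Longrightarrow> embed i a j = (if j = i then a else \<one>\<^bsub>F\<^esub>)"
  unfolding embed_def factor_embed_def by simp

lemma embed_carrier: "a \<in> carrier F \<Longrightarrow> embed i a \<in> carrier D"
  unfolding carrier_D embed_def factor_embed_def by auto

lemma embed_hom: "embed i \<in> hom F D"
  by (rule homI, simp add: embed_carrier, rule D_ext) (simp_all add: embed_carrier D_mult embed_coord)

lemma embed_conj:
  assumes "b \<in> carrier D" "a \<in> carrier F" "i \<in> I"
  shows "b \<otimes>\<^bsub>D\<^esub> embed i a \<otimes>\<^bsub>D\<^esub> inv\<^bsub>D\<^esub> b = embed i (b i \<otimes>\<^bsub>F\<^esub> a \<otimes>\<^bsub>F\<^esub> inv\<^bsub>F\<^esub> (b i))"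
  by (rule D_ext) (use assms coord_closed in \<open>auto simp: embed_carrier D_mult D_inv embed_coord\<close>)

text \<open>An element of a finite product is the product of its embedded entries; the induction
  fills in one coordinate after the other.\<close>

lemma decompose:
  assumes B: "subgroup B D" and s: "s \<in> carrier D"
    and parts: "\<And>i. i \<in> I \<Longrightarrow> embed i (s i) \<in> B"
  shows "s \<in> B"
proof -
  have "(\<lambda>i\<in>I. if i \<in> J then s i else \<one>\<^bsub>F\<^esub>) \<in> B" if "finite J" "J \<subseteq> I" for J
    using that
  proof (induction J rule: finite_induct)
    case empty
    have "(\<lambda>i\<in>I. if i \<in> {} then s i else \<one>\<^bsub>F\<^esub>) = \<one>\<^bsub>D\<^esub>" unfolding D_def by simp
    then show ?case using subgroup.one_closed[OF B] by simp
  next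
    case (insert j J)
    let ?t = "\<lambda>J. (\<lambda>i\<in>I. if i \<in> J then s i else \<one>\<^bsub>F\<^esub>)"
    have tc: "?t J' \<in> carrier D" for J' unfolding carrier_D using coord_closed[OF s] by auto
    have jI: "j \<in> I" using insert.prems by simp
    have eq: "?t (insert j J) = ?t J \<otimes>\<^bsub>D\<^esub> embed j (s j)"
    proof (rule D_ext[OF tc])
      show "?t J \<otimes>\<^bsub>D\<^esub> embed j (s j) \<in> carrier D"
        by (rule D.m_closed[OF tc embed_carrier[OF coord_closed[OF s jI]]])
      fix i assume i: "i \<in> I"
      show "?t (insert j J) i = (?t J \<otimes>\<^bsub>D\<^esub> embed j (s j)) i"
        unfolding D_mult[OF i] embed_coord[OF i] using i coord_closed[OF s i] insert.hyps by auto
    qed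
    have IH: "?t J \<in> B" using insert.IH insert.prems by blast
    show ?case unfolding eq by (rule subgroup.m_closed[OF B IH parts[OF jI]])
  qed
  from this[OF I(1) order_refl] have "(\<lambda>i\<in>I. if i \<in> I then s i else \<one>\<^bsub>F\<^esub>) \<in> B" .
  moreover have "(\<lambda>i\<in>I. if i \<in> I then s i else \<one>\<^bsub>F\<^esub>) = s"
    using s unfolding carrier_D by (auto simp: restrict_def PiE_def extensional_def)
  ultimately show ?thesis by simp
qed

lemma gen: "finite gen" "gen \<subseteq> carrier F" "generate F gen = carrier F"
proof -
  show "finite gen" unfolding gen_def using X by simp
  show "gen \<subseteq> carrier F" unfolding gen_def F_def by (auto intro: free_group_letter)
  show "generate F gen = carrier F" unfolding gen_def F_def by (rule generate_free_group)
qed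

lemma L_polycyclic: "polycyclic_over F L (carrier F)"
  unfolding L_def by (rule F.lower_central_polycyclic[OF gen]) simp

section \<open>Finite generation of the coordinate kernels\<close>

definition coordinate_kernel :: "'i \<Rightarrow> ('i \<Rightarrow> 'x letter list) set" where
  "coordinate_kernel j = {s \<in> S. s j = \<one>\<^bsub>F\<^esub>}"

lemma S_carrier: "s \<in> S \<Longrightarrow> s \<in> carrier D"
  by (rule subgroup.mem_carrier[OF S])

lemma coordinate_kernel_subgroup: "j \<in> I \<Longrightarrow> subgroup (coordinate_kernel j) D"
  using F.subgroup_vimage[OF D.is_group coord_hom F.triv_subgroup S]
  unfolding coordinate_kernel_def by simp

text \<open>Conjugation by the diagonal realizes conjugation by any element of F, so P is normal. It
  contains L and a power of every generator, hence F/P is a nilpotent torsion group; being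
  polycyclic it is finite, and Schreier's lemma applies to P.\<close>

lemma coordinate_image:
  assumes ij: "i \<in> I" "j \<in> I" "i \<noteq> j"
  defines "P \<equiv> (\<lambda>s. s i) ` coordinate_kernel j"
  shows "subgroup P F" "L \<subseteq> P" "\<exists>T. finite T \<and> T \<subseteq> P \<and> generate F T = P"
proof -
  interpret h: group_hom D F "\<lambda>s. s i"
    using coord_hom[OF ij(1)] by (simp add: group_hom_def group_hom_axioms_def D.is_group F.is_group)
  show P: "subgroup P F"
    unfolding P_def by (rule h.subgroup_img_is_subgroup[OF coordinate_kernel_subgroup[OF ij(2)]])
  show LP: "L \<subseteq> P"
  proof
    fix m assume m: "m \<in> L"
    have "embed i m \<in> coordinate_kernel j"
      unfolding coordinate_kernel_def using embed_S[OF ij(1) m] ij by (simp add: embed_coord)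
    moreover have "m = (embed i m) i" using ij by (simp add: embed_coord)
    ultimately show "m \<in> P" unfolding P_def by blast
  qed
  have Pn: "P \<lhd> F"
  proof (rule F.normal_invI[OF P])
    fix x p assume x: "x \<in> carrier F" and "p \<in> P"
    then obtain s where s: "s \<in> S" "s j = \<one>\<^bsub>F\<^esub>" "p = s i" unfolding P_def coordinate_kernel_def by blast
    let ?t = "diag x \<otimes>\<^bsub>D\<^esub> s \<otimes>\<^bsub>D\<^esub> inv\<^bsub>D\<^esub> diag x"
    have tS: "?t \<in> S" using diag_S[OF x] s(1) by (simp add: subgroup.m_closed[OF S] subgroup.m_inv_closed[OF S])
    have t: "?t j = \<one>\<^bsub>F\<^esub>" "?t i = x \<otimes>\<^bsub>F\<^esub> p \<otimes>\<^bsub>F\<^esub> inv\<^bsub>F\<^esub> x"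
      using ij s x by (simp_all add: D_mult D_inv diag_carrier diag_coord)
    have "?t \<in> coordinate_kernel j" unfolding coordinate_kernel_def using tS t(1) by (intro CollectI conjI)
    then have "?t i \<in> P" unfolding P_def by (rule imageI)
    then show "x \<otimes>\<^bsub>F\<^esub> p \<otimes>\<^bsub>F\<^esub> inv\<^bsub>F\<^esub> x \<in> P" unfolding t(2) .
  qed
  have "\<exists>r::nat. 0 < r \<and> x [^]\<^bsub>F\<^esub> r \<in> P" if x: "x \<in> gen" for x
  proof -
    obtain s and r :: nat where s: "s \<in> S" "s j = \<one>\<^bsub>F\<^esub>" "0 < r" "s i = x [^]\<^bsub>F\<^esub> r"
      using torsion_S[OF ij x] by blast
    have "s \<in> coordinate_kernel j" unfolding coordinate_kernel_def using s(1,2) by (intro CollectI conjI)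
    then have "s i \<in> P" unfolding P_def by (rule imageI)
    then show ?thesis unfolding s(4) using s(3) by blast
  qed
  then have tor: "\<exists>r::nat. 0 < r \<and> g [^]\<^bsub>F\<^esub> r \<in> P" if "g \<in> carrier F" for g
    using F.torsion_mod_of_torsion_generators[OF gen(2,3) Pn LP[unfolded L_def] _ that] by blast
  obtain T where T: "finite T" "T \<subseteq> carrier F" "\<And>g. g \<in> carrier F \<Longrightarrow> \<exists>s\<in>T. inv\<^bsub>F\<^esub> s \<otimes>\<^bsub>F\<^esub> g \<in> P"
    using F.polycyclic_over_torsion_finite[OF L_polycyclic Pn LP tor] by blast
  show "\<exists>T. finite T \<and> T \<subseteq> P \<and> generate F T = P"
    by (rule F.finite_index_finitely_generated[OF gen P T])
qed

text \<open>The kernel is polycyclic over its elements with all entries in L, so these remain to be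
  generated. In coordinate i, the image P_i of the kernel is finitely generated with P_i/L
  polycyclic, so finitely many elements generate L under conjugation by P_i, and this conjugation is
  carried out by elements of the kernel.\<close>

lemma coordinate_kernel_finitely_generated:
  assumes j: "j \<in> I"
  shows "\<exists>A. finite A \<and> A \<subseteq> coordinate_kernel j \<and> generate D A = coordinate_kernel j"
proof -
  let ?K = "coordinate_kernel j"
  let ?P = "\<lambda>i. (\<lambda>s. s i) ` ?K"
  have K: "subgroup ?K D" by (rule coordinate_kernel_subgroup[OF j])
  have Kc: "s \<in> carrier D" if "s \<in> ?K" for s using that subgroup.mem_carrier[OF K] by blast
  define GL where "GL = D\<lparr>carrier := ?K\<rparr>"
  interpret GL: group GL unfolding GL_def by (rule D.subgroup_imp_group[OF K])
  define \<Gamma> where "\<Gamma> = {s \<in> ?K. \<forall>i\<in>I. s i \<in> L}"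
  have hom: "(\<lambda>s. s i) \<in> hom GL F" if "i \<in> I" for i
    unfolding GL_def by (rule D.restrict_hom_subgroup[OF F.is_group K coord_hom[OF that]])
  have "polycyclic_over GL {g \<in> carrier GL. \<forall>i\<in>I. g i \<in> L} (carrier GL)"
    using GL.polycyclic_over_joint_vimage[where q = "\<lambda>i s. s i", OF I(1) F.is_group hom L.normal_axioms L_polycyclic] by blast
  then have pc\<Gamma>: "polycyclic_over GL \<Gamma> ?K" unfolding \<Gamma>_def GL_def by simp
  obtain T where T: "finite T" "T \<subseteq> ?K" "?K = generate GL (T \<union> \<Gamma>)"
    using GL.polycyclic_over_finitely_generated[OF pc\<Gamma>] by metis
  \<comment> \<open>This says that L is the normal closure of \<open>W\<close> in P_i, the group
    generated by the i-th entries of \<open>Y\<close>. Quantifying over the stable subgroups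
    \<open>H\<close> expresses it inside F, so that it can be used after \<open>Y\<close> and
    \<open>W\<close> have been chosen for all i.\<close>
  have "\<exists>Y W. finite Y \<and> Y \<subseteq> ?K \<and> finite W \<and> W \<subseteq> L \<and>
      (\<forall>H. subgroup H F \<longrightarrow> H \<subseteq> L \<longrightarrow> W \<subseteq> H \<longrightarrow> (\<forall>p\<in>generate F ((\<lambda>s. s i) ` Y). \<forall>m\<in>H. p \<otimes>\<^bsub>F\<^esub> m \<otimes>\<^bsub>F\<^esub> inv\<^bsub>F\<^esub> p \<in> H) \<longrightarrow> L \<subseteq> H)"
    if i: "i \<in> I - {j}" for i
  proof -
    have ij: "i \<in> I" "j \<in> I" "i \<noteq> j" using i j by auto
    note P = coordinate_image[OF ij]
    obtain Y0 where Y0: "finite Y0" "Y0 \<subseteq> ?P i" "generate F Y0 = ?P i" using P(3) by blast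
    obtain Y where Y: "finite Y" "Y \<subseteq> ?K" "Y0 = (\<lambda>s. s i) ` Y" using finite_subset_image[OF Y0(1,2)] by blast
    define GP where "GP = F\<lparr>carrier := ?P i\<rparr>"
    interpret GP: group GP unfolding GP_def by (rule F.subgroup_imp_group[OF P(1)])
    have id: "(\<lambda>x. x) \<in> hom GP F"
      unfolding GP_def by (rule F.restrict_hom_subgroup[OF F.is_group P(1)]) (simp add: hom_def)
    have Pc: "?P i \<subseteq> carrier F" by (rule subgroup.subset[OF P(1)])
    have "{b \<in> carrier GP. b \<in> L} = L" "{b \<in> carrier GP. b \<in> carrier F} = carrier GP"
      using P(2) Pc unfolding GP_def by auto
    then have pc: "polycyclic_over GP L (carrier GP)" and LP: "L \<lhd> GP"
      using F.polycyclic_over_vimage[OF L_polycyclic GP.is_group id GP.subgroup_self]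
        F.normal_vimage[OF GP.is_group id L.normal_axioms] by auto
    have gP: "generate GP Y0 = carrier GP" using F.generate_consistent[OF Y0(2) P(1)] Y0(3) unfolding GP_def by simp
    have Y0c: "Y0 \<subseteq> carrier GP" using Y0(2) unfolding GP_def by simp
    obtain W where W: "finite W" "W \<subseteq> L" "normal_closure GP W = L"
      by (rule GP.polycyclic_quotient_normally_finitely_generated[OF Y0(1) Y0c gP LP pc])
    have HL: "L \<subseteq> H" if H: "subgroup H F" "H \<subseteq> L" "W \<subseteq> H"
      "\<And>p m. p \<in> generate F ((\<lambda>s. s i) ` Y) \<Longrightarrow> m \<in> H \<Longrightarrow> p \<otimes>\<^bsub>F\<^esub> m \<otimes>\<^bsub>F\<^esub> inv\<^bsub>F\<^esub> p \<in> H" for H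
    proof -
      have HP: "H \<subseteq> ?P i" using H(2) P(2) by (rule order_trans)
      have "H \<lhd> GP"
      proof (rule GP.normal_invI)
        have "subgroup {b \<in> carrier GP. b \<in> H} GP" by (rule F.subgroup_vimage[OF GP.is_group id H(1) GP.subgroup_self])
        moreover have "{b \<in> carrier GP. b \<in> H} = H" using HP unfolding GP_def by auto
        ultimately show "subgroup H GP" by simp
        fix p m assume p: "p \<in> carrier GP" and m: "m \<in> H"
        have p': "p \<in> ?P i" using p unfolding GP_def by simp
        have "inv\<^bsub>GP\<^esub> p = inv\<^bsub>F\<^esub> p" unfolding GP_def using F.m_inv_consistent[OF P(1) p'] by simp
        then show "p \<otimes>\<^bsub>GP\<^esub> m \<otimes>\<^bsub>GP\<^esub> inv\<^bsub>GP\<^esub> p \<in> H"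
          using H(4)[of p m] m p' Y0(3) Y(3) unfolding GP_def by simp
      qed
      then show ?thesis using GP.normal_closure_least[OF _ H(3)] W(3) by blast
    qed
    show ?thesis
    proof (intro exI conjI allI impI)
      show "finite Y" "Y \<subseteq> ?K" "finite W" "W \<subseteq> L" by (fact Y(1) Y(2) W(1) W(2))+
      fix H assume H: "subgroup H F" "H \<subseteq> L" "W \<subseteq> H"
        and conj: "\<forall>p\<in>generate F ((\<lambda>s. s i) ` Y). \<forall>m\<in>H. p \<otimes>\<^bsub>F\<^esub> m \<otimes>\<^bsub>F\<^esub> inv\<^bsub>F\<^esub> p \<in> H"
      show "L \<subseteq> H" by (rule HL[OF H]) (rule conj[rule_format])
    qed
  qed
  then have "\<forall>i\<in>I - {j}. \<exists>YW. finite (fst YW) \<and> fst YW \<subseteq> ?K \<and> finite (snd YW) \<and> snd YW \<subseteq> L \<and>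
      (\<forall>H. subgroup H F \<longrightarrow> H \<subseteq> L \<longrightarrow> snd YW \<subseteq> H \<longrightarrow> (\<forall>p\<in>generate F ((\<lambda>s. s i) ` fst YW). \<forall>m\<in>H. p \<otimes>\<^bsub>F\<^esub> m \<otimes>\<^bsub>F\<^esub> inv\<^bsub>F\<^esub> p \<in> H) \<longrightarrow> L \<subseteq> H)"
    unfolding split_paired_Ex fst_conv snd_conv by (intro ballI)
  then obtain YW where YW: "\<forall>i\<in>I - {j}. finite (fst (YW i)) \<and> fst (YW i) \<subseteq> ?K \<and> finite (snd (YW i)) \<and> snd (YW i) \<subseteq> L \<and>
      (\<forall>H. subgroup H F \<longrightarrow> H \<subseteq> L \<longrightarrow> snd (YW i) \<subseteq> H \<longrightarrow> (\<forall>p\<in>generate F ((\<lambda>s. s i) ` fst (YW i)). \<forall>m\<in>H. p \<otimes>\<^bsub>F\<^esub> m \<otimes>\<^bsub>F\<^esub> inv\<^bsub>F\<^esub> p \<in> H) \<longrightarrow> L \<subseteq> H)"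
    by (rule bchoice[THEN exE])
  define Y W where "Y i = fst (YW i)" and "W i = snd (YW i)" for i
  have Y: "finite (Y i)" "Y i \<subseteq> ?K" and W: "finite (W i)" "W i \<subseteq> L"
    and least: "\<And>H. \<lbrakk>subgroup H F; H \<subseteq> L; W i \<subseteq> H;
      \<And>p m. \<lbrakk>p \<in> generate F ((\<lambda>s. s i) ` Y i); m \<in> H\<rbrakk> \<Longrightarrow> p \<otimes>\<^bsub>F\<^esub> m \<otimes>\<^bsub>F\<^esub> inv\<^bsub>F\<^esub> p \<in> H\<rbrakk> \<Longrightarrow> L \<subseteq> H"
    if "i \<in> I - {j}" for i
  proof -
    note h = bspec[OF YW that, folded Y_def W_def]
    show "finite (Y i)" "Y i \<subseteq> ?K" "finite (W i)" "W i \<subseteq> L" using h by blast+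
    fix H assume H: "subgroup H F" "H \<subseteq> L" "W i \<subseteq> H"
      and conj: "\<And>p m. \<lbrakk>p \<in> generate F ((\<lambda>s. s i) ` Y i); m \<in> H\<rbrakk> \<Longrightarrow> p \<otimes>\<^bsub>F\<^esub> m \<otimes>\<^bsub>F\<^esub> inv\<^bsub>F\<^esub> p \<in> H"
    from h have "subgroup H F \<longrightarrow> H \<subseteq> L \<longrightarrow> W i \<subseteq> H \<longrightarrow> (\<forall>p\<in>generate F ((\<lambda>s. s i) ` Y i). \<forall>m\<in>H. p \<otimes>\<^bsub>F\<^esub> m \<otimes>\<^bsub>F\<^esub> inv\<^bsub>F\<^esub> p \<in> H) \<longrightarrow> L \<subseteq> H"
      by (elim conjE allE)
    then show "L \<subseteq> H" using H conj by (elim impE) (assumption | intro ballI)+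
  qed
  define A where "A = T \<union> (\<Union>i\<in>I - {j}. Y i \<union> embed i ` W i)"
  have Afin: "finite A" unfolding A_def using T(1) Y(1) W(1) I(1) by simp
  have eK: "embed i m \<in> ?K" if "i \<in> I - {j}" "m \<in> L" for i m
    unfolding coordinate_kernel_def using embed_S[of i m] that j by (auto simp: embed_coord)
  have AK: "A \<subseteq> ?K" unfolding A_def using T(2) Y(2) W(2) eK by blast
  have Ac: "A \<subseteq> carrier D" using AK Kc by blast
  define B where "B = generate D A"
  have B: "subgroup B D" unfolding B_def by (rule D.generate_is_subgroup[OF Ac])
  have BK: "B \<subseteq> ?K" unfolding B_def by (rule D.generate_subgroup_incl[OF AK K])
  have AB: "A \<subseteq> B" unfolding B_def by (auto intro: generate.incl)
  have LB: "embed i m \<in> B" if i: "i \<in> I - {j}" and m: "m \<in> L" for i m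
  proof -
    have iI: "i \<in> I" using i by blast
    let ?H = "{m \<in> L. embed i m \<in> B}"
    have "subgroup ?H F" by (rule D.subgroup_vimage[OF F.is_group embed_hom B L.is_subgroup])
    moreover have "W i \<subseteq> ?H" using W(2)[OF i] AB i unfolding A_def by blast
    moreover have "p \<otimes>\<^bsub>F\<^esub> m \<otimes>\<^bsub>F\<^esub> inv\<^bsub>F\<^esub> p \<in> ?H" if p: "p \<in> generate F ((\<lambda>s. s i) ` Y i)" and m: "m \<in> ?H" for p m
    proof -
      interpret h: group_hom D F "\<lambda>s. s i"
        using coord_hom[OF iI] by (simp add: group_hom_def group_hom_axioms_def D.is_group F.is_group)
      have "(\<lambda>s. s i) ` Y i \<subseteq> (\<lambda>s. s i) ` B" using AB i unfolding A_def by blast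
      then have "generate F ((\<lambda>s. s i) ` Y i) \<subseteq> (\<lambda>s. s i) ` B"
        by (rule F.generate_subgroup_incl[OF _ h.subgroup_img_is_subgroup[OF B]])
      then obtain b where b: "b \<in> B" "p = b i" using p by blast
      have bc: "b \<in> carrier D" using b(1) BK Kc by blast
      have pc: "p \<in> carrier F" unfolding b(2) by (rule coord_closed[OF bc iI])
      have "b \<otimes>\<^bsub>D\<^esub> embed i m \<otimes>\<^bsub>D\<^esub> inv\<^bsub>D\<^esub> b \<in> B"
        using b(1) m by (simp add: subgroup.m_closed[OF B] subgroup.m_inv_closed[OF B])
      then have "embed i (p \<otimes>\<^bsub>F\<^esub> m \<otimes>\<^bsub>F\<^esub> inv\<^bsub>F\<^esub> p) \<in> B" using embed_conj[OF bc _ iI, of m] m b(2) by simp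
      then show ?thesis using L.inv_op_closed2[OF pc] m by blast
    qed
    ultimately have "L \<subseteq> ?H" using least[OF i, of ?H] by blast
    then show ?thesis using m by blast
  qed
  have "\<Gamma> \<subseteq> B"
  proof
    fix s assume s: "s \<in> \<Gamma>"
    have sK: "s \<in> ?K" using s unfolding \<Gamma>_def by blast
    show "s \<in> B"
    proof (rule decompose[OF B Kc[OF sK]])
      fix i assume i: "i \<in> I"
      show "embed i (s i) \<in> B"
      proof (cases "i = j")
        case True
        have "s j = \<one>\<^bsub>F\<^esub>" using sK unfolding coordinate_kernel_def by blast
        moreover have "embed i \<one>\<^bsub>F\<^esub> = \<one>\<^bsub>D\<^esub>" by (rule hom_one[OF embed_hom F.is_group D.is_group])
        ultimately show ?thesis using True subgroup.one_closed[OF B] by simp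
      next
        case False
        then show ?thesis using LB[of i "s i"] i s unfolding \<Gamma>_def by blast
      qed
    qed
  qed
  moreover have "T \<subseteq> B" using AB unfolding A_def by blast
  ultimately have "generate D (T \<union> \<Gamma>) \<subseteq> B" by (intro D.generate_subgroup_incl[OF _ B]) blast
  moreover have "generate GL (T \<union> \<Gamma>) = generate D (T \<union> \<Gamma>)"
    unfolding GL_def by (rule D.generate_consistent[OF _ K]) (use T(2) in \<open>auto simp: \<Gamma>_def\<close>)
  ultimately have "?K \<subseteq> B" using T(3) by simp
  then show ?thesis using Afin AK BK unfolding B_def by blast
qed

text \<open>The relations among generators of \<open>S\<close> form the joint kernel of the
  coordinates of a map from a free group onto \<open>S\<close>. The criterion for joint kernels
  applies, with lifts of generators of the coordinate kernels for \<open>A\<close> and lifts of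
  normal generators of the embedded copies of L for \<open>V\<close>.\<close>

theorem subdirect_power_finitely_presented: "finitely_presented (D\<lparr>carrier := S\<rparr>)"
proof -
  define GS where "GS = D\<lparr>carrier := S\<rparr>"
  interpret GS: group GS unfolding GS_def by (rule D.subgroup_imp_group[OF S])
  have GSc: "carrier GS = S" unfolding GS_def by simp
  have "\<forall>j\<in>I. \<exists>A. finite A \<and> A \<subseteq> coordinate_kernel j \<and> generate D A = coordinate_kernel j"
    using coordinate_kernel_finitely_generated by blast
  then obtain A where A': "\<forall>j\<in>I. finite (A j) \<and> A j \<subseteq> coordinate_kernel j \<and> generate D (A j) = coordinate_kernel j"
    by (rule bchoice[THEN exE])
  then have A: "finite (A j)" "A j \<subseteq> coordinate_kernel j" "generate D (A j) = coordinate_kernel j" if "j \<in> I" for j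
    using that by blast+
  have kS: "coordinate_kernel j \<subseteq> S" for j unfolding coordinate_kernel_def by blast
  have AS: "A j \<subseteq> S" if "j \<in> I" for j using A(2)[OF that] kS by (rule order_trans)
  have genA: "generate GS (A j) = coordinate_kernel j" if "j \<in> I" for j
    using D.generate_consistent[OF AS[OF that] S] A(3)[OF that] unfolding GS_def by simp
  have coord: "(\<lambda>s. s i) \<in> hom GS F" if "i \<in> I" for i
    unfolding GS_def by (rule D.restrict_hom_subgroup[OF F.is_group S coord_hom[OF that]])
  have diagGS: "diag \<in> hom F GS"
    using diag_hom diag_S unfolding GS_def hom_def by auto
  have embedGS: "embed i m \<in> S" if "i \<in> I" "m \<in> L" for i m by (rule embed_S[OF that])
  obtain j0 where j0: "j0 \<in> I" using I(2) by blast
  \<comment> \<open>Dividing an element of \<open>S\<close> by the diagonal element of its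
    \<open>j0\<close>-th entry moves it into the kernel of that coordinate, so these elements
    generate \<open>S\<close>.\<close>
  define Z where "Z = A j0 \<union> diag ` gen"
  have Zfin: "finite Z" unfolding Z_def using A(1)[OF j0] gen(1) by simp
  have ZS: "Z \<subseteq> S" unfolding Z_def using AS[OF j0] diag_S gen(2) by blast
  have Zgen: "generate GS Z = S"
  proof
    have ZGS: "Z \<subseteq> carrier GS" using ZS unfolding GSc .
    show "generate GS Z \<subseteq> S" using GS.generate_incl[OF ZGS] unfolding GSc .
    interpret d: group_hom F GS diag using diagGS by (simp add: group_hom_def group_hom_axioms_def F.is_group GS.is_group)
    interpret sg: subgroup "generate GS Z" GS by (rule GS.generate_is_subgroup[OF ZGS])
    have dg: "diag f \<in> generate GS Z" if f: "f \<in> carrier F" for f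
    proof -
      have "diag ` generate F gen = generate GS (diag ` gen)" by (rule d.generate_img[OF gen(2), symmetric])
      moreover have "generate GS (diag ` gen) \<subseteq> generate GS Z" by (rule GS.mono_generate) (auto simp: Z_def)
      ultimately show ?thesis using f gen(3) by blast
    qed
    have kg: "coordinate_kernel j0 \<subseteq> generate GS Z"
      using genA[OF j0] GS.mono_generate[of "A j0" Z] unfolding Z_def by blast
    show "S \<subseteq> generate GS Z"
    proof
      fix s assume s: "s \<in> S"
      have sc: "s \<in> carrier D" by (rule S_carrier[OF s])
      have f: "s j0 \<in> carrier F" by (rule coord_closed[OF sc j0])
      define t where "t = s \<otimes>\<^bsub>D\<^esub> inv\<^bsub>D\<^esub> diag (s j0)"
      have tS: "t \<in> S" unfolding t_def using s diag_S[OF f] by (simp add: subgroup.m_closed[OF S] subgroup.m_inv_closed[OF S])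
      have "t j0 = \<one>\<^bsub>F\<^esub>" unfolding t_def using f diag_carrier[OF f] j0 by (simp add: D_mult D_inv diag_coord)
      then have "t \<in> coordinate_kernel j0" unfolding coordinate_kernel_def using tS by blast
      then have "t \<otimes>\<^bsub>GS\<^esub> diag (s j0) \<in> generate GS Z" using kg dg[OF f] by (intro sg.m_closed) auto
      moreover have "t \<otimes>\<^bsub>GS\<^esub> diag (s j0) = s"
        unfolding t_def GS_def using sc diag_carrier[OF f] by (simp add: D.m_assoc)
      ultimately show "s \<in> generate GS Z" by simp
    qed
  qed
  obtain zs where zs: "set zs = Z" using finite_list[OF Zfin] by blast
  define m where "m = length zs"
  define \<Phi> where "\<Phi> = free_group {..<m}"
  define \<pi> where "\<pi> = free_lift GS (\<lambda>a. zs ! a)"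
  interpret \<Phi>: group \<Phi> unfolding \<Phi>_def by (rule group_free_group)
  have zsS: "(\<lambda>a. zs ! a) ` {..<m} \<subseteq> carrier GS"
    using ZS zs unfolding m_def GSc by auto
  have \<pi>hom: "\<pi> \<in> hom \<Phi> GS" unfolding \<pi>_def \<Phi>_def by (rule GS.free_lift_hom[OF zsS])
  interpret \<pi>: group_hom \<Phi> GS \<pi> using \<pi>hom by (simp add: group_hom_def group_hom_axioms_def \<Phi>.is_group GS.is_group)
  define G where "G = (\<lambda>a. [(a, True)]) ` {..<m}"
  have G: "finite G" "G \<subseteq> carrier \<Phi>" "generate \<Phi> G = carrier \<Phi>"
  proof -
    show "finite G" unfolding G_def by simp
    show "G \<subseteq> carrier \<Phi>" unfolding G_def \<Phi>_def by (auto intro: free_group_letter)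
    show "generate \<Phi> G = carrier \<Phi>" unfolding G_def \<Phi>_def by (rule generate_free_group)
  qed
  have \<pi>gen: "\<pi> [(a, True)] = zs ! a" if "a < m" for a
    unfolding \<pi>_def by (rule GS.free_lift_generator) (use zsS that in auto)
  have \<pi>surj: "\<pi> ` carrier \<Phi> = S"
  proof -
    have "\<pi> ` G = (\<lambda>a. zs ! a) ` {..<m}" unfolding G_def image_image by (rule image_cong) (simp_all add: \<pi>gen)
    also have "\<dots> = Z" unfolding zs[symmetric] m_def by (auto simp: set_conv_nth)
    finally have "\<pi> ` G = Z" .
    then show ?thesis using \<pi>.generate_img[OF G(2)] G(3) Zgen by simp
  qed
  have "\<forall>s\<in>S. \<exists>g. g \<in> carrier \<Phi> \<and> \<pi> g = s" using \<pi>surj by blast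
  then obtain lift where lift: "\<forall>s\<in>S. lift s \<in> carrier \<Phi> \<and> \<pi> (lift s) = s" by (rule bchoice[THEN exE])
  then have liftc: "lift s \<in> carrier \<Phi>" and \<pi>lift: "\<pi> (lift s) = s" if "s \<in> S" for s using that by auto
  have \<pi>S: "\<pi> g \<in> S" if "g \<in> carrier \<Phi>" for g using \<pi>surj that by blast
  have \<pi>image: "\<pi> ` lift ` T = T" if "T \<subseteq> S" for T
  proof -
    have "\<pi> ` lift ` T = (\<lambda>s. s) ` T" unfolding image_image by (rule image_cong) (use \<pi>lift that in auto)
    then show ?thesis by simp
  qed
  define q where "q i g = \<pi> g i" for i g
  have q: "q i \<in> hom \<Phi> F" if "i \<in> I" for i
  proof (rule homI)
    fix x y assume xy: "x \<in> carrier \<Phi>" "y \<in> carrier \<Phi>"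
    show "q i x \<in> carrier F" unfolding q_def by (rule coord_closed[OF S_carrier[OF \<pi>S[OF xy(1)]] that])
    have "\<pi> (x \<otimes>\<^bsub>\<Phi>\<^esub> y) = \<pi> x \<otimes>\<^bsub>D\<^esub> \<pi> y" using \<pi>.hom_mult[OF xy] unfolding GS_def by simp
    then show "q i (x \<otimes>\<^bsub>\<Phi>\<^esub> y) = q i x \<otimes>\<^bsub>F\<^esub> q i y" unfolding q_def by (simp add: D_mult[OF that])
  qed
  \<comment> \<open>A lift of the diagonal, which is a common section of all coordinate
    maps.\<close>
  define \<delta> where "\<delta> = free_lift \<Phi> (\<lambda>x. lift (diag [(x, True)]))"
  have xF: "[(x, True)] \<in> carrier F" if "x \<in> X" for x unfolding F_def by (rule free_group_letter) (simp add: that)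
  have lX: "(\<lambda>x. lift (diag [(x, True)])) ` X \<subseteq> carrier \<Phi>" using liftc[OF diag_S[OF xF]] by blast
  have \<delta>: "\<delta> \<in> hom F \<Phi>" unfolding \<delta>_def F_def by (rule \<Phi>.free_lift_hom[OF lX])
  have \<delta>c: "\<delta> f \<in> carrier \<Phi>" if "f \<in> carrier F" for f using \<delta> that by (auto simp: hom_def)
  have q\<delta>: "q i (\<delta> f) = f" if i: "i \<in> I" and f: "f \<in> carrier F" for i f
  proof -
    have h1: "(\<lambda>f. q i (\<delta> f)) \<in> hom F F"
      using q[OF i] \<delta> unfolding hom_def by auto
    have h2: "(\<lambda>f. f) \<in> hom F F" by (simp add: hom_def)
    have "q i (\<delta> x) = x" if xg: "x \<in> gen" for x
    proof -
      obtain a where a: "a \<in> X" "x = [(a, True)]" using xg unfolding gen_def by blast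
      have "\<delta> x = lift (diag x)" unfolding \<delta>_def a(2) by (rule \<Phi>.free_lift_generator) (rule liftc[OF diag_S[OF xF[OF a(1)]]])
      then have "\<pi> (\<delta> x) = diag x" using \<pi>lift[OF diag_S[OF xF[OF a(1)]]] a(2) by simp
      then show ?thesis unfolding q_def by (simp add: diag_coord[OF i])
    qed
    then show ?thesis
      using F.hom_eq_on_generate[OF F.is_group h1 h2 gen(2), of f] f gen(3) by blast
  qed
  obtain V where V: "finite V" "V \<subseteq> L" "normal_closure F V = L"
    by (rule F.polycyclic_quotient_normally_finitely_generated[OF gen L.normal_axioms L_polycyclic])
  define Al where "Al i = lift ` A i" for i
  define Vl where "Vl i = lift ` embed i ` V" for i
  have eVS: "embed i ` V \<subseteq> S" if "i \<in> I" for i using embedGS[OF that] V(2) by blast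
  have Alc: "Al i \<subseteq> carrier \<Phi>" if "i \<in> I" for i unfolding Al_def using AS[OF that] liftc by blast
  have Vlc: "Vl i \<subseteq> carrier \<Phi>" if "i \<in> I" for i unfolding Vl_def using eVS[OF that] liftc by blast
  have \<pi>Al: "\<pi> ` Al i = A i" if "i \<in> I" for i unfolding Al_def by (rule \<pi>image[OF AS[OF that]])
  have \<pi>Vl: "\<pi> ` Vl i = embed i ` V" if "i \<in> I" for i unfolding Vl_def by (rule \<pi>image[OF eVS[OF that]])
  have Vc: "v \<in> carrier F" if "v \<in> V" for v using that V(2) L.subset by blast
  define R where "R = {g \<in> carrier \<Phi>. \<forall>i\<in>I. q i g = \<one>\<^bsub>F\<^esub>}"
  have R_ker: "R = kernel \<Phi> GS \<pi>"
  proof -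
    have "(\<forall>i\<in>I. q i g = \<one>\<^bsub>F\<^esub>) \<longleftrightarrow> \<pi> g = \<one>\<^bsub>GS\<^esub>" if g: "g \<in> carrier \<Phi>" for g
    proof
      assume h: "\<forall>i\<in>I. q i g = \<one>\<^bsub>F\<^esub>"
      have "\<pi> g = \<one>\<^bsub>D\<^esub>"
        by (rule D_ext[OF S_carrier[OF \<pi>S[OF g]] D.one_closed]) (use h in \<open>simp add: q_def D_one\<close>)
      then show "\<pi> g = \<one>\<^bsub>GS\<^esub>" unfolding GS_def by simp
    next
      assume "\<pi> g = \<one>\<^bsub>GS\<^esub>"
      then have "\<pi> g = \<one>\<^bsub>D\<^esub>" unfolding GS_def by simp
      then show "\<forall>i\<in>I. q i g = \<one>\<^bsub>F\<^esub>" unfolding q_def by (simp add: D_one)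
    qed
    then show ?thesis unfolding R_def kernel_def by blast
  qed
  have R_diff: "inv\<^bsub>\<Phi>\<^esub> a \<otimes>\<^bsub>\<Phi>\<^esub> g \<in> R" if "a \<in> carrier \<Phi>" "g \<in> carrier \<Phi>" "\<pi> a = \<pi> g" for a g
    using that unfolding R_ker kernel_def by simp
  obtain B where B: "finite B" "B \<subseteq> R" "normal_closure \<Phi> B = R"
  proof (rule \<Phi>.joint_kernel_of_coordinates_normally_finitely_generated[where q = q and \<delta> = \<delta> and A = Al and V = Vl and M = L and X = X,
        OF I(1) G, folded F_def])
    show "q i \<in> hom \<Phi> F" if "i \<in> I" for i by (rule q[OF that])
    show "\<delta> \<in> hom F \<Phi>" by (rule \<delta>)
    show "q i (\<delta> f) = f" if "i \<in> I" "f \<in> carrier F" for i f by (rule q\<delta>[OF that])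
    show "R = {g \<in> carrier \<Phi>. \<forall>i\<in>I. q i g = \<one>\<^bsub>F\<^esub>}" by (rule R_def)
    show "finite (Al i)" if "i \<in> I" for i unfolding Al_def using A(1)[OF that] by simp
    show "Al i \<subseteq> carrier \<Phi>" if "i \<in> I" for i by (rule Alc[OF that])
    show "q i a = \<one>\<^bsub>F\<^esub>" if i: "i \<in> I" and a: "a \<in> Al i" for i a
    proof -
      have "\<pi> a \<in> coordinate_kernel i" using \<pi>Al[OF i] A(2)[OF i] a by blast
      then show ?thesis unfolding q_def coordinate_kernel_def by blast
    qed
    show "\<exists>a\<in>generate \<Phi> (Al i). \<exists>r\<in>R. g = a \<otimes>\<^bsub>\<Phi>\<^esub> r" if i: "i \<in> I" and g: "g \<in> carrier \<Phi>" "q i g = \<one>\<^bsub>F\<^esub>" for i g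
    proof -
      have "\<pi> g \<in> coordinate_kernel i" unfolding coordinate_kernel_def using g(2) \<pi>S[OF g(1)] unfolding q_def by blast
      also have "coordinate_kernel i = \<pi> ` generate \<Phi> (Al i)"
        using \<pi>.generate_img[OF Alc[OF i]] \<pi>Al[OF i] genA[OF i] by simp
      finally obtain a where a: "a \<in> generate \<Phi> (Al i)" "\<pi> g = \<pi> a" by blast
      have ac: "a \<in> carrier \<Phi>" using \<Phi>.generate_in_carrier[OF Alc[OF i] a(1)] .
      have "g = a \<otimes>\<^bsub>\<Phi>\<^esub> (inv\<^bsub>\<Phi>\<^esub> a \<otimes>\<^bsub>\<Phi>\<^esub> g)" using ac g(1) by simp
      then show ?thesis using a(1) R_diff[OF ac g(1) a(2)[symmetric]] by blast
    qed
    show "finite (Vl i)" if "i \<in> I" for i unfolding Vl_def using V(1) by simp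
    show "Vl i \<subseteq> carrier \<Phi>" if "i \<in> I" for i by (rule Vlc[OF that])
    show "q j v = \<one>\<^bsub>F\<^esub>" if ij: "i \<in> I" "j \<in> I" "i \<noteq> j" and v: "v \<in> Vl i" for i j v
    proof -
      obtain w where "w \<in> V" "\<pi> v = embed i w" using \<pi>Vl[OF ij(1)] v by blast
      then show ?thesis unfolding q_def using ij by (simp add: embed_coord)
    qed
    show "L \<lhd> F" by (rule L.normal_axioms)
    show "polycyclic_over F L (carrier F)" by (rule L_polycyclic)
    show "normal_closure F (q i ` Vl i) = L" if i: "i \<in> I" for i
    proof -
      have "q i ` Vl i = (\<lambda>s. s i) ` \<pi> ` Vl i" unfolding q_def image_image ..
      also have "\<dots> = (\<lambda>w. embed i w i) ` V" unfolding \<pi>Vl[OF i] image_image ..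
      also have "\<dots> = V" by (simp add: embed_coord[OF i])
      finally show ?thesis using V(3) by simp
    qed
    show "\<exists>v\<in>normal_closure \<Phi> (\<Union>i\<in>I. Vl i). \<exists>r\<in>R. g = v \<otimes>\<^bsub>\<Phi>\<^esub> r" if g: "g \<in> carrier \<Phi>" "\<And>i. i \<in> I \<Longrightarrow> q i g \<in> L" for g
    proof -
      have Uc: "(\<Union>i\<in>I. Vl i) \<subseteq> carrier \<Phi>" using Vlc by blast
      define N where "N = normal_closure \<Phi> (\<Union>i\<in>I. Vl i)"
      interpret N: normal N \<Phi> unfolding N_def by (rule \<Phi>.normal_closure_normal[OF Uc])
      have \<pi>GS: "\<pi> ` carrier \<Phi> = carrier GS" unfolding GSc by (rule \<pi>surj)
      \<comment> \<open>Conjugation by the diagonal makes the part of L that is embedded into this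
        image a normal subgroup of F. It contains \<open>V\<close>, hence all of L, and
        \<open>decompose\<close> reaches every element with entries in L.\<close>
      define B where "B = \<pi> ` N"
      have Bn: "B \<lhd> GS" unfolding B_def by (rule GS.image_normal[OF \<Phi>.is_group \<pi>hom \<pi>GS N.normal_axioms])
      interpret B: normal B GS by (rule Bn)
      have BS: "B \<subseteq> S" using B.subset unfolding GSc .
      have BD: "subgroup B D"
        using D.incl_subgroup[OF S] B.is_subgroup unfolding GS_def by blast
      have LB: "embed i w \<in> B" if i: "i \<in> I" and w: "w \<in> L" for i w
      proof -
        let ?H = "{w \<in> L. embed i w \<in> B}"
        have "?H \<lhd> F"
        proof (rule F.normal_invI)
          show "subgroup ?H F" by (rule D.subgroup_vimage[OF F.is_group embed_hom BD L.is_subgroup])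
          fix x w assume x: "x \<in> carrier F" and w: "w \<in> ?H"
          have wc: "w \<in> carrier F" using w by simp
          have dx: "diag x \<in> carrier GS" unfolding GSc by (rule diag_S[OF x])
          have "diag x \<otimes>\<^bsub>GS\<^esub> embed i w \<otimes>\<^bsub>GS\<^esub> inv\<^bsub>GS\<^esub> diag x \<in> B" using B.inv_op_closed2[OF dx] w by blast
          moreover have "inv\<^bsub>GS\<^esub> diag x = inv\<^bsub>D\<^esub> diag x"
            unfolding GS_def using D.m_inv_consistent[OF S diag_S[OF x]] by simp
          ultimately have "diag x \<otimes>\<^bsub>D\<^esub> embed i w \<otimes>\<^bsub>D\<^esub> inv\<^bsub>D\<^esub> diag x \<in> B" unfolding GS_def by simp
          then have "embed i (x \<otimes>\<^bsub>F\<^esub> w \<otimes>\<^bsub>F\<^esub> inv\<^bsub>F\<^esub> x) \<in> B"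
            unfolding embed_conj[OF diag_carrier[OF x] wc i] diag_coord[OF i] .
          then show "x \<otimes>\<^bsub>F\<^esub> w \<otimes>\<^bsub>F\<^esub> inv\<^bsub>F\<^esub> x \<in> ?H" using L.inv_op_closed2[OF x] w by blast
        qed
        moreover have "V \<subseteq> ?H"
        proof
          fix v assume v: "v \<in> V"
          then obtain g where g: "g \<in> Vl i" "\<pi> g = embed i v" using \<pi>Vl[OF i] by (metis imageE imageI)
          have "g \<in> N" unfolding N_def using \<Phi>.normal_closure_incl[of "\<Union>i\<in>I. Vl i"] g(1) i by blast
          then have "embed i v \<in> B" unfolding B_def using g(2) by (metis imageI)
          then show "v \<in> ?H" using v V(2) by blast
        qed
        ultimately have "L \<subseteq> ?H" using F.normal_closure_least[of ?H V] V(3) by blast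
        then show ?thesis using w by blast
      qed
      have "\<pi> g \<in> B"
      proof (rule decompose[OF BD S_carrier[OF \<pi>S[OF g(1)]]])
        fix i assume i: "i \<in> I"
        show "embed i (\<pi> g i) \<in> B" using LB[OF i] g(2)[OF i] unfolding q_def by blast
      qed
      then obtain v where v: "v \<in> N" "\<pi> g = \<pi> v" unfolding B_def by blast
      have vc: "v \<in> carrier \<Phi>" using v(1) by simp
      have "g = v \<otimes>\<^bsub>\<Phi>\<^esub> (inv\<^bsub>\<Phi>\<^esub> v \<otimes>\<^bsub>\<Phi>\<^esub> g)" using vc g(1) by simp
      then show ?thesis using v(1) R_diff[OF vc g(1) v(2)[symmetric]] unfolding N_def by blast
    qed
  next
    fix B assume "finite B" "B \<subseteq> R" "normal_closure \<Phi> B = R"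
    then show thesis by (rule that)
  qed
  have "\<Phi> Mod normal_closure \<Phi> B \<cong> GS"
    unfolding B(3) R_ker by (rule \<pi>.FactGroup_iso) (simp add: GSc \<pi>surj)
  moreover have "group (\<Phi> Mod normal_closure \<Phi> B)"
    unfolding B(3) R_ker by (rule normal.factorgroup_is_group[OF \<pi>.normal_kernel])
  ultimately have "GS \<cong> \<Phi> Mod normal_closure \<Phi> B" by (simp add: group.iso_sym)
  moreover have "B \<subseteq> carrier \<Phi>" using B(2) unfolding R_def by blast
  ultimately show ?thesis
    unfolding finitely_presented_def GS_def[symmetric] using GS.is_group B(1) unfolding \<Phi>_def by blast
qed

end

section \<open>The subgroup of the product\<close>

text \<open>The condition a b^-1 \<in> H is congruence modulo H. The rules for products, inverses
  and powers make the set \<open>S\<close> below a subgroup.\<close>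

lemma (in normal) cong_mult:
  assumes "a \<in> carrier G" "b \<in> carrier G" "a' \<in> carrier G" "b' \<in> carrier G" "a \<otimes> inv b \<in> H" "a' \<otimes> inv b' \<in> H"
  shows "(a \<otimes> a') \<otimes> inv (b \<otimes> b') \<in> H"
proof -
  have "(a \<otimes> (a' \<otimes> inv b') \<otimes> inv a) \<otimes> (a \<otimes> inv b) \<in> H"
    by (rule subgroup.m_closed[OF subgroup_axioms inv_op_closed2[OF assms(1,6)] assms(5)])
  then show ?thesis using assms by (simp add: m_assoc inv_mult_group)
qed

lemma (in normal) cong_inv:
  assumes "a \<in> carrier G" "b \<in> carrier G" "a \<otimes> inv b \<in> H"
  shows "inv a \<otimes> inv (inv b) \<in> H"
proof -
  have "inv a \<otimes> inv (a \<otimes> inv b) \<otimes> a \<in> H"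
    by (rule inv_op_closed1[OF assms(1) m_inv_closed[OF assms(3)]])
  then show ?thesis using assms(1,2) by (simp add: m_assoc inv_mult_group)
qed

lemma (in normal) cong_pow:
  assumes "a \<in> carrier G" "b \<in> carrier G" "a \<otimes> inv b \<in> H"
  shows "a [^] (n::nat) \<otimes> inv (b [^] n) \<in> H"
proof (induction n)
  case (Suc n)
  then show ?case using cong_mult[of "a [^] n" "b [^] n" a b] assms by simp
qed simp

lemma finitely_presented_iso:
  assumes "finitely_presented G" "G \<cong> H" "group H"
  shows "finitely_presented H"
  using assms iso_trans[OF group.iso_sym[of G H]] unfolding finitely_presented_def by blast

proposition exists_subdirect_power:
  fixes c n :: nat
  assumes n: "c + 2 \<le> n"
  defines "F \<equiv> free_group {..<2::nat}"
  defines "D \<equiv> product_group {1..n} (\<lambda>_. F)"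
  shows "\<exists>S. subgroup S D \<and> finitely_presented (D\<lparr>carrier := S\<rparr>) \<and>
    (\<forall>i\<in>{1..n}. \<forall>a\<in>carrier F. factor_embed {1..n} (\<lambda>_. F) i a \<in> S \<longleftrightarrow> a \<in> lower_central F (Suc c))"
proof -
  define A where "A = free_group {..<4::nat}"
  define gx where "gx a = [(a, True)]" for a :: nat
  interpret F: group F unfolding F_def by (rule group_free_group)
  interpret A: group A unfolding A_def by (rule group_free_group)
  interpret D: group D unfolding D_def by (rule product_group) (rule F.is_group)
  have gxF: "gx a \<in> carrier F" if "a < 2" for a unfolding gx_def F_def by (rule free_group_letter) (simp add: that)
  have gxA: "gx a \<in> carrier A" if "a < 4" for a unfolding gx_def A_def by (rule free_group_letter) (simp add: that)
  \<comment> \<open>The generators 0, 1 are x, y and 2, 3 are x', y'. As i starts from 0 the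
    exponent is \<open>Suc i\<close>: coordinate j of the product uses
    \<open>\<phi> (j - 1)\<close>, which sends x' to x^j.\<close>
  define \<phi> where "\<phi> i = free_lift F (\<lambda>a. if a < 2 then gx a else gx (a - 2) [^]\<^bsub>F\<^esub> Suc i)" for i
  define \<alpha> where "\<alpha> = free_lift A (\<lambda>a. gx a [^]\<^bsub>A\<^esub> (2::nat))"
  define \<beta> where "\<beta> = free_lift F (\<lambda>a. gx a [^]\<^bsub>F\<^esub> (2::nat))"
  \<comment> \<open>A common section of all the maps \<open>\<phi> i\<close>, since these fix x and
    y. Words in its image place the diagonal in \<open>S\<close>.\<close>
  define \<iota> where "\<iota> = free_lift A gx"
  have \<phi>c: "(if a < 2 then gx a else gx (a - 2) [^]\<^bsub>F\<^esub> Suc i) \<in> carrier F" if "a < 4" for a i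
  proof (cases "a < 2")
    case False
    then have "a - 2 < 2" using that by linarith
    then show ?thesis using False F.nat_pow_closed[OF gxF, of "a - 2" "Suc i"] by (simp del: nat_pow_Suc)
  qed (simp add: gxF)
  have \<phi>: "\<phi> i \<in> hom A F" for i unfolding \<phi>_def A_def by (rule F.free_lift_hom) (use \<phi>c in blast)
  have \<alpha>: "\<alpha> \<in> hom A A" unfolding \<alpha>_def by (subst (1) A_def, rule A.free_lift_hom) (use gxA in auto)
  have \<beta>: "\<beta> \<in> hom F F" unfolding \<beta>_def by (subst (1) F_def, rule F.free_lift_hom) (use gxF in auto)
  have \<iota>: "\<iota> \<in> hom F A" unfolding \<iota>_def F_def by (rule A.free_lift_hom) (use gxA in auto)
  have \<phi>gx: "\<phi> i (gx a) = (if a < 2 then gx a else gx (a - 2) [^]\<^bsub>F\<^esub> Suc i)" if "a < 4" for i a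
    unfolding \<phi>_def gx_def[of a] by (subst F.free_lift_generator) (use \<phi>c[OF that] in \<open>simp_all add: gx_def\<close>)
  have \<alpha>gx: "\<alpha> (gx a) = gx a [^]\<^bsub>A\<^esub> (2::nat)" if "a < 4" for a
    unfolding \<alpha>_def gx_def[of a] by (subst A.free_lift_generator) (use gxA[OF that] in \<open>simp_all add: gx_def\<close>)
  have \<beta>gx: "\<beta> (gx a) = gx a [^]\<^bsub>F\<^esub> (2::nat)" if "a < 2" for a
    unfolding \<beta>_def gx_def[of a] by (subst F.free_lift_generator) (use gxF[OF that] in \<open>simp_all add: gx_def\<close>)
  have \<iota>gx: "\<iota> (gx a) = gx a" if "a < 2" for a
    unfolding \<iota>_def gx_def[of a] by (subst A.free_lift_generator) (use gxA that in \<open>simp_all add: gx_def\<close>)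
  have genF: "finite (gx ` {..<2})" "gx ` {..<2} \<subseteq> carrier F" "generate F (gx ` {..<2}) = carrier F"
    using gxF generate_free_group[of "{..<2::nat}"] unfolding F_def gx_def[abs_def] by auto
  have genA: "gx ` {..<4} \<subseteq> carrier A" "generate A (gx ` {..<4}) = carrier A"
    using gxA generate_free_group[of "{..<4::nat}"] unfolding A_def gx_def[abs_def] by auto
  interpret \<beta>: group_hom F F \<beta> using \<beta> by (simp add: group_hom_def group_hom_axioms_def F.is_group)
  interpret \<alpha>: group_hom A A \<alpha> using \<alpha> by (simp add: group_hom_def group_hom_axioms_def A.is_group)
  interpret \<iota>: group_hom F A \<iota> using \<iota> by (simp add: group_hom_def group_hom_axioms_def A.is_group F.is_group)
  interpret \<phi>: group_hom A F "\<phi> i" for i using \<phi> by (simp add: group_hom_def group_hom_axioms_def A.is_group F.is_group)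
  \<comment> \<open>It suffices to compare on generators. Each of them goes to a power of a
    generator of F, and squaring commutes with taking that power.\<close>
  have \<phi>\<alpha>: "\<phi> i (\<alpha> w) = \<beta> (\<phi> i w)" if w: "w \<in> carrier A" for i w
  proof -
    have h1: "(\<lambda>w. \<phi> i (\<alpha> w)) \<in> hom A F" by (rule homI) simp_all
    have h2: "(\<lambda>w. \<beta> (\<phi> i w)) \<in> hom A F" by (rule homI) simp_all
    have "\<phi> i (\<alpha> x) = \<beta> (\<phi> i x)" if x: "x \<in> gx ` {..<4}" for x
    proof -
      obtain a where a: "a < 4" "x = gx a" using x by blast
      have l: "\<phi> i (\<alpha> x) = \<phi> i (gx a) [^]\<^bsub>F\<^esub> (2::nat)" unfolding a(2) \<alpha>gx[OF a(1)] by (rule \<phi>.hom_nat_pow[OF gxA[OF a(1)]])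
      show ?thesis
      proof (cases "a < 2")
        case True
        then show ?thesis unfolding l unfolding a(2) \<phi>gx[OF a(1)] by (simp add: \<beta>gx)
      next
        case False
        then have b: "a - 2 < 2" using a(1) by linarith
        have "\<beta> (gx (a - 2) [^]\<^bsub>F\<^esub> Suc i) = (gx (a - 2) [^]\<^bsub>F\<^esub> (2::nat)) [^]\<^bsub>F\<^esub> Suc i"
          unfolding \<beta>.hom_nat_pow[OF gxF[OF b]] \<beta>gx[OF b] ..
        also have "\<dots> = (gx (a - 2) [^]\<^bsub>F\<^esub> Suc i) [^]\<^bsub>F\<^esub> (2::nat)"
          by (simp only: F.nat_pow_pow[OF gxF[OF b]] mult.commute)
        finally show ?thesis using False unfolding l unfolding a(2) \<phi>gx[OF a(1)] by (simp del: nat_pow_Suc)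
      qed
    qed
    then show ?thesis using A.hom_eq_on_generate[OF F.is_group h1 h2 genA(1), of w] w genA(2) by blast
  qed
  have \<phi>\<iota>: "\<phi> i (\<iota> f) = f" if f: "f \<in> carrier F" for i f
  proof -
    have h1: "(\<lambda>w. \<phi> i (\<iota> w)) \<in> hom F F" by (rule homI) simp_all
    have h2: "(\<lambda>w. w) \<in> hom F F" by (rule homI) simp_all
    have "\<phi> i (\<iota> x) = x" if x: "x \<in> gx ` {..<2}" for x
    proof -
      obtain a where a: "a < 2" "x = gx a" using x by blast
      show ?thesis unfolding a(2) \<iota>gx[OF a(1)] using \<phi>gx[of a i] a(1) by simp
    qed
    then show ?thesis using F.hom_eq_on_generate[OF F.is_group h1 h2 genF(2), of f] f genF(3) by blast
  qed
  interpret CF: coordinate_family A F "gx ` {..<4}" "gx ` {..<2}" \<alpha> \<beta> \<phi> n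
  proof (intro coordinate_family.intro coordinate_family_axioms.intro A.is_group F.is_group genA genF(2,3) \<alpha> \<beta> \<phi> \<phi>\<alpha>)
    show "\<alpha> x = x [^]\<^bsub>A\<^esub> (2::nat)" if "x \<in> gx ` {..<4}" for x using that \<alpha>gx by blast
    show "\<beta> x = x [^]\<^bsub>F\<^esub> (2::nat)" if "x \<in> gx ` {..<2}" for x using that \<beta>gx by blast
    show "\<exists>b\<in>carrier F. (\<forall>i<n. \<phi> i x = b) \<or> (\<forall>i<n. \<phi> i x = b [^]\<^bsub>F\<^esub> Suc i)" if x: "x \<in> gx ` {..<4}" for x
    proof -
      obtain a where a: "a < 4" "x = gx a" using x by blast
      show ?thesis
      proof (cases "a < 2")
        case True
        then have "\<forall>i<n. \<phi> i x = gx a" using \<phi>gx[OF a(1)] a(2) by simp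
        then show ?thesis using gxF[OF True] by blast
      next
        case False
        then have b: "a - 2 < 2" using a(1) by linarith
        have "\<forall>i<n. \<phi> i x = gx (a - 2) [^]\<^bsub>F\<^esub> Suc i" using \<phi>gx[OF a(1)] a(2) False by (simp del: nat_pow_Suc)
        then show ?thesis using gxF[OF b] by blast
      qed
    qed
    show "2 \<le> n" using n by simp
  qed
  define L where "L = lower_central F (Suc c)"
  interpret L: normal L F unfolding L_def by (rule F.lower_central_normal)
  obtain U where U: "U \<lhd> F" "L \<subseteq> U" "\<And>u r. \<lbrakk>u \<in> U; 0 < (r::nat); u [^]\<^bsub>F\<^esub> r \<in> L\<rbrakk> \<Longrightarrow> u \<in> L"
    "\<And>g. g \<in> carrier F \<Longrightarrow> \<exists>r::nat. 0 < r \<and> g [^]\<^bsub>F\<^esub> r \<in> U"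
    unfolding L_def by (rule F.torsion_free_complement[OF genF, of c]) blast
  interpret U: normal U F by (rule U(1))
  define I where "I = {1..n}"
  define S where "S = {s \<in> carrier D. (\<exists>w\<in>carrier A. \<forall>j\<in>I. s j \<otimes>\<^bsub>F\<^esub> inv\<^bsub>F\<^esub> (\<phi> (j - 1) w) \<in> L) \<and>
    (\<forall>i\<in>I. \<forall>j\<in>I. s i \<otimes>\<^bsub>F\<^esub> inv\<^bsub>F\<^esub> (s j) \<in> U)}"
  have cD: "s j \<in> carrier F" if "s \<in> carrier D" "j \<in> I" for s j using that unfolding D_def I_def by auto
  have mD: "(s \<otimes>\<^bsub>D\<^esub> t) j = s j \<otimes>\<^bsub>F\<^esub> t j" if "j \<in> I" for s t j using that unfolding D_def I_def by simp
  have iD: "(inv\<^bsub>D\<^esub> s) j = inv\<^bsub>F\<^esub> (s j)" if "s \<in> carrier D" "j \<in> I" for s j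
    using that inv_product_group[of s "{1..n}" "\<lambda>_. F"] F.is_group unfolding D_def I_def by simp
  have SI: "s \<in> S" if "s \<in> carrier D" "w \<in> carrier A" "\<And>j. j \<in> I \<Longrightarrow> s j \<otimes>\<^bsub>F\<^esub> inv\<^bsub>F\<^esub> (\<phi> (j - 1) w) \<in> L"
    "\<And>i j. i \<in> I \<Longrightarrow> j \<in> I \<Longrightarrow> s i \<otimes>\<^bsub>F\<^esub> inv\<^bsub>F\<^esub> (s j) \<in> U" for s w
    unfolding S_def using that by blast
  have oneS: "\<one>\<^bsub>D\<^esub> \<in> S"
    by (rule SI[OF D.one_closed A.one_closed]) (simp_all add: D_def I_def)
  have S: "subgroup S D"
  proof (rule D.subgroupI)
    show "S \<subseteq> carrier D" unfolding S_def by blast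
    show "S \<noteq> {}" using oneS by blast
    fix a assume "a \<in> S"
    then obtain w where a: "a \<in> carrier D" "w \<in> carrier A" "\<And>j. j \<in> I \<Longrightarrow> a j \<otimes>\<^bsub>F\<^esub> inv\<^bsub>F\<^esub> (\<phi> (j - 1) w) \<in> L"
      "\<And>i j. i \<in> I \<Longrightarrow> j \<in> I \<Longrightarrow> a i \<otimes>\<^bsub>F\<^esub> inv\<^bsub>F\<^esub> (a j) \<in> U" unfolding S_def by blast
    show "inv\<^bsub>D\<^esub> a \<in> S"
    proof (rule SI[OF D.inv_closed[OF a(1)] A.inv_closed[OF a(2)]])
      fix j assume j: "j \<in> I"
      show "(inv\<^bsub>D\<^esub> a) j \<otimes>\<^bsub>F\<^esub> inv\<^bsub>F\<^esub> (\<phi> (j - 1) (inv\<^bsub>A\<^esub> w)) \<in> L"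
        unfolding iD[OF a(1) j] \<phi>.hom_inv[OF a(2)] by (rule L.cong_inv[OF cD[OF a(1) j] \<phi>.hom_closed[OF a(2)] a(3)[OF j]])
    next
      fix i j assume i: "i \<in> I" and j: "j \<in> I"
      show "(inv\<^bsub>D\<^esub> a) i \<otimes>\<^bsub>F\<^esub> inv\<^bsub>F\<^esub> ((inv\<^bsub>D\<^esub> a) j) \<in> U"
        unfolding iD[OF a(1) i] iD[OF a(1) j] by (rule U.cong_inv[OF cD[OF a(1) i] cD[OF a(1) j] a(4)[OF i j]])
    qed
    fix b assume "b \<in> S"
    then obtain v where b: "b \<in> carrier D" "v \<in> carrier A" "\<And>j. j \<in> I \<Longrightarrow> b j \<otimes>\<^bsub>F\<^esub> inv\<^bsub>F\<^esub> (\<phi> (j - 1) v) \<in> L"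
      "\<And>i j. i \<in> I \<Longrightarrow> j \<in> I \<Longrightarrow> b i \<otimes>\<^bsub>F\<^esub> inv\<^bsub>F\<^esub> (b j) \<in> U" unfolding S_def by blast
    show "a \<otimes>\<^bsub>D\<^esub> b \<in> S"
    proof (rule SI[OF D.m_closed[OF a(1) b(1)] A.m_closed[OF a(2) b(2)]])
      fix j assume j: "j \<in> I"
      show "(a \<otimes>\<^bsub>D\<^esub> b) j \<otimes>\<^bsub>F\<^esub> inv\<^bsub>F\<^esub> (\<phi> (j - 1) (w \<otimes>\<^bsub>A\<^esub> v)) \<in> L"
        unfolding mD[OF j] \<phi>.hom_mult[OF a(2) b(2)]
        by (rule L.cong_mult[OF cD[OF a(1) j] \<phi>.hom_closed[OF a(2)] cD[OF b(1) j] \<phi>.hom_closed[OF b(2)] a(3)[OF j] b(3)[OF j]])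
    next
      fix i j assume i: "i \<in> I" and j: "j \<in> I"
      show "(a \<otimes>\<^bsub>D\<^esub> b) i \<otimes>\<^bsub>F\<^esub> inv\<^bsub>F\<^esub> ((a \<otimes>\<^bsub>D\<^esub> b) j) \<in> U"
        unfolding mD[OF i] mD[OF j]
        by (rule U.cong_mult[OF cD[OF a(1) i] cD[OF a(1) j] cD[OF b(1) i] cD[OF b(1) j] a(4)[OF i j] b(4)[OF i j]])
    qed
  qed
  let ?embed = "factor_embed I (\<lambda>_. F)"
  have ecoord: "?embed i a j = (if j = i then a else \<one>\<^bsub>F\<^esub>)" if "j \<in> I" for i j a
    using that unfolding factor_embed_def by simp
  have ecar: "?embed i a \<in> carrier D" if "a \<in> carrier F" for i a
    using that unfolding factor_embed_def D_def I_def by auto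
  have embed_in: "?embed i m \<in> S" if i: "i \<in> I" and m: "m \<in> L" for i m
  proof (rule SI[OF ecar[OF L.mem_carrier[OF m]] A.one_closed])
    have mc: "m \<in> carrier F" using m by simp
    fix j assume j: "j \<in> I"
    show "?embed i m j \<otimes>\<^bsub>F\<^esub> inv\<^bsub>F\<^esub> (\<phi> (j - 1) \<one>\<^bsub>A\<^esub>) \<in> L" using m mc j by (simp add: ecoord)
  next
    have mU: "m \<in> U" using m U(2) by blast
    fix j k assume "j \<in> I" "k \<in> I"
    then show "?embed i m j \<otimes>\<^bsub>F\<^esub> inv\<^bsub>F\<^esub> (?embed i m k) \<in> U" using mU by (simp add: ecoord)
  qed
  have DI: "D = product_group I (\<lambda>_. F)" unfolding D_def I_def ..
  have "subdirect_power {..<2::nat} I S L c"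
  proof (rule subdirect_power.intro, fold F_def, fold DI)
    show "finite {..<2::nat}" "finite I" by (simp_all add: I_def)
    show "I \<noteq> {}" using n unfolding I_def by simp
    show "L = lower_central F (Suc c)" by (rule L_def)
    show "subgroup S D" by (rule S)
    show "(\<lambda>j\<in>I. f) \<in> S" if f: "f \<in> carrier F" for f
    proof (rule SI[OF _ \<iota>.hom_closed[OF f]])
      show "(\<lambda>j\<in>I. f) \<in> carrier D" using f unfolding D_def I_def by auto
    qed (use f \<phi>\<iota>[OF f] in simp_all)
    show "?embed i m \<in> S" if "i \<in> I" "m \<in> L" for i m by (rule embed_in[OF that])
    fix i j x assume ij: "i \<in> I" "j \<in> I" "i \<noteq> j" and "x \<in> (\<lambda>x. [(x, True)]) ` {..<2::nat}"
    then obtain a where a: "a < 2" "x = gx a" unfolding gx_def by blast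
    have xc: "x \<in> carrier F" unfolding a(2) by (rule gxF[OF a(1)])
    obtain r :: nat where r: "0 < r" "x [^]\<^bsub>F\<^esub> r \<in> U" using U(4)[OF xc] by blast
    \<comment> \<open>The word w = x'^e x^(-ej) has the value x^(e(k-j)) in coordinate k, hence is
      trivial for k = j. Since r divides e and x^r lies in \<open>U\<close>, all values are
      congruent modulo \<open>U\<close>; the sign makes the exponent in coordinate i
      positive.\<close>
    define e where "e = (if j < i then int r else - int r)"
    define s where "s = (\<lambda>k\<in>I. x [^]\<^bsub>F\<^esub> (e * (int k - int j)))"
    have ac: "gx a \<in> carrier A" "gx (a + 2) \<in> carrier A" using gxA a(1) by simp_all
    define w where "w = gx (a + 2) [^]\<^bsub>A\<^esub> e \<otimes>\<^bsub>A\<^esub> gx a [^]\<^bsub>A\<^esub> (- (e * int j))"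
    have wc: "w \<in> carrier A" unfolding w_def using ac by simp
    have \<phi>w: "\<phi> (k - 1) w = x [^]\<^bsub>F\<^esub> (e * (int k - int j))" if k: "k \<in> I" for k
    proof -
      have k1: "Suc (k - 1) = k" using k unfolding I_def by simp
      have p1: "\<phi> (k - 1) (gx (a + 2)) = x [^]\<^bsub>F\<^esub> int k"
        using \<phi>gx[of "a + 2" "k - 1"] a unfolding k1 int_pow_int by simp
      have p2: "\<phi> (k - 1) (gx a) = x" using \<phi>gx[of a "k - 1"] a by simp
      have "\<phi> (k - 1) w = (x [^]\<^bsub>F\<^esub> int k) [^]\<^bsub>F\<^esub> e \<otimes>\<^bsub>F\<^esub> x [^]\<^bsub>F\<^esub> (- (e * int j))"
        unfolding w_def using ac \<phi>.hom_mult[of "gx (a + 2) [^]\<^bsub>A\<^esub> e" "gx a [^]\<^bsub>A\<^esub> (- (e * int j))" "k - 1"]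
        by (simp only: A.int_pow_closed \<phi>.hom_int_pow p1 p2)
      also have "\<dots> = x [^]\<^bsub>F\<^esub> (int k * e + - (e * int j))"
        by (simp only: F.int_pow_pow[OF xc] F.int_pow_mult[OF xc])
      also have "int k * e + - (e * int j) = e * (int k - int j)" by (simp add: algebra_simps)
      finally show ?thesis .
    qed
    have sS: "s \<in> S"
    proof (rule SI[OF _ wc])
      show "s \<in> carrier D" unfolding s_def D_def I_def using xc by auto
      fix k assume k: "k \<in> I"
      show "s k \<otimes>\<^bsub>F\<^esub> inv\<^bsub>F\<^esub> (\<phi> (k - 1) w) \<in> L" unfolding \<phi>w[OF k] s_def using k xc by simp
      fix l assume l: "l \<in> I"
      have "s k \<otimes>\<^bsub>F\<^esub> inv\<^bsub>F\<^esub> (s l) = x [^]\<^bsub>F\<^esub> (e * (int k - int j) - e * (int l - int j))"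
        unfolding s_def using k l by (simp only: restrict_apply if_True F.int_pow_diff[OF xc])
      also have "e * (int k - int j) - e * (int l - int j) = int r * (if j < i then int k - int l else int l - int k)"
        unfolding e_def by (simp add: algebra_simps)
      also have "x [^]\<^bsub>F\<^esub> (int r * (if j < i then int k - int l else int l - int k))
          = (x [^]\<^bsub>F\<^esub> r) [^]\<^bsub>F\<^esub> (if j < i then int k - int l else int l - int k)"
        by (simp only: F.int_pow_pow[OF xc, symmetric] int_pow_int)
      also have "\<dots> \<in> U" by (rule F.subgroup_int_pow_closed[OF U.is_subgroup r(2)])
      finally show "s k \<otimes>\<^bsub>F\<^esub> inv\<^bsub>F\<^esub> (s l) \<in> U" .
    qed
    have sj: "s j = \<one>\<^bsub>F\<^esub>" unfolding s_def using ij(2) by simp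
    define p where "p = nat (e * (int i - int j))"
    have pos: "0 < e * (int i - int j)" unfolding e_def using r(1) ij(3) by (auto intro: mult_pos_neg)
    then have p: "0 < p" "e * (int i - int j) = int p" unfolding p_def by auto
    have "s i = x [^]\<^bsub>F\<^esub> p" unfolding s_def using ij(1) by (simp only: restrict_apply if_True p(2) int_pow_int)
    then show "\<exists>s\<in>S. s j = \<one>\<^bsub>F\<^esub> \<and> (\<exists>r::nat. 0 < r \<and> s i = x [^]\<^bsub>F\<^esub> r)" using sS sj p(1) by blast
  qed
  then have fp: "finitely_presented (D\<lparr>carrier := S\<rparr>)"
    using subdirect_power.subdirect_power_finitely_presented unfolding D_def F_def I_def by blast
  have "?embed i a \<in> S \<longleftrightarrow> a \<in> L" if i: "i \<in> I" and a: "a \<in> carrier F" for i a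
  proof
    assume "?embed i a \<in> S"
    then obtain w where w: "w \<in> carrier A" "\<And>j. j \<in> I \<Longrightarrow> ?embed i a j \<otimes>\<^bsub>F\<^esub> inv\<^bsub>F\<^esub> (\<phi> (j - 1) w) \<in> L"
      and u: "\<And>k j. k \<in> I \<Longrightarrow> j \<in> I \<Longrightarrow> ?embed i a k \<otimes>\<^bsub>F\<^esub> inv\<^bsub>F\<^esub> (?embed i a j) \<in> U" unfolding S_def by blast
    have i1: "i - 1 < n" using i unfolding I_def by auto
    have oth: "\<phi> k w \<in> L" if k: "k < n" "k \<noteq> i - 1" for k
    proof -
      have kI: "Suc k \<in> I" "Suc k \<noteq> i" using k unfolding I_def by auto
      have "inv\<^bsub>F\<^esub> (\<phi> k w) \<in> L" using w(2)[OF kI(1)] kI(2) w(1) by (simp add: ecoord[OF kI(1)])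
      from L.m_inv_closed[OF this] show ?thesis using w(1) by simp
    qed
    have "c \<le> n - 2" using n by simp
    then obtain M :: nat where M: "0 < M" "\<phi> (i - 1) w [^]\<^bsub>F\<^esub> M \<in> L"
      using CF.isolated_coordinate_torsion[of c "i - 1" w] i1 w(1) oth unfolding L_def by blast
    have \<phi>c: "\<phi> (i - 1) w \<in> carrier F" using w(1) by simp
    have "a \<otimes>\<^bsub>F\<^esub> inv\<^bsub>F\<^esub> (\<phi> (i - 1) w) \<in> L" using w(2)[OF i] by (simp add: ecoord[OF i])
    then have "a [^]\<^bsub>F\<^esub> M \<otimes>\<^bsub>F\<^esub> inv\<^bsub>F\<^esub> (\<phi> (i - 1) w [^]\<^bsub>F\<^esub> M) \<in> L" by (rule L.cong_pow[OF a \<phi>c])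
    from L.m_closed[OF this M(2)] have aM: "a [^]\<^bsub>F\<^esub> M \<in> L" using a \<phi>c by (simp add: F.m_assoc)
    \<comment> \<open>A second coordinate exists because n is at least 2. Comparing with its trivial
      entry shows that a lies in \<open>U\<close>, where torsion modulo \<open>L\<close> is
      excluded.\<close>
    obtain j where j: "j \<in> I" "j \<noteq> i"
    proof (cases "i = 1")
      case True
      then show ?thesis using n by (intro that[of 2]) (auto simp: I_def)
    next
      case False
      then show ?thesis using n by (intro that[of 1]) (auto simp: I_def)
    qed
    have "a \<in> U" using u[OF i j(1)] j a by (simp add: ecoord[OF i] ecoord[OF j(1)])
    then show "a \<in> L" using U(3) M(1) aM by blast
  next
    assume "a \<in> L"
    then show "?embed i a \<in> S" by (rule embed_in[OF i])
  qed
  then show ?thesis using S fp unfolding I_def L_def by blast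
qed

section \<open>Transfer to arbitrary free groups of rank 2\<close>

theorem theoremH:
  fixes c n :: nat and F :: "nat \<Rightarrow> ('a, 'b) monoid_scheme"
  assumes "c \<ge> 1" and "n \<ge> 1" and "n \<ge> c + 2"
    and "\<And>i. i \<in> {1..n} \<Longrightarrow> is_free_of_rank (F i) 2"
  shows "\<exists>S. subgroup S (product_group {1..n} F) \<and>
    finitely_presented (product_group {1..n} F \<lparr>carrier := S\<rparr>) \<and>
    (\<forall>i\<in>{1..n}. S \<inter> factor_embed {1..n} F i ` carrier (F i) =
       factor_embed {1..n} F i ` lower_central (F i) (c + 1))"
proof -
  define F2 where "F2 = free_group {..<2::nat}"
  define D where "D = product_group {1..n} (\<lambda>_. F2)"
  define D' where "D' = product_group {1..n} F"
  interpret F2: group F2 unfolding F2_def by (rule group_free_group)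
  interpret D: group D unfolding D_def by (rule product_group) (rule F2.is_group)
  have Fg: "group (F i)" if "i \<in> {1..n}" for i using assms(4)[OF that] unfolding is_free_of_rank_def by blast
  interpret D': group D' unfolding D'_def by (rule product_group) (rule Fg)
  have "\<exists>\<psi>. \<psi> \<in> iso F2 (F i)" if "i \<in> {1..n}" for i
    using assms(4)[OF that] group.iso_sym[OF Fg[OF that]] unfolding is_free_of_rank_def F2_def is_iso_def by blast
  then have "\<forall>i\<in>{1..n}. \<exists>\<psi>. \<psi> \<in> iso F2 (F i)" by blast
  then obtain \<psi> where \<psi>': "\<forall>i\<in>{1..n}. \<psi> i \<in> iso F2 (F i)" by (rule bchoice[THEN exE])
  then have \<psi>: "\<psi> i \<in> hom F2 (F i)" "inj_on (\<psi> i) (carrier F2)" "\<psi> i ` carrier F2 = carrier (F i)" if "i \<in> {1..n}" for i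
    using that unfolding iso_def bij_betw_def by auto
  define \<Psi> where "\<Psi> s = (\<lambda>i\<in>{1..n}. \<psi> i (s i))" for s
  have cD: "s i \<in> carrier F2" if "s \<in> carrier D" "i \<in> {1..n}" for s i using that unfolding D_def by auto
  have \<Psi>c: "\<Psi> s \<in> carrier D'" if "s \<in> carrier D" for s
  proof -
    have "\<psi> i (s i) \<in> carrier (F i)" if i: "i \<in> {1..n}" for i
      by (rule hom_in_carrier[OF \<psi>(1)[OF i] cD[OF \<open>s \<in> carrier D\<close> i]])
    then show ?thesis unfolding \<Psi>_def D'_def carrier_product_group restrict_PiE_iff by blast
  qed
  have \<Psi>: "\<Psi> \<in> hom D D'"
  proof (rule homI)
    fix s t assume st: "s \<in> carrier D" "t \<in> carrier D"
    show "\<Psi> (s \<otimes>\<^bsub>D\<^esub> t) = \<Psi> s \<otimes>\<^bsub>D'\<^esub> \<Psi> t"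
      unfolding \<Psi>_def D'_def mult_product_group
    proof (rule restrict_ext)
      fix i assume i: "i \<in> {1..n}"
      have "(s \<otimes>\<^bsub>D\<^esub> t) i = s i \<otimes>\<^bsub>F2\<^esub> t i" unfolding D_def using i by simp
      then show "\<psi> i ((s \<otimes>\<^bsub>D\<^esub> t) i) = (\<lambda>i\<in>{1..n}. \<psi> i (s i)) i \<otimes>\<^bsub>F i\<^esub> (\<lambda>i\<in>{1..n}. \<psi> i (t i)) i"
        using hom_mult[OF \<psi>(1)[OF i] cD[OF st(1) i] cD[OF st(2) i]] i by simp
    qed
  qed (rule \<Psi>c)
  interpret \<Psi>: group_hom D D' \<Psi> using \<Psi> by (simp add: group_hom_def group_hom_axioms_def D.is_group D'.is_group)
  have inj: "inj_on \<Psi> (carrier D)"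
  proof (rule inj_onI)
    fix s t assume st: "s \<in> carrier D" "t \<in> carrier D" and eq: "\<Psi> s = \<Psi> t"
    have "s i = t i" if i: "i \<in> {1..n}" for i
    proof -
      have "\<psi> i (s i) = \<psi> i (t i)" using fun_cong[OF eq, of i] i unfolding \<Psi>_def by simp
      then show ?thesis using inj_onD[OF \<psi>(2)[OF i]] cD[OF st(1) i] cD[OF st(2) i] by blast
    qed
    moreover have "s \<in> (\<Pi>\<^sub>E i\<in>{1..n}. carrier F2)" "t \<in> (\<Pi>\<^sub>E i\<in>{1..n}. carrier F2)" using st unfolding D_def by auto
    ultimately show "s = t" by (intro PiE_ext)
  qed
  obtain S where S: "subgroup S D" "finitely_presented (D\<lparr>carrier := S\<rparr>)"
    "\<And>i a. i \<in> {1..n} \<Longrightarrow> a \<in> carrier F2 \<Longrightarrow> factor_embed {1..n} (\<lambda>_. F2) i a \<in> S \<longleftrightarrow> a \<in> lower_central F2 (Suc c)"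
    using exists_subdirect_power[OF assms(3)] unfolding D_def F2_def by blast
  have Sc: "S \<subseteq> carrier D" by (rule subgroup.subset[OF S(1)])
  define T where "T = \<Psi> ` S"
  have T: "subgroup T D'" unfolding T_def by (rule \<Psi>.subgroup_img_is_subgroup[OF S(1)])
  have "\<Psi> \<in> iso (D\<lparr>carrier := S\<rparr>) (D'\<lparr>carrier := T\<rparr>)"
    unfolding iso_def bij_betw_def T_def using inj_on_subset[OF inj Sc] \<Psi>.hom_mult[OF subsetD[OF Sc] subsetD[OF Sc]]
    by (auto simp: hom_def)
  then have "D\<lparr>carrier := S\<rparr> \<cong> D'\<lparr>carrier := T\<rparr>" unfolding is_iso_def by blast
  then have fp: "finitely_presented (D'\<lparr>carrier := T\<rparr>)"
    by (rule finitely_presented_iso[OF S(2) _ D'.subgroup_imp_group[OF T]])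
  have "T \<inter> factor_embed {1..n} F i ` carrier (F i) = factor_embed {1..n} F i ` lower_central (F i) (c + 1)"
    if i: "i \<in> {1..n}" for i
  proof -
    let ?e = "factor_embed {1..n} (\<lambda>_. F2) i" and ?e' = "factor_embed {1..n} F i"
    have ec: "?e a \<in> carrier D" if "a \<in> carrier F2" for a using that unfolding factor_embed_def D_def by auto
    have e: "?e' (\<psi> i a) = \<Psi> (?e a)" if "a \<in> carrier F2" for a
      unfolding factor_embed_def \<Psi>_def
    proof (rule restrict_ext)
      fix j assume j: "j \<in> {1..n}"
      have "\<psi> j \<one>\<^bsub>F2\<^esub> = \<one>\<^bsub>F j\<^esub>" by (rule hom_one[OF \<psi>(1)[OF j] F2.is_group Fg[OF j]])
      then show "(if j = i then \<psi> i a else \<one>\<^bsub>F j\<^esub>) = \<psi> j ((\<lambda>j\<in>{1..n}. if j = i then a else \<one>\<^bsub>F2\<^esub>) j)"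
        using j by simp
    qed
    \<comment> \<open>Isomorphisms carry lower central terms to each other, so the description of
      the intersections does not depend on the chosen identifications of the factors.\<close>
    have lc: "lower_central (F i) (c + 1) = \<psi> i ` lower_central F2 (Suc c)"
      using F2.lower_central_hom_onto[OF Fg[OF i] \<psi>(1)[OF i] \<psi>(3)[OF i]] by simp
    have in_T: "?e' (\<psi> i a) \<in> T \<longleftrightarrow> a \<in> lower_central F2 (Suc c)" if a: "a \<in> carrier F2" for a
    proof -
      have "\<Psi> (?e a) \<in> T \<longleftrightarrow> ?e a \<in> S" unfolding T_def using inj_on_image_mem_iff[OF inj ec[OF a] Sc] .
      then show ?thesis unfolding e[OF a] using S(3)[OF i a] by simp
    qed
    show ?thesis unfolding lc \<psi>(3)[OF i, symmetric]
      using in_T F2.lower_central_carrier by blast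
  qed
  then show ?thesis using T fp unfolding D'_def by blast
qed

end
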